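(* Let $M$ be a (connected) Riemann surface with canonical bundle $K$ and let $L=(K\bar K)^{-1/2}$ be the real line bundle of $1$-densities. (1) If $f_1,f_2:M\to S^3$ are two conformal immersions inducing the same Hopf differentials and the same Schwarzian derivatives (i.e. $\kappa_1=\kappa_2$ and $c_1=c_2$ in every local holomorphic coordinate $z$ of $M$), then there is a Möbius transformation $T:S^3\to S^3$ with $T\circ f_1=f_2$. (2) Conversely, let $\kappa\,\frac{dz^2}{|dz|}\in\Gamma(LK^2)$ be a smooth quadratic differential with values in $L$, and let $c$ be a Schwarzian derivative on $M$, i.e. an assignment to each local holomorphic coordinate $z$ of a smooth complex valued function $c=c^{(z)}$ such that $c^{(w)}dw^2=(c^{(z)}-S_z(w))dz^2$ under a change of holomorphic coordinates. Suppose that in every local holomorphic coordinate $z$ the conformal Gauss and Codazzi equations $$\tfrac12 c_{\bar z}=3\,\bar\kappa_z\,\kappa+\bar\kappa\,\kappa_z,\qquad \mathrm{Im}\big(\kappa_{\bar z\bar z}+\tfrac12\bar c\,\kappa\big)=0$$ hold, where $\bar\kappa_z=\partial_z(\bar\kappa)$. Then there exists a conformal immersion $f:M\to S^3$ with Möbius holonomy, with Hopf differential $\kappa$ and Schwarzian derivative $c$.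
   Context: Let $\mathbb R^{4,1}$ carry the Lorentzian form $\langle v,v\rangle=-v_0^2+\sum_{k=1}^{4}v_k^2$, extended complex bilinearly to $\mathbb C^5$, and let $\mathcal L_+$ be its forward light cone. Identify $S^3$ with the projectivized light cone via $x\leftrightarrow[1:x]$; Möbius transformations are the conformal diffeomorphisms of $S^3$, i.e. the maps induced by Lorentz transformations. For a conformal immersion $f:M\to S^3$ and a local holomorphic coordinate $z$ there is a unique normalized lift $\psi$ with values in $\mathcal L_+$ such that $\psi(p)$ spans the null line $f(p)$ and $|d\psi|^2=|dz|^2$. Let $V=\mathrm{span}\{\psi,d\psi,\psi_{z\bar z}\}$, a rank $4$ subbundle of $M\times\mathbb R^{4,1}$ of signature $(3,1)$, independent of the choice of coordinate; $V^\perp$ is a real line bundle with positive definite metric. The equation $$\psi_{zz}+\tfrac c2\psi=\kappa$$ defines the complex valued function $c=S_z(f)$, the Schwarzian derivative of $f$ in the coordinate $z$, and the section $\kappa$ of $V^\perp\otimes\mathbb C$, the Hopf differential. Using the orientations of $M$ and $S^3$, $V^\perp$ is trivialized by a unit section, so $\kappa$ is regarded as a complex valued function. Under a change of coordinate $z\to w$ these transform by $\tilde\kappa\,\frac{dw^2}{|dw|}=\kappa\,\frac{dz^2}{|dz|}$ and $S_w(f)dw^2=(S_z(f)-S_z(w))dz^2$, where $S_z(w)=\big(\frac{w''}{w'}\big)'-\frac12\big(\frac{w''}{w'}\big)^2$ (with $'=\partial_z$) is the classical Schwarzian. "A conformal immersion $f:M\to S^3$ with Möbius holonomy" means a conformal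 immersion $\tilde f:\tilde M\to S^3$ of the universal cover of $M$ such that $\tilde f\circ\gamma=\rho(\gamma)\circ\tilde f$ for all deck transformations $\gamma\in\pi_1(M)$, for some homomorphism $\rho$ from $\pi_1(M)$ to the Möbius group of $S^3$; its Hopf differential and Schwarzian derivative (computed from $\tilde f$) descend to $M$. *)

theory Defs
  imports "HOL-Analysis.Analysis" "HOL-Algebra.Bij"
begin

section \<open>Smooth maps and Wirtinger derivatives\<close>

fun Ck_on :: "nat \<Rightarrow> 'a::real_normed_vector set \<Rightarrow> ('a \<Rightarrow> 'b::real_normed_vector) \<Rightarrow> bool" where
  "Ck_on 0 S g \<longleftrightarrow> continuous_on S g"
| "Ck_on (Suc k) S g \<longleftrightarrow> (\<forall>x\<in>S. g differentiable (at x)) \<and>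
     (\<forall>v. Ck_on k S (\<lambda>x. frechet_derivative g (at x) v))"

text \<open>Only used for open \<open>S\<close>.\<close>
definition smooth_on :: "'a::real_normed_vector set \<Rightarrow> ('a \<Rightarrow> 'b::real_normed_vector) \<Rightarrow> bool" where
  "smooth_on S g \<longleftrightarrow> (\<forall>k. Ck_on k S g)"

definition dz :: "(complex \<Rightarrow> complex) \<Rightarrow> complex \<Rightarrow> complex" where
  "dz g \<zeta> = (frechet_derivative g (at \<zeta>) 1 - \<i> * frechet_derivative g (at \<zeta>) \<i>) / 2"

definition dzbar :: "(complex \<Rightarrow> complex) \<Rightarrow> complex \<Rightarrow> complex" where
  "dzbar g \<zeta> = (frechet_derivative g (at \<zeta>) 1 + \<i> * frechet_derivative g (at \<zeta>) \<i>) / 2"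

definition classical_schwarzian :: "(complex \<Rightarrow> complex) \<Rightarrow> complex \<Rightarrow> complex" where
  "classical_schwarzian \<tau> \<zeta> =
     deriv (\<lambda>s. deriv (deriv \<tau>) s / deriv \<tau> s) \<zeta> - (1/2) * (deriv (deriv \<tau>) \<zeta> / deriv \<tau> \<zeta>)\<^sup>2"


section \<open>Riemann surfaces\<close>

text \<open>A chart is a pair \<open>(U, z)\<close>; the values of \<open>z\<close> outside \<open>U\<close> are irrelevant.\<close>
type_synonym 'a chart = "'a set \<times> ('a \<Rightarrow> complex)"

text \<open>Coordinate representation \<open>g \<circ> z\<inverse>\<close>, meaningful on \<open>z ` U\<close>; for a second chart \<open>(V, w)\<close>,
  \<open>local_rep (U, z) w\<close> is the change of coordinates, meaningful on \<open>z ` (U \<inter> V)\<close>.\<close>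
definition local_rep :: "'a chart \<Rightarrow> ('a \<Rightarrow> 'c) \<Rightarrow> complex \<Rightarrow> 'c" where
  "local_rep = (\<lambda>(U, z) g. g \<circ> inv_into U z)"

text \<open>All local holomorphic coordinates of \<open>M\<close>, i.e. the maximal atlas determined by \<open>A\<close>.\<close>
definition hol_charts :: "'a::topological_space set \<Rightarrow> 'a chart set \<Rightarrow> 'a chart set" where
  "hol_charts M A = {(U, z).
     openin (top_of_set M) U \<and> open (z ` U) \<and> homeomorphism U (z ` U) z (inv_into U z) \<and>
     (\<forall>(V, w)\<in>A. local_rep (U, z) w holomorphic_on z ` (U \<inter> V) \<and>
                 local_rep (V, w) z holomorphic_on w ` (U \<inter> V))}"

definition riemann_surface :: "'a::topological_space set \<Rightarrow> 'a chart set \<Rightarrow> bool" where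
  "riemann_surface M A \<longleftrightarrow>
     Hausdorff_space (top_of_set M) \<and> (\<Union>(U, z)\<in>A. U) = M \<and> A \<subseteq> hol_charts M A"

definition universal_cover ::
  "'b::topological_space set \<Rightarrow> ('b \<Rightarrow> 'a::topological_space) \<Rightarrow> 'a set \<Rightarrow> bool" where
  "universal_cover N p M \<longleftrightarrow> covering_space N p M \<and> simply_connected N"

definition pullback_atlas ::
  "'b::topological_space set \<Rightarrow> ('b \<Rightarrow> 'a) \<Rightarrow> 'a chart set \<Rightarrow> 'b chart set" where
  "pullback_atlas N p A = {(U', z \<circ> p) | U' U z.
     (U, z) \<in> A \<and> openin (top_of_set N) U' \<and> inj_on p U' \<and> p ` U' \<subseteq> U}"

definition deck_group ::
  "'b::topological_space set \<Rightarrow> ('b \<Rightarrow> 'a) \<Rightarrow> ('b \<Rightarrow> 'b) monoid" where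
  "deck_group N p = (BijGroup N)\<lparr>carrier :=
     {\<gamma> \<in> Bij N. homeomorphism N N \<gamma> (inv_into N \<gamma>) \<and> (\<forall>x\<in>N. p (\<gamma> x) = p x)}\<rparr>"


section \<open>The light cone model of the 3-sphere\<close>

text \<open>The index \<open>None\<close> is the time direction \<open>0\<close>, the indices \<open>Some k\<close> are the space directions
  of \<open>real ^ 4\<close>.\<close>
type_synonym lvec = "(real, 4 option) vec"
type_synonym clvec = "(complex, 4 option) vec"

text \<open>The form on \<open>lvec\<close>, and its complex bilinear extension to \<open>clvec\<close>.\<close>
definition lor :: "('k::comm_ring_1, 4 option) vec \<Rightarrow> ('k, 4 option) vec \<Rightarrow> 'k" where
  "lor u v = - (u $ None * v $ None) + (\<Sum>k\<in>UNIV. u $ Some k * v $ Some k)"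

definition light_cone :: "lvec set" where
  "light_cone = {v. lor v v = 0 \<and> v $ None > 0}"

definition cvec :: "lvec \<Rightarrow> clvec" where
  "cvec v = (\<chi> i. complex_of_real (v $ i))"

abbreviation S3 :: "(real^4) set" where
  "S3 \<equiv> sphere 0 1"

text \<open>The representative \<open>(1, x)\<close> of the null line \<open>[1 : x]\<close>.\<close>
definition null_vec :: "real^4 \<Rightarrow> lvec" where
  "null_vec x = (\<chi> i. case i of None \<Rightarrow> 1 | Some k \<Rightarrow> x $ k)"

definition moebius_maps :: "(real^4 \<Rightarrow> real^4) set" where
  "moebius_maps = {T \<in> Bij S3. \<exists>B :: lvec \<Rightarrow> lvec. linear B \<and> (\<forall>u v. lor (B u) (B v) = lor u v) \<and>
     (\<forall>x\<in>S3. B (null_vec x) \<in> span {null_vec (T x)})}"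

definition moebius_group :: "(real^4 \<Rightarrow> real^4) monoid" where
  "moebius_group = (BijGroup S3)\<lparr>carrier := moebius_maps\<rparr>"


section \<open>Conformal immersions and their invariants\<close>

definition conformal_immersion ::
  "'a::topological_space set \<Rightarrow> 'a chart set \<Rightarrow> ('a \<Rightarrow> real^4) \<Rightarrow> bool" where
  "conformal_immersion M A f \<longleftrightarrow> f ` M \<subseteq> S3 \<and>
     (\<forall>(U, z) \<in> hol_charts M A.
        smooth_on (z ` U) (local_rep (U, z) f) \<and>
        (\<forall>\<zeta> \<in> z ` U. \<exists>r>0. \<forall>v.
           norm (frechet_derivative (local_rep (U, z) f) (at \<zeta>) v) = r * norm v))"

text \<open>In the following \<open>F\<close> is the coordinate representation of an immersion on the open set
  \<open>D\<close> of the complex plane.\<close>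

definition normalized_lift :: "complex set \<Rightarrow> (complex \<Rightarrow> real^4) \<Rightarrow> (complex \<Rightarrow> lvec) \<Rightarrow> bool" where
  "normalized_lift D F \<psi> \<longleftrightarrow> smooth_on D \<psi> \<and>
     (\<forall>\<zeta>\<in>D. \<psi> \<zeta> \<in> light_cone \<and> span {\<psi> \<zeta>} = span {null_vec (F \<zeta>)} \<and>
        (\<forall>v. lor (frechet_derivative \<psi> (at \<zeta>) v) (frechet_derivative \<psi> (at \<zeta>) v) = (norm v)\<^sup>2))"

text \<open>\<open>\<psi>\<^sub>z\<^sub>z\<close>, and the real vector \<open>\<psi>\<close> differentiated once in \<open>z\<close> and once in \<open>z\<close>-bar.\<close>

definition lift_zz :: "(complex \<Rightarrow> lvec) \<Rightarrow> complex \<Rightarrow> clvec" where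
  "lift_zz \<psi> \<zeta> = (\<chi> i. dz (dz (\<lambda>s. cvec (\<psi> s) $ i)) \<zeta>)"

definition lift_zzbar :: "(complex \<Rightarrow> lvec) \<Rightarrow> complex \<Rightarrow> lvec" where
  "lift_zzbar \<psi> \<zeta> = (\<chi> i. Re (dzbar (dz (\<lambda>s. cvec (\<psi> s) $ i)) \<zeta>))"

text \<open>The fibre over \<open>\<zeta>\<close> of the rank 4 bundle \<open>V\<close>.\<close>
definition V_fibre :: "(complex \<Rightarrow> lvec) \<Rightarrow> complex \<Rightarrow> lvec set" where
  "V_fibre \<psi> \<zeta> = span ({\<psi> \<zeta>, lift_zzbar \<psi> \<zeta>} \<union> range (frechet_derivative \<psi> (at \<zeta>)))"

text \<open>Orthogonality to \<open>\<psi>\<close> gives \<open>\<nu> = \<nu>\<^sub>0 (1, F) + (0, n)\<close>, where \<open>n\<close> is a unit normal of the surface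
  in \<open>T\<^sub>F S\<^sup>3\<close>. The positive one of the two choices is that for which \<open>(F\<^sub>x, F\<^sub>y, n)\<close> is a
  positive basis of \<open>T\<^sub>F S\<^sup>3\<close>, the sphere being oriented as the boundary of the unit ball.\<close>
definition oriented_unit_normal ::
  "(complex \<Rightarrow> real^4) \<Rightarrow> (complex \<Rightarrow> lvec) \<Rightarrow> complex \<Rightarrow> lvec \<Rightarrow> bool" where
  "oriented_unit_normal F \<psi> \<zeta> \<nu> \<longleftrightarrow>
     (\<forall>v \<in> V_fibre \<psi> \<zeta>. lor \<nu> v = 0) \<and> lor \<nu> \<nu> = 1 \<and>
     det ((\<chi> i. if i = 1 then F \<zeta>
                else if i = 2 then frechet_derivative F (at \<zeta>) 1
                else if i = 3 then frechet_derivative F (at \<zeta>) \<i>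
                else (\<chi> k. \<nu> $ Some k - \<nu> $ None * F \<zeta> $ k)) :: real^4^4) > 0"

definition fundamental_eq ::
  "complex set \<Rightarrow> (complex \<Rightarrow> real^4) \<Rightarrow> complex \<Rightarrow> complex \<Rightarrow> complex \<Rightarrow> bool" where
  "fundamental_eq D F \<zeta> c \<kappa> \<longleftrightarrow>
     (\<exists>\<psi> \<nu>. normalized_lift D F \<psi> \<and> oriented_unit_normal F \<psi> \<zeta> \<nu> \<and>
        lift_zz \<psi> \<zeta> + (c / 2) *s cvec (\<psi> \<zeta>) = \<kappa> *s cvec \<nu>)"

text \<open>Schwarzian derivative \<open>S\<^sub>z(f)\<close> and Hopf differential of \<open>f\<close> in the chart \<open>(U, z)\<close>, as functions
  on \<open>U\<close>. The numbers described exist uniquely for a conformal immersion.\<close>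

definition schwarzian :: "('a \<Rightarrow> real^4) \<Rightarrow> 'a chart \<Rightarrow> 'a \<Rightarrow> complex" where
  "schwarzian f = (\<lambda>(U, z) x.
     THE c. \<exists>\<kappa>. fundamental_eq (z ` U) (local_rep (U, z) f) (z x) c \<kappa>)"

definition hopf :: "('a \<Rightarrow> real^4) \<Rightarrow> 'a chart \<Rightarrow> 'a \<Rightarrow> complex" where
  "hopf f = (\<lambda>(U, z) x.
     THE \<kappa>. \<exists>c. fundamental_eq (z ` U) (local_rep (U, z) f) (z x) c \<kappa>)"


section \<open>Abstract Hopf differentials and Schwarzian derivatives\<close>

text \<open>A smooth section \<open>\<kappa> dz\<^sup>2 / |dz|\<close> of \<open>L K\<^sup>2\<close>, given by its coefficient functions \<open>\<kappa> (U, z)\<close>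
  on \<open>U\<close>.\<close>
definition LK2_section ::
  "'a::topological_space set \<Rightarrow> 'a chart set \<Rightarrow> ('a chart \<Rightarrow> 'a \<Rightarrow> complex) \<Rightarrow> bool" where
  "LK2_section M A \<kappa> \<longleftrightarrow>
     (\<forall>(U, z) \<in> hol_charts M A. smooth_on (z ` U) (local_rep (U, z) (\<kappa> (U, z)))) \<and>
     (\<forall>(U, z) \<in> hol_charts M A. \<forall>(V, w) \<in> hol_charts M A. \<forall>x \<in> U \<inter> V.
        let w' = deriv (local_rep (U, z) w) (z x)
        in \<kappa> (V, w) x * (w'\<^sup>2 / of_real (cmod w')) = \<kappa> (U, z) x)"

definition schwarzian_derivative_on ::
  "'a::topological_space set \<Rightarrow> 'a chart set \<Rightarrow> ('a chart \<Rightarrow> 'a \<Rightarrow> complex) \<Rightarrow> bool" where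
  "schwarzian_derivative_on M A c \<longleftrightarrow>
     (\<forall>(U, z) \<in> hol_charts M A. smooth_on (z ` U) (local_rep (U, z) (c (U, z)))) \<and>
     (\<forall>(U, z) \<in> hol_charts M A. \<forall>(V, w) \<in> hol_charts M A. \<forall>x \<in> U \<inter> V.
        let \<tau> = local_rep (U, z) w
        in c (V, w) x * (deriv \<tau> (z x))\<^sup>2 = c (U, z) x - classical_schwarzian \<tau> (z x))"

definition gauss_codazzi ::
  "'a::topological_space set \<Rightarrow> 'a chart set \<Rightarrow>
   ('a chart \<Rightarrow> 'a \<Rightarrow> complex) \<Rightarrow> ('a chart \<Rightarrow> 'a \<Rightarrow> complex) \<Rightarrow> bool" where
  "gauss_codazzi M A \<kappa> c \<longleftrightarrow>
     (\<forall>(U, z) \<in> hol_charts M A. \<forall>\<zeta> \<in> z ` U.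
        let k = local_rep (U, z) (\<kappa> (U, z)); s = local_rep (U, z) (c (U, z))
        in (1/2) * dzbar s \<zeta> = 3 * dz (\<lambda>t. cnj (k t)) \<zeta> * k \<zeta> + cnj (k \<zeta>) * dz k \<zeta> \<and>
           Im (dzbar (dzbar k) \<zeta> + (1/2) * cnj (s \<zeta>) * k \<zeta>) = 0)"

text \<open>A conformal immersion of \<open>M\<close> with Moebius holonomy, for a universal cover \<open>p : N \<rightarrow> M\<close>.\<close>
definition moebius_holonomy_immersion ::
  "'a::topological_space set \<Rightarrow> 'a chart set \<Rightarrow>
   'b::topological_space set \<Rightarrow> ('b \<Rightarrow> 'a) \<Rightarrow> ('b \<Rightarrow> real^4) \<Rightarrow> bool" where
  "moebius_holonomy_immersion M A N p f \<longleftrightarrow>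
     universal_cover N p M \<and> conformal_immersion N (pullback_atlas N p A) f \<and>
     (\<exists>\<rho> \<in> hom (deck_group N p) moebius_group.
        \<forall>\<gamma> \<in> carrier (deck_group N p). \<forall>x\<in>N. f (\<gamma> x) = \<rho> \<gamma> (f x))"

text \<open>The Hopf differential and Schwarzian derivative of \<open>f\<close>, an immersion of the cover, descend to
  \<open>\<kappa>\<close> and \<open>c\<close> on \<open>M\<close>: a local coordinate \<open>z\<close> of \<open>M\<close> gives the coordinates \<open>z \<circ> p\<close> of the cover.\<close>
definition invariants_descend_to ::
  "'a::topological_space set \<Rightarrow> 'a chart set \<Rightarrow> 'b::topological_space set \<Rightarrow> ('b \<Rightarrow> 'a) \<Rightarrow>
   ('b \<Rightarrow> real^4) \<Rightarrow> ('a chart \<Rightarrow> 'a \<Rightarrow> complex) \<Rightarrow> ('a chart \<Rightarrow> 'a \<Rightarrow> complex) \<Rightarrow> bool" where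
  "invariants_descend_to M A N p f \<kappa> c \<longleftrightarrow>
     (\<forall>(U, z) \<in> hol_charts M A. \<forall>U'.
        openin (top_of_set N) U' \<and> inj_on p U' \<and> p ` U' \<subseteq> U \<longrightarrow>
        (\<forall>x\<in>U'. hopf f (U', z \<circ> p) x = \<kappa> (U, z) (p x) \<and>
                schwarzian f (U', z \<circ> p) x = c (U, z) (p x)))"

end

theory Submission
  imports Defs "HOL-Complex_Analysis.Complex_Analysis"
begin

text \<open>Let \<open>\<psi>\<close> be the normalized lift of a conformal immersion, \<open>\<nu>\<close> a unit section of \<open>V\<^sup>\<bottom>\<close>, and
  \<open>h = 2 \<psi>\<^sub>z\<^sub>z\<^sub>b\<^sub>a\<^sub>r + 2 \<bar>\<kappa>\<bar>\<^sup>2 \<psi>\<close>.  The moving frame \<open>(\<psi>, \<psi>\<^sub>x, \<psi>\<^sub>y, h, \<nu>)\<close> of \<open>\<real>\<^sup>4\<^sup>,\<^sup>1\<close> has a constant Gram matrix,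
  and its first derivatives are linear combinations of the frame itself, with coefficients which
  are real-linear in \<open>(1, c, \<bar>\<kappa>\<bar>\<^sup>2, \<kappa>, \<kappa>\<^sub>z\<^sub>b\<^sub>a\<^sub>r)\<close> (\<open>structure_equations\<close>).  So the frame solves a linear total
  differential equation which is determined by \<open>c\<close> and \<open>\<kappa>\<close>, and both parts of the theorem follow the
  pattern of the fundamental theorem of surface theory.

  \<^bold>\<open>Rigidity.\<close>  If two immersions have the same invariants, the linear map \<open>B\<close> which matches their
  frames at a point is a Lorentz transformation, and it matches the frames nearby because both
  solve the same system (\<open>framed_lift_rigidity\<close>).  A Lorentz transformation is determined by its
  action on a germ of an immersion and its normal, so \<open>B\<close> is locally constant, hence constant on a
  connected surface (\<open>rigidity\<close>).  The normal field is carried along everywhere: an immersion into a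
  round 2-sphere alone does not determine \<open>B\<close>.  By orientation the normal of an immersion of a
  Riemann surface is globally defined (\<open>oriented_framing\<close>).

  \<^bold>\<open>Existence.\<close>  The conformal Gauss and Codazzi equations say that the system is flat
  (\<open>structure_data_flat\<close>); it is then solvable near each point (\<open>flat_linear_system_solvable\<close>), its
  solutions remain frames, and the first component of a solution is a normalized lift with the
  given invariants (\<open>framed_lift_exists\<close>).  Since the invariants of a pulled back lift obey the
  transformation laws for \<open>\<kappa>\<close> and \<open>c\<close> (\<open>framed_lift_pullback\<close>), it does not matter in which
  coordinate a pair \<open>(f, \<nu>)\<close> has the prescribed invariants.  By rigidity two such pairs on the
  universal cover differ on overlaps by locally constant Lorentz transformations.  These form a
  cocycle, which is trivial on a simply connected space (\<open>trivial_on_simply_connected\<close>), so that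
  local solutions can be moved into positions in which they fit together (\<open>global_solution\<close>).
  Composing the global solution with a deck transformation gives another solution; rigidity
  provides the Moebius transformation between the two, and uniqueness makes this correspondence a
  homomorphism (\<open>solution_holonomy\<close>).\<close>

section \<open>Calculus of smooth maps\<close>

lemma has_derivative_cong_open:
  assumes "open S" "x \<in> S" "\<And>y. y \<in> S \<Longrightarrow> f y = g y"
  shows "(f has_derivative f') (at x) \<longleftrightarrow> (g has_derivative f') (at x)"
  using assms by (metis has_derivative_transform_within_open)

lemma frechet_derivative_cong_open:
  assumes "open S" "x \<in> S" "\<And>y. y \<in> S \<Longrightarrow> f y = g y"
  shows "frechet_derivative f (at x) = frechet_derivative g (at x)"
  unfolding frechet_derivative_def using has_derivative_cong_open[OF assms] by simp

lemma differentiable_cong_open: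
  assumes "open S" "x \<in> S" "\<And>y. y \<in> S \<Longrightarrow> f y = g y"
  shows "f differentiable (at x) \<longleftrightarrow> g differentiable (at x)"
  unfolding differentiable_def using has_derivative_cong_open[OF assms] by simp

lemma Ck_on_cong:
  assumes "open S" "\<And>y. y \<in> S \<Longrightarrow> f y = g y"
  shows "Ck_on k S f \<longleftrightarrow> Ck_on k S g"
  using assms(2)
proof (induction k arbitrary: f g)
  case 0
  then show ?case by (simp cong: continuous_on_cong)
next
  case (Suc k)
  have "Ck_on k S (\<lambda>x. frechet_derivative f (at x) v) \<longleftrightarrow>
        Ck_on k S (\<lambda>x. frechet_derivative g (at x) v)" for v
    using Suc.IH[of "\<lambda>x. frechet_derivative f (at x) v" "\<lambda>x. frechet_derivative g (at x) v"]
      frechet_derivative_cong_open[OF assms(1) _ Suc.prems] by simp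
  then show ?case
    using differentiable_cong_open[OF assms(1) _ Suc.prems] by simp
qed

text \<open>Products, inverses and composites have derivatives which are again such expressions, so
  that their differentiability of all orders follows by induction from this rule.\<close>

lemma Ck_on_SucI:
  assumes "open S" "\<And>x. x \<in> S \<Longrightarrow> (f has_derivative f' x) (at x)" "\<And>v. Ck_on k S (\<lambda>x. f' x v)"
  shows "Ck_on (Suc k) S f"
proof -
  have "Ck_on k S (\<lambda>x. frechet_derivative f (at x) v)" for v
    using assms(3)[of v] Ck_on_cong[OF assms(1), of "\<lambda>x. frechet_derivative f (at x) v" "\<lambda>x. f' x v"]
      frechet_derivative_at[OF assms(2)] by force
  then show ?thesis using assms(2) by (auto simp: differentiable_def)
qed

lemma Ck_on_SucD: "Ck_on (Suc k) S f \<Longrightarrow> Ck_on k S f"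
proof (induction k arbitrary: f)
  case 0
  then show ?case
    by (auto intro: continuous_at_imp_continuous_on differentiable_imp_continuous_within)
next
  case (Suc k)
  then show ?case by (metis Ck_on.simps(2))
qed

lemma Ck_on_has_derivative:
  "Ck_on (Suc k) S f \<Longrightarrow> x \<in> S \<Longrightarrow> (f has_derivative frechet_derivative f (at x)) (at x)"
  by (simp add: frechet_derivative_works)

lemma Ck_on_subset: "Ck_on k S f \<Longrightarrow> T \<subseteq> S \<Longrightarrow> Ck_on k T f"
  by (induction k arbitrary: f) (auto intro: continuous_on_subset)

lemma Ck_on_local:
  "(\<And>x. x \<in> S \<Longrightarrow> \<exists>T. open T \<and> x \<in> T \<and> Ck_on k T f) \<Longrightarrow> Ck_on k S f"
proof (induction k arbitrary: f)
  case 0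
  show ?case unfolding Ck_on.simps
  proof (rule continuous_at_imp_continuous_on, rule ballI)
    fix x assume "x \<in> S"
    then obtain T where "open T" "x \<in> T" "continuous_on T f" using 0 by (metis Ck_on.simps(1))
    then show "isCont f x" using continuous_on_eq_continuous_at by blast
  qed
next
  case (Suc k)
  show ?case unfolding Ck_on.simps(2)
  proof (intro conjI allI ballI)
    show "f differentiable (at x)" if "x \<in> S" for x
      using Suc.prems[OF that] by auto
    show "Ck_on k S (\<lambda>x. frechet_derivative f (at x) v)" for v
      by (rule Suc.IH) (use Suc.prems in fastforce)
  qed
qed

lemma Ck_on_const [simp]: "Ck_on k S (\<lambda>x. c)"
  by (induction k arbitrary: c) simp_all

lemma Ck_on_linear:
  assumes "open S" "bounded_linear L"
  shows "Ck_on k S f \<Longrightarrow> Ck_on k S (\<lambda>x. L (f x))"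
proof (induction k arbitrary: f)
  case 0
  then show ?case using assms(2) by (simp add: bounded_linear.continuous_on)
next
  case (Suc k)
  show ?case
    by (rule Ck_on_SucI[OF assms(1)], rule bounded_linear.has_derivative[OF assms(2)],
        rule Ck_on_has_derivative[OF Suc.prems], assumption)
      (use Suc in auto)
qed

lemma Ck_on_add:
  assumes "open S"
  shows "Ck_on k S f \<Longrightarrow> Ck_on k S g \<Longrightarrow> Ck_on k S (\<lambda>x. f x + g x)"
proof (induction k arbitrary: f g)
  case 0
  then show ?case by (simp add: continuous_on_add)
next
  case (Suc k)
  show ?case
    by (rule Ck_on_SucI[OF assms], rule has_derivative_add; (rule Ck_on_has_derivative)?)
      (use Suc in auto)
qed

lemma Ck_on_bilinear:
  assumes "open S" "bounded_bilinear B"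
  shows "Ck_on k S f \<Longrightarrow> Ck_on k S g \<Longrightarrow> Ck_on k S (\<lambda>x. B (f x) (g x))"
proof (induction k arbitrary: f g)
  case 0
  then show ?case by (simp add: bounded_bilinear.continuous_on[OF assms(2)])
next
  case (Suc k)
  show ?case
  proof (rule Ck_on_SucI[OF assms(1)])
    show "((\<lambda>x. B (f x) (g x)) has_derivative
       (\<lambda>v. B (f x) (frechet_derivative g (at x) v) + B (frechet_derivative f (at x) v) (g x))) (at x)"
      if "x \<in> S" for x
      using bounded_bilinear.FDERIV[OF assms(2) Ck_on_has_derivative[OF Suc.prems(1) that]
          Ck_on_has_derivative[OF Suc.prems(2) that]] .
    show "Ck_on k S (\<lambda>x. B (f x) (frechet_derivative g (at x) v) + B (frechet_derivative f (at x) v) (g x))" for v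
      using Suc.prems Ck_on_SucD[OF Suc.prems(1)] Ck_on_SucD[OF Suc.prems(2)]
      by (intro Ck_on_add[OF assms(1)] Suc.IH) auto
  qed
qed

lemma Ck_on_inverse:
  fixes f :: "'a::real_normed_vector \<Rightarrow> real"
  assumes "open S" "\<And>x. x \<in> S \<Longrightarrow> f x \<noteq> 0"
  shows "Ck_on k S f \<Longrightarrow> Ck_on k S (\<lambda>x. inverse (f x))"
proof (induction k)
  case 0
  then show ?case using assms(2) by (simp add: continuous_on_inverse)
next
  case (Suc k)
  show ?case
  proof (rule Ck_on_SucI[OF assms(1)])
    show "((\<lambda>x. inverse (f x)) has_derivative
       (\<lambda>v. - (inverse (f x) * frechet_derivative f (at x) v * inverse (f x)))) (at x)"
      if "x \<in> S" for x
      using Deriv.has_derivative_inverse[OF assms(2)[OF that] Ck_on_has_derivative[OF Suc.prems that]] .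
    have "Ck_on k S (\<lambda>x. (-1) * (inverse (f x) * frechet_derivative f (at x) v * inverse (f x)))" for v
      using Suc.prems Ck_on_SucD[OF Suc.prems]
      by (intro Ck_on_bilinear[OF assms(1) bounded_bilinear_mult] Suc.IH Ck_on_const) auto
    then show "Ck_on k S (\<lambda>x. - (inverse (f x) * frechet_derivative f (at x) v * inverse (f x)))" for v
      by simp
  qed
qed

lemma Ck_on_sqrt:
  fixes f :: "'a::real_normed_vector \<Rightarrow> real"
  assumes "open S" "\<And>x. x \<in> S \<Longrightarrow> f x > 0"
  shows "Ck_on k S f \<Longrightarrow> Ck_on k S (\<lambda>x. sqrt (f x))"
proof (induction k)
  case 0
  then show ?case by (simp add: continuous_on_real_sqrt)
next
  case (Suc k)
  show ?case
  proof (rule Ck_on_SucI[OF assms(1)])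
    show "((\<lambda>x. sqrt (f x)) has_derivative
       (\<lambda>v. (1/2) * inverse (sqrt (f x)) * frechet_derivative f (at x) v)) (at x)"
      if "x \<in> S" for x
      using assms(2)[OF that] 
      by (auto intro!: derivative_eq_intros Ck_on_has_derivative[OF Suc.prems that] simp: field_simps)
    show "Ck_on k S (\<lambda>x. (1/2) * inverse (sqrt (f x)) * frechet_derivative f (at x) v)" for v
      using Suc.prems Ck_on_SucD[OF Suc.prems] assms
      by (intro Ck_on_bilinear[OF assms(1) bounded_bilinear_mult] Ck_on_inverse Suc.IH Ck_on_const)
        (auto simp: less_le)
  qed
qed

text \<open>A real-linear map on \<open>\<complex>\<close> is determined by its values at \<open>1\<close> and \<open>\<i>\<close>; this turns the chain
  rule into a sum of products, to which the product rule applies.\<close>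

lemma real_linear_complex:
  assumes "linear (L :: complex \<Rightarrow> 'b::real_vector)"
  shows "L v = Re v *\<^sub>R L 1 + Im v *\<^sub>R L \<i>"
proof -
  have "v = Re v *\<^sub>R 1 + Im v *\<^sub>R \<i>" by (simp add: complex_eq_iff)
  then have "L v = L (Re v *\<^sub>R 1 + Im v *\<^sub>R \<i>)" by simp
  then show ?thesis using assms by (simp only: linear_add linear_scale)
qed

lemma Ck_on_compose:
  fixes g :: "complex \<Rightarrow> 'b::real_normed_vector" and t :: "'a::real_normed_vector \<Rightarrow> complex"
  assumes "open S" "t ` S \<subseteq> S'"
  shows "Ck_on k S' g \<Longrightarrow> Ck_on k S t \<Longrightarrow> Ck_on k S (\<lambda>x. g (t x))"
proof (induction k arbitrary: g)
  case 0
  then show ?case using assms continuous_on_compose2 by fastforce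
next
  case (Suc k)
  let ?g = "\<lambda>x. frechet_derivative g (at (t x))" and ?t = "\<lambda>x. frechet_derivative t (at x)"
  show ?case
  proof (rule Ck_on_SucI[OF assms(1)])
    fix x assume x: "x \<in> S"
    then have tx: "t x \<in> S'" using assms by auto
    note dg = Ck_on_has_derivative[OF Suc.prems(1) tx]
    have "((\<lambda>x. g (t x)) has_derivative (\<lambda>v. ?g x (?t x v))) (at x)"
      using has_derivative_compose[OF Ck_on_has_derivative[OF Suc.prems(2) x] dg] .
    moreover have "(\<lambda>v. ?g x (?t x v)) = (\<lambda>v. Re (?t x v) *\<^sub>R ?g x 1 + Im (?t x v) *\<^sub>R ?g x \<i>)"
      by (rule ext, rule real_linear_complex[OF has_derivative_linear[OF dg]])
    ultimately show "((\<lambda>x. g (t x)) has_derivative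
        (\<lambda>v. Re (?t x v) *\<^sub>R ?g x 1 + Im (?t x v) *\<^sub>R ?g x \<i>)) (at x)" by simp
  next
    fix v
    have "Ck_on k S (\<lambda>x. ?g x w)" for w
      using Suc.IH[of "\<lambda>y. frechet_derivative g (at y) w"] Suc.prems(1) Ck_on_SucD[OF Suc.prems(2)]
      by simp
    moreover have "Ck_on k S (\<lambda>x. ?t x v)" using Suc.prems(2) by simp
    ultimately show "Ck_on k S (\<lambda>x. Re (?t x v) *\<^sub>R ?g x 1 + Im (?t x v) *\<^sub>R ?g x \<i>)"
      by (intro Ck_on_add[OF assms(1)] Ck_on_bilinear[OF assms(1) bounded_bilinear_scaleR]
          Ck_on_linear[OF assms(1) bounded_linear_Re, of _ "\<lambda>x. ?t x v"]
          Ck_on_linear[OF assms(1) bounded_linear_Im, of _ "\<lambda>x. ?t x v"])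
  qed
qed

lemma Ck_on_holomorphic:
  assumes "open S"
  shows "g holomorphic_on S \<Longrightarrow> Ck_on k S g"
proof (induction k arbitrary: g)
  case 0
  then show ?case by (simp add: holomorphic_on_imp_continuous_on)
next
  case (Suc k)
  show ?case
  proof (rule Ck_on_SucI[OF assms])
    show "(g has_derivative (\<lambda>v. deriv g x * v)) (at x)" if "x \<in> S" for x
      using holomorphic_derivI[OF Suc.prems assms that] by (simp add: has_field_derivative_def)
    show "Ck_on k S (\<lambda>x. deriv g x * v)" for v
      using Suc.IH[OF holomorphic_deriv[OF Suc.prems assms]] assms
      by (intro Ck_on_bilinear[OF assms bounded_bilinear_mult]) auto
  qed
qed

lemma smooth_on_cong:
  "open S \<Longrightarrow> (\<And>y. y \<in> S \<Longrightarrow> f y = g y) \<Longrightarrow> smooth_on S f \<longleftrightarrow> smooth_on S g"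
  unfolding smooth_on_def using Ck_on_cong by blast

lemma smooth_on_subset: "smooth_on S f \<Longrightarrow> T \<subseteq> S \<Longrightarrow> smooth_on T f"
  unfolding smooth_on_def using Ck_on_subset by blast

lemma smooth_on_local:
  "(\<And>x. x \<in> S \<Longrightarrow> \<exists>T. open T \<and> x \<in> T \<and> smooth_on T f) \<Longrightarrow> smooth_on S f"
  unfolding smooth_on_def by (intro allI Ck_on_local) meson

lemma smooth_on_const [simp]: "smooth_on S (\<lambda>x. c)"
  by (simp add: smooth_on_def)

lemma smooth_on_linear:
  "open S \<Longrightarrow> bounded_linear L \<Longrightarrow> smooth_on S f \<Longrightarrow> smooth_on S (\<lambda>x. L (f x))"
  by (simp add: smooth_on_def Ck_on_linear)

lemma smooth_on_add:
  "open S \<Longrightarrow> smooth_on S f \<Longrightarrow> smooth_on S g \<Longrightarrow> smooth_on S (\<lambda>x. f x + g x)"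
  by (simp add: smooth_on_def Ck_on_add)

lemma smooth_on_bilinear:
  "open S \<Longrightarrow> bounded_bilinear B \<Longrightarrow> smooth_on S f \<Longrightarrow> smooth_on S g \<Longrightarrow>
   smooth_on S (\<lambda>x. B (f x) (g x))"
  by (simp add: smooth_on_def Ck_on_bilinear)

lemmas smooth_on_mult = smooth_on_bilinear[OF _ bounded_bilinear_mult]
lemmas smooth_on_scaleR = smooth_on_bilinear[OF _ bounded_bilinear_scaleR]

lemma smooth_on_uminus:
  "open S \<Longrightarrow> smooth_on S f \<Longrightarrow> smooth_on S (\<lambda>x. - f x)"
  using smooth_on_linear[OF _ bounded_linear_minus[OF bounded_linear_ident]] by blast

lemma smooth_on_diff:
  "open S \<Longrightarrow> smooth_on S f \<Longrightarrow> smooth_on S g \<Longrightarrow> smooth_on S (\<lambda>x. f x - g x)"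
  using smooth_on_add[of S f "\<lambda>x. - g x"] smooth_on_uminus[of S g] by simp

lemma smooth_on_sum:
  "open S \<Longrightarrow> (\<And>i. i \<in> I \<Longrightarrow> smooth_on S (f i)) \<Longrightarrow> smooth_on S (\<lambda>x. \<Sum>i\<in>I. f i x)"
  by (induction I rule: infinite_finite_induct) (auto intro: smooth_on_add)

lemma smooth_on_inverse:
  fixes f :: "'a::real_normed_vector \<Rightarrow> real"
  shows "open S \<Longrightarrow> (\<And>x. x \<in> S \<Longrightarrow> f x \<noteq> 0) \<Longrightarrow> smooth_on S f \<Longrightarrow> smooth_on S (\<lambda>x. inverse (f x))"
  by (simp add: smooth_on_def Ck_on_inverse)

lemma smooth_on_sqrt:
  fixes f :: "'a::real_normed_vector \<Rightarrow> real"
  shows "open S \<Longrightarrow> (\<And>x. x \<in> S \<Longrightarrow> f x > 0) \<Longrightarrow> smooth_on S f \<Longrightarrow> smooth_on S (\<lambda>x. sqrt (f x))"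
  by (simp add: smooth_on_def Ck_on_sqrt)

lemma smooth_on_compose:
  fixes g :: "complex \<Rightarrow> 'b::real_normed_vector" and t :: "'a::real_normed_vector \<Rightarrow> complex"
  shows "open S \<Longrightarrow> t ` S \<subseteq> S' \<Longrightarrow> smooth_on S' g \<Longrightarrow> smooth_on S t \<Longrightarrow> smooth_on S (\<lambda>x. g (t x))"
  by (simp add: smooth_on_def Ck_on_compose)

lemma smooth_on_holomorphic: "open S \<Longrightarrow> g holomorphic_on S \<Longrightarrow> smooth_on S g"
  by (simp add: smooth_on_def Ck_on_holomorphic)

lemma smooth_on_vec:
  fixes f :: "'a::real_normed_vector \<Rightarrow> 'b::euclidean_space ^ 'n"
  assumes "open S" "\<And>i. smooth_on S (\<lambda>x. f x $ i)"
  shows "smooth_on S f"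
proof -
  have bl: "bounded_linear (\<lambda>y::'b. axis i y :: 'b^'n)" for i
    by (rule linear_conv_bounded_linear[THEN iffD1], rule linearI) (simp_all add: axis_def vec_eq_iff)
  have "smooth_on S (\<lambda>x. \<Sum>i\<in>UNIV. axis i (f x $ i))"
    using smooth_on_linear[OF assms(1) bl assms(2)] by (intro smooth_on_sum assms(1))
  moreover have "(\<Sum>i\<in>UNIV. axis i (f x $ i)) = f x" for x
    by (simp add: vec_eq_iff axis_def if_distrib cong: if_cong)
  ultimately show ?thesis by simp
qed

lemma smooth_on_imp_continuous_on: "smooth_on S f \<Longrightarrow> continuous_on S f"
  unfolding smooth_on_def using Ck_on.simps(1) by blast

lemma smooth_on_has_derivative:
  "smooth_on S f \<Longrightarrow> x \<in> S \<Longrightarrow> (f has_derivative frechet_derivative f (at x)) (at x)"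
  unfolding smooth_on_def using Ck_on_has_derivative by blast

lemma smooth_on_frechet_derivative:
  "smooth_on S f \<Longrightarrow> smooth_on S (\<lambda>x. frechet_derivative f (at x) v)"
  unfolding smooth_on_def by (metis Ck_on.simps(2))

lemma vector_mean_value_bound:
  fixes f :: "real \<Rightarrow> 'b::real_normed_vector"
  assumes "a \<le> b" "\<And>t. t \<in> {a..b} \<Longrightarrow> (f has_vector_derivative f' t) (at t within {a..b})"
    and "\<And>t. t \<in> {a..b} \<Longrightarrow> norm (f' t) \<le> B"
  shows "norm (f b - f a) \<le> B * (b - a)"
proof -
  have "norm (f b - f a) \<le> B * norm (b - a)"
    using assms
    by (intro differentiable_bound[where f' = "\<lambda>t s. s *\<^sub>R f' t" and S = "{a..b}"])
      (auto simp: has_vector_derivative_def mult.commute[of B] intro!: onorm_le mult_left_mono)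
  then show ?thesis using assms(1) by simp
qed

text \<open>The second difference quotient of \<open>g\<close> in the directions \<open>a\<close>, \<open>b\<close> converges to the iterated
  directional derivative.  Since the second difference is symmetric in \<open>a\<close> and \<open>b\<close>, the two
  iterated derivatives agree.\<close>

lemma second_difference_quotient:
  fixes g :: "'a::real_normed_vector \<Rightarrow> 'b::real_normed_vector" and a b :: 'a
  assumes "open S" "smooth_on S g" "p \<in> S" "e > 0"
  defines "G \<equiv> \<lambda>x. frechet_derivative (\<lambda>y. frechet_derivative g (at y) a) (at x) b"
  shows "\<exists>d>0. \<forall>h. 0 < h \<and> h < d \<longrightarrow>
    norm (g (p + h *\<^sub>R a + h *\<^sub>R b) - g (p + h *\<^sub>R a) - g (p + h *\<^sub>R b) + g p - h\<^sup>2 *\<^sub>R G p) \<le> e * h\<^sup>2"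
proof -
  let ?g = "\<lambda>y. frechet_derivative g (at y) a"
  have sg: "smooth_on S ?g" by (rule smooth_on_frechet_derivative[OF assms(2)])
  have sG: "smooth_on S G" unfolding G_def by (rule smooth_on_frechet_derivative[OF sg])
  have "isCont G p"
    using smooth_on_imp_continuous_on[OF sG] assms(1,3) continuous_on_eq_continuous_at by blast
  then obtain r0 where r0: "r0 > 0" "\<And>x. dist x p < r0 \<Longrightarrow> dist (G x) (G p) < e"
    unfolding continuous_at_eps_delta using assms(4) by blast
  obtain r1 where r1: "r1 > 0" "ball p r1 \<subseteq> S" using assms(1,3) openE by blast
  define r where "r = min r0 r1"
  have r: "r > 0" "\<And>x. dist x p < r \<Longrightarrow> x \<in> S" "\<And>x. dist x p < r \<Longrightarrow> norm (G x - G p) \<le> e"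
    using r0 r1 by (auto simp: r_def dist_norm norm_minus_commute subset_iff less_imp_le)
  define d where "d = r / (1 + norm a + norm b)"
  have pos: "1 + norm a + norm b > 0" by (smt (verit) norm_ge_zero)
  have "d > 0" using r(1) pos by (simp add: d_def)
  moreover have "norm (g (p + h *\<^sub>R a + h *\<^sub>R b) - g (p + h *\<^sub>R a) - g (p + h *\<^sub>R b) + g p - h\<^sup>2 *\<^sub>R G p)
      \<le> e * h\<^sup>2" if h: "0 < h" "h < d" for h
  proof -
    have near: "dist (p + s *\<^sub>R a + t *\<^sub>R b) p < r" if "s \<in> {0..h}" "t \<in> {0..h}" for s t
    proof -
      have "dist (p + s *\<^sub>R a + t *\<^sub>R b) p \<le> \<bar>s\<bar> * norm a + \<bar>t\<bar> * norm b"
        by (metis add_diff_cancel_left' dist_norm group_cancel.add1 norm_scaleR norm_triangle_ineq)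
      also have "\<dots> \<le> h * norm a + h * norm b"
        using that by (intro add_mono mult_right_mono) auto
      also have "\<dots> < h * (1 + norm a + norm b)" using h by (simp add: algebra_simps)
      also have "\<dots> < r" using h pos by (simp add: d_def field_simps)
      finally show ?thesis .
    qed
    have inner: "norm (?g (p + s *\<^sub>R a + h *\<^sub>R b) - ?g (p + s *\<^sub>R a) - h *\<^sub>R G p) \<le> e * h"
      if s: "s \<in> {0..h}" for s
    proof -
      have "((\<lambda>t. ?g (p + s *\<^sub>R a + t *\<^sub>R b) - t *\<^sub>R G p) has_vector_derivative
          G (p + s *\<^sub>R a + t *\<^sub>R b) - G p) (at t within {0..h})" if t: "t \<in> {0..h}" for t
      proof -
        let ?x = "p + s *\<^sub>R a + t *\<^sub>R b"
        have dg: "(?g has_derivative frechet_derivative ?g (at ?x)) (at ?x)"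
          using smooth_on_has_derivative[OF sg] r(2) near[OF s t] by blast
        have "((\<lambda>t. ?g (p + s *\<^sub>R a + t *\<^sub>R b)) has_derivative
           (\<lambda>u. frechet_derivative ?g (at ?x) (u *\<^sub>R b))) (at t within {0..h})"
          by (rule has_derivative_compose[where g = ?g and f = "\<lambda>t. p + s *\<^sub>R a + t *\<^sub>R b", OF _ dg]) (auto intro!: derivative_eq_intros)
        then have "((\<lambda>t. ?g (p + s *\<^sub>R a + t *\<^sub>R b)) has_vector_derivative G ?x) (at t within {0..h})"
          unfolding has_vector_derivative_def G_def linear_scale[OF has_derivative_linear[OF dg]] .
        then show ?thesis by (auto intro!: derivative_eq_intros)
      qed
      from vector_mean_value_bound[OF _ this, where B = e] h r(3)[OF near[OF s]]
      show ?thesis by (simp add: algebra_simps)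
    qed
    have "((\<lambda>s. g (p + s *\<^sub>R a + h *\<^sub>R b) - g (p + s *\<^sub>R a) - s *\<^sub>R (h *\<^sub>R G p)) has_vector_derivative
        ?g (p + s *\<^sub>R a + h *\<^sub>R b) - ?g (p + s *\<^sub>R a) - h *\<^sub>R G p) (at s within {0..h})"
      if s: "s \<in> {0..h}" for s
    proof -
      have *: "((\<lambda>s. g (p + s *\<^sub>R a + t *\<^sub>R b)) has_vector_derivative ?g (p + s *\<^sub>R a + t *\<^sub>R b))
         (at s within {0..h})" if t: "t \<in> {0..h}" for t
      proof -
        let ?x = "p + s *\<^sub>R a + t *\<^sub>R b"
        have dg: "(g has_derivative frechet_derivative g (at ?x)) (at ?x)"
          using smooth_on_has_derivative[OF assms(2)] r(2) near[OF s t] by blast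
        have "((\<lambda>s. g (p + s *\<^sub>R a + t *\<^sub>R b)) has_derivative
           (\<lambda>u. frechet_derivative g (at ?x) (u *\<^sub>R a))) (at s within {0..h})"
          by (rule has_derivative_compose[where g = g and f = "\<lambda>s. p + s *\<^sub>R a + t *\<^sub>R b", OF _ dg]) (auto intro!: derivative_eq_intros)
        then show ?thesis
          unfolding has_vector_derivative_def linear_scale[OF has_derivative_linear[OF dg]] .
      qed
      have "((\<lambda>s. g (p + s *\<^sub>R a)) has_vector_derivative ?g (p + s *\<^sub>R a)) (at s within {0..h})"
        using *[of 0] h by simp
      moreover have "((\<lambda>s. s *\<^sub>R (h *\<^sub>R G p)) has_vector_derivative h *\<^sub>R G p) (at s within {0..h})"
        by (auto intro!: derivative_eq_intros)
      ultimately show ?thesis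
        using *[of h] h by (auto intro!: has_vector_derivative_diff)
    qed
    from vector_mean_value_bound[OF _ this, where B = "e * h"] h inner
    show ?thesis by (simp add: algebra_simps power2_eq_square)
  qed
  ultimately show ?thesis by blast
qed

lemma frechet_derivative_commute:
  fixes g :: "'a::real_normed_vector \<Rightarrow> 'b::real_normed_vector"
  assumes "open S" "smooth_on S g" "p \<in> S"
  shows "frechet_derivative (\<lambda>y. frechet_derivative g (at y) a) (at p) b =
         frechet_derivative (\<lambda>y. frechet_derivative g (at y) b) (at p) a" (is "?A = ?B")
proof (rule ccontr)
  assume ne: "?A \<noteq> ?B"
  define e where "e = norm (?A - ?B) / 3"
  have e: "e > 0" using ne by (simp add: e_def)
  obtain d1 where d1: "d1 > 0" "\<And>h. 0 < h \<Longrightarrow> h < d1 \<Longrightarrow>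
    norm (g (p + h *\<^sub>R a + h *\<^sub>R b) - g (p + h *\<^sub>R a) - g (p + h *\<^sub>R b) + g p - h\<^sup>2 *\<^sub>R ?A) \<le> e * h\<^sup>2"
    using second_difference_quotient[OF assms e, of a b] by blast
  obtain d2 where d2: "d2 > 0" "\<And>h. 0 < h \<Longrightarrow> h < d2 \<Longrightarrow>
    norm (g (p + h *\<^sub>R b + h *\<^sub>R a) - g (p + h *\<^sub>R b) - g (p + h *\<^sub>R a) + g p - h\<^sup>2 *\<^sub>R ?B) \<le> e * h\<^sup>2"
    using second_difference_quotient[OF assms e, of b a] by blast
  define h where "h = min d1 d2 / 2"
  have h: "0 < h" "h < d1" "h < d2" using d1(1) d2(1) by (auto simp: h_def)
  let ?X = "g (p + h *\<^sub>R a + h *\<^sub>R b) - g (p + h *\<^sub>R a) - g (p + h *\<^sub>R b) + g p"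
  have Y: "g (p + h *\<^sub>R b + h *\<^sub>R a) - g (p + h *\<^sub>R b) - g (p + h *\<^sub>R a) + g p = ?X"
    by (simp add: algebra_simps)
  have "norm ((?X - h\<^sup>2 *\<^sub>R ?B) - (?X - h\<^sup>2 *\<^sub>R ?A)) \<le> e * h\<^sup>2 + e * h\<^sup>2"
    using norm_triangle_ineq4 d1(2)[OF h(1,2)] d2(2)[OF h(1,3), unfolded Y] by (smt (verit))
  moreover have "(?X - h\<^sup>2 *\<^sub>R ?B) - (?X - h\<^sup>2 *\<^sub>R ?A) = h\<^sup>2 *\<^sub>R (?A - ?B)" by (simp add: algebra_simps)
  ultimately have "norm (h\<^sup>2 *\<^sub>R (?A - ?B)) \<le> h\<^sup>2 * (2 * e)" by (simp add: mult.commute[of e])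
  then have "h\<^sup>2 * norm (?A - ?B) \<le> h\<^sup>2 * (2 * e)" by simp
  then have "norm (?A - ?B) \<le> 2 * e" using h by simp
  then show False using e by (simp add: e_def)
qed

definition pdx :: "(complex \<Rightarrow> 'b::real_normed_vector) \<Rightarrow> complex \<Rightarrow> 'b" where
  "pdx g \<zeta> = frechet_derivative g (at \<zeta>) 1"

definition pdy :: "(complex \<Rightarrow> 'b::real_normed_vector) \<Rightarrow> complex \<Rightarrow> 'b" where
  "pdy g \<zeta> = frechet_derivative g (at \<zeta>) \<i>"

lemma smooth_on_pd:
  "smooth_on S g \<Longrightarrow> smooth_on S (pdx g)" "smooth_on S g \<Longrightarrow> smooth_on S (pdy g)"
  unfolding pdx_def[abs_def] pdy_def[abs_def] by (rule smooth_on_frechet_derivative; assumption)+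

lemma pd_commute: "open S \<Longrightarrow> smooth_on S g \<Longrightarrow> \<zeta> \<in> S \<Longrightarrow> pdx (pdy g) \<zeta> = pdy (pdx g) \<zeta>"
  unfolding pdx_def[abs_def] pdy_def[abs_def] by (rule frechet_derivative_commute)

lemma pd_eqI:
  assumes "(g has_derivative g') (at \<zeta>)"
  shows "pdx g \<zeta> = g' 1" "pdy g \<zeta> = g' \<i>"
  unfolding pdx_def pdy_def using frechet_derivative_at[OF assms] by auto

lemma pd_cong:
  assumes "open S" "\<zeta> \<in> S" "\<And>y. y \<in> S \<Longrightarrow> f y = g y"
  shows "pdx f \<zeta> = pdx g \<zeta>" "pdy f \<zeta> = pdy g \<zeta>"
  unfolding pdx_def pdy_def using frechet_derivative_cong_open[OF assms] by auto

lemma frechet_pd: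
  assumes "g differentiable (at \<zeta>)"
  shows "frechet_derivative g (at \<zeta>) v = Re v *\<^sub>R pdx g \<zeta> + Im v *\<^sub>R pdy g \<zeta>"
  unfolding pdx_def pdy_def
  by (rule real_linear_complex[OF linear_frechet_derivative[OF assms]])

lemma smooth_on_differentiable: "smooth_on S g \<Longrightarrow> \<zeta> \<in> S \<Longrightarrow> g differentiable (at \<zeta>)"
  using smooth_on_has_derivative differentiable_def by blast

lemma smooth_on_has_derivative_pd:
  "smooth_on S g \<Longrightarrow> \<zeta> \<in> S \<Longrightarrow> (g has_derivative (\<lambda>v. Re v *\<^sub>R pdx g \<zeta> + Im v *\<^sub>R pdy g \<zeta>)) (at \<zeta>)"
  using smooth_on_has_derivative[of S g \<zeta>]
  by (simp add: frechet_pd[OF smooth_on_differentiable, THEN ext])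

section \<open>Linear total differential equations in the plane\<close>

lemma vector_mean_value_bound_on:
  fixes f :: "real \<Rightarrow> 'b::real_normed_vector"
  assumes "\<And>t. t \<in> {a..b} \<Longrightarrow> (f has_vector_derivative f' t) (at t within {a..b})"
    and "\<And>t. t \<in> {a..b} \<Longrightarrow> norm (f' t) \<le> B" and "x \<in> {a..b}" "y \<in> {a..b}"
  shows "norm (f x - f y) \<le> B * \<bar>x - y\<bar>"
proof -
  have "norm (f x - f y) \<le> B * norm (x - y)"
    using assms
    by (intro differentiable_bound[where f' = "\<lambda>t s. s *\<^sub>R f' t" and S = "{a..b}"])
      (auto simp: has_vector_derivative_def mult.commute[of B] intro!: onorm_le mult_left_mono)
  then show ?thesis by simp
qed

text \<open>On an interval so short that \<open>r K \<le> 1/2\<close>, the differential inequality bounds the maximum of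
  the solution by half of itself plus the data; this replaces Gronwall's inequality.\<close>

lemma short_interval_bound:
  fixes w :: "real \<Rightarrow> 'e::real_normed_vector"
  assumes r: "r > 0" "r * K \<le> 1/2"
    and w: "\<And>t. t \<in> {-r..r} \<Longrightarrow> (w has_vector_derivative w' t) (at t within {-r..r})"
    and bd: "\<And>t. t \<in> {-r..r} \<Longrightarrow> norm (w' t) \<le> K * norm (w t) + e" and "K \<ge> 0"
    and t: "t \<in> {-r..r}"
  shows "norm (w t) \<le> 2 * (norm (w 0) + r * e)"
proof -
  have "continuous_on {-r..r} w"
    using w by (meson continuous_on_eq_continuous_within has_vector_derivative_continuous)
  then have "continuous_on {-r..r} (\<lambda>t. norm (w t))" by (rule continuous_on_norm)
  then obtain s where s: "s \<in> {-r..r}" "\<And>t. t \<in> {-r..r} \<Longrightarrow> norm (w t) \<le> norm (w s)"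
    using continuous_attains_sup[of "{-r..r}" "\<lambda>t. norm (w t)"] r by auto
  let ?M = "norm (w s)"
  have B: "norm (w' t) \<le> K * ?M + e" if "t \<in> {-r..r}" for t
    using bd[OF that] s(2)[OF that] \<open>K \<ge> 0\<close> by (smt (verit) mult_left_mono)
  then have nn: "K * ?M + e \<ge> 0" using s(1) by (smt (verit) norm_ge_zero)
  have "norm (w s - w 0) \<le> (K * ?M + e) * \<bar>s - 0\<bar>"
    by (rule vector_mean_value_bound_on[where f' = w' and a = "-r" and b = r]) (use w B s r in auto)
  also have "\<dots> \<le> (K * ?M + e) * r" using s(1) nn by (intro mult_left_mono) auto
  also have "\<dots> = (r * K) * ?M + r * e" by (simp add: algebra_simps)
  also have "\<dots> \<le> 1/2 * ?M + r * e" using mult_right_mono[OF r(2), of ?M] by simp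
  finally have "norm (w s - w 0) \<le> 1/2 * ?M + r * e" .
  moreover have "?M \<le> norm (w s - w 0) + norm (w 0)" by (metis add.commute norm_triangle_sub)
  ultimately have "?M \<le> 2 * (norm (w 0) + r * e)" by simp
  then show ?thesis using s(2)[OF t] by simp
qed

text \<open>Picard iteration on a short interval is a contraction.\<close>

lemma short_interval_ode:
  fixes L :: "real \<Rightarrow> 'e::banach \<Rightarrow> 'e"
  assumes r: "r > 0" "r * K \<le> 1/2"
    and lip: "\<And>t u v. t \<in> {-r..r} \<Longrightarrow> norm (L t u - L t v) \<le> K * norm (u - v)"
    and cont: "\<And>y. continuous_on {-r..r} y \<Longrightarrow> continuous_on {-r..r} (\<lambda>t. L t (y t))"
    and "K \<ge> 0"
  shows "\<exists>y. y 0 = y0 \<and> (\<forall>t\<in>{-r..r}. (y has_vector_derivative L t (y t)) (at t within {-r..r}))"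
proof -
  define g where "g y s = L s (apply_bcontfun y s)" for y :: "real \<Rightarrow>\<^sub>C 'e" and s
  define J where "J y t = y0 + (integral {-r..t} (g y) - integral {-r..0} (g y))" for y t
  have gc: "continuous_on {-r..r} (g y)" for y unfolding g_def
    by (intro cont continuous_on_subset[OF continuous_on_apply_bcontfun]) auto
  have dJ: "(J y has_vector_derivative g y t) (at t within {-r..r})" if "t \<in> {-r..r}" for y t
    unfolding J_def using integral_has_vector_derivative[OF gc that]
    by (auto intro!: derivative_eq_intros)
  have "continuous_on {-r..r} (J y)" for y
    using dJ by (meson continuous_on_eq_continuous_within has_vector_derivative_continuous)
  then have "\<exists>z::real \<Rightarrow>\<^sub>C 'e. \<forall>t. apply_bcontfun z t = J y (clamp (-r) r t)" for y
    using continuous_on_cbox_bcontfunE[of "-r" r "J y"] by (metis cbox_interval)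
  then obtain \<Phi> where \<Phi>: "\<And>y t. apply_bcontfun (\<Phi> y) t = J y (clamp (-r) r t)" by metis
  have "dist (\<Phi> y) (\<Phi> z) \<le> (1/2) * dist y z" for y z
  proof (rule dist_bound)
    fix t
    let ?t = "clamp (-r) r t"
    have t: "?t \<in> {-r..r}" using clamp_in_interval[of "-r" r t] r by (simp add: cbox_interval)
    have "norm ((J y ?t - J z ?t) - (J y 0 - J z 0)) \<le> (K * dist y z) * \<bar>?t - 0\<bar>"
    proof (rule vector_mean_value_bound_on[where f = "\<lambda>t. J y t - J z t" and f' = "\<lambda>t. g y t - g z t" and a = "-r" and b = r])
      show "((\<lambda>t. J y t - J z t) has_vector_derivative g y t - g z t) (at t within {-r..r})"
        if "t \<in> {-r..r}" for t using dJ[OF that] by (auto intro!: derivative_eq_intros)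
      show "norm (g y t - g z t) \<le> K * dist y z" if "t \<in> {-r..r}" for t
        using lip[OF that, of "apply_bcontfun y t" "apply_bcontfun z t"] dist_bounded[of y t z] \<open>K \<ge> 0\<close>
        unfolding g_def dist_norm[of "apply_bcontfun y t"] by (smt (verit) mult_left_mono)
    qed (use t r in auto)
    also have "\<dots> \<le> (K * dist y z) * r" using t \<open>K \<ge> 0\<close> by (intro mult_left_mono) auto
    also have "\<dots> = (r * K) * dist y z" by simp
    also have "\<dots> \<le> (1/2) * dist y z" using r by (intro mult_right_mono) auto
    finally show "dist (apply_bcontfun (\<Phi> y) t) (apply_bcontfun (\<Phi> z) t) \<le> 1/2 * dist y z"
      unfolding \<Phi> by (simp add: J_def dist_norm)
  qed
  then obtain y where y: "\<Phi> y = y" using banach_fix_type[of "1/2" \<Phi>] by auto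
  have eq: "apply_bcontfun y t = J y t" if "t \<in> {-r..r}" for t
    using \<Phi>[of y t] that unfolding y by (simp add: clamp_cancel_cbox cbox_interval)
  show ?thesis
  proof (intro exI[of _ "apply_bcontfun y"] conjI ballI)
    show "apply_bcontfun y 0 = y0" using eq[of 0] r by (simp add: J_def)
    show "(apply_bcontfun y has_vector_derivative L t (apply_bcontfun y t)) (at t within {-r..r})"
      if t: "t \<in> {-r..r}" for t
      using dJ[OF t, of y] unfolding g_def by (rule has_vector_derivative_transform[OF t, rotated]) (rule eq)
  qed
qed

text \<open>The existence of one partial derivative at the point and the continuity of the other one
  around it suffice: the increment is split along a horizontal and a vertical segment.\<close>

lemma has_derivative_from_partials:
  fixes u :: "complex \<Rightarrow> 'e::real_normed_vector"
  assumes "open S" "p \<in> S"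
    and x: "((\<lambda>s. u (p + of_real s)) has_vector_derivative ux) (at 0)"
    and y: "\<And>q. q \<in> S \<Longrightarrow> ((\<lambda>t. u (q + \<i> * of_real t)) has_vector_derivative uy q) (at 0)"
    and cont: "continuous_on S uy"
  shows "(u has_derivative (\<lambda>v. Re v *\<^sub>R ux + Im v *\<^sub>R uy p)) (at p)"
  unfolding has_derivative_at_alt
proof (intro conjI allI impI)
  show "bounded_linear (\<lambda>v. Re v *\<^sub>R ux + Im v *\<^sub>R uy p)"
    by (intro bounded_linear_add bounded_linear_scaleR_const bounded_linear_Re bounded_linear_Im)
  fix e :: real assume "e > 0"
  then have e: "e / 2 > 0" by simp
  have "isCont uy p" using cont assms(1,2) continuous_on_eq_continuous_at by blast
  then obtain d0 where d0: "d0 > 0" "\<And>q. dist q p < d0 \<Longrightarrow> dist (uy q) (uy p) < e / 2"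
    unfolding continuous_at_eps_delta using e by blast
  obtain d1 where d1: "d1 > 0" "ball p d1 \<subseteq> S" using assms(1,2) openE by blast
  obtain d2 where d2: "d2 > 0"
    "\<And>s. norm s < d2 \<Longrightarrow> norm (u (p + of_real s) - u p - s *\<^sub>R ux) \<le> e / 2 * norm s"
    using x[unfolded has_vector_derivative_def has_derivative_at_alt, THEN conjunct2, rule_format, OF e] by auto
  define d where "d = min d0 (min d1 d2)"
  have "norm (u q - u p - (Re (q - p) *\<^sub>R ux + Im (q - p) *\<^sub>R uy p)) \<le> e * norm (q - p)"
    if q: "norm (q - p) < d" for q
  proof -
    define s t where "s = Re (q - p)" and "t = Im (q - p)"
    have st: "\<bar>s\<bar> \<le> norm (q - p)" "\<bar>t\<bar> \<le> norm (q - p)"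
      unfolding s_def t_def by (rule abs_Re_le_cmod abs_Im_le_cmod)+
    have q_eq: "q = p + of_real s + \<i> * of_real t" by (simp add: s_def t_def complex_eq_iff)
    have near: "dist (p + of_real s + \<i> * of_real \<tau>) p < d" if "\<tau> \<in> {-\<bar>t\<bar>..\<bar>t\<bar>}" for \<tau>
    proof -
      have "norm (of_real s + \<i> * of_real \<tau>) \<le> norm (q - p)"
        unfolding q_eq using that by (auto simp: cmod_def intro!: abs_le_square_iff[THEN iffD1])
      then show ?thesis using q by (simp add: dist_norm add.assoc)
    qed
    have "norm ((u (p + of_real s + \<i> * of_real t) - t *\<^sub>R uy p) - (u (p + of_real s + \<i> * of_real 0) - 0 *\<^sub>R uy p))
        \<le> (e / 2) * \<bar>t - 0\<bar>"
    proof (rule vector_mean_value_bound_on[where a = "-\<bar>t\<bar>" and b = "\<bar>t\<bar>" and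
          f = "\<lambda>\<tau>. u (p + of_real s + \<i> * of_real \<tau>) - \<tau> *\<^sub>R uy p" and f' = "\<lambda>\<tau>. uy (p + of_real s + \<i> * of_real \<tau>) - uy p"])
      fix \<tau> assume \<tau>: "\<tau> \<in> {-\<bar>t\<bar>..\<bar>t\<bar>}"
      have "p + of_real s + \<i> * of_real \<tau> \<in> S"
        using near[OF \<tau>] d1(2) unfolding d_def by (auto simp: dist_commute)
      from y[OF this] have "((\<lambda>\<sigma>. u (p + of_real s + \<i> * of_real (\<tau> + \<sigma>))) has_vector_derivative
        uy (p + of_real s + \<i> * of_real \<tau>)) (at 0)" by (simp add: algebra_simps)
      then have *: "((\<lambda>\<sigma>. u (p + of_real s + \<i> * of_real (\<tau> + \<sigma>))) has_derivative
        (\<lambda>x. x *\<^sub>R uy (p + of_real s + \<i> * of_real \<tau>))) (at (\<tau> - \<tau>))" by (simp add: has_vector_derivative_def)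
      have "((\<lambda>\<sigma>. \<sigma> - \<tau>) has_derivative (\<lambda>x. x)) (at \<tau>)" by (auto intro!: derivative_eq_intros)
      from has_derivative_compose[OF this *]
      have "((\<lambda>\<sigma>. u (p + of_real s + \<i> * of_real \<sigma>)) has_vector_derivative
        uy (p + of_real s + \<i> * of_real \<tau>)) (at \<tau>)" by (simp add: has_vector_derivative_def)
      moreover have "((\<lambda>\<tau>. \<tau> *\<^sub>R uy p) has_vector_derivative uy p) (at \<tau>)"
        by (auto intro!: derivative_eq_intros)
      ultimately show "((\<lambda>\<tau>. u (p + of_real s + \<i> * of_real \<tau>) - \<tau> *\<^sub>R uy p) has_vector_derivative
        uy (p + of_real s + \<i> * of_real \<tau>) - uy p) (at \<tau> within {-\<bar>t\<bar>..\<bar>t\<bar>})"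
        by (rule has_vector_derivative_at_within[OF has_vector_derivative_diff])
      show "norm (uy (p + of_real s + \<i> * of_real \<tau>) - uy p) \<le> e / 2"
        using d0(2)[of "p + of_real s + \<i> * of_real \<tau>"] near[OF \<tau>] by (auto simp: d_def dist_norm)
    qed auto
    moreover have "norm (u (p + of_real s) - u p - s *\<^sub>R ux) \<le> e / 2 * norm s"
      using d2(2)[of s] st q by (simp add: d_def)
    ultimately have "norm (u q - u p - (s *\<^sub>R ux + t *\<^sub>R uy p)) \<le> e / 2 * \<bar>t\<bar> + e / 2 * \<bar>s\<bar>"
      unfolding q_eq
      using norm_triangle_ineq[of "u (p + of_real s + \<i> * of_real t) - t *\<^sub>R uy p - u (p + of_real s)" "u (p + of_real s) - u p - s *\<^sub>R ux"]
      by (simp add: algebra_simps)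
    also have "\<dots> \<le> e / 2 * norm (q - p) + e / 2 * norm (q - p)"
      using st e by (intro add_mono mult_left_mono) auto
    finally show ?thesis by (simp add: s_def t_def)
  qed
  moreover have "d > 0" using d0 d1 d2 by (simp add: d_def)
  ultimately show "\<exists>d>0. \<forall>y. norm (y - p) < d \<longrightarrow>
    norm (u y - u p - (Re (y - p) *\<^sub>R ux + Im (y - p) *\<^sub>R uy p)) \<le> e * norm (y - p)" by blast
qed

text \<open>The system \<open>u\<^sub>x = a P u\<close>, \<open>u\<^sub>y = b P u\<close> is solved along the horizontal line through \<open>p\<close> and then
  along all vertical lines.  This gives \<open>u\<^sub>y = b P u\<close> everywhere, while flatness of the connection
  makes the error \<open>u (x + \<sigma>, y) - u (x, y) - \<sigma> a P u\<close> a solution, in the variable \<open>y\<close>, of an equation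
  with small inhomogeneity, so that it is \<open>o(\<sigma>)\<close> because it is so on the horizontal line.\<close>

theorem flat_linear_system_solvable:
  fixes P :: "complex \<Rightarrow> 'm::real_normed_vector" and a b :: "'m \<Rightarrow> 'e::banach \<Rightarrow> 'e"
  assumes D: "open D" "p \<in> D" and P: "smooth_on D P"
    and a: "bounded_bilinear a" and b: "bounded_bilinear b"
    and flat: "\<And>\<zeta> u. \<zeta> \<in> D \<Longrightarrow> a (pdy P \<zeta>) u + a (P \<zeta>) (b (P \<zeta>) u) = b (pdx P \<zeta>) u + b (P \<zeta>) (a (P \<zeta>) u)"
  shows "\<exists>r>0. ball p r \<subseteq> D \<and> (\<exists>u. u p = u0 \<and> (\<forall>\<zeta>\<in>ball p r.
     (u has_derivative (\<lambda>v. Re v *\<^sub>R a (P \<zeta>) (u \<zeta>) + Im v *\<^sub>R b (P \<zeta>) (u \<zeta>))) (at \<zeta>)))"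
proof -
  interpret a: bounded_bilinear a by fact
  interpret b: bounded_bilinear b by fact
  obtain R where R: "R > 0" "cball p R \<subseteq> D" using D open_contains_cball by blast
  note contP = continuous_on_subset[OF smooth_on_imp_continuous_on[OF P] R(2)]
  note contPx = continuous_on_subset[OF smooth_on_imp_continuous_on[OF smooth_on_pd(1)[OF P]] R(2)]
  obtain N where N: "N > 0" "\<And>z. z \<in> cball p R \<Longrightarrow> norm (P z) \<le> N"
    using compact_imp_bounded[OF compact_continuous_image[OF contP compact_cball]]
    unfolding bounded_pos by auto
  obtain Ca where Ca: "Ca > 0" "\<And>x y. norm (a x y) \<le> norm x * norm y * Ca" using a.pos_bounded by blast
  obtain Cb where Cb: "Cb > 0" "\<And>x y. norm (b x y) \<le> norm x * norm y * Cb" using b.pos_bounded by blast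
  define C where "C = max Ca Cb"
  have C: "C > 0" "\<And>x y. norm (a x y) \<le> norm x * norm y * C" "\<And>x y. norm (b x y) \<le> norm x * norm y * C"
  proof -
    show "C > 0" using Ca by (simp add: C_def)
    show "norm (a x y) \<le> norm x * norm y * C" for x y
      using Ca(2)[of x y] mult_left_mono[of Ca C "norm x * norm y"] by (simp add: C_def)
    show "norm (b x y) \<le> norm x * norm y * C" for x y
      using Cb(2)[of x y] mult_left_mono[of Cb C "norm x * norm y"] by (simp add: C_def)
  qed
  define K where "K = N * C"
  have K: "K > 0" using N C by (simp add: K_def)
  have PK: "norm (a (P z) u) \<le> K * norm u" "norm (b (P z) u) \<le> K * norm u" if "z \<in> cball p R" for z u
  proof -
    have "norm (P z) * norm u * C \<le> N * norm u * C"
      using N(2)[OF that] C(1) by (intro mult_right_mono) auto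
    then show "norm (a (P z) u) \<le> K * norm u" "norm (b (P z) u) \<le> K * norm u"
      using C(2)[of "P z" u] C(3)[of "P z" u] unfolding K_def by (simp_all add: mult_ac)
  qed
  \<comment> \<open>Square of half side \<open>r\<close> inside the disc, on which all the line problems are contractions.\<close>
  define r where "r = min (R / 2) (1 / (2 * K))"
  have r: "r > 0" "r * K \<le> 1/2" "2 * r \<le> R" using R K by (auto simp: r_def field_simps min_def)
  define Z where "Z s t = p + of_real s + \<i> * of_real t" for s t :: real
  have Zin: "Z s t \<in> cball p R" if "s \<in> {-r..r}" "t \<in> {-r..r}" for s t
  proof -
    have "norm (of_real s + \<i> * of_real t) \<le> \<bar>s\<bar> + \<bar>t\<bar>"
      using norm_triangle_ineq[of "of_real s" "\<i> * of_real t"] by (simp add: norm_mult)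
    also have "\<dots> \<le> R" using that r(3) by auto
    finally have "dist (Z s t) p \<le> R" unfolding Z_def dist_norm by (simp add: add.assoc)
    then show ?thesis by (simp add: dist_commute)
  qed
  have ZD: "Z s t \<in> D" if "s \<in> {-r..r}" "t \<in> {-r..r}" for s t using Zin[OF that] R(2) by blast
  have vP: "((\<lambda>t. P (Z s t)) has_vector_derivative pdy P (Z s t)) (at t within T)"
    "((\<lambda>s. P (Z s t)) has_vector_derivative pdx P (Z s t)) (at s within T)"
    if "s \<in> {-r..r}" "t \<in> {-r..r}" for s t T
  proof -
    note dP = smooth_on_has_derivative_pd[OF P ZD[OF that]]
    have "((\<lambda>t. P (Z s t)) has_derivative (\<lambda>v. Re (\<i> * of_real v) *\<^sub>R pdx P (Z s t) + Im (\<i> * of_real v) *\<^sub>R pdy P (Z s t))) (at t within T)"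
      by (rule has_derivative_compose[where g = P and f = "\<lambda>t. Z s t", OF _ dP])
        (auto intro!: derivative_eq_intros simp: Z_def)
    then show "((\<lambda>t. P (Z s t)) has_vector_derivative pdy P (Z s t)) (at t within T)"
      by (simp add: has_vector_derivative_def)
    have "((\<lambda>s. P (Z s t)) has_derivative (\<lambda>v. Re (of_real v) *\<^sub>R pdx P (Z s t) + Im (of_real v) *\<^sub>R pdy P (Z s t))) (at s within T)"
      by (rule has_derivative_compose[where g = P and f = "\<lambda>s. Z s t", OF _ dP])
        (auto intro!: derivative_eq_intros simp: Z_def)
    then show "((\<lambda>s. P (Z s t)) has_vector_derivative pdx P (Z s t)) (at s within T)"
      by (simp add: has_vector_derivative_def)
  qed
  have r0: "0 \<in> {-r..r}" using r by simp
  have "\<exists>h. h 0 = u0 \<and> (\<forall>s\<in>{-r..r}. (h has_vector_derivative a (P (Z s 0)) (h s)) (at s within {-r..r}))"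
  proof (rule short_interval_ode[OF r(1,2)])
    show "norm (a (P (Z t 0)) u - a (P (Z t 0)) v) \<le> K * norm (u - v)" if "t \<in> {-r..r}" for t u v
      using PK(1)[OF Zin[OF that r0], of "u - v"] by (simp add: a.diff_right)
    show "continuous_on {-r..r} (\<lambda>t. a (P (Z t 0)) (y t))" if "continuous_on {-r..r} y" for y
      by (rule a.continuous_on[OF _ that], unfold continuous_on_eq_continuous_within)
        (use has_vector_derivative_continuous[OF vP(2)[OF _ r0]] in fast)
  qed (use K in auto)
  then obtain h where h: "h 0 = u0"
    "\<And>s. s \<in> {-r..r} \<Longrightarrow> (h has_vector_derivative a (P (Z s 0)) (h s)) (at s within {-r..r})" by blast
  have "\<exists>w. w 0 = h s \<and> (\<forall>t\<in>{-r..r}. (w has_vector_derivative b (P (Z s t)) (w t)) (at t within {-r..r}))"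
    if s: "s \<in> {-r..r}" for s
  proof (rule short_interval_ode[OF r(1,2)])
    show "norm (b (P (Z s t)) u - b (P (Z s t)) v) \<le> K * norm (u - v)" if "t \<in> {-r..r}" for t u v
      using PK(2)[OF Zin[OF s that], of "u - v"] by (simp add: b.diff_right)
    show "continuous_on {-r..r} (\<lambda>t. b (P (Z s t)) (y t))" if "continuous_on {-r..r} y" for y
      by (rule b.continuous_on[OF _ that], unfold continuous_on_eq_continuous_within)
        (use has_vector_derivative_continuous[OF vP(1)[OF s]] in fast)
  qed (use K in auto)
  then obtain w where w: "\<And>s. s \<in> {-r..r} \<Longrightarrow> w s 0 = h s"
    "\<And>s t. s \<in> {-r..r} \<Longrightarrow> t \<in> {-r..r} \<Longrightarrow> (w s has_vector_derivative b (P (Z s t)) (w s t)) (at t within {-r..r})"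
    by metis
  \<comment> \<open>Each of the two integrations at most doubles the norm.\<close>
  define M where "M = 4 * norm u0"
  have hb: "norm (h s) \<le> 2 * norm u0" if s: "s \<in> {-r..r}" for s
    using short_interval_bound[OF r(1,2) h(2), of 0 s] PK(1)[OF Zin[OF _ r0]] K s by (simp add: h(1))
  have wb: "norm (w s t) \<le> M" if s: "s \<in> {-r..r}" and t: "t \<in> {-r..r}" for s t
    using short_interval_bound[OF r(1,2) w(2)[OF s], of 0 t] PK(2)[OF Zin[OF s]] K t hb[OF s] w(1)[OF s]
    by (simp add: M_def)
  have M: "M \<ge> 0" by (simp add: M_def)
  have wKM: "norm (a (P (Z s t)) (w s t)) \<le> K * M" "norm (b (P (Z s t)) (w s t)) \<le> K * M"
    if "s \<in> {-r..r}" "t \<in> {-r..r}" for s t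
    using order_trans[OF PK(1)[OF Zin[OF that]] mult_left_mono[OF wb[OF that] less_imp_le[OF K]]]
      order_trans[OF PK(2)[OF Zin[OF that]] mult_left_mono[OF wb[OF that] less_imp_le[OF K]]] by blast+
  have wx: "((\<lambda>s. w s t) has_vector_derivative a (P (Z s t)) (w s t)) (at s)"
    if s: "\<bar>s\<bar> < r" and t: "t \<in> {-r..r}" for s t
    unfolding has_vector_derivative_def has_derivative_at_alt
  proof (intro conjI allI impI)
    show "bounded_linear (\<lambda>x. x *\<^sub>R a (P (Z s t)) (w s t))" by (rule bounded_linear_scaleR_left)
    fix e :: real assume e: "e > 0"
    have s': "s \<in> {-r..r}" using s by auto
    \<comment> \<open>The final estimate of the error has the constant \<open>\<eta> * c\<close>, which must be \<open>e\<close>.\<close>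
    define c where "c = 2 * (1 + r * (C * M * (1 + K)))"
    have c: "c > 0" unfolding c_def using r C M K by (intro mult_pos_pos add_pos_nonneg mult_nonneg_nonneg) auto
    define \<eta> where "\<eta> = e / c"
    have \<eta>: "\<eta> > 0" using e c by (simp add: \<eta>_def)
    obtain d1 where d1: "d1 > 0" "\<And>x y. x \<in> cball p R \<Longrightarrow> y \<in> cball p R \<Longrightarrow> dist y x < d1 \<Longrightarrow> dist (P y) (P x) < \<eta>"
      using compact_uniformly_continuous[OF contP compact_cball] \<eta> unfolding uniformly_continuous_on_def by metis
    obtain d2 where d2: "d2 > 0" "\<And>x y. x \<in> cball p R \<Longrightarrow> y \<in> cball p R \<Longrightarrow> dist y x < d2 \<Longrightarrow> dist (pdx P y) (pdx P x) < \<eta>"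
      using compact_uniformly_continuous[OF contPx compact_cball] \<eta> unfolding uniformly_continuous_on_def by metis
    have "(h has_derivative (\<lambda>x. x *\<^sub>R a (P (Z s 0)) (h s))) (at s)"
      using h(2)[OF s'] s at_within_Icc_at[of "-r" s r] by (simp add: has_vector_derivative_def abs_less_iff)
    then obtain d3 where d3: "d3 > 0" "\<And>y. norm (y - s) < d3 \<Longrightarrow> norm (h y - h s - (y - s) *\<^sub>R a (P (Z s 0)) (h s)) \<le> \<eta> * norm (y - s)"
      unfolding has_derivative_at_alt using \<eta> by blast
    define d where "d = min (min d1 d2) (min d3 (r - \<bar>s\<bar>))"
    have "d > 0" using d1 d2 d3 s by (simp add: d_def)
    moreover have "norm (w y t - w s t - (y - s) *\<^sub>R a (P (Z s t)) (w s t)) \<le> e * norm (y - s)"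
      if y: "norm (y - s) < d" for y
    proof -
      define \<sigma> where "\<sigma> = y - s"
      have \<sigma>: "\<bar>\<sigma>\<bar> < d1" "\<bar>\<sigma>\<bar> < d2" "\<bar>\<sigma>\<bar> < d3" "\<bar>\<sigma>\<bar> < r - \<bar>s\<bar>" and y_eq: "y = s + \<sigma>"
        using y by (auto simp: d_def \<sigma>_def)
      have near: "s + \<tau> \<in> {-r..r}" "\<And>t. dist (Z (s + \<tau>) t) (Z s t) \<le> \<bar>\<sigma>\<bar>" if "\<tau> \<in> {-\<bar>\<sigma>\<bar>..\<bar>\<sigma>\<bar>}" for \<tau>
        using that \<sigma>(4) by (auto simp: Z_def dist_norm)
      have \<sigma>in: "\<sigma> \<in> {-\<bar>\<sigma>\<bar>..\<bar>\<sigma>\<bar>}" by auto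
      have y': "y \<in> {-r..r}" using near(1)[OF \<sigma>in] y_eq by simp
      have p1: "norm (P (Z y t) - P (Z s t)) \<le> \<eta>" if "t \<in> {-r..r}" for t
        using d1(2)[OF Zin[OF s' that] Zin[OF y' that]] near(2)[OF \<sigma>in, of t] \<sigma>(1) by (simp add: y_eq dist_norm)
      have p2: "norm (P (Z y t) - P (Z s t) - \<sigma> *\<^sub>R pdx P (Z s t)) \<le> \<eta> * \<bar>\<sigma>\<bar>" if t: "t \<in> {-r..r}" for t
      proof -
        have "norm ((P (Z (s + \<sigma>) t) - \<sigma> *\<^sub>R pdx P (Z s t)) - (P (Z (s + 0) t) - 0 *\<^sub>R pdx P (Z s t))) \<le> \<eta> * \<bar>\<sigma> - 0\<bar>"
        proof (rule vector_mean_value_bound_on[where a = "-\<bar>\<sigma>\<bar>" and b = "\<bar>\<sigma>\<bar>" and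
             f = "\<lambda>\<tau>. P (Z (s + \<tau>) t) - \<tau> *\<^sub>R pdx P (Z s t)" and f' = "\<lambda>\<tau>. pdx P (Z (s + \<tau>) t) - pdx P (Z s t)"])
          fix \<tau> assume \<tau>: "\<tau> \<in> {-\<bar>\<sigma>\<bar>..\<bar>\<sigma>\<bar>}"
          have "((\<lambda>\<tau>. P (Z (s + \<tau>) t)) has_derivative (\<lambda>x. x *\<^sub>R pdx P (Z (s + \<tau>) t))) (at \<tau> within {-\<bar>\<sigma>\<bar>..\<bar>\<sigma>\<bar>})"
            by (rule has_derivative_compose[where f = "\<lambda>\<tau>. s + \<tau>" and f' = "\<lambda>x. x" and g = "\<lambda>s. P (Z s t)"])
              (use vP(2)[OF near(1)[OF \<tau>] t] in \<open>auto intro!: derivative_eq_intros simp: has_vector_derivative_def\<close>)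
          then show "((\<lambda>\<tau>. P (Z (s + \<tau>) t) - \<tau> *\<^sub>R pdx P (Z s t)) has_vector_derivative
             pdx P (Z (s + \<tau>) t) - pdx P (Z s t)) (at \<tau> within {-\<bar>\<sigma>\<bar>..\<bar>\<sigma>\<bar>})"
            unfolding has_vector_derivative_def[symmetric] by (auto intro!: derivative_eq_intros)
          show "norm (pdx P (Z (s + \<tau>) t) - pdx P (Z s t)) \<le> \<eta>"
            using d2(2)[OF Zin[OF s' t] Zin[OF near(1)[OF \<tau>] t]] near(2)[OF \<tau>, of t] \<sigma>(2) by (simp add: dist_norm)
        qed auto
        then show ?thesis by (simp add: y_eq algebra_simps)
      qed
      define E where "E t = a (P (Z s t)) (w s t)" for t
      \<comment> \<open>Flatness enters here: \<open>E\<close> solves the vertical equation differentiated in the horizontal direction.\<close>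
      have dE: "(E has_vector_derivative b (pdx P (Z s t)) (w s t) + b (P (Z s t)) (E t)) (at t within {-r..r})"
        if t: "t \<in> {-r..r}" for t
        using a.has_vector_derivative[OF vP(1)[OF s' t] w(2)[OF s' t]] flat[OF ZD[OF s' t], of "w s t"]
        unfolding E_def by (simp add: add.commute)
      have Eb: "norm (E t) \<le> K * M" if t: "t \<in> {-r..r}" for t
        using PK(1)[OF Zin[OF s' t], of "w s t"] wb[OF s' t] K unfolding E_def by (smt (verit) mult_left_mono)
      \<comment> \<open>The error of the linear approximation; it is to be \<open>o(\<sigma>)\<close> uniformly in \<open>t\<close>.\<close>
      define W where "W t = w y t - w s t - \<sigma> *\<^sub>R E t" for t
      define W' where "W' t = b (P (Z y t)) (w y t) - b (P (Z s t)) (w s t)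
          - \<sigma> *\<^sub>R (b (pdx P (Z s t)) (w s t) + b (P (Z s t)) (E t))" for t
      have dW: "(W has_vector_derivative W' t) (at t within {-r..r})" if t: "t \<in> {-r..r}" for t
        unfolding W_def W'_def using w(2)[OF y' t] w(2)[OF s' t] dE[OF t]
        by (intro has_vector_derivative_diff has_vector_derivative_scaleR[of "\<lambda>_. \<sigma>" 0, simplified]) auto
      have W'b: "norm (W' t) \<le> K * norm (W t) + \<bar>\<sigma>\<bar> * \<eta> * (C * M * (1 + K))" if t: "t \<in> {-r..r}" for t
      proof -
        have "W' t = b (P (Z y t)) (W t) + b (P (Z y t) - P (Z s t) - \<sigma> *\<^sub>R pdx P (Z s t)) (w s t)
            + \<sigma> *\<^sub>R b (P (Z y t) - P (Z s t)) (E t)"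
          by (simp add: W'_def W_def b.diff_right b.diff_left b.add_left b.add_right b.scaleR_right b.scaleR_left algebra_simps)
        also have "norm \<dots> \<le> norm (b (P (Z y t)) (W t)) + norm (b (P (Z y t) - P (Z s t) - \<sigma> *\<^sub>R pdx P (Z s t)) (w s t))
            + norm (\<sigma> *\<^sub>R b (P (Z y t) - P (Z s t)) (E t))"
          by (intro norm_triangle_mono order_refl)
        also have "\<dots> \<le> K * norm (W t) + (\<eta> * \<bar>\<sigma>\<bar>) * M * C + \<bar>\<sigma>\<bar> * (\<eta> * (K * M) * C)"
        proof (intro add_mono)
          show "norm (b (P (Z y t)) (W t)) \<le> K * norm (W t)" by (rule PK(2)[OF Zin[OF y' t]])
          have "norm (P (Z y t) - P (Z s t) - \<sigma> *\<^sub>R pdx P (Z s t)) * norm (w s t) * C \<le> (\<eta> * \<bar>\<sigma>\<bar>) * M * C"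
            using p2[OF t] wb[OF s' t] C(1) \<eta> by (intro mult_right_mono mult_mono) auto
          then show "norm (b (P (Z y t) - P (Z s t) - \<sigma> *\<^sub>R pdx P (Z s t)) (w s t)) \<le> (\<eta> * \<bar>\<sigma>\<bar>) * M * C"
            using C(3) order_trans by blast
          have "norm (P (Z y t) - P (Z s t)) * norm (E t) * C \<le> \<eta> * (K * M) * C"
            using p1[OF t] Eb[OF t] C(1) \<eta> by (intro mult_right_mono mult_mono) auto
          then have "norm (b (P (Z y t) - P (Z s t)) (E t)) \<le> \<eta> * (K * M) * C"
            using C(3) order_trans by blast
          then show "norm (\<sigma> *\<^sub>R b (P (Z y t) - P (Z s t)) (E t)) \<le> \<bar>\<sigma>\<bar> * (\<eta> * (K * M) * C)"
            by (simp add: mult_left_mono)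
        qed
        finally show ?thesis by (simp add: algebra_simps)
      qed
      have "norm (W t) \<le> 2 * (norm (W 0) + r * (\<bar>\<sigma>\<bar> * \<eta> * (C * M * (1 + K))))"
        by (rule short_interval_bound[OF r(1,2) dW W'b _ t]) (use K in auto)
      also have "norm (W 0) \<le> \<eta> * \<bar>\<sigma>\<bar>"
        using d3(2)[of y] \<sigma>(3) w(1)[OF y'] w(1)[OF s'] by (simp add: W_def E_def \<sigma>_def)
      also have "2 * (\<eta> * \<bar>\<sigma>\<bar> + r * (\<bar>\<sigma>\<bar> * \<eta> * (C * M * (1 + K)))) = (\<eta> * c) * \<bar>\<sigma>\<bar>"
        by (simp add: c_def algebra_simps)
      also have "\<eta> * c = e" using c by (simp add: \<eta>_def)
      finally show ?thesis by (simp add: W_def E_def \<sigma>_def)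
    qed
    ultimately show "\<exists>d>0. \<forall>y. norm (y - s) < d \<longrightarrow>
      norm (w y t - w s t - (y - s) *\<^sub>R a (P (Z s t)) (w s t)) \<le> e * norm (y - s)" by blast
  qed
  define u where "u \<zeta> = w (Re (\<zeta> - p)) (Im (\<zeta> - p))" for \<zeta>
  have coord: "\<bar>Re (\<zeta> - p)\<bar> < r" "\<bar>Im (\<zeta> - p)\<bar> < r" "Z (Re (\<zeta> - p)) (Im (\<zeta> - p)) = \<zeta>" if "\<zeta> \<in> ball p r" for \<zeta>
    using that abs_Re_le_cmod[of "\<zeta> - p"] abs_Im_le_cmod[of "\<zeta> - p"]
    by (auto simp: dist_norm norm_minus_commute Z_def complex_eq_iff)
  have ux: "((\<lambda>s. u (\<zeta> + of_real s)) has_vector_derivative a (P \<zeta>) (u \<zeta>)) (at 0)" if "\<zeta> \<in> ball p r" for \<zeta>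
  proof -
    have "((\<lambda>s. w s (Im (\<zeta> - p))) has_derivative (\<lambda>v. v *\<^sub>R a (P \<zeta>) (u \<zeta>))) (at (Re (\<zeta> - p) + 0))"
      using wx[OF coord(1)[OF that], of "Im (\<zeta> - p)"] coord(2,3)[OF that]
      by (simp add: has_vector_derivative_def u_def abs_less_iff)
    then have *: "((\<lambda>s. w s (Im (\<zeta> - p))) has_derivative (\<lambda>v. v *\<^sub>R a (P \<zeta>) (u \<zeta>))) (at (Re (\<zeta> - p) + 0))" .
    have "((\<lambda>s. Re (\<zeta> - p) + s) has_derivative (\<lambda>x. x)) (at 0)" by (auto intro!: derivative_eq_intros)
    from has_derivative_compose[OF this *]
    have "((\<lambda>s. w (Re (\<zeta> - p) + s) (Im (\<zeta> - p))) has_derivative (\<lambda>v. v *\<^sub>R a (P \<zeta>) (u \<zeta>))) (at 0)" .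
    then show ?thesis by (simp add: has_vector_derivative_def u_def algebra_simps)
  qed
  have uy: "((\<lambda>t. u (\<zeta> + \<i> * of_real t)) has_vector_derivative b (P \<zeta>) (u \<zeta>)) (at 0)" if "\<zeta> \<in> ball p r" for \<zeta>
  proof -
    have "(w (Re (\<zeta> - p)) has_derivative (\<lambda>v. v *\<^sub>R b (P \<zeta>) (u \<zeta>))) (at (Im (\<zeta> - p) + 0))"
      using w(2)[of "Re (\<zeta> - p)" "Im (\<zeta> - p)"] coord[OF that] at_within_Icc_at[of "-r" "Im (\<zeta> - p)" r]
      by (auto simp: has_vector_derivative_def u_def abs_less_iff)
    then have *: "(w (Re (\<zeta> - p)) has_derivative (\<lambda>v. v *\<^sub>R b (P \<zeta>) (u \<zeta>))) (at (Im (\<zeta> - p) + 0))" .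
    have "((\<lambda>s. Im (\<zeta> - p) + s) has_derivative (\<lambda>x. x)) (at 0)" by (auto intro!: derivative_eq_intros)
    from has_derivative_compose[OF this *]
    have "((\<lambda>s. w (Re (\<zeta> - p)) (Im (\<zeta> - p) + s)) has_derivative (\<lambda>v. v *\<^sub>R b (P \<zeta>) (u \<zeta>))) (at 0)" .
    then show ?thesis by (simp add: has_vector_derivative_def u_def algebra_simps)
  qed
  have "norm (u q - u q') \<le> 2 * (K * M) * norm (q - q')" if q: "q \<in> ball p r" "q' \<in> ball p r" for q q'
  proof -
    define s t s' t' where "s = Re (q - p)" and "t = Im (q - p)" and "s' = Re (q' - p)" and "t' = Im (q' - p)"
    note defs = s_def t_def s'_def t'_def
    have in_r: "\<bar>s\<bar> < r" "\<bar>t\<bar> < r" "\<bar>s'\<bar> < r" "\<bar>t'\<bar> < r" using coord[OF q(1)] coord[OF q(2)] by (auto simp: defs)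
    have "norm (w s t - w s' t) \<le> (K * M) * \<bar>s - s'\<bar>"
    proof (rule vector_mean_value_bound_on[where a = "min s s'" and b = "max s s'"])
      fix x assume x: "x \<in> {min s s'..max s s'}"
      then have x': "\<bar>x\<bar> < r" using in_r by auto
      show "((\<lambda>s. w s t) has_vector_derivative a (P (Z x t)) (w x t)) (at x within {min s s'..max s s'})"
        using wx[OF x', of t] in_r by (simp add: has_vector_derivative_at_within abs_less_iff)
      show "norm (a (P (Z x t)) (w x t)) \<le> K * M"
        using wKM(1)[of x t] x' in_r by (simp add: abs_less_iff)
    qed auto
    moreover have "norm (w s' t - w s' t') \<le> (K * M) * \<bar>t - t'\<bar>"
      by (rule vector_mean_value_bound_on[where a = "-r" and b = r and f' = "\<lambda>t. b (P (Z s' t)) (w s' t)"])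
        (use w(2)[of s'] wKM(2)[of s'] in_r in \<open>auto simp: abs_less_iff\<close>)
    moreover have "norm (w s t - w s' t') \<le> norm (w s t - w s' t) + norm (w s' t - w s' t')"
      using norm_triangle_ineq[of "w s t - w s' t" "w s' t - w s' t'"] by simp
    moreover have "\<bar>s - s'\<bar> \<le> norm (q - q')" "\<bar>t - t'\<bar> \<le> norm (q - q')"
      using abs_Re_le_cmod[of "q - q'"] abs_Im_le_cmod[of "q - q'"] by (auto simp: defs)
    then have "(K * M) * \<bar>s - s'\<bar> \<le> (K * M) * norm (q - q')" "(K * M) * \<bar>t - t'\<bar> \<le> (K * M) * norm (q - q')"
      using K M by (auto intro!: mult_left_mono)
    ultimately show ?thesis by (simp add: u_def defs algebra_simps)
  qed
  then have "(2 * (K * M))-lipschitz_on (ball p r) u"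
    using K M by (intro lipschitz_onI) (auto simp: dist_norm)
  then have "continuous_on (ball p r) u" by (rule lipschitz_on_continuous_on)
  then have cont: "continuous_on (ball p r) (\<lambda>\<zeta>. b (P \<zeta>) (u \<zeta>))"
    by (intro b.continuous_on continuous_on_subset[OF contP]) (use r R in auto)
  show ?thesis
  proof (intro exI[of _ r] exI[of _ u] conjI ballI)
    show "ball p r \<subseteq> D" using R(2) r by auto
    show "u p = u0" using w(1)[of 0] h(1) r by (simp add: u_def)
    show "(u has_derivative (\<lambda>v. Re v *\<^sub>R a (P \<zeta>) (u \<zeta>) + Im v *\<^sub>R b (P \<zeta>) (u \<zeta>))) (at \<zeta>)"
      if "\<zeta> \<in> ball p r" for \<zeta>
      using has_derivative_from_partials[OF open_ball that ux[OF that] uy cont] by simp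
  qed (rule r(1))
qed

text \<open>The difference of two solutions with the same initial value is a solution whose maximum on a
  small disc is at most half of itself.\<close>

lemma linear_system_unique:
  fixes P :: "complex \<Rightarrow> 'm::real_normed_vector" and a b :: "'m \<Rightarrow> 'e::real_normed_vector \<Rightarrow> 'e"
  assumes D: "open D" "p \<in> D" and P: "continuous_on D P"
    and a: "bounded_bilinear a" and b: "bounded_bilinear b"
    and w: "\<And>\<zeta>. \<zeta> \<in> D \<Longrightarrow> (w has_derivative (\<lambda>v. Re v *\<^sub>R a (P \<zeta>) (w \<zeta>) + Im v *\<^sub>R b (P \<zeta>) (w \<zeta>))) (at \<zeta>)"
    and u: "\<And>\<zeta>. \<zeta> \<in> D \<Longrightarrow> (u has_derivative (\<lambda>v. Re v *\<^sub>R a (P \<zeta>) (u \<zeta>) + Im v *\<^sub>R b (P \<zeta>) (u \<zeta>))) (at \<zeta>)"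
    and eq: "w p = u p"
  shows "\<exists>r>0. ball p r \<subseteq> D \<and> (\<forall>\<zeta>\<in>ball p r. w \<zeta> = u \<zeta>)"
proof -
  interpret a: bounded_bilinear a by fact
  interpret b: bounded_bilinear b by fact
  obtain R where R: "R > 0" "cball p R \<subseteq> D" using D open_contains_cball by blast
  have contP: "continuous_on (cball p R) P" by (rule continuous_on_subset[OF P R(2)])
  obtain N where N: "N > 0" "\<And>z. z \<in> cball p R \<Longrightarrow> norm (P z) \<le> N"
    using compact_imp_bounded[OF compact_continuous_image[OF contP compact_cball]]
    unfolding bounded_pos by auto
  obtain Ca where Ca: "Ca > 0" "\<And>x y. norm (a x y) \<le> norm x * norm y * Ca" using a.pos_bounded by blast
  obtain Cb where Cb: "Cb > 0" "\<And>x y. norm (b x y) \<le> norm x * norm y * Cb" using b.pos_bounded by blast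
  define K where "K = N * Ca + N * Cb"
  have K: "K > 0" using N Ca Cb by (simp add: K_def add_pos_pos)
  define r where "r = min R (1 / (2 * K))"
  have r: "r > 0" "r * K \<le> 1/2" "r \<le> R" using R K by (auto simp: r_def field_simps min_def)
  have sub: "cball p r \<subseteq> D" "\<And>z. z \<in> cball p r \<Longrightarrow> norm (P z) \<le> N" using R N r by (auto simp: subset_iff)
  let ?d = "\<lambda>\<zeta>. w \<zeta> - u \<zeta>"
  have dd: "(?d has_derivative (\<lambda>v. Re v *\<^sub>R a (P \<zeta>) (?d \<zeta>) + Im v *\<^sub>R b (P \<zeta>) (?d \<zeta>))) (at \<zeta> within cball p r)"
    if "\<zeta> \<in> cball p r" for \<zeta>
  proof -
    have "\<zeta> \<in> D" using that sub(1) by blast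
    note has_derivative_diff[OF w[OF this] u[OF this]]
    moreover have "(\<lambda>v. Re v *\<^sub>R a (P \<zeta>) (w \<zeta>) + Im v *\<^sub>R b (P \<zeta>) (w \<zeta>) - (Re v *\<^sub>R a (P \<zeta>) (u \<zeta>) + Im v *\<^sub>R b (P \<zeta>) (u \<zeta>)))
       = (\<lambda>v. Re v *\<^sub>R a (P \<zeta>) (?d \<zeta>) + Im v *\<^sub>R b (P \<zeta>) (?d \<zeta>))"
      by (simp add: a.diff_right b.diff_right scaleR_diff_right fun_eq_iff)
    ultimately show ?thesis by (simp add: has_derivative_at_withinI)
  qed
  have "continuous_on (cball p r) ?d"
    unfolding continuous_on_eq_continuous_within using dd has_derivative_continuous by fast
  then have cn: "continuous_on (cball p r) (\<lambda>\<zeta>. norm (?d \<zeta>))" by (rule continuous_on_norm)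
  have "cball p r \<noteq> {}" using r by simp
  then obtain q where q: "q \<in> cball p r" "\<And>\<zeta>. \<zeta> \<in> cball p r \<Longrightarrow> norm (?d \<zeta>) \<le> norm (?d q)"
    using continuous_attains_sup[OF compact_cball _ cn] by blast
  let ?M = "norm (?d q)"
  have "norm (?d q - ?d p) \<le> (K * ?M) * norm (q - p)"
  proof (rule differentiable_bound[OF convex_cball dd])
    fix \<zeta> assume \<zeta>: "\<zeta> \<in> cball p r"
    show "onorm (\<lambda>v. Re v *\<^sub>R a (P \<zeta>) (?d \<zeta>) + Im v *\<^sub>R b (P \<zeta>) (?d \<zeta>)) \<le> K * ?M"
    proof (rule onorm_le)
      fix v
      have "norm (a (P \<zeta>) (?d \<zeta>)) \<le> norm (P \<zeta>) * norm (?d \<zeta>) * Ca" by (rule Ca(2))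
      also have "\<dots> \<le> N * ?M * Ca"
        using sub(2)[OF \<zeta>] q(2)[OF \<zeta>] Ca N by (intro mult_right_mono mult_mono) auto
      finally have A: "norm (a (P \<zeta>) (?d \<zeta>)) \<le> N * ?M * Ca" .
      have "norm (b (P \<zeta>) (?d \<zeta>)) \<le> norm (P \<zeta>) * norm (?d \<zeta>) * Cb" by (rule Cb(2))
      also have "\<dots> \<le> N * ?M * Cb"
        using sub(2)[OF \<zeta>] q(2)[OF \<zeta>] Cb N by (intro mult_right_mono mult_mono) auto
      finally have B: "norm (b (P \<zeta>) (?d \<zeta>)) \<le> N * ?M * Cb" .
      have "norm (Re v *\<^sub>R a (P \<zeta>) (?d \<zeta>) + Im v *\<^sub>R b (P \<zeta>) (?d \<zeta>))
        \<le> \<bar>Re v\<bar> * norm (a (P \<zeta>) (?d \<zeta>)) + \<bar>Im v\<bar> * norm (b (P \<zeta>) (?d \<zeta>))"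
        by (intro order_trans[OF norm_triangle_ineq]) simp
      also have "\<dots> \<le> norm v * (N * ?M * Ca) + norm v * (N * ?M * Cb)"
        using A B by (intro add_mono mult_mono abs_Re_le_cmod abs_Im_le_cmod) auto
      finally show "norm (Re v *\<^sub>R a (P \<zeta>) (?d \<zeta>) + Im v *\<^sub>R b (P \<zeta>) (?d \<zeta>)) \<le> K * ?M * norm v"
        by (simp add: K_def algebra_simps)
    qed
  qed (use q r in auto)
  also have "\<dots> \<le> (K * ?M) * r" using q(1) K by (intro mult_left_mono) (auto simp: dist_norm norm_minus_commute)
  also have "\<dots> = (r * K) * ?M" by simp
  also have "\<dots> \<le> 1/2 * ?M" using r by (intro mult_right_mono) auto
  finally have "?M = 0" using eq by simp
  then show ?thesis using q(2) r sub(1) by (intro exI[of _ r]) (auto simp: subset_iff)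
qed

text \<open>The right-hand side is as often differentiable as the solution itself.\<close>

lemma linear_system_smooth:
  fixes P :: "complex \<Rightarrow> 'm::real_normed_vector" and a b :: "'m \<Rightarrow> 'e::real_normed_vector \<Rightarrow> 'e"
  assumes D: "open D" and P: "smooth_on D P"
    and a: "bounded_bilinear a" and b: "bounded_bilinear b"
    and u: "\<And>\<zeta>. \<zeta> \<in> D \<Longrightarrow> (u has_derivative (\<lambda>v. Re v *\<^sub>R a (P \<zeta>) (u \<zeta>) + Im v *\<^sub>R b (P \<zeta>) (u \<zeta>))) (at \<zeta>)"
  shows "smooth_on D u"
proof -
  have "Ck_on k D u" for k
  proof (induction k)
    case 0
    have "isCont u \<zeta>" if "\<zeta> \<in> D" for \<zeta> using has_derivative_continuous[OF u[OF that]] .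
    then show ?case by (simp add: continuous_at_imp_continuous_on)
  next
    case (Suc k)
    have "Ck_on k D P" using P by (simp add: smooth_on_def)
    then have rhs: "Ck_on k D (\<lambda>\<zeta>. a (P \<zeta>) (u \<zeta>))" "Ck_on k D (\<lambda>\<zeta>. b (P \<zeta>) (u \<zeta>))"
      using Suc by (auto intro: Ck_on_bilinear[OF D a] Ck_on_bilinear[OF D b])
    have "Ck_on k D (\<lambda>\<zeta>. Re v *\<^sub>R a (P \<zeta>) (u \<zeta>) + Im v *\<^sub>R b (P \<zeta>) (u \<zeta>))" for v
      by (rule Ck_on_add[OF D Ck_on_linear[OF D bounded_linear_scaleR_right rhs(1)]
            Ck_on_linear[OF D bounded_linear_scaleR_right rhs(2)]])
    then show ?case using Ck_on_SucI[OF D u] by blast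
  qed
  then show ?thesis by (simp add: smooth_on_def)
qed

section \<open>Lorentzian linear algebra\<close>

definition space_part :: "lvec \<Rightarrow> real^4" where
  "space_part v = (\<chi> k. v $ Some k)"

text \<open>The point of the sphere represented by a null line.\<close>
definition sphere_point :: "lvec \<Rightarrow> real^4" where
  "sphere_point v = (1 / v $ None) *\<^sub>R space_part v"

lemma space_part_simps [simp]:
  "space_part v $ k = v $ Some k" "space_part (u + v) = space_part u + space_part v"
  "space_part (u - v) = space_part u - space_part v"
  "space_part (c *\<^sub>R v) = c *\<^sub>R space_part v" "space_part (- v) = - space_part v" "space_part 0 = 0"
  "space_part (null_vec x) = x"
  by (simp_all add: space_part_def vec_eq_iff null_vec_def)

lemma null_vec_None [simp]: "null_vec x $ None = 1"
  by (simp add: null_vec_def)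

lemma linear_space_part: "linear space_part"
  by (intro linearI) simp_all

lemma bounded_linear_space_part: "bounded_linear space_part"
  using linear_space_part linear_conv_bounded_linear by blast

lemma lvec_eqI: "u $ None = v $ None \<Longrightarrow> space_part u = space_part v \<Longrightarrow> u = (v :: lvec)"
  by (auto simp: vec_eq_iff space_part_def) (metis option.exhaust)

lemma lor_space_part: "lor u v = space_part u \<bullet> space_part v - u $ None * v $ None"
  by (simp add: lor_def inner_vec_def)

lemma lor_commute: "lor u (v::lvec) = lor v u"
  by (simp add: lor_space_part inner_commute mult.commute)

lemma lor_simps [simp]:
  fixes u v w :: lvec
  shows "lor (u + v) w = lor u w + lor v w" "lor w (u + v) = lor w u + lor w v"
    "lor (u - v) w = lor u w - lor v w" "lor w (u - v) = lor w u - lor w v"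
    "lor (c *\<^sub>R u) w = c * lor u w" "lor w (c *\<^sub>R u) = c * lor w u"
    "lor (- u) w = - lor u w" "lor w (- u) = - lor w u" "lor 0 w = 0" "lor w 0 = 0"
  by (simp_all add: lor_space_part algebra_simps)

lemma bounded_bilinear_lor: "bounded_bilinear (lor :: lvec \<Rightarrow> lvec \<Rightarrow> real)"
  unfolding bilinear_conv_bounded_bilinear[symmetric] bilinear_def by (auto intro: linearI)

lemma lor_nondegenerate:
  assumes "\<And>v. lor u v = 0"
  shows "u = (0 :: lvec)"
proof (rule lvec_eqI)
  show "u $ None = (0::lvec) $ None" using assms[of "axis None 1"]
    by (simp add: lor_space_part inner_vec_def axis_def)
  have "lor u (\<chi> i. case i of None \<Rightarrow> 0 | Some k \<Rightarrow> u $ Some k) = 0" by (rule assms)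
  then have "space_part u \<bullet> space_part u = 0" by (simp add: lor_space_part inner_vec_def)
  then show "space_part u = space_part 0" by simp
qed

lemma light_cone_norm: "v \<in> light_cone \<longleftrightarrow> v $ None > 0 \<and> norm (space_part v) = v $ None"
proof -
  have "lor v v = 0 \<longleftrightarrow> (norm (space_part v))\<^sup>2 = (v $ None)\<^sup>2"
    by (simp add: lor_space_part power2_norm_eq_inner[symmetric] power2_eq_square[symmetric])
  also have "v $ None > 0 \<Longrightarrow> \<dots> \<longleftrightarrow> norm (space_part v) = v $ None"
    by (metis less_imp_le norm_ge_zero power2_eq_iff_nonneg)
  finally show ?thesis unfolding light_cone_def by blast
qed

lemma null_vec_light_cone: "x \<in> S3 \<longleftrightarrow> null_vec x \<in> light_cone"
  by (simp add: light_cone_norm)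

lemma scaleR_light_cone: "v \<in> light_cone \<Longrightarrow> c > 0 \<Longrightarrow> c *\<^sub>R v \<in> light_cone"
  by (simp add: light_cone_def)

lemma sphere_point_scaleR [simp]: "c \<noteq> 0 \<Longrightarrow> sphere_point (c *\<^sub>R v) = sphere_point v"
  by (simp add: sphere_point_def)

lemma sphere_point_null_vec [simp]: "sphere_point (null_vec x) = x"
  by (simp add: sphere_point_def)

lemma null_vec_sphere_point: "v $ None \<noteq> 0 \<Longrightarrow> v = v $ None *\<^sub>R null_vec (sphere_point v)"
  by (rule lvec_eqI) (simp_all add: sphere_point_def)

lemma sphere_point_S3: "v \<in> light_cone \<Longrightarrow> sphere_point v \<in> S3"
  by (auto simp: light_cone_norm sphere_point_def)

text \<open>By the Cauchy--Schwarz inequality for the space parts.\<close>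

lemma lor_light_cone_nonpos: "v \<in> light_cone \<Longrightarrow> w \<in> light_cone \<Longrightarrow> lor v w \<le> 0"
  using norm_cauchy_schwarz[of "space_part v" "space_part w"] by (simp add: light_cone_norm lor_space_part)

text \<open>Equality in the Cauchy--Schwarz inequality.\<close>

lemma light_cone_orthogonal_imp_parallel:
  assumes v: "v \<in> light_cone" and w: "w \<in> light_cone" and "lor v w = 0"
  shows "w = (w $ None / v $ None) *\<^sub>R v"
proof -
  have "norm (space_part v) *\<^sub>R space_part w = norm (space_part w) *\<^sub>R space_part v"
    using assms norm_cauchy_schwarz_eq[of "space_part v" "space_part w"]
    by (simp add: light_cone_norm lor_space_part)
  then have "v $ None *\<^sub>R space_part w = w $ None *\<^sub>R space_part v"
    using v w by (simp add: light_cone_norm)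
  then have "(1 / v $ None) *\<^sub>R (v $ None *\<^sub>R space_part w) = (1 / v $ None) *\<^sub>R (w $ None *\<^sub>R space_part v)"
    by simp
  then show ?thesis using v by (intro lvec_eqI) (simp_all add: light_cone_def)
qed

subsection \<open>Frames\<close>

text \<open>In the application \<open>p\<close> is the normalized lift, \<open>X\<close> and \<open>Y\<close> are its partial derivatives, \<open>n\<close> is the
  unit normal, and \<open>h\<close> is the null vector dual to \<open>p\<close>.\<close>

definition lorentz_frame :: "lvec \<Rightarrow> lvec \<Rightarrow> lvec \<Rightarrow> lvec \<Rightarrow> lvec \<Rightarrow> bool" where
  "lorentz_frame p X Y h n \<longleftrightarrow>
     lor p p = 0 \<and> lor h h = 0 \<and> lor p h = -1 \<and> lor X X = 1 \<and> lor Y Y = 1 \<and> lor n n = 1 \<and>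
     lor p X = 0 \<and> lor p Y = 0 \<and> lor p n = 0 \<and> lor h X = 0 \<and> lor h Y = 0 \<and> lor h n = 0 \<and>
     lor X Y = 0 \<and> lor X n = 0 \<and> lor Y n = 0"

lemma lorentz_frame_lor:
  assumes "lorentz_frame p X Y h n"
  shows "lor p p = 0" "lor h h = 0" "lor X X = 1" "lor Y Y = 1" "lor n n = 1"
    "lor p h = -1" "lor h p = -1" "lor p X = 0" "lor X p = 0" "lor p Y = 0" "lor Y p = 0"
    "lor p n = 0" "lor n p = 0" "lor h X = 0" "lor X h = 0" "lor h Y = 0" "lor Y h = 0"
    "lor h n = 0" "lor n h = 0" "lor X Y = 0" "lor Y X = 0" "lor X n = 0" "lor n X = 0"
    "lor Y n = 0" "lor n Y = 0"
  using assms by (simp_all add: lorentz_frame_def lor_commute)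

text \<open>The linear map which takes the frame \<open>p, X, Y, h, n\<close> to the primed vectors; the signs invert
  the Gram matrix of a frame.\<close>

definition frame_map :: "lvec \<Rightarrow> lvec \<Rightarrow> lvec \<Rightarrow> lvec \<Rightarrow> lvec \<Rightarrow>
    lvec \<Rightarrow> lvec \<Rightarrow> lvec \<Rightarrow> lvec \<Rightarrow> lvec \<Rightarrow> lvec \<Rightarrow> lvec" where
  "frame_map p X Y h n p' X' Y' h' n' w =
     lor X w *\<^sub>R X' + lor Y w *\<^sub>R Y' + lor n w *\<^sub>R n' - lor h w *\<^sub>R p' - lor p w *\<^sub>R h'"

lemma linear_frame_map: "linear (frame_map p X Y h n p' X' Y' h' n')"
  by (intro linearI) (simp_all add: frame_map_def algebra_simps)

text \<open>Linear combinations of five vectors, as a linear endomorphism: it is injective iff it is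
  surjective, so that vectors with the Gram matrix of a frame span, and conversely.\<close>

definition combination :: "lvec \<Rightarrow> lvec \<Rightarrow> lvec \<Rightarrow> lvec \<Rightarrow> lvec \<Rightarrow> lvec \<Rightarrow> lvec" where
  "combination p X Y h n v =
     v $ None *\<^sub>R p + v $ Some 1 *\<^sub>R X + v $ Some 2 *\<^sub>R Y + v $ Some 3 *\<^sub>R h + v $ Some 4 *\<^sub>R n"

definition coefficients :: "real \<Rightarrow> real \<Rightarrow> real \<Rightarrow> real \<Rightarrow> real \<Rightarrow> lvec" where
  "coefficients a b c d e = (\<chi> i. case i of None \<Rightarrow> a
     | Some k \<Rightarrow> if k = 1 then b else if k = 2 then c else if k = 3 then d else e)"

lemma combination_coefficients:
  "combination p X Y h n (coefficients a b c d e) = a *\<^sub>R p + b *\<^sub>R X + c *\<^sub>R Y + d *\<^sub>R h + e *\<^sub>R n"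
  by (simp add: combination_def coefficients_def)

lemma coefficients_eq_iff:
  "coefficients a b c d e = coefficients a' b' c' d' e' \<longleftrightarrow> a = a' \<and> b = b' \<and> c = c' \<and> d = d' \<and> e = e'"
proof
  assume *: "coefficients a b c d e = coefficients a' b' c' d' e'"
  then have "coefficients a b c d e $ i = coefficients a' b' c' d' e' $ i" for i by simp
  from this[of None] this[of "Some 1"] this[of "Some 2"] this[of "Some 3"] this[of "Some 4"]
  show "a = a' \<and> b = b' \<and> c = c' \<and> d = d' \<and> e = e'" by (simp add: coefficients_def)
qed simp

lemma linear_combination: "linear (combination p X Y h n)"
  by (intro linearI) (simp_all add: combination_def algebra_simps)

lemma frame_expansion:
  assumes "lorentz_frame p X Y h n"
  shows "frame_map p X Y h n p X Y h n w = w"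
proof -
  note L = lorentz_frame_lor[OF assms]
  have "inj (combination p X Y h n)"
    unfolding linear_injective_0[OF linear_combination]
  proof (intro allI impI)
    fix v assume v: "combination p X Y h n v = 0"
    have "lor (combination p X Y h n v) u = 0" for u by (simp add: v)
    from this[of h] this[of X] this[of Y] this[of p] this[of n]
    have "v $ None = 0" "v $ Some 1 = 0" "v $ Some 2 = 0" "v $ Some 3 = 0" "v $ Some 4 = 0"
      by (simp_all add: combination_def L)
    then show "v = 0" by (intro lvec_eqI) (simp_all add: vec_eq_iff forall_4)
  qed
  then have "surj (combination p X Y h n)"
    by (rule linear_injective_imp_surjective[OF linear_combination]) (rule refl)
  then obtain v where v: "w = combination p X Y h n v" by blast
  show ?thesis unfolding v by (simp add: frame_map_def combination_def L algebra_simps)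
qed

text \<open>The expansion formula says that the vectors span and that the given signs invert their Gram
  matrix; comparing coefficients in the expansion of the vectors themselves recovers the Gram
  matrix.\<close>

lemma lorentz_frame_of_expansion:
  assumes "\<And>w. frame_map p X Y h n p X Y h n w = w"
  shows "lorentz_frame p X Y h n"
proof -
  have ex: "combination p X Y h n (coefficients (- lor h w) (lor X w) (lor Y w) (- lor p w) (lor n w)) = w" for w
    unfolding combination_coefficients using assms[of w] by (simp add: frame_map_def algebra_simps)
  then have "surj (combination p X Y h n)" unfolding surj_def by metis
  then have inj: "inj (combination p X Y h n)"
    by (rule linear_surjective_imp_injective[OF linear_combination]) (rule refl)
  have vecs: "combination p X Y h n (coefficients 1 0 0 0 0) = p" "combination p X Y h n (coefficients 0 1 0 0 0) = X"
    "combination p X Y h n (coefficients 0 0 1 0 0) = Y" "combination p X Y h n (coefficients 0 0 0 1 0) = h"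
    "combination p X Y h n (coefficients 0 0 0 0 1) = n" by (simp_all add: combination_coefficients)
  have "coefficients (- lor h p) (lor X p) (lor Y p) (- lor p p) (lor n p) = coefficients 1 0 0 0 0"
    "coefficients (- lor h X) (lor X X) (lor Y X) (- lor p X) (lor n X) = coefficients 0 1 0 0 0"
    "coefficients (- lor h Y) (lor X Y) (lor Y Y) (- lor p Y) (lor n Y) = coefficients 0 0 1 0 0"
    "coefficients (- lor h h) (lor X h) (lor Y h) (- lor p h) (lor n h) = coefficients 0 0 0 1 0"
    "coefficients (- lor h n) (lor X n) (lor Y n) (- lor p n) (lor n n) = coefficients 0 0 0 0 1"
    by (rule injD[OF inj]; simp only: ex vecs)+
  then show ?thesis by (simp add: coefficients_eq_iff lorentz_frame_def lor_commute)
qed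

lemma frame_map_lor:
  assumes f: "lorentz_frame p X Y h n" and f': "lorentz_frame p' X' Y' h' n'"
  shows "lor (frame_map p X Y h n p' X' Y' h' n' u) (frame_map p X Y h n p' X' Y' h' n' v) = lor u v"
proof -
  have "lor u v = lor (frame_map p X Y h n p X Y h n u) (frame_map p X Y h n p X Y h n v)"
    by (simp add: frame_expansion[OF f])
  then show ?thesis
    by (simp add: frame_map_def lorentz_frame_lor[OF f] lorentz_frame_lor[OF f'])
qed

lemma frame_map_frame:
  assumes "lorentz_frame p X Y h n"
  shows "frame_map p X Y h n p' X' Y' h' n' p = p'" "frame_map p X Y h n p' X' Y' h' n' X = X'"
    "frame_map p X Y h n p' X' Y' h' n' Y = Y'" "frame_map p X Y h n p' X' Y' h' n' h = h'"
    "frame_map p X Y h n p' X' Y' h' n' n = n'"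
  by (simp_all add: frame_map_def lorentz_frame_lor[OF assms])

lemma linear_eq_on_frame:
  assumes f: "lorentz_frame p X Y h n" and B: "linear B" "linear B'"
    and eq: "B p = B' p" "B X = B' X" "B Y = B' Y" "B h = B' h" "B n = B' n"
  shows "B = B'"
proof
  fix w
  have w: "w = lor X w *\<^sub>R X + lor Y w *\<^sub>R Y + lor n w *\<^sub>R n - lor h w *\<^sub>R p - lor p w *\<^sub>R h"
    using frame_expansion[OF f, of w] by (simp add: frame_map_def)
  show "B w = B' w"
    by (subst (1 2) w) (simp add: B[THEN linear_add] B[THEN linear_diff] B[THEN linear_scale] eq)
qed

subsection \<open>Lorentz transformations and the Moebius transformations they induce\<close>

definition lorentz_maps :: "(lvec \<Rightarrow> lvec) set" where
  "lorentz_maps = {B. linear B \<and> (\<forall>u v. lor (B u) (B v) = lor u v) \<and> B ` light_cone \<subseteq> light_cone}"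

lemma lorentz_mapsD:
  assumes "B \<in> lorentz_maps"
  shows "linear B" "lor (B u) (B v) = lor u v" "v \<in> light_cone \<Longrightarrow> B v \<in> light_cone"
  using assms by (auto simp: lorentz_maps_def)

lemma isometry_bij:
  assumes "linear B" "\<And>u v :: lvec. lor (B u) (B v) = lor u v"
  shows "bij B"
proof -
  have "inj B" unfolding linear_injective_0[OF assms(1)]
  proof (intro allI impI)
    fix u assume "B u = 0"
    then have "lor u v = 0" for v using assms(2)[of u v] by simp
    then show "u = 0" by (rule lor_nondegenerate)
  qed
  then show ?thesis
    using linear_injective_imp_surjective[OF assms(1)] by (simp add: bij_def)
qed

text \<open>A linear isometry keeping one forward null vector in the forward cone keeps all of them
  there: the time orientation of a null vector is read off from the sign of its product with a
  forward one.\<close>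

lemma lorentz_mapsI:
  assumes B: "linear B" "\<And>u v. lor (B u) (B v) = lor u v" and p: "p \<in> light_cone" "B p \<in> light_cone"
  shows "B \<in> lorentz_maps"
proof -
  have "B w \<in> light_cone" if w: "w \<in> light_cone" for w
  proof (rule ccontr)
    assume not: "B w \<notin> light_cone"
    have null: "lor (B w) (B w) = 0" using w B(2) by (simp add: light_cone_def)
    have "B w \<noteq> 0"
    proof
      assume "B w = 0"
      then have "B w = B 0" using linear_0[OF B(1)] by simp
      then have "w = 0" using isometry_bij[OF B] by (metis bij_is_inj injD)
      then show False using w by (simp add: light_cone_def)
    qed
    moreover have "B w = 0" if "B w $ None = 0"
      using null that by (intro lvec_eqI) (auto simp: lor_space_part)
    ultimately have "- B w \<in> light_cone" using not null by (force simp: light_cone_def)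
    then have "lor (B p) (- B w) \<le> 0" by (rule lor_light_cone_nonpos[OF p(2)])
    then have "lor p w = 0" using lor_light_cone_nonpos[OF p(1) w] B(2) by simp
    then have "w = (w $ None / p $ None) *\<^sub>R p" by (rule light_cone_orthogonal_imp_parallel[OF p(1) w])
    then have "B w = (w $ None / p $ None) *\<^sub>R B p" using linear_scale[OF B(1)] by metis
    moreover have "w $ None / p $ None > 0" using w p(1) by (simp add: light_cone_def)
    ultimately show False using not scaleR_light_cone[OF p(2)] by metis
  qed
  then show ?thesis using B by (auto simp: lorentz_maps_def)
qed

lemma lorentz_maps_id: "id \<in> lorentz_maps" and lorentz_maps_comp:
  "B \<in> lorentz_maps \<Longrightarrow> C \<in> lorentz_maps \<Longrightarrow> B \<circ> C \<in> lorentz_maps"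
  by (auto simp: lorentz_maps_def linear_compose linear_id image_subset_iff)

lemma lorentz_maps_inv:
  assumes "B \<in> lorentz_maps"
  shows "inv_into UNIV B \<in> lorentz_maps" "inv_into UNIV B \<circ> B = id" "B \<circ> inv_into UNIV B = id"
proof -
  note B = lorentz_mapsD[OF assms]
  have bij: "bij B" by (rule isometry_bij[OF B(1,2)])
  then show id: "inv_into UNIV B \<circ> B = id" "B \<circ> inv_into UNIV B = id" by (auto simp: bij_def surj_iff)
  have lin: "linear (inv_into UNIV B)" using B(1) bij
    by (metis bij_betw_def bij_is_inj bij_is_surj id(1) left_inverse_linear linear_injective_left_inverse inv_o_cancel)
  have iso: "lor (inv_into UNIV B u) (inv_into UNIV B v) = lor u v" for u v
    using B(2)[of "inv_into UNIV B u" "inv_into UNIV B v"] id(2) by (simp add: fun_eq_iff)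
  show "inv_into UNIV B \<in> lorentz_maps"
  proof -
    let ?v = "null_vec (axis 1 1)"
    have v: "?v \<in> light_cone" by (simp add: null_vec_light_cone[symmetric])
    then have "B ?v \<in> light_cone" by (rule B(3))
    moreover have "inv_into UNIV B (B ?v) = ?v" using id(1) by (simp add: fun_eq_iff)
    ultimately show ?thesis using lorentz_mapsI[OF lin iso, of "B ?v"] v by simp
  qed
qed

text \<open>The cocycle of the existence proof takes values in this group; working with linear maps
  instead of Moebius transformations also keeps track of the normal fields.\<close>

definition lorentz_group :: "(lvec \<Rightarrow> lvec) monoid" where
  "lorentz_group = \<lparr>carrier = lorentz_maps, mult = (\<circ>), one = id\<rparr>"

lemma group_lorentz_group: "group lorentz_group"
proof (rule groupI)
  fix B assume "B \<in> carrier lorentz_group"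
  then show "\<exists>C\<in>carrier lorentz_group. C \<otimes>\<^bsub>lorentz_group\<^esub> B = \<one>\<^bsub>lorentz_group\<^esub>"
    using lorentz_maps_inv by (auto simp: lorentz_group_def)
qed (auto simp: lorentz_group_def lorentz_maps_id lorentz_maps_comp o_assoc)

text \<open>Restricted to the sphere, because the elements of the Moebius group are extensional.\<close>

definition moebius_of :: "(lvec \<Rightarrow> lvec) \<Rightarrow> real^4 \<Rightarrow> real^4" where
  "moebius_of B = (\<lambda>x\<in>S3. sphere_point (B (null_vec x)))"

lemma moebius_of_S3: "B \<in> lorentz_maps \<Longrightarrow> x \<in> S3 \<Longrightarrow> moebius_of B x \<in> S3"
  unfolding moebius_of_def using sphere_point_S3 lorentz_mapsD(3) null_vec_light_cone by simp

lemma moebius_of_sphere_point: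
  assumes B: "B \<in> lorentz_maps" and v: "v \<in> light_cone"
  shows "moebius_of B (sphere_point v) = sphere_point (B v)"
proof -
  have n: "v $ None > 0" using v by (simp add: light_cone_def)
  have "B v = v $ None *\<^sub>R B (null_vec (sphere_point v))"
    using null_vec_sphere_point[of v] n linear_scale[OF lorentz_mapsD(1)[OF B]] by (metis less_irrefl)
  then show ?thesis using sphere_point_S3[OF v] n by (simp add: moebius_of_def)
qed

lemma moebius_of_comp:
  assumes "B \<in> lorentz_maps" "C \<in> lorentz_maps"
  shows "moebius_of (B \<circ> C) = compose S3 (moebius_of B) (moebius_of C)"
proof
  fix x
  show "moebius_of (B \<circ> C) x = compose S3 (moebius_of B) (moebius_of C) x"
  proof (cases "x \<in> S3")
    case True
    then have "C (null_vec x) \<in> light_cone" using lorentz_mapsD(3)[OF assms(2)] null_vec_light_cone by blast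
    from moebius_of_sphere_point[OF assms(1) this] show ?thesis
      using True by (auto simp: compose_def moebius_of_def)
  qed (simp add: compose_def moebius_of_def)
qed

lemma moebius_of_id: "moebius_of id = (\<lambda>x\<in>S3. x)"
  by (simp add: moebius_of_def)

lemma moebius_of_moebius_maps:
  assumes B: "B \<in> lorentz_maps"
  shows "moebius_of B \<in> moebius_maps"
proof -
  have inv: "moebius_of C (moebius_of B x) = x" if "C \<in> lorentz_maps" "B \<in> lorentz_maps" "C \<circ> B = id" "x \<in> S3" for B C x
    using moebius_of_comp[OF that(1,2)] that(3,4) moebius_of_id by (metis compose_eq restrict_apply')
  have "bij_betw (moebius_of B) S3 S3"
    by (rule bij_betw_byWitness[where f' = "moebius_of (inv_into UNIV B)"])
      (use inv lorentz_maps_inv[OF B] B moebius_of_S3 in auto)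
  then have "moebius_of B \<in> Bij S3" by (simp add: Bij_def moebius_of_def)
  moreover have "B (null_vec x) \<in> span {null_vec (moebius_of B x)}" if "x \<in> S3" for x
  proof -
    have "B (null_vec x) \<in> light_cone" using lorentz_mapsD(3)[OF B] that null_vec_light_cone by blast
    then have "B (null_vec x) = B (null_vec x) $ None *\<^sub>R null_vec (moebius_of B x)"
      using null_vec_sphere_point[of "B (null_vec x)"] that by (simp add: moebius_of_def light_cone_def)
    then show ?thesis by (metis span_base span_scale singletonI)
  qed
  ultimately show ?thesis using lorentz_mapsD[OF B] unfolding moebius_maps_def by blast
qed

section \<open>Locally constant cocycles on simply connected spaces\<close>

lemma eventually_at_within_self: "\<forall>\<^sub>F y in at a within Y. y \<in> Y"
  unfolding eventually_at_topological by (intro exI[of _ UNIV]) simp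

lemma eventually_at_within_subset:
  "\<forall>\<^sub>F y in at a within Y. P y \<Longrightarrow> Z \<subseteq> Y \<Longrightarrow> \<forall>\<^sub>F y in at a within Z. P y"
  by (meson at_le filter_leD)

lemma eventually_at_within_openin:
  assumes "openin (top_of_set X) T" "x \<in> T" "\<And>y. y \<in> T \<Longrightarrow> P y"
  shows "\<forall>\<^sub>F y in at x within X. P y"
  using assms unfolding openin_open eventually_at_topological by blast

lemma eventually_at_within_openinD:
  assumes ev: "\<forall>\<^sub>F y in at x within X. P y" and x: "x \<in> X" "P x"
  shows "\<exists>T. openin (top_of_set X) T \<and> x \<in> T \<and> (\<forall>y\<in>T. P y)"
proof -
  obtain S where "open S" "x \<in> S" "\<forall>y\<in>S. y \<noteq> x \<longrightarrow> y \<in> X \<longrightarrow> P y"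
    using ev unfolding eventually_at_topological by blast
  then show ?thesis using x by (intro exI[of _ "X \<inter> S"]) (auto simp: openin_open_Int)
qed

lemma eventually_continuous_on:
  assumes "continuous_on Y q" "y \<in> Y" "open T" "q y \<in> T"
  shows "\<forall>\<^sub>F y' in at y within Y. q y' \<in> T"
  using topological_tendstoD[of q "q y" "at y within Y" T] assms unfolding continuous_on_def by blast

lemma eventually_constant_imp_constant:
  assumes "connected Y" "\<And>a. a \<in> Y \<Longrightarrow> \<forall>\<^sub>F y in at a within Y. d y = d a"
  shows "d constant_on Y"
proof (rule locally_constant_imp_constant[OF assms(1)])
  fix a assume a: "a \<in> Y"
  obtain S where S: "open S" "a \<in> S" "\<And>y. y \<in> S \<Longrightarrow> y \<in> Y \<Longrightarrow> d y = d a"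
    using assms(2)[OF a] unfolding eventually_at_topological by metis
  have "openin (top_of_set Y) (Y \<inter> S)" using S(1) by (rule openin_open_Int)
  then show "\<exists>T. openin (top_of_set Y) T \<and> a \<in> T \<and> (\<forall>x\<in>T. d x = d a)" using S a by blast
qed

text \<open>Constant loops are freely homotopic, and a homotopy traces out a path.\<close>

lemma simply_connected_paths:
  fixes N :: "'x::topological_space set"
  assumes sc: "simply_connected N" and x: "x0 \<in> N" "x \<in> N"
  shows "\<exists>p. path p \<and> path_image p \<subseteq> N \<and> pathstart p = x0 \<and> pathfinish p = x"
proof -
  have "homotopic_loops N (\<lambda>_. x) (\<lambda>_. x0)"
    by (rule sc[unfolded simply_connected_def, rule_format])
      (use x in \<open>auto simp: path_def path_image_def pathfinish_def pathstart_def\<close>)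
  then obtain H :: "real \<times> real \<Rightarrow> 'x" where H: "continuous_on ({0..1} \<times> {0..1}) H"
    "\<forall>x\<in>{0..1} \<times> {0..1}. H x \<in> N" "\<forall>t\<in>{0..1}. H (0, t) = x" "\<forall>t\<in>{0..1}. H (1, t) = x0"
    unfolding homotopic_loops pathfinish_def pathstart_def Pi_iff o_def by auto
  have "path (\<lambda>t. H (1 - t, 0))"
    unfolding path_def by (rule continuous_on_compose2[OF H(1)]) (auto intro!: continuous_intros)
  then show ?thesis
    using H(2-4) by (intro exI[of _ "\<lambda>t. H (1 - t, 0)"]) (auto simp: path_image_def pathstart_def pathfinish_def)
qed

lemma simply_connected_connected:
  fixes N :: "'x::topological_space set"
  assumes "simply_connected N"
  shows "connected N"
  using simply_connected_paths[OF assms] by (intro path_connected_imp_connected) (simp add: path_connected_def)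

text \<open>Local constancy is stated pointwise, since the functions \<open>g i j\<close> matter only on \<open>W i \<inter> W j\<close>.\<close>

locale locally_constant_cocycle = group G for G (structure) +
  fixes N :: "'x::topological_space set" and I :: "'i set" and W :: "'i \<Rightarrow> 'x set"
    and g :: "'i \<Rightarrow> 'i \<Rightarrow> 'x \<Rightarrow> 'a"
  assumes W_open: "\<And>i. i \<in> I \<Longrightarrow> openin (top_of_set N) (W i)"
    and W_cover: "\<And>x. x \<in> N \<Longrightarrow> \<exists>i\<in>I. x \<in> W i"
    and g_carrier: "\<And>i j x. i \<in> I \<Longrightarrow> j \<in> I \<Longrightarrow> x \<in> W i \<Longrightarrow> x \<in> W j \<Longrightarrow> g i j x \<in> carrier G"
    and g_cocycle: "\<And>i j k x. i \<in> I \<Longrightarrow> j \<in> I \<Longrightarrow> k \<in> I \<Longrightarrow> x \<in> W i \<Longrightarrow> x \<in> W j \<Longrightarrow> x \<in> W k \<Longrightarrow>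
      g i j x \<otimes> g j k x = g i k x"
    and g_local: "\<And>i j x. i \<in> I \<Longrightarrow> j \<in> I \<Longrightarrow> x \<in> W i \<Longrightarrow> x \<in> W j \<Longrightarrow>
      \<forall>\<^sub>F y in at x within N. g i j y = g i j x"
begin

text \<open>A trivialisation of the pullback of the cocycle under \<open>q : Y \<rightarrow> N\<close>.  Pullbacks to intervals
  and squares are needed for the monodromy argument; the identity map of \<open>N\<close> is the case of
  interest.\<close>

definition trivial_along :: "('y::topological_space \<Rightarrow> 'x) \<Rightarrow> 'y set \<Rightarrow> ('i \<Rightarrow> 'y \<Rightarrow> 'a) \<Rightarrow> bool" where
  "trivial_along q Y h \<longleftrightarrow> continuous_on Y q \<and> q ` Y \<subseteq> N \<and>
     (\<forall>i\<in>I. \<forall>y\<in>Y. q y \<in> W i \<longrightarrow> h i y \<in> carrier G \<and> (\<forall>\<^sub>F y' in at y within Y. h i y' = h i y)) \<and>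
     (\<forall>i\<in>I. \<forall>j\<in>I. \<forall>y\<in>Y. q y \<in> W i \<longrightarrow> q y \<in> W j \<longrightarrow> h j y = h i y \<otimes> g i j (q y))"

lemma trivial_alongD:
  assumes "trivial_along q Y h" "y \<in> Y" "i \<in> I" "q y \<in> W i"
  shows "h i y \<in> carrier G" "\<forall>\<^sub>F y' in at y within Y. h i y' = h i y"
    "j \<in> I \<Longrightarrow> q y \<in> W j \<Longrightarrow> h j y = h i y \<otimes> g i j (q y)"
  using assms unfolding trivial_along_def by blast+

lemma trivial_alongI:
  assumes "continuous_on Y q" "\<And>y. y \<in> Y \<Longrightarrow> q y \<in> N"
    and "\<And>i y. y \<in> Y \<Longrightarrow> i \<in> I \<Longrightarrow> q y \<in> W i \<Longrightarrow> h i y \<in> carrier G"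
    and "\<And>i y. y \<in> Y \<Longrightarrow> i \<in> I \<Longrightarrow> q y \<in> W i \<Longrightarrow> \<forall>\<^sub>F y' in at y within Y. h i y' = h i y"
    and "\<And>i j y. y \<in> Y \<Longrightarrow> i \<in> I \<Longrightarrow> q y \<in> W i \<Longrightarrow> j \<in> I \<Longrightarrow> q y \<in> W j \<Longrightarrow> h j y = h i y \<otimes> g i j (q y)"
  shows "trivial_along q Y h"
  unfolding trivial_along_def image_subset_iff by (intro conjI ballI impI assms)

lemma trivial_along_continuous: "trivial_along q Y h \<Longrightarrow> continuous_on Y q"
  and trivial_along_maps: "trivial_along q Y h \<Longrightarrow> y \<in> Y \<Longrightarrow> q y \<in> N"
  unfolding trivial_along_def by auto

lemma trivial_along_subset:
  assumes h: "trivial_along q Y h" and Z: "Z \<subseteq> Y"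
  shows "trivial_along q Z h"
proof (rule trivial_alongI)
  show "continuous_on Z q" using trivial_along_continuous[OF h] Z by (rule continuous_on_subset)
  fix i y assume y: "y \<in> Z"
  then have y': "y \<in> Y" using Z by blast
  show "q y \<in> N" using trivial_along_maps[OF h y'] .
  assume i: "i \<in> I" "q y \<in> W i"
  note D = trivial_alongD[OF h y' i]
  show "h i y \<in> carrier G" by (rule D(1))
  show "\<forall>\<^sub>F y' in at y within Z. h i y' = h i y" by (rule eventually_at_within_subset[OF D(2) Z])
  show "h j y = h i y \<otimes> g i j (q y)" if "j \<in> I" "q y \<in> W j" for j by (rule D(3)[OF that])
qed

lemma trivial_along_cong:
  assumes h: "trivial_along q Y h" and eq: "\<And>y. y \<in> Y \<Longrightarrow> q y = q' y"
  shows "trivial_along q' Y h"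
proof (rule trivial_alongI)
  show "continuous_on Y q'" using trivial_along_continuous[OF h] eq by (simp cong: continuous_on_cong)
  fix i y assume y: "y \<in> Y"
  show "q' y \<in> N" using trivial_along_maps[OF h y] eq[OF y] by simp
  assume i: "i \<in> I" "q' y \<in> W i"
  note D = trivial_alongD[OF h y i(1), unfolded eq[OF y], OF i(2)]
  show "h i y \<in> carrier G" "\<forall>\<^sub>F y' in at y within Y. h i y' = h i y" by (rule D(1), rule D(2))
  show "h j y = h i y \<otimes> g i j (q' y)" if "j \<in> I" "q' y \<in> W j" for j by (rule D(3)[OF that])
qed

lemma trivial_along_compose:
  assumes h: "trivial_along q Y h" and r: "continuous_on Z r" "r ` Z \<subseteq> Y"
  shows "trivial_along (q \<circ> r) Z (\<lambda>i z. h i (r z))"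
proof (rule trivial_alongI)
  show "continuous_on Z (q \<circ> r)"
    using continuous_on_compose[OF r(1) continuous_on_subset[OF trivial_along_continuous[OF h] r(2)]] .
  fix i z assume z: "z \<in> Z"
  then have y: "r z \<in> Y" using r(2) by blast
  show "(q \<circ> r) z \<in> N" using trivial_along_maps[OF h y] by simp
  assume i: "i \<in> I" "(q \<circ> r) z \<in> W i"
  then have i': "i \<in> I" "q (r z) \<in> W i" by auto
  note D = trivial_alongD[OF h y i']
  show "h i (r z) \<in> carrier G" by (rule D(1))
  show "h j (r z) = h i (r z) \<otimes> g i j ((q \<circ> r) z)" if "j \<in> I" "(q \<circ> r) z \<in> W j" for j
    using D(3)[of j] that by simp
  obtain S where S: "open S" "r z \<in> S" "\<And>y'. y' \<in> S \<Longrightarrow> y' \<in> Y \<Longrightarrow> h i y' = h i (r z)"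
    using D(2) unfolding eventually_at_topological by metis
  have "\<forall>\<^sub>F z' in at z within Z. r z' \<in> S"
    using eventually_continuous_on[OF r(1) z S(1,2)] .
  moreover have "\<forall>\<^sub>F z' in at z within Z. z' \<in> Z" by (rule eventually_at_within_self)
  ultimately show "\<forall>\<^sub>F z' in at z within Z. h i (r z') = h i (r z)"
    by eventually_elim (use S r(2) in auto)
qed

lemma trivial_along_translate:
  assumes h: "trivial_along q Y h" and c: "c \<in> carrier G"
  shows "trivial_along q Y (\<lambda>i y. c \<otimes> h i y)"
proof (rule trivial_alongI)
  show "continuous_on Y q" using trivial_along_continuous[OF h] .
  fix i y assume y: "y \<in> Y"
  show "q y \<in> N" using trivial_along_maps[OF h y] .
  assume i: "i \<in> I" "q y \<in> W i"
  note D = trivial_alongD[OF h y i]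
  show "c \<otimes> h i y \<in> carrier G" using D(1) c by simp
  show "\<forall>\<^sub>F y' in at y within Y. c \<otimes> h i y' = c \<otimes> h i y" using D(2) by eventually_elim simp
  show "c \<otimes> h j y = (c \<otimes> h i y) \<otimes> g i j (q y)" if j: "j \<in> I" "q y \<in> W j" for j
    using D(1) D(3)[OF j] g_carrier[OF i(1) j(1) i(2) j(2)] c by (simp add: m_assoc)
qed

text \<open>The quotient of two trivialisations is independent of the index and locally constant.\<close>

lemma trivial_along_unique:
  assumes h: "trivial_along q Y h" and k: "trivial_along q Y k" and "connected Y"
    and y0: "y0 \<in> Y" "i0 \<in> I" "q y0 \<in> W i0" and y: "y \<in> Y" "i \<in> I" "q y \<in> W i"
  shows "k i y = (k i0 y0 \<otimes> inv h i0 y0) \<otimes> h i y"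
proof -
  define e where "e y = (SOME i. i \<in> I \<and> q y \<in> W i)" for y
  have e: "e y \<in> I \<and> q y \<in> W (e y)" if "y \<in> Y" for y
  proof -
    have "\<exists>i. i \<in> I \<and> q y \<in> W i" using W_cover[OF trivial_along_maps[OF h that]] by blast
    then show ?thesis unfolding e_def by (rule someI_ex)
  qed
  define d where "d y = k (e y) y \<otimes> inv h (e y) y" for y
  have indep: "k i y \<otimes> inv h i y = d y" if "y \<in> Y" "i \<in> I" "q y \<in> W i" for i y
  proof -
    note e = e[OF \<open>y \<in> Y\<close>, THEN conjunct1] e[OF \<open>y \<in> Y\<close>, THEN conjunct2]
    have c: "h (e y) y \<in> carrier G" "k (e y) y \<in> carrier G" "g (e y) i (q y) \<in> carrier G"
      using trivial_alongD(1)[OF h that(1) e] trivial_alongD(1)[OF k that(1) e] g_carrier e that by auto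
    have "k i y \<otimes> inv h i y = (k (e y) y \<otimes> g (e y) i (q y)) \<otimes> inv (h (e y) y \<otimes> g (e y) i (q y))"
      using trivial_alongD(3)[OF h that(1) e that(2,3)] trivial_alongD(3)[OF k that(1) e that(2,3)] by simp
    also have "\<dots> = k (e y) y \<otimes> (g (e y) i (q y) \<otimes> (inv g (e y) i (q y) \<otimes> inv h (e y) y))"
      using c by (simp add: inv_mult_group m_assoc)
    also have "g (e y) i (q y) \<otimes> (inv g (e y) i (q y) \<otimes> inv h (e y) y) = inv h (e y) y"
      using c by (metis inv_closed l_one m_assoc r_inv)
    finally show ?thesis by (simp add: d_def)
  qed
  have "d constant_on Y"
  proof (rule eventually_constant_imp_constant[OF \<open>connected Y\<close>])
    fix a assume a: "a \<in> Y"
    note e = e[OF a, THEN conjunct1] e[OF a, THEN conjunct2]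
    have "\<forall>\<^sub>F y in at a within Y. q y \<in> W (e a)"
    proof -
      obtain T where T: "open T" "W (e a) = N \<inter> T" using W_open[OF e(1)] unfolding openin_open by blast
      have "\<forall>\<^sub>F y in at a within Y. q y \<in> T"
        using eventually_continuous_on[OF trivial_along_continuous[OF h] a T(1)] T(2) e by blast
      moreover have "\<forall>\<^sub>F y in at a within Y. y \<in> Y" by (rule eventually_at_within_self)
      ultimately show ?thesis
        by eventually_elim (use trivial_along_maps[OF h] T in auto)
    qed
    moreover note trivial_alongD(2)[OF h a e] trivial_alongD(2)[OF k a e]
    moreover have "\<forall>\<^sub>F y in at a within Y. y \<in> Y" by (rule eventually_at_within_self)
    ultimately show "\<forall>\<^sub>F y in at a within Y. d y = d a"
      by eventually_elim (metis indep a e)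
  qed
  then have "d y = d y0" using y(1) y0(1) unfolding constant_on_def by auto
  then have "k i y \<otimes> inv h i y = k i0 y0 \<otimes> inv h i0 y0" using indep[OF y] indep[OF y0] by simp
  moreover have "h i y \<in> carrier G" "k i y \<in> carrier G"
    using trivial_alongD(1)[OF h y] trivial_alongD(1)[OF k y] by auto
  ultimately show ?thesis
    by (metis inv_closed l_inv m_assoc m_closed r_one)
qed

lemma trivial_along_unique_eq:
  assumes h: "trivial_along q Y h" and k: "trivial_along q Y k" and "connected Y"
    and y0: "y0 \<in> Y" "i0 \<in> I" "q y0 \<in> W i0" "k i0 y0 = h i0 y0" and y: "y \<in> Y" "i \<in> I" "q y \<in> W i"
  shows "k i y = h i y"
  using trivial_along_unique[OF h k \<open>connected Y\<close> y0(1-3) y] y0(4)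
    trivial_alongD(1)[OF h y0(1-3)] trivial_alongD(1)[OF h y] by simp

lemma trivial_along_normalise:
  assumes h: "trivial_along q Y h" and y0: "y0 \<in> Y" "i0 \<in> I" "q y0 \<in> W i0"
  obtains k where "trivial_along q Y k" "k i0 y0 = \<one>"
proof -
  have c: "h i0 y0 \<in> carrier G" using trivial_alongD(1)[OF h y0] .
  show ?thesis
    by (rule that[OF trivial_along_translate[OF h, of "inv h i0 y0"]]) (use c in auto)
qed

text \<open>On a connected overlap two trivialisations differ by a constant, which can be absorbed into
  one of them.\<close>

lemma trivial_along_glue:
  assumes h: "trivial_along q A h" and k: "trivial_along q B k" and cl: "closed A" "closed B"
    and con: "connected (A \<inter> B)" and ne: "A \<inter> B \<noteq> {}"
  shows "\<exists>l. trivial_along q (A \<union> B) l"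
proof -
  obtain y0 where y0: "y0 \<in> A" "y0 \<in> B" using ne by blast
  obtain i0 where i0: "i0 \<in> I" "q y0 \<in> W i0" using W_cover[OF trivial_along_maps[OF h y0(1)]] by blast
  have c: "h i0 y0 \<in> carrier G" "k i0 y0 \<in> carrier G"
    using trivial_alongD(1)[OF h y0(1) i0] trivial_alongD(1)[OF k y0(2) i0] by auto
  define k' where "k' i y = (h i0 y0 \<otimes> inv k i0 y0) \<otimes> k i y" for i y
  have k': "trivial_along q B k'"
    unfolding k'_def using trivial_along_translate[OF k] c by simp
  have agree: "h i y = k' i y" if "y \<in> A \<inter> B" "i \<in> I" "q y \<in> W i" for i y
    unfolding k'_def
    by (rule trivial_along_unique[OF trivial_along_subset[OF k, of "A \<inter> B"] trivial_along_subset[OF h, of "A \<inter> B"] con _ i0 that])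
      (use y0 in auto)
  define l where "l i y = (if y \<in> A then h i y else k' i y)" for i y
  have lA: "l i y = h i y" if "y \<in> A" for i y using that by (simp add: l_def)
  have lB: "l i y = k' i y" if "y \<in> B" "i \<in> I" "q y \<in> W i" for i y using that agree by (auto simp: l_def)
  have cont: "continuous_on (A \<union> B) q"
    using continuous_on_closed_Un[OF cl trivial_along_continuous[OF h] trivial_along_continuous[OF k]] .
  have sub: "q y \<in> N" if "y \<in> A \<union> B" for y using trivial_along_maps[OF h] trivial_along_maps[OF k] that by blast
  have "\<forall>\<^sub>F y' in at y within A \<union> B. l i y' = l i y" if y: "y \<in> A \<union> B" "i \<in> I" "q y \<in> W i" for i y
  proof -
    have near: "\<forall>\<^sub>F y' in at y within S. q y' \<in> W i" if "S \<subseteq> A \<union> B" for S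
    proof -
      obtain T where T: "open T" "W i = N \<inter> T" using W_open[OF y(2)] unfolding openin_open by blast
      have "\<forall>\<^sub>F y' in at y within A \<union> B. q y' \<in> T"
        using eventually_continuous_on[OF cont y(1) T(1)] y(3) T(2) by blast
      moreover have "\<forall>\<^sub>F y' in at y within A \<union> B. y' \<in> A \<union> B" by (rule eventually_at_within_self)
      ultimately have "\<forall>\<^sub>F y' in at y within A \<union> B. q y' \<in> W i"
        by eventually_elim (use sub T in auto)
      then show ?thesis using that by (meson at_le filter_leD)
    qed
    have "\<forall>\<^sub>F y' in at y within A. l i y' = l i y"
    proof (cases "y \<in> A")
      case True
      have "\<forall>\<^sub>F y' in at y within A. y' \<in> A" by (rule eventually_at_within_self)
      with trivial_alongD(2)[OF h True y(2,3)] show ?thesis by eventually_elim (use True lA in simp)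
    next
      case False
      then show ?thesis unfolding eventually_at_topological using cl(1) by (intro exI[of _ "- A"]) auto
    qed
    moreover have "\<forall>\<^sub>F y' in at y within B. l i y' = l i y"
    proof (cases "y \<in> B")
      case True
      have "\<forall>\<^sub>F y' in at y within B. y' \<in> B" by (rule eventually_at_within_self)
      moreover have "\<forall>\<^sub>F y' in at y within B. q y' \<in> W i" using near by blast
      moreover note trivial_alongD(2)[OF k' True y(2,3)]
      ultimately show ?thesis by eventually_elim (use True lB y in simp)
    next
      case False
      then show ?thesis unfolding eventually_at_topological using cl(2) by (intro exI[of _ "- B"]) auto
    qed
    ultimately show ?thesis unfolding at_within_union eventually_sup by simp
  qed
  moreover have "l i y \<in> carrier G" if "y \<in> A \<union> B" "i \<in> I" "q y \<in> W i" for i y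
    using trivial_alongD(1)[OF h _ that(2,3)] trivial_alongD(1)[OF k' _ that(2,3)] that(1) by (auto simp: l_def)
  moreover have "l j y = l i y \<otimes> g i j (q y)"
    if "y \<in> A \<union> B" "i \<in> I" "q y \<in> W i" "j \<in> I" "q y \<in> W j" for i j y
    using trivial_alongD(3)[OF h _ that(2-5)] trivial_alongD(3)[OF k' _ that(2-5)] that(1) by (auto simp: l_def)
  ultimately have "trivial_along q (A \<union> B) l" using cont sub by (intro trivial_alongI)
  then show ?thesis by blast
qed

text \<open>Inside one set \<open>W i\<close> of the cover the cocycle itself provides a trivialisation.\<close>

lemma trivial_along_small:
  assumes q: "continuous_on Y q" "q ` Y \<subseteq> W i" and i: "i \<in> I"
  shows "\<exists>h. trivial_along q Y h"
proof -
  have WN: "W i \<subseteq> N" using W_open[OF i] openin_imp_subset by blast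
  have "trivial_along q Y (\<lambda>j y. g i j (q y))"
  proof (rule trivial_alongI[OF q(1)])
    fix j y assume y: "y \<in> Y"
    then have qy: "q y \<in> W i" using q(2) by blast
    then show "q y \<in> N" using WN by blast
    assume j: "j \<in> I" "q y \<in> W j"
    show "g i j (q y) \<in> carrier G" using g_carrier[OF i j(1) qy j(2)] .
    show "g i k (q y) = g i j (q y) \<otimes> g j k (q y)" if "k \<in> I" "q y \<in> W k" for k
      using g_cocycle[OF i j(1) that(1) qy j(2) that(2)] by simp
    obtain S where S: "open S" "q y \<in> S" "\<And>x. x \<in> S \<Longrightarrow> x \<in> N \<Longrightarrow> g i j x = g i j (q y)"
      using g_local[OF i j(1) qy j(2)] unfolding eventually_at_topological by metis
    have "\<forall>\<^sub>F y' in at y within Y. q y' \<in> S" using eventually_continuous_on[OF q(1) y S(1,2)] .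
    moreover have "\<forall>\<^sub>F y' in at y within Y. y' \<in> Y" by (rule eventually_at_within_self)
    ultimately show "\<forall>\<^sub>F y' in at y within Y. g i j (q y') = g i j (q y)"
      by eventually_elim (use S q(2) WN in auto)
  qed
  then show ?thesis by blast
qed

lemma trivial_near:
  fixes q :: "'y::metric_space \<Rightarrow> 'x"
  assumes q: "continuous_on Y q" "q ` Y \<subseteq> N" and y: "y \<in> Y"
  shows "\<exists>d>0. \<forall>Z. Z \<subseteq> Y \<and> Z \<subseteq> ball y d \<longrightarrow> (\<exists>h. trivial_along q Z h)"
proof -
  obtain i where i: "i \<in> I" "q y \<in> W i" using W_cover q y by blast
  obtain T where T: "open T" "W i = N \<inter> T" using W_open[OF i(1)] unfolding openin_open by blast
  have "\<forall>\<^sub>F y' in at y within Y. q y' \<in> T"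
    using eventually_continuous_on[OF q(1) y T(1)] i T by blast
  then obtain d where d: "d > 0" "\<And>y'. y' \<in> Y \<Longrightarrow> y' \<noteq> y \<Longrightarrow> dist y' y < d \<Longrightarrow> q y' \<in> T"
    unfolding eventually_at by blast
  have "\<exists>h. trivial_along q Z h" if "Z \<subseteq> Y" "Z \<subseteq> ball y d" for Z
  proof (rule trivial_along_small[OF continuous_on_subset[OF q(1) that(1)] _ i(1)])
    show "q ` Z \<subseteq> W i"
    proof
      fix x assume "x \<in> q ` Z"
      then obtain z where "z \<in> Z" "x = q z" by blast
      moreover then have "z \<in> Y" "dist z y < d" using that by (auto simp: dist_commute)
      ultimately show "x \<in> W i" using d(2)[of z] i q T by (cases "z = y") auto
    qed
  qed
  then show ?thesis using d(1) by blast
qed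

text \<open>Subdividing an interval by the compactness principle behind Bolzano's theorem trivialises the
  cocycle along paths; applied twice, it trivialises the cocycle along squares.\<close>

lemma trivial_along_path:
  fixes q :: "real \<Rightarrow> 'x"
  assumes "a \<le> b" "continuous_on {a..b} q" "q ` {a..b} \<subseteq> N"
  shows "\<exists>h. trivial_along q {a..b} h"
proof -
  let ?P = "\<lambda>c d. a \<le> c \<longrightarrow> c \<le> d \<longrightarrow> d \<le> b \<longrightarrow> (\<exists>h. trivial_along q {c..d} h)"
  have "?P a b"
  proof (rule Bolzano[where P = ?P, OF \<open>a \<le> b\<close>])
    fix c d e assume A: "?P c d" "?P d e" "c \<le> d" "d \<le> e"
    show "?P c e"
    proof (intro impI)
      assume "a \<le> c" "c \<le> e" "e \<le> b"
      then obtain h k where "trivial_along q {c..d} h" "trivial_along q {d..e} k" using A by auto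
      then have "\<exists>l. trivial_along q ({c..d} \<union> {d..e}) l"
        by (rule trivial_along_glue) (use A in auto)
      then show "\<exists>h. trivial_along q {c..e} h" using A by (simp add: ivl_disj_un_two_touch)
    qed
  next
    fix x assume x: "a \<le> x" "x \<le> b"
    obtain d where d: "d > 0" "\<And>Z. Z \<subseteq> {a..b} \<Longrightarrow> Z \<subseteq> ball x d \<Longrightarrow> \<exists>h. trivial_along q Z h"
      using trivial_near[OF assms(2,3), of x] x by auto
    have "?P c e" if "c \<le> x" "x \<le> e" "e - c < d" for c e
    proof (intro impI d(2))
      show "{c..e} \<subseteq> ball x d" using that unfolding subset_iff mem_ball dist_real_def by auto
    qed auto
    then show "\<exists>d>0. \<forall>c e. c \<le> x \<and> x \<le> e \<and> e - c < d \<longrightarrow> ?P c e" using d(1) by blast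
  qed
  then show ?thesis using assms(1) by blast
qed

lemma trivial_along_square:
  fixes q :: "real \<times> real \<Rightarrow> 'x"
  assumes q: "continuous_on ({0..1} \<times> {0..1}) q" "q ` ({0..1} \<times> {0..1}) \<subseteq> N"
  shows "\<exists>h. trivial_along q ({0..1} \<times> {0..1}) h"
proof -
  let ?P = "\<lambda>c d. 0 \<le> c \<longrightarrow> c \<le> d \<longrightarrow> d \<le> 1 \<longrightarrow> (\<exists>h. trivial_along q ({c..d} \<times> {0..1}) h)"
  have "?P 0 1"
  proof (rule Bolzano[where P = ?P])
    fix c d e assume A: "?P c d" "?P d e" "c \<le> d" "d \<le> e"
    show "?P c e"
    proof (intro impI)
      assume "0 \<le> c" "c \<le> e" "e \<le> 1"
      then obtain h k where "trivial_along q ({c..d} \<times> {0..1}) h" "trivial_along q ({d..e} \<times> {0..1}) k" using A by auto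
      moreover have int: "({c..d} \<times> {0..1}) \<inter> ({d..e} \<times> {0..1::real}) = {d} \<times> {0..1}" using A by auto
      have "connected (({c..d} \<times> {0..1}) \<inter> ({d..e} \<times> {0..1::real}))"
        unfolding int by (intro connected_Times) auto
      ultimately have "\<exists>l. trivial_along q (({c..d} \<times> {0..1}) \<union> ({d..e} \<times> {0..1})) l"
        by (rule_tac trivial_along_glue) (use A int in \<open>auto intro: closed_Times\<close>)
      moreover have "({c..d} \<times> {0..1}) \<union> ({d..e} \<times> {0..1}) = {c..e} \<times> {0..1::real}" using A by auto
      ultimately show "\<exists>h. trivial_along q ({c..e} \<times> {0..1}) h" by simp
    qed
  next
    fix x :: real assume x: "0 \<le> x" "x \<le> 1"
    let ?S = "\<lambda>\<delta>. {x-\<delta>..x+\<delta>} \<inter> {0..1}"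
    \<comment> \<open>A vertical strip around \<open>x\<close>, built up from pieces whose width may shrink finitely often.\<close>
    let ?Q = "\<lambda>c d. 0 \<le> c \<longrightarrow> c \<le> d \<longrightarrow> d \<le> 1 \<longrightarrow> (\<exists>\<delta>>0. \<exists>h. trivial_along q (?S \<delta> \<times> {c..d}) h)"
    have "?Q 0 1"
    proof (rule Bolzano[where P = ?Q])
      fix c d e :: real assume A: "?Q c d" "?Q d e" "c \<le> d" "d \<le> e"
      show "?Q c e"
      proof (intro impI)
        assume "0 \<le> c" "c \<le> e" "e \<le> 1"
        then obtain \<delta>1 \<delta>2 h k where hk: "\<delta>1 > 0" "\<delta>2 > 0" "trivial_along q (?S \<delta>1 \<times> {c..d}) h" "trivial_along q (?S \<delta>2 \<times> {d..e}) k"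
          using A by auto
        define \<delta> where "\<delta> = min \<delta>1 \<delta>2"
        have \<delta>: "\<delta> > 0" "?S \<delta> \<subseteq> ?S \<delta>1" "?S \<delta> \<subseteq> ?S \<delta>2" using hk by (auto simp: \<delta>_def)
        have "trivial_along q (?S \<delta> \<times> {c..d}) h" "trivial_along q (?S \<delta> \<times> {d..e}) k"
          using trivial_along_subset[OF hk(3)] trivial_along_subset[OF hk(4)] \<delta> by (meson Sigma_mono order_refl)+
        moreover have int: "(?S \<delta> \<times> {c..d}) \<inter> (?S \<delta> \<times> {d..e}) = ?S \<delta> \<times> {d}" using A by auto
        have "connected (?S \<delta>)" by (simp add: is_interval_connected_1 [symmetric] is_interval_Int is_interval_cc)
        then have "connected ((?S \<delta> \<times> {c..d}) \<inter> (?S \<delta> \<times> {d..e}))"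
          unfolding int by (intro connected_Times) auto
        moreover have "x \<in> ?S \<delta>" using x \<delta> by auto
        ultimately have "\<exists>l. trivial_along q ((?S \<delta> \<times> {c..d}) \<union> (?S \<delta> \<times> {d..e})) l"
          by (rule_tac trivial_along_glue) (use A int in \<open>auto intro!: closed_Times closed_Int\<close>)
        moreover have "(?S \<delta> \<times> {c..d}) \<union> (?S \<delta> \<times> {d..e}) = ?S \<delta> \<times> {c..e}" using A by auto
        ultimately show "\<exists>\<delta>>0. \<exists>h. trivial_along q (?S \<delta> \<times> {c..e}) h" using \<delta>(1) by auto
      qed
    next
      fix y :: real assume y: "0 \<le> y" "y \<le> 1"
      obtain d where d: "d > 0" "\<And>Z. Z \<subseteq> {0..1} \<times> {0..1} \<Longrightarrow> Z \<subseteq> ball (x, y) d \<Longrightarrow> \<exists>h. trivial_along q Z h"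
        using trivial_near[OF q, of "(x, y)"] x y by auto
      have "?Q c e" if "c \<le> y" "y \<le> e" "e - c < d / 2" for c e
      proof (intro impI)
        assume "0 \<le> c" "c \<le> e" "e \<le> 1"
        have "?S (d/4) \<times> {c..e} \<subseteq> ball (x, y) d"
        proof
          fix z assume "z \<in> ?S (d/4) \<times> {c..e}"
          then have "fst z \<in> ?S (d/4)" "snd z \<in> {c..e}" by (auto simp: mem_Times_iff)
          then have z: "\<bar>x - fst z\<bar> \<le> d/4" "\<bar>y - snd z\<bar> < d/2"
            using that unfolding Int_iff atLeastAtMost_iff by linarith+
          have "dist (x, y) z \<le> dist x (fst z) + dist y (snd z)"
            unfolding dist_prod_def by (simp add: sqrt_sum_squares_le_sum)
          also have "\<dots> < d" using z d(1) by (simp add: dist_real_def)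
          finally show "z \<in> ball (x, y) d" by simp
        qed
        then have "\<exists>h. trivial_along q (?S (d/4) \<times> {c..e}) h"
          using \<open>0 \<le> c\<close> \<open>e \<le> 1\<close> by (intro d(2)) auto
        then show "\<exists>\<delta>>0. \<exists>h. trivial_along q (?S \<delta> \<times> {c..e}) h"
          using d(1) by (intro exI[of _ "d/4"]) auto
      qed
      then show "\<exists>d>0. \<forall>c e. c \<le> y \<and> y \<le> e \<and> e - c < d \<longrightarrow> ?Q c e" using d(1) by (intro exI[of _ "d/2"]) auto
    qed simp
    then obtain \<delta> h where \<delta>: "\<delta> > 0" "trivial_along q (?S \<delta> \<times> {0..1}) h" by auto
    have "?P c e" if "c \<le> x" "x \<le> e" "e - c < \<delta>" for c e
    proof (intro impI)
      assume "0 \<le> c" "c \<le> e" "e \<le> 1"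
      then have "{c..e} \<times> {0..1::real} \<subseteq> ?S \<delta> \<times> {0..1}" using that by auto
      then show "\<exists>h. trivial_along q ({c..e} \<times> {0..1}) h" using trivial_along_subset[OF \<delta>(2)] by blast
    qed
    then show "\<exists>d>0. \<forall>c e. c \<le> x \<and> x \<le> e \<and> e - c < d \<longrightarrow> ?P c e" using \<delta>(1) by blast
  qed simp
  then show ?thesis by simp
qed

text \<open>The cocycle is trivial over the square of the homotopy.  The edge which is mapped to a point
  has no holonomy, and the two lateral edges are mapped to the same path, so that the fourth edge
  has no holonomy either.\<close>

lemma trivial_along_null_homotopic_loop:
  fixes q :: "real \<Rightarrow> 'x"
  assumes hom: "homotopic_loops N q (\<lambda>_. a)" and h: "trivial_along q {0..1} h"
    and i: "i \<in> I" "q 0 \<in> W i"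
  shows "h i 1 = h i 0"
proof -
  obtain H :: "real \<times> real \<Rightarrow> 'x" where "continuous_on ({0..1} \<times> {0..1}) H"
    "\<forall>x\<in>{0..1} \<times> {0..1}. H x \<in> N" "\<forall>x\<in>{0..1}. H (0, x) = q x" "\<forall>x\<in>{0..1}. H (1, x) = a"
    "\<forall>t\<in>{0..1}. H (t, 1) = H (t, 0)"
    using hom unfolding homotopic_loops pathfinish_def pathstart_def Pi_iff o_def by blast
  then have H: "continuous_on ({0..1} \<times> {0..1}) H" "H ` ({0..1} \<times> {0..1}) \<subseteq> N"
    "\<And>x. x \<in> {0..1} \<Longrightarrow> H (0, x) = q x" "\<And>x. x \<in> {0..1} \<Longrightarrow> H (1, x) = a"
    "\<And>t. t \<in> {0..1} \<Longrightarrow> H (t, 1) = H (t, 0)"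
    by (blast, blast, blast, blast, blast)
  obtain k where k: "trivial_along H ({0..1} \<times> {0..1}) k" using trivial_along_square[OF H(1,2)] by blast
  have "a \<in> N" using H(2) H(4)[of 0] by force
  then obtain j where j: "j \<in> I" "a \<in> W j" using W_cover by blast
  have edge: "trivial_along (H \<circ> r) {0..1} (\<lambda>i t. k i (r t))"
    if "continuous_on {0..1::real} r" "r ` {0..1} \<subseteq> {0..1} \<times> {0..1}" for r
    using trivial_along_compose[OF k that] .
  have c01: "connected {0..1::real}" by simp
  have right: "trivial_along (H \<circ> (\<lambda>t. (1, t))) {0..1} (\<lambda>i t. k i (1, t))"
    by (rule edge) (auto intro!: continuous_intros)
  have "(\<lambda>t. k j (1, t)) constant_on {0..1::real}"
  proof (rule eventually_constant_imp_constant[OF c01])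
    fix t :: real assume t: "t \<in> {0..1}"
    show "\<forall>\<^sub>F t' in at t within {0..1}. k j (1, t') = k j (1, t)"
      using trivial_alongD(2)[OF right t j(1)] j(2) H(4)[OF t] by simp
  qed
  \<comment> \<open>No holonomy along the edge which is mapped to the point \<open>a\<close>.\<close>
  then have jj: "k j (1, 1) = k j (1, 0)" unfolding constant_on_def by auto
  have bottom: "trivial_along (H \<circ> (\<lambda>t. (t, 0))) {0..1} (\<lambda>i t. k i (t, 0))"
    by (rule edge) (auto intro!: continuous_intros)
  have "trivial_along (H \<circ> (\<lambda>t. (t, 1))) {0..1} (\<lambda>i t. k i (t, 1))"
    by (rule edge) (auto intro!: continuous_intros)
  then have top: "trivial_along (H \<circ> (\<lambda>t. (t, 0))) {0..1} (\<lambda>i t. k i (t, 1))"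
    by (rule trivial_along_cong) (use H(5) in auto)
  \<comment> \<open>The lateral edges carry two trivialisations along one path which agree at its end \<open>a\<close>.\<close>
  have ends: "k i (0, 1) = k i (0, 0)"
    by (rule trivial_along_unique_eq[OF bottom top c01, of 1 j]) (use i j H(3)[of 0] H(4)[of 0] jj in auto)
  have "trivial_along (H \<circ> (\<lambda>t. (0, t))) {0..1} (\<lambda>i t. k i (0, t))"
    by (rule edge) (auto intro!: continuous_intros)
  then have left: "trivial_along q {0..1} (\<lambda>i t. k i (0, t))"
    by (rule trivial_along_cong) (use H(3) in auto)
  have q1: "q 1 = q 0" using H(3)[of 0] H(3)[of 1] H(5)[of 0] by simp
  have cl: "h i 0 \<in> carrier G" "k i (0, 0) \<in> carrier G"
    using trivial_alongD(1)[OF h _ i] trivial_alongD(1)[OF left _ i] by auto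
  have "h i t = (h i 0 \<otimes> inv k i (0, 0)) \<otimes> k i (0, t)" if "t \<in> {0, 1}" for t
    by (rule trivial_along_unique[OF left h c01]) (use i q1 that in auto)
  from this[of 1] this[of 0] show ?thesis using ends by simp
qed

lemma trivial_along_constant:
  fixes q :: "real \<Rightarrow> 'x"
  assumes h: "trivial_along q {a..b} h" and i: "i \<in> I" "\<And>t. t \<in> {a..b} \<Longrightarrow> q t \<in> W i"
    and st: "s \<in> {a..b}" "t \<in> {a..b}"
  shows "h i s = h i t"
proof -
  have "h i constant_on {a..b}"
    by (rule eventually_constant_imp_constant) (use trivial_alongD(2)[OF h _ i(1)] i(2) in auto)
  then show ?thesis using st unfolding constant_on_def by auto
qed

lemma normalised_trivial_along_path:
  fixes q :: "real \<Rightarrow> 'x"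
  assumes "continuous_on {0..1} q" "q ` {0..1} \<subseteq> N" "i0 \<in> I" "q 0 \<in> W i0"
  obtains k where "trivial_along q {0..1} k" "k i0 0 = \<one>"
proof -
  obtain h where h: "trivial_along q {0..1} h" using trivial_along_path[OF _ assms(1,2)] by auto
  obtain k where "trivial_along q {0..1} k" "k i0 0 = \<one>"
    using trivial_along_normalise[OF h _ assms(3,4)] by auto
  then show ?thesis by (rule that)
qed

text \<open>Monodromy: transport of the unit along a path from \<open>x0\<close> depends on the end point only, because
  two paths form a loop, and it is locally constant because small paths stay in one set of the
  cover.\<close>

theorem trivial_on_simply_connected:
  assumes sc: "simply_connected N" and lpc: "locally path_connected N"
    and i0: "i0 \<in> I" "x0 \<in> W i0"
  shows "\<exists>h. trivial_along (\<lambda>x. x) N h \<and> h i0 x0 = \<one>"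
proof -
  have c01: "connected {0..1::real}" by simp
  have x0: "x0 \<in> N" using W_open[OF i0(1)] i0(2) openin_imp_subset by blast
  have null: "homotopic_loops N p (\<lambda>_. x0)"
    if "path p" "path_image p \<subseteq> N" "pathfinish p = pathstart p" for p
    by (rule sc[unfolded simply_connected_def, rule_format])
      (use x0 that in \<open>auto simp: path_def path_image_def pathfinish_def pathstart_def\<close>)
  have "\<exists>p. path p \<and> path_image p \<subseteq> N \<and> pathstart p = x0 \<and> pathfinish p = x" if x: "x \<in> N" for x
    by (rule simply_connected_paths[OF sc x0 x])
  then obtain \<pi> where \<pi>: "\<And>x. x \<in> N \<Longrightarrow> path (\<pi> x)" "\<And>x. x \<in> N \<Longrightarrow> path_image (\<pi> x) \<subseteq> N"
    "\<And>x. x \<in> N \<Longrightarrow> pathstart (\<pi> x) = x0" "\<And>x. x \<in> N \<Longrightarrow> pathfinish (\<pi> x) = x" by metis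
  have transport: "\<exists>k. trivial_along q {0..1} k \<and> k i0 0 = \<one>"
    if "path q" "path_image q \<subseteq> N" "pathstart q = x0" for q
    using normalised_trivial_along_path[of q i0] that i0 unfolding path_def path_image_def pathstart_def by metis
  have "\<forall>x\<in>N. \<exists>k. trivial_along (\<pi> x) {0..1} k \<and> k i0 0 = \<one>"
    using transport[OF \<pi>(1-3)] by blast
  from bchoice[OF this] obtain \<tau> where
    \<tau>: "\<And>x. x \<in> N \<Longrightarrow> trivial_along (\<pi> x) {0..1} (\<tau> x)" "\<And>x. x \<in> N \<Longrightarrow> \<tau> x i0 0 = \<one>"
    by blast
  define h where "h i x = \<tau> x i 1" for i x
  have indep: "l i 1 = h i x"
    if x: "x \<in> N" and q: "path q" "path_image q \<subseteq> N" "pathstart q = x0" "pathfinish q = x"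
      and l: "trivial_along q {0..1} l" "l i0 0 = \<one>" and i: "i \<in> I" "x \<in> W i" for x q l i
  proof -
    \<comment> \<open>Going along \<open>q\<close> and back along the chosen path is a loop, without holonomy.\<close>
    let ?c = "q +++ reversepath (\<pi> x)"
    have c: "path ?c" "path_image ?c \<subseteq> N" "pathstart ?c = x0" "pathfinish ?c = x0"
      using q \<pi>[OF x] by (auto simp: path_image_join)
    obtain m where m: "trivial_along ?c {0..1} m" "m i0 0 = \<one>" using transport[OF c(1-3)] by blast
    have "m i0 1 = m i0 0"
      by (rule trivial_along_null_homotopic_loop[OF null m(1) i0(1)]) (use c i0 in \<open>auto simp: pathstart_def\<close>)
    then have m1: "m i0 1 = \<one>" using m(2) by simp
    have "trivial_along (?c \<circ> (\<lambda>t. t / 2)) {0..1} (\<lambda>i t. m i (t / 2))"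
      by (rule trivial_along_compose[OF m(1)]) (auto intro!: continuous_intros)
    then have A: "trivial_along q {0..1} (\<lambda>i t. m i (t / 2))"
      by (rule trivial_along_cong) (auto simp: joinpaths_def)
    have "trivial_along (?c \<circ> (\<lambda>t. 1 - t / 2)) {0..1} (\<lambda>i t. m i (1 - t / 2))"
      by (rule trivial_along_compose[OF m(1)]) (auto intro!: continuous_intros)
    then have B: "trivial_along (\<pi> x) {0..1} (\<lambda>i t. m i (1 - t / 2))"
      by (rule trivial_along_cong)
        (use q(4) \<pi>(4)[OF x] in \<open>auto simp: joinpaths_def reversepath_def pathfinish_def\<close>)
    have "m i (1 / 2) = l i 1"
      by (rule trivial_along_unique_eq[OF l(1) A c01, of 0 i0])
        (use l(2) m(2) i i0 q in \<open>auto simp: pathstart_def pathfinish_def\<close>)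
    moreover have "m i (1 - 1 / 2) = \<tau> x i 1"
      by (rule trivial_along_unique_eq[OF \<tau>(1)[OF x] B c01, of 0 i0])
        (use m1 \<tau>(2)[OF x] i i0 \<pi>[OF x] in \<open>auto simp: pathstart_def pathfinish_def\<close>)
    ultimately show ?thesis by (simp add: h_def)
  qed
  have end_in: "1 \<in> {0..1::real}" by simp
  have "trivial_along (\<lambda>x. x) N h"
  proof (rule trivial_alongI)
    fix i x assume x: "x \<in> N" and i: "i \<in> I" "x \<in> W i"
    have \<pi>1: "\<pi> x 1 = x" using \<pi>(4)[OF x] by (simp add: pathfinish_def)
    note D = trivial_alongD[OF \<tau>(1)[OF x] end_in i(1), unfolded \<pi>1, OF i(2)]
    show "h i x \<in> carrier G" unfolding h_def by (rule D(1))
    show "h j x = h i x \<otimes> g i j x" if "j \<in> I" "x \<in> W j" for j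
      unfolding h_def by (rule D(3)[OF that])
    obtain U V where UV: "openin (top_of_set N) U" "path_connected V" "x \<in> U" "U \<subseteq> V" "V \<subseteq> W i"
      using lpc W_open[OF i(1)] i(2) unfolding locally_def by metis
    have VN: "V \<subseteq> N" using UV(5) W_open[OF i(1)] openin_imp_subset by blast
    have "h i y = h i x" if y: "y \<in> U" for y
    proof -
      obtain r where r: "path r" "path_image r \<subseteq> V" "pathstart r = x" "pathfinish r = y"
        using UV y unfolding path_connected_def by blast
      let ?c = "\<pi> x +++ r"
      have c: "path ?c" "path_image ?c \<subseteq> N" "pathstart ?c = x0" "pathfinish ?c = y"
        using r \<pi>[OF x] VN by (auto simp: path_image_join)
      obtain m where m: "trivial_along ?c {0..1} m" "m i0 0 = \<one>" using transport[OF c(1-3)] by blast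
      have "trivial_along (?c \<circ> (\<lambda>t. t / 2)) {0..1} (\<lambda>i t. m i (t / 2))"
        by (rule trivial_along_compose[OF m(1)]) (auto intro!: continuous_intros)
      then have A: "trivial_along (\<pi> x) {0..1} (\<lambda>i t. m i (t / 2))"
        by (rule trivial_along_cong) (auto simp: joinpaths_def)
      have "m i (1 / 2) = \<tau> x i 1"
        by (rule trivial_along_unique_eq[OF \<tau>(1)[OF x] A c01, of 0 i0])
          (use m(2) \<tau>(2)[OF x] i i0 \<pi>[OF x] in \<open>auto simp: pathstart_def pathfinish_def\<close>)
      moreover have "trivial_along (?c \<circ> (\<lambda>t. (1 + t) / 2)) {0..1} (\<lambda>i t. m i ((1 + t) / 2))"
        by (rule trivial_along_compose[OF m(1)]) (auto intro!: continuous_intros)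
      then have B: "trivial_along r {0..1} (\<lambda>i t. m i ((1 + t) / 2))"
        by (rule trivial_along_cong)
          (use r(3) \<pi>(4)[OF x] in \<open>auto simp: joinpaths_def pathstart_def pathfinish_def add_divide_distrib\<close>)
      have "m i ((1 + 0) / 2) = m i ((1 + 1) / 2)"
        by (rule trivial_along_constant[OF B i(1)]) (use r(2) UV(5) in \<open>auto simp: path_image_def image_subset_iff subset_iff\<close>)
      moreover have "m i 1 = h i y"
        by (rule indep[OF _ c m i(1)]) (use y UV VN in auto)
      ultimately show ?thesis by (simp add: h_def)
    qed
    moreover obtain S where "open S" "U = N \<inter> S" using UV(1) unfolding openin_open by blast
    ultimately show "\<forall>\<^sub>F y in at x within N. h i y = h i x"
      unfolding eventually_at_topological using UV(3) by blast
  qed auto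
  moreover have "h i0 x0 = \<one>"
  proof -
    have "\<exists>k. trivial_along (\<lambda>_::real. x0) {0..1} k \<and> k i0 0 = \<one>"
      by (rule transport) (use x0 in \<open>auto simp: path_def path_image_def pathstart_def\<close>)
    then obtain l where l: "trivial_along (\<lambda>_::real. x0) {0..1} l" "l i0 0 = \<one>" by blast
    have "l i0 1 = h i0 x0"
      by (rule indep[OF x0 _ _ _ _ l i0]) (use x0 in \<open>auto simp: path_def path_image_def pathstart_def pathfinish_def\<close>)
    moreover have "l i0 0 = l i0 1" by (rule trivial_along_constant[OF l(1) i0(1)]) (use i0 in auto)
    ultimately show ?thesis using l(2) by simp
  qed
  ultimately show ?thesis by blast
qed

end

section \<open>Structure equations of a conformal immersion\<close>

lemma smooth_on_eqI:
  "open S \<Longrightarrow> (\<And>y. y \<in> S \<Longrightarrow> f y = g y) \<Longrightarrow> smooth_on S g \<Longrightarrow> smooth_on S f"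
  using smooth_on_cong by metis

lemma pd_add:
  assumes "f differentiable (at \<zeta>)" "g differentiable (at \<zeta>)"
  shows "pdx (\<lambda>t. f t + g t) \<zeta> = pdx f \<zeta> + pdx g \<zeta>" "pdy (\<lambda>t. f t + g t) \<zeta> = pdy f \<zeta> + pdy g \<zeta>"
  using pd_eqI[OF has_derivative_add[OF assms[unfolded frechet_derivative_works]]] by (simp_all add: pdx_def pdy_def)

lemma pd_linear:
  assumes "bounded_linear L" "f differentiable (at \<zeta>)"
  shows "pdx (\<lambda>t. L (f t)) \<zeta> = L (pdx f \<zeta>)" "pdy (\<lambda>t. L (f t)) \<zeta> = L (pdy f \<zeta>)"
  using pd_eqI[OF bounded_linear.has_derivative[OF assms(1) assms(2)[unfolded frechet_derivative_works]]]
  by (simp_all add: pdx_def pdy_def)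

lemma pd_bilinear:
  assumes "bounded_bilinear B" "f differentiable (at \<zeta>)" "g differentiable (at \<zeta>)"
  shows "pdx (\<lambda>t. B (f t) (g t)) \<zeta> = B (f \<zeta>) (pdx g \<zeta>) + B (pdx f \<zeta>) (g \<zeta>)"
    "pdy (\<lambda>t. B (f t) (g t)) \<zeta> = B (f \<zeta>) (pdy g \<zeta>) + B (pdy f \<zeta>) (g \<zeta>)"
  using pd_eqI[OF bounded_bilinear.FDERIV[OF assms(1) assms(2,3)[unfolded frechet_derivative_works]]]
  by (simp_all add: pdx_def pdy_def)

lemma pd_const: "pdx (\<lambda>t. c) \<zeta> = 0" "pdy (\<lambda>t. c) \<zeta> = 0"
  by (simp_all add: pdx_def pdy_def)

lemma dz_pd: "dz g \<zeta> = (pdx g \<zeta> - \<i> * pdy g \<zeta>) / 2" "dzbar g \<zeta> = (pdx g \<zeta> + \<i> * pdy g \<zeta>) / 2"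
  by (simp_all add: dz_def dzbar_def pdx_def pdy_def)

text \<open>Differentiating a known Lorentz product moves the derivative to the other factor.\<close>

lemma lor_pd_const:
  fixes f g :: "complex \<Rightarrow> lvec"
  assumes D: "open D" "\<zeta> \<in> D" and f: "smooth_on D f" and g: "smooth_on D g"
    and c: "\<And>t. t \<in> D \<Longrightarrow> lor (f t) (g t) = c t"
  shows "lor (f \<zeta>) (pdx g \<zeta>) = pdx c \<zeta> - lor (pdx f \<zeta>) (g \<zeta>)" "lor (f \<zeta>) (pdy g \<zeta>) = pdy c \<zeta> - lor (pdy f \<zeta>) (g \<zeta>)"
  using pd_bilinear[OF bounded_bilinear_lor smooth_on_differentiable[OF f D(2)] smooth_on_differentiable[OF g D(2)]]
    pd_cong[of D \<zeta> "\<lambda>t. lor (f t) (g t)" c, OF D c] by simp_all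

lemma bounded_linear_cvec_nth: "bounded_linear (\<lambda>v. cvec v $ i)"
  unfolding cvec_def by (auto intro!: bounded_linear_compose[OF bounded_linear_of_real] bounded_linear_vec_nth)

lemma dz_component:
  assumes "smooth_on D \<psi>" "\<zeta> \<in> D"
  shows "dz (\<lambda>s. cvec (\<psi> s) $ i) \<zeta> = cvec (pdx \<psi> \<zeta>) $ i / 2 - \<i> * cvec (pdy \<psi> \<zeta>) $ i / 2"
    "dzbar (\<lambda>s. cvec (\<psi> s) $ i) \<zeta> = cvec (pdx \<psi> \<zeta>) $ i / 2 + \<i> * cvec (pdy \<psi> \<zeta>) $ i / 2"
  using pd_linear[OF bounded_linear_cvec_nth[of i] smooth_on_differentiable[OF assms]]
  by (simp_all add: dz_pd diff_divide_distrib add_divide_distrib)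

lemma lift_second_derivatives:
  assumes D: "open D" "\<zeta> \<in> D" and s: "smooth_on D \<psi>"
  shows "lift_zz \<psi> \<zeta> $ i = complex_of_real ((pdx (pdx \<psi>) \<zeta> - pdy (pdy \<psi>) \<zeta>) $ i / 4) - \<i> * complex_of_real (pdy (pdx \<psi>) \<zeta> $ i / 2)"
    "lift_zzbar \<psi> \<zeta> = (1/4) *\<^sub>R (pdx (pdx \<psi>) \<zeta> + pdy (pdy \<psi>) \<zeta>)"
proof -
  note X = smooth_on_pd(1)[OF s] and Y = smooth_on_pd(2)[OF s]
  have g: "dz (\<lambda>s. cvec (\<psi> s) $ j) t = (1/2) * cvec (pdx \<psi> t) $ j + (- \<i> / 2) * cvec (pdy \<psi> t) $ j" if "t \<in> D" for t j
    using dz_component(1)[OF s that] by simp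
  have lin: "bounded_linear (\<lambda>v. c * cvec v $ j)" for c j
    by (rule bounded_linear_compose[OF bounded_linear_mult_right bounded_linear_cvec_nth])
  have dif: "(\<lambda>t. c * cvec (pdx \<psi> t) $ j) differentiable (at \<zeta>)" "(\<lambda>t. c * cvec (pdy \<psi> t) $ j) differentiable (at \<zeta>)" for c j
    using smooth_on_linear[OF D(1) lin[of c j] X] smooth_on_linear[OF D(1) lin[of c j] Y] smooth_on_differentiable D(2) by blast+
  have px: "pdx (dz (\<lambda>s. cvec (\<psi> s) $ j)) \<zeta> = (1/2) * cvec (pdx (pdx \<psi>) \<zeta>) $ j + (- \<i> / 2) * cvec (pdx (pdy \<psi>) \<zeta>) $ j" for j
    using trans[OF pd_cong(1)[OF D g] pd_add(1)[OF dif]]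
      pd_linear(1)[OF lin smooth_on_differentiable[OF X D(2)]] pd_linear(1)[OF lin smooth_on_differentiable[OF Y D(2)]]
    by metis
  have py: "pdy (dz (\<lambda>s. cvec (\<psi> s) $ j)) \<zeta> = (1/2) * cvec (pdy (pdx \<psi>) \<zeta>) $ j + (- \<i> / 2) * cvec (pdy (pdy \<psi>) \<zeta>) $ j" for j
    using trans[OF pd_cong(2)[OF D g] pd_add(2)[OF dif]]
      pd_linear(2)[OF lin smooth_on_differentiable[OF X D(2)]] pd_linear(2)[OF lin smooth_on_differentiable[OF Y D(2)]]
    by metis
  note comm = pd_commute[OF D(1) s D(2)]
  show "lift_zz \<psi> \<zeta> $ i = complex_of_real ((pdx (pdx \<psi>) \<zeta> - pdy (pdy \<psi>) \<zeta>) $ i / 4) - \<i> * complex_of_real (pdy (pdx \<psi>) \<zeta> $ i / 2)"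
  proof -
    have "lift_zz \<psi> \<zeta> $ i = (pdx (dz (\<lambda>s. cvec (\<psi> s) $ i)) \<zeta> - \<i> * pdy (dz (\<lambda>s. cvec (\<psi> s) $ i)) \<zeta>) / 2"
      by (simp only: lift_zz_def vec_lambda_beta dz_pd(1)[of "dz _"])
    then show ?thesis unfolding px py comm by (simp add: cvec_def complex_eq_iff field_simps)
  qed
  show "lift_zzbar \<psi> \<zeta> = (1/4) *\<^sub>R (pdx (pdx \<psi>) \<zeta> + pdy (pdy \<psi>) \<zeta>)"
  proof -
    have "lift_zzbar \<psi> \<zeta> $ j = Re ((pdx (dz (\<lambda>s. cvec (\<psi> s) $ j)) \<zeta> + \<i> * pdy (dz (\<lambda>s. cvec (\<psi> s) $ j)) \<zeta>) / 2)" for j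
      by (simp only: lift_zzbar_def vec_lambda_beta dz_pd(2)[of "dz _"])
    then show ?thesis unfolding px py comm by (simp add: cvec_def vec_eq_iff field_simps)
  qed
qed

text \<open>The defining equation of the two invariants, separated into real and imaginary parts, is a
  statement about \<open>\<psi>\<^sub>x\<^sub>x - \<psi>\<^sub>y\<^sub>y\<close> and \<open>\<psi>\<^sub>x\<^sub>y\<close>.\<close>

lemma fundamental_real:
  assumes D: "open D" "t \<in> D" and \<psi>: "smooth_on D \<psi>"
  shows "lift_zz \<psi> t + (a / 2) *s cvec (\<psi> t) = b *s cvec \<nu> \<longleftrightarrow>
     pdx (pdx \<psi>) t - pdy (pdy \<psi>) t = (4 * Re b) *\<^sub>R \<nu> - (2 * Re a) *\<^sub>R \<psi> t \<and>
     pdy (pdx \<psi>) t = Im a *\<^sub>R \<psi> t - (2 * Im b) *\<^sub>R \<nu>"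
proof -
  have "(lift_zz \<psi> t + (a / 2) *s cvec (\<psi> t)) $ i = (b *s cvec \<nu>) $ i \<longleftrightarrow>
     (pdx (pdx \<psi>) t - pdy (pdy \<psi>) t) $ i = ((4 * Re b) *\<^sub>R \<nu> - (2 * Re a) *\<^sub>R \<psi> t) $ i \<and>
     pdy (pdx \<psi>) t $ i = (Im a *\<^sub>R \<psi> t - (2 * Im b) *\<^sub>R \<nu>) $ i" for i
    using lift_second_derivatives(1)[OF D \<psi>, of i] by (simp add: cvec_def complex_eq_iff field_simps) argo
  then show ?thesis unfolding vec_eq_iff by blast
qed

text \<open>A normalized lift \<open>\<psi>\<close> together with a unit normal field \<open>n\<close>, whose Schwarzian derivative and
  Hopf differential are \<open>s\<close> and \<open>k\<close>.  No orientation is fixed, so that the notion is invariant under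
  all Lorentz transformations.\<close>

definition framed_lift :: "complex set \<Rightarrow> (complex \<Rightarrow> complex) \<Rightarrow> (complex \<Rightarrow> complex) \<Rightarrow>
    (complex \<Rightarrow> lvec) \<Rightarrow> (complex \<Rightarrow> lvec) \<Rightarrow> bool" where
  "framed_lift D s k \<psi> n \<longleftrightarrow> open D \<and> smooth_on D \<psi> \<and> smooth_on D n \<and>
     (\<forall>\<zeta>\<in>D. \<psi> \<zeta> \<in> light_cone \<and>
        (\<forall>v. lor (frechet_derivative \<psi> (at \<zeta>) v) (frechet_derivative \<psi> (at \<zeta>) v) = (norm v)\<^sup>2) \<and>
        (\<forall>v\<in>V_fibre \<psi> \<zeta>. lor (n \<zeta>) v = 0) \<and> lor (n \<zeta>) (n \<zeta>) = 1 \<and>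
        lift_zz \<psi> \<zeta> + (s \<zeta> / 2) *s cvec (\<psi> \<zeta>) = k \<zeta> *s cvec (n \<zeta>))"

lemma framed_liftD:
  assumes "framed_lift D s k \<psi> n"
  shows "open D" "smooth_on D \<psi>" "smooth_on D n"
    "\<zeta> \<in> D \<Longrightarrow> \<psi> \<zeta> \<in> light_cone"
    "\<zeta> \<in> D \<Longrightarrow> lor (frechet_derivative \<psi> (at \<zeta>) v) (frechet_derivative \<psi> (at \<zeta>) v) = (norm v)\<^sup>2"
    "\<zeta> \<in> D \<Longrightarrow> w \<in> V_fibre \<psi> \<zeta> \<Longrightarrow> lor (n \<zeta>) w = 0"
    "\<zeta> \<in> D \<Longrightarrow> lor (n \<zeta>) (n \<zeta>) = 1"
    "\<zeta> \<in> D \<Longrightarrow> lift_zz \<psi> \<zeta> + (s \<zeta> / 2) *s cvec (\<psi> \<zeta>) = k \<zeta> *s cvec (n \<zeta>)"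
  using assms unfolding framed_lift_def by blast+

lemma V_fibre_generators:
  assumes "smooth_on D \<psi>" "\<zeta> \<in> D"
  shows "\<psi> \<zeta> \<in> V_fibre \<psi> \<zeta>" "lift_zzbar \<psi> \<zeta> \<in> V_fibre \<psi> \<zeta>" "pdx \<psi> \<zeta> \<in> V_fibre \<psi> \<zeta>" "pdy \<psi> \<zeta> \<in> V_fibre \<psi> \<zeta>"
  unfolding V_fibre_def pdx_def pdy_def by (auto intro: span_base)

lemma V_fibre_orthogonalI:
  assumes s: "smooth_on D \<psi>" "\<zeta> \<in> D"
    and 0: "lor \<nu> (\<psi> \<zeta>) = 0" "lor \<nu> (lift_zzbar \<psi> \<zeta>) = 0" "lor \<nu> (pdx \<psi> \<zeta>) = 0" "lor \<nu> (pdy \<psi> \<zeta>) = 0"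
    and v: "v \<in> V_fibre \<psi> \<zeta>"
  shows "lor \<nu> v = 0"
  using v unfolding V_fibre_def
proof (induction rule: span_induct)
  case base
  show ?case by (auto simp: subspace_def)
next
  case (step x)
  then show ?case using 0 frechet_pd[OF smooth_on_differentiable[OF s]] by auto
qed

text \<open>The null vector \<open>h\<close> of the adapted frame, with \<open>\<psi>\<^sub>z\<^sub>z\<^sub>b\<^sub>a\<^sub>r = - \<bar>\<kappa>\<bar>\<^sup>2 \<psi> + h/2\<close>.\<close>

definition dual_lift :: "(complex \<Rightarrow> complex) \<Rightarrow> (complex \<Rightarrow> lvec) \<Rightarrow> complex \<Rightarrow> lvec" where
  "dual_lift k \<psi> \<zeta> = 2 *\<^sub>R lift_zzbar \<psi> \<zeta> + (2 * (cmod (k \<zeta>))\<^sup>2) *\<^sub>R \<psi> \<zeta>"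

text \<open>All of these come from differentiating \<open>\<langle>\<psi>, \<psi>\<rangle> = 0\<close>, \<open>\<langle>X, X\<rangle> = \<langle>Y, Y\<rangle> = 1\<close> and \<open>\<langle>X, Y\<rangle> = 0\<close>.\<close>

lemma isothermal_products:
  assumes D: "open D" and \<psi>: "smooth_on D \<psi>" 
    and nulls: "\<forall>\<zeta>\<in>D. lor (\<psi> \<zeta>) (\<psi> \<zeta>) = 0"
    and isos: "\<forall>\<zeta>\<in>D. \<forall>v. lor (frechet_derivative \<psi> (at \<zeta>) v) (frechet_derivative \<psi> (at \<zeta>) v) = (norm v)\<^sup>2"
    and \<zeta>: "\<zeta> \<in> D"
  defines "X \<equiv> pdx \<psi>" and "Y \<equiv> pdy \<psi>"
  shows "lor (X \<zeta>) (X \<zeta>) = 1" "lor (Y \<zeta>) (Y \<zeta>) = 1" "lor (X \<zeta>) (Y \<zeta>) = 0"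
    "lor (\<psi> \<zeta>) (X \<zeta>) = 0" "lor (\<psi> \<zeta>) (Y \<zeta>) = 0"
    "lor (X \<zeta>) (pdx X \<zeta>) = 0" "lor (X \<zeta>) (pdy X \<zeta>) = 0" "lor (Y \<zeta>) (pdy X \<zeta>) = 0"
    "lor (Y \<zeta>) (pdy Y \<zeta>) = 0" "lor (Y \<zeta>) (pdx X \<zeta>) = 0" "lor (X \<zeta>) (pdy Y \<zeta>) = 0"
    "lor (\<psi> \<zeta>) (pdx X \<zeta>) = -1" "lor (\<psi> \<zeta>) (pdy Y \<zeta>) = -1" "lor (\<psi> \<zeta>) (pdy X \<zeta>) = 0"
    "pdx Y \<zeta> = pdy X \<zeta>"
    "lor (\<psi> \<zeta>) (lift_zzbar \<psi> \<zeta>) = - 1/2" "lor (X \<zeta>) (lift_zzbar \<psi> \<zeta>) = 0" "lor (Y \<zeta>) (lift_zzbar \<psi> \<zeta>) = 0"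
proof -
  note null = nulls[rule_format] and iso = isos[rule_format]
  have sX: "smooth_on D X" "smooth_on D Y" unfolding X_def Y_def by (rule smooth_on_pd[OF \<psi>])+
  have fd: "frechet_derivative \<psi> (at t) v = Re v *\<^sub>R X t + Im v *\<^sub>R Y t" if "t \<in> D" for t v
    unfolding X_def Y_def by (rule frechet_pd[OF smooth_on_differentiable[OF \<psi> that]])
  have XX: "lor (X t) (X t) = 1" and YY: "lor (Y t) (Y t) = 1" and XY: "lor (X t) (Y t) = 0" if t: "t \<in> D" for t
  proof -
    show xx: "lor (X t) (X t) = 1" using iso[OF t, of 1] by (simp add: fd[OF t])
    show yy: "lor (Y t) (Y t) = 1" using iso[OF t, of \<i>] by (simp add: fd[OF t])
    have "(norm (1 + \<i>))\<^sup>2 = 2" by (simp add: cmod_def)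
    then show "lor (X t) (Y t) = 0" using iso[OF t, of "1 + \<i>"] xx yy by (simp add: fd[OF t] lor_commute)
  qed
  have pX: "lor (\<psi> t) (X t) = 0" "lor (\<psi> t) (Y t) = 0" if t: "t \<in> D" for t
    using lor_pd_const[OF D t \<psi> \<psi> null] by (simp_all add: X_def Y_def pd_const lor_commute)
  show comm: "pdx Y \<zeta> = pdy X \<zeta>" unfolding X_def Y_def by (rule pd_commute[OF D \<psi> \<zeta>])
  note XX' = lor_pd_const[OF D \<zeta> sX(1) sX(1) XX] and YY' = lor_pd_const[OF D \<zeta> sX(2) sX(2) YY]
    and XY' = lor_pd_const[OF D \<zeta> sX(1) sX(2) XY]
    and pX' = lor_pd_const[OF D \<zeta> \<psi> sX(1) pX(1)] and pY' = lor_pd_const[OF D \<zeta> \<psi> sX(2) pX(2)]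
  show *: "lor (X \<zeta>) (X \<zeta>) = 1" "lor (Y \<zeta>) (Y \<zeta>) = 1" "lor (X \<zeta>) (Y \<zeta>) = 0"
    "lor (\<psi> \<zeta>) (X \<zeta>) = 0" "lor (\<psi> \<zeta>) (Y \<zeta>) = 0" using XX YY XY pX \<zeta> by auto
  show 1: "lor (X \<zeta>) (pdx X \<zeta>) = 0" "lor (X \<zeta>) (pdy X \<zeta>) = 0"
    "lor (Y \<zeta>) (pdy X \<zeta>) = 0" "lor (Y \<zeta>) (pdy Y \<zeta>) = 0"
    using XX' YY' comm by (simp_all add: pd_const lor_commute)
  show 2: "lor (Y \<zeta>) (pdx X \<zeta>) = 0" "lor (X \<zeta>) (pdy Y \<zeta>) = 0"
    using XY' 1 comm by (simp_all add: pd_const lor_commute)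
  show 3: "lor (\<psi> \<zeta>) (pdx X \<zeta>) = -1" "lor (\<psi> \<zeta>) (pdy Y \<zeta>) = -1" "lor (\<psi> \<zeta>) (pdy X \<zeta>) = 0"
    using pX' pY' * by (simp_all add: pd_const lor_commute X_def[symmetric] Y_def[symmetric])
  note zz = lift_second_derivatives(2)[OF D \<zeta> \<psi>, folded X_def Y_def]
  show "lor (\<psi> \<zeta>) (lift_zzbar \<psi> \<zeta>) = - 1/2" "lor (X \<zeta>) (lift_zzbar \<psi> \<zeta>) = 0" "lor (Y \<zeta>) (lift_zzbar \<psi> \<zeta>) = 0"
    unfolding zz using 1 2 3 by simp_all
qed

text \<open>The equations for the derivatives of \<open>X\<close> and \<open>Y\<close> rewrite the definition of \<open>s\<close> and \<open>k\<close>, once it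
  is known that \<open>h\<close> is null: the relation \<open>\<langle>X\<^sub>x, Y\<^sub>y\<rangle> = \<langle>X\<^sub>y, X\<^sub>y\<rangle>\<close>, a consequence of \<open>X\<^sub>x\<^sub>y = X\<^sub>y\<^sub>x\<close>, gives
  \<open>\<langle>\<psi>\<^sub>z\<^sub>z\<^sub>b\<^sub>a\<^sub>r, \<psi>\<^sub>z\<^sub>z\<^sub>b\<^sub>a\<^sub>r\<rangle> = \<bar>k\<bar>\<^sup>2\<close>.  Constancy of the Gram matrix determines the derivatives of \<open>n\<close> and \<open>h\<close> up
  to one unknown coefficient each, which the normal components of \<open>X\<^sub>x\<^sub>y = X\<^sub>y\<^sub>x\<close> and \<open>Y\<^sub>x\<^sub>y = Y\<^sub>y\<^sub>x\<close> express by
  \<open>dzbar k\<close>.\<close>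

lemma structure_equations:
  assumes fl: "framed_lift D s k \<psi> n" and \<zeta>: "\<zeta> \<in> D"
  defines "X \<equiv> pdx \<psi>" and "Y \<equiv> pdy \<psi>" and "h \<equiv> dual_lift k \<psi>" and "q \<equiv> (cmod (k \<zeta>))\<^sup>2" and "m \<equiv> dzbar k \<zeta>"
  shows "smooth_on D k" "smooth_on D s" "smooth_on D h"
    "lorentz_frame (\<psi> \<zeta>) (X \<zeta>) (Y \<zeta>) (h \<zeta>) (n \<zeta>)"
    "pdx X \<zeta> = (- Re (s \<zeta>) - 2 * q) *\<^sub>R \<psi> \<zeta> + h \<zeta> + (2 * Re (k \<zeta>)) *\<^sub>R n \<zeta>"
    "pdy X \<zeta> = Im (s \<zeta>) *\<^sub>R \<psi> \<zeta> - (2 * Im (k \<zeta>)) *\<^sub>R n \<zeta>"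
    "pdx Y \<zeta> = Im (s \<zeta>) *\<^sub>R \<psi> \<zeta> - (2 * Im (k \<zeta>)) *\<^sub>R n \<zeta>"
    "pdy Y \<zeta> = (Re (s \<zeta>) - 2 * q) *\<^sub>R \<psi> \<zeta> + h \<zeta> - (2 * Re (k \<zeta>)) *\<^sub>R n \<zeta>"
    "pdx n \<zeta> = (4 * Re m) *\<^sub>R \<psi> \<zeta> - (2 * Re (k \<zeta>)) *\<^sub>R X \<zeta> + (2 * Im (k \<zeta>)) *\<^sub>R Y \<zeta>"
    "pdy n \<zeta> = - (4 * Im m) *\<^sub>R \<psi> \<zeta> + (2 * Im (k \<zeta>)) *\<^sub>R X \<zeta> + (2 * Re (k \<zeta>)) *\<^sub>R Y \<zeta>"
    "pdx h \<zeta> = (- Re (s \<zeta>) - 2 * q) *\<^sub>R X \<zeta> + Im (s \<zeta>) *\<^sub>R Y \<zeta> + (4 * Re m) *\<^sub>R n \<zeta>"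
    "pdy h \<zeta> = Im (s \<zeta>) *\<^sub>R X \<zeta> + (Re (s \<zeta>) - 2 * q) *\<^sub>R Y \<zeta> - (4 * Im m) *\<^sub>R n \<zeta>"
proof -
  note D = framed_liftD(1)[OF fl] and s\<psi> = framed_liftD(2)[OF fl] and sn = framed_liftD(3)[OF fl]
  have sX: "smooth_on D X" and sY: "smooth_on D Y" unfolding X_def Y_def by (rule smooth_on_pd[OF s\<psi>])+
  have null: "lor (\<psi> t) (\<psi> t) = 0" if "t \<in> D" for t using framed_liftD(4)[OF fl that] by (simp add: light_cone_def)
  have "\<forall>t\<in>D. lor (\<psi> t) (\<psi> t) = 0" "\<forall>t\<in>D. \<forall>v. lor (frechet_derivative \<psi> (at t) v) (frechet_derivative \<psi> (at t) v) = (norm v)\<^sup>2"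
    using null framed_liftD(5)[OF fl] by auto
  note iso = isothermal_products[OF D s\<psi> this, folded X_def Y_def]
  have n: "lor (n t) (n t) = 1" "lor (n t) (\<psi> t) = 0" "lor (n t) (X t) = 0" "lor (n t) (Y t) = 0" "lor (n t) (lift_zzbar \<psi> t) = 0"
    if t: "t \<in> D" for t
    using framed_liftD(6,7)[OF fl t] V_fibre_generators[OF s\<psi> t] unfolding X_def Y_def by blast+
  note second = lift_second_derivatives[OF D _ s\<psi>, folded X_def Y_def]
  have fund: "pdx X t - pdy Y t = (4 * Re (k t)) *\<^sub>R n t - (2 * Re (s t)) *\<^sub>R \<psi> t"
    "pdy X t = Im (s t) *\<^sub>R \<psi> t - (2 * Im (k t)) *\<^sub>R n t" if t: "t \<in> D" for t
    using framed_liftD(8)[OF fl t] unfolding fundamental_real[OF D t s\<psi>] X_def Y_def by auto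
  have Xx: "pdx X t = 2 *\<^sub>R lift_zzbar \<psi> t - Re (s t) *\<^sub>R \<psi> t + (2 * Re (k t)) *\<^sub>R n t"
    and Yy: "pdy Y t = 2 *\<^sub>R lift_zzbar \<psi> t + Re (s t) *\<^sub>R \<psi> t - (2 * Re (k t)) *\<^sub>R n t" if t: "t \<in> D" for t
  proof -
    have sum: "pdx X t + pdy Y t = 4 *\<^sub>R lift_zzbar \<psi> t" using second(2)[OF t] by simp
    have "pdx X t = (1/2) *\<^sub>R ((pdx X t + pdy Y t) + (pdx X t - pdy Y t))"
      "pdy Y t = (1/2) *\<^sub>R ((pdx X t + pdy Y t) - (pdx X t - pdy Y t))" by (simp_all add: vec_eq_iff field_simps)
    then show "pdx X t = 2 *\<^sub>R lift_zzbar \<psi> t - Re (s t) *\<^sub>R \<psi> t + (2 * Re (k t)) *\<^sub>R n t"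
      "pdy Y t = 2 *\<^sub>R lift_zzbar \<psi> t + Re (s t) *\<^sub>R \<psi> t - (2 * Re (k t)) *\<^sub>R n t"
      unfolding sum fund(1)[OF t] by (simp_all add: algebra_simps)
  qed
  have sXx: "smooth_on D (pdx X)" "smooth_on D (pdy X)" "smooth_on D (pdy Y)" by (rule smooth_on_pd[OF sX] smooth_on_pd[OF sY])+
  have sc: "smooth_on D (lift_zzbar \<psi>)"
    by (rule smooth_on_eqI[OF D second(2)], assumption)
      (intro smooth_on_linear[OF D bounded_linear_scaleR_right] smooth_on_add[OF D] sXx)
  have nXx: "lor (n t) (pdx X t) = 2 * Re (k t)" "lor (n t) (pdy X t) = - 2 * Im (k t)" "lor (n t) (pdy Y t) = - 2 * Re (k t)" if t: "t \<in> D" for t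
    using n[OF t] by (simp_all add: Xx[OF t] Yy[OF t] fund(2)[OF t])
  \<comment> \<open>From \<open>\<langle>X\<^sub>x, Y\<rangle> = 0 = \<langle>X\<^sub>y, Y\<rangle>\<close> by differentiating in \<open>y\<close> and in \<open>x\<close>.\<close>
  have norm_zz: "lor (lift_zzbar \<psi> t) (lift_zzbar \<psi> t) = (cmod (k t))\<^sup>2" if t: "t \<in> D" for t
  proof -
    note pd1 = lor_pd_const(2)[OF D t sXx(1) sY, of "\<lambda>_. 0"] and pd2 = lor_pd_const(1)[OF D t sXx(2) sY, of "\<lambda>_. 0"]
    have "lor (pdx X t) (pdy Y t) = - lor (pdy (pdx X) t) (Y t)"
      using pd1 iso by (simp add: pd_const lor_commute)
    moreover have "lor (pdy X t) (pdx Y t) = - lor (pdx (pdy X) t) (Y t)"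
      using pd2 iso by (simp add: pd_const lor_commute)
    ultimately have "lor (pdx X t) (pdy Y t) = lor (pdy X t) (pdy X t)"
      using pd_commute[OF D sX t] iso(15)[OF t] by simp
    then have "4 * lor (lift_zzbar \<psi> t) (lift_zzbar \<psi> t) = 4 * ((Re (k t))\<^sup>2 + (Im (k t))\<^sup>2)"
      unfolding Xx[OF t] Yy[OF t] fund(2)[OF t]
      using n[OF t] null[OF t] iso(16)[OF t]
      by (simp add: lor_commute algebra_simps power2_eq_square)
    then show ?thesis by (simp add: cmod_power2)
  qed
  have frame: "lorentz_frame (\<psi> t) (X t) (Y t) (h t) (n t)" if t: "t \<in> D" for t
    unfolding lorentz_frame_def h_def dual_lift_def
    using iso[OF t] n[OF t] null[OF t] norm_zz[OF t] by (simp add: lor_commute algebra_simps)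
  show fr: "lorentz_frame (\<psi> \<zeta>) (X \<zeta>) (Y \<zeta>) (h \<zeta>) (n \<zeta>)" by (rule frame[OF \<zeta>])
  have k_eq: "k t = of_real (lor (n t) (pdx X t) / 2) + \<i> * of_real (- lor (n t) (pdy X t) / 2)" if t: "t \<in> D" for t
    using nXx[OF t] by (simp add: complex_eq_iff)
  have slor: "smooth_on D (\<lambda>t. lor (f t) (g t))" if "smooth_on D f" "smooth_on D g" for f g :: "complex \<Rightarrow> lvec"
    by (rule smooth_on_bilinear[OF D bounded_bilinear_lor that])
  have sof: "smooth_on D (\<lambda>t. complex_of_real (f t) + \<i> * complex_of_real (g t))" if "smooth_on D f" "smooth_on D g" for f g
    by (intro smooth_on_add[OF D] smooth_on_linear[OF D bounded_linear_of_real] that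
        smooth_on_linear[OF D bounded_linear_compose[OF bounded_linear_mult_right bounded_linear_of_real]])
  show sk: "smooth_on D k"
    by (rule smooth_on_eqI[OF D k_eq], assumption)
      (intro sof smooth_on_linear[OF D bounded_linear_divide] smooth_on_uminus[OF D] slor sn sXx)
  have sq: "smooth_on D (\<lambda>t. (cmod (k t))\<^sup>2)"
    unfolding cmod_power2 unfolding power2_eq_square
    by (intro smooth_on_add[OF D] smooth_on_mult[OF D] smooth_on_linear[OF D bounded_linear_Re] smooth_on_linear[OF D bounded_linear_Im] sk)
  show sh: "smooth_on D h"
    unfolding h_def dual_lift_def[abs_def]
    by (intro smooth_on_add[OF D] smooth_on_linear[OF D bounded_linear_scaleR_right] smooth_on_scaleR[OF D]
        smooth_on_linear[OF D bounded_linear_mult_right] sc sq s\<psi>)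
  have Xx': "pdx X t = (- Re (s t) - 2 * (cmod (k t))\<^sup>2) *\<^sub>R \<psi> t + h t + (2 * Re (k t)) *\<^sub>R n t"
    and Yy': "pdy Y t = (Re (s t) - 2 * (cmod (k t))\<^sup>2) *\<^sub>R \<psi> t + h t - (2 * Re (k t)) *\<^sub>R n t" if t: "t \<in> D" for t
    unfolding Xx[OF t] Yy[OF t] h_def dual_lift_def by (simp_all add: algebra_simps)
  have s_eq: "s t = of_real (lor (h t) (pdx X t) - 2 * (cmod (k t))\<^sup>2) + \<i> * of_real (- lor (h t) (pdy X t))" if t: "t \<in> D" for t
    using lorentz_frame_lor[OF frame[OF t]] by (simp add: Xx'[OF t] fund(2)[OF t] complex_eq_iff)
  show "smooth_on D s"
    by (rule smooth_on_eqI[OF D s_eq], assumption)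
      (intro sof smooth_on_diff[OF D] smooth_on_linear[OF D bounded_linear_mult_right] smooth_on_uminus[OF D] slor sq sh sXx)
  show 1: "pdx X \<zeta> = (- Re (s \<zeta>) - 2 * q) *\<^sub>R \<psi> \<zeta> + h \<zeta> + (2 * Re (k \<zeta>)) *\<^sub>R n \<zeta>"
    "pdy Y \<zeta> = (Re (s \<zeta>) - 2 * q) *\<^sub>R \<psi> \<zeta> + h \<zeta> - (2 * Re (k \<zeta>)) *\<^sub>R n \<zeta>"
    unfolding q_def by (rule Xx'[OF \<zeta>] Yy'[OF \<zeta>])+
  show 2: "pdy X \<zeta> = Im (s \<zeta>) *\<^sub>R \<psi> \<zeta> - (2 * Im (k \<zeta>)) *\<^sub>R n \<zeta>"
    "pdx Y \<zeta> = Im (s \<zeta>) *\<^sub>R \<psi> \<zeta> - (2 * Im (k \<zeta>)) *\<^sub>R n \<zeta>"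
    using fund(2)[OF \<zeta>] iso(15)[OF \<zeta>] by simp_all
  note F = lorentz_frame_lor[OF fr]
  have kd: "pdx (\<lambda>t. Re (k t)) \<zeta> = Re (pdx k \<zeta>)" "pdy (\<lambda>t. Re (k t)) \<zeta> = Re (pdy k \<zeta>)"
    "pdx (\<lambda>t. Im (k t)) \<zeta> = Im (pdx k \<zeta>)" "pdy (\<lambda>t. Im (k t)) \<zeta> = Im (pdy k \<zeta>)"
    using pd_linear[OF bounded_linear_Re smooth_on_differentiable[OF sk \<zeta>]] pd_linear[OF bounded_linear_Im smooth_on_differentiable[OF sk \<zeta>]]
    by auto
  have kd2: "pdx (\<lambda>t. c * Re (k t)) \<zeta> = c * Re (pdx k \<zeta>)" "pdy (\<lambda>t. c * Re (k t)) \<zeta> = c * Re (pdy k \<zeta>)"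
    "pdx (\<lambda>t. c * Im (k t)) \<zeta> = c * Im (pdx k \<zeta>)" "pdy (\<lambda>t. c * Im (k t)) \<zeta> = c * Im (pdy k \<zeta>)" for c
    using pd_linear[OF bounded_linear_compose[OF bounded_linear_mult_right bounded_linear_Re] smooth_on_differentiable[OF sk \<zeta>]]
      pd_linear[OF bounded_linear_compose[OF bounded_linear_mult_right bounded_linear_Im] smooth_on_differentiable[OF sk \<zeta>]]
    by auto
  have hf: "lor (h t) (h t) = 0" "lor (h t) (\<psi> t) = -1" "lor (h t) (X t) = 0" "lor (h t) (Y t) = 0" "lor (h t) (n t) = 0" if t: "t \<in> D" for t
    using lorentz_frame_lor[OF frame[OF t]] by auto
  \<comment> \<open>The components of the derivatives of \<open>n\<close> along \<open>\<psi>\<close>; the other ones follow from the Gram matrix and the equations for \<open>X\<close> and \<open>Y\<close>.\<close>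
  define e1 e2 where "e1 = - lor (h \<zeta>) (pdx n \<zeta>)" and "e2 = - lor (h \<zeta>) (pdy n \<zeta>)"
  then have e_lor: "lor (h \<zeta>) (pdx n \<zeta>) = - e1" "lor (h \<zeta>) (pdy n \<zeta>) = - e2" by simp_all
  have n_lor: "lor (n \<zeta>) (pdx n \<zeta>) = 0" "lor (n \<zeta>) (pdy n \<zeta>) = 0" "lor (\<psi> \<zeta>) (pdx n \<zeta>) = 0" "lor (\<psi> \<zeta>) (pdy n \<zeta>) = 0"
    "lor (X \<zeta>) (pdx n \<zeta>) = - 2 * Re (k \<zeta>)" "lor (X \<zeta>) (pdy n \<zeta>) = 2 * Im (k \<zeta>)"
    "lor (Y \<zeta>) (pdx n \<zeta>) = 2 * Im (k \<zeta>)" "lor (Y \<zeta>) (pdy n \<zeta>) = 2 * Re (k \<zeta>)"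
    using lor_pd_const[OF D \<zeta> sn sn n(1)] lor_pd_const[OF D \<zeta> sn s\<psi> n(2)] lor_pd_const[OF D \<zeta> sn sX n(3)] lor_pd_const[OF D \<zeta> sn sY n(4)]
      nXx[OF \<zeta>] n[OF \<zeta>] iso(15)[OF \<zeta>]
    by (simp_all add: pd_const lor_commute X_def[symmetric] Y_def[symmetric])
  have n_x: "pdx n \<zeta> = e1 *\<^sub>R \<psi> \<zeta> - (2 * Re (k \<zeta>)) *\<^sub>R X \<zeta> + (2 * Im (k \<zeta>)) *\<^sub>R Y \<zeta>"
    and n_y: "pdy n \<zeta> = e2 *\<^sub>R \<psi> \<zeta> + (2 * Im (k \<zeta>)) *\<^sub>R X \<zeta> + (2 * Re (k \<zeta>)) *\<^sub>R Y \<zeta>"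
    by (rule trans[OF frame_expansion[OF fr, symmetric]], simp add: frame_map_def n_lor e_lor)+
  have h_lor: "lor (h \<zeta>) (pdx h \<zeta>) = 0" "lor (h \<zeta>) (pdy h \<zeta>) = 0" "lor (\<psi> \<zeta>) (pdx h \<zeta>) = 0" "lor (\<psi> \<zeta>) (pdy h \<zeta>) = 0"
    "lor (X \<zeta>) (pdx h \<zeta>) = - Re (s \<zeta>) - 2 * q" "lor (X \<zeta>) (pdy h \<zeta>) = Im (s \<zeta>)"
    "lor (Y \<zeta>) (pdx h \<zeta>) = Im (s \<zeta>)" "lor (Y \<zeta>) (pdy h \<zeta>) = Re (s \<zeta>) - 2 * q"
    "lor (n \<zeta>) (pdx h \<zeta>) = e1" "lor (n \<zeta>) (pdy h \<zeta>) = e2"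
    using lor_pd_const[OF D \<zeta> sh sh hf(1)] lor_pd_const[OF D \<zeta> sh s\<psi> hf(2)] lor_pd_const[OF D \<zeta> sh sX hf(3)] lor_pd_const[OF D \<zeta> sh sY hf(4)]
      lor_pd_const[OF D \<zeta> sh sn hf(5)] F
    by (simp_all add: pd_const lor_commute X_def[symmetric] Y_def[symmetric] 1 2 e1_def e2_def)
  have h_x: "pdx h \<zeta> = (- Re (s \<zeta>) - 2 * q) *\<^sub>R X \<zeta> + Im (s \<zeta>) *\<^sub>R Y \<zeta> + e1 *\<^sub>R n \<zeta>"
    and h_y: "pdy h \<zeta> = Im (s \<zeta>) *\<^sub>R X \<zeta> + (Re (s \<zeta>) - 2 * q) *\<^sub>R Y \<zeta> + e2 *\<^sub>R n \<zeta>"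
    by (rule trans[OF frame_expansion[OF fr, symmetric]], simp add: frame_map_def h_lor)+
  have e2: "e2 = - 4 * Im m"
  proof -
    have "lor (n \<zeta>) (pdy (pdx X) \<zeta>) = 2 * Re (pdy k \<zeta>) + e2"
      using lor_pd_const(2)[OF D \<zeta> sn sXx(1) nXx(1)] F unfolding n_y 1 kd2 by simp
    moreover have "lor (n \<zeta>) (pdx (pdy X) \<zeta>) = - 2 * Im (pdx k \<zeta>)"
      using lor_pd_const(1)[OF D \<zeta> sn sXx(2) nXx(2)] F unfolding n_x 2 kd2 by simp
    ultimately show ?thesis using pd_commute[OF D sX \<zeta>] by (simp add: m_def dz_pd)
  qed
  have e1: "e1 = 4 * Re m"
  proof -
    have nYx: "lor (n t) (pdx Y t) = - 2 * Im (k t)" if "t \<in> D" for t using nXx(2)[OF that] iso(15)[OF that] by simp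
    have "lor (n \<zeta>) (pdy (pdx Y) \<zeta>) = - 2 * Im (pdy k \<zeta>)"
      using lor_pd_const(2)[OF D \<zeta> sn smooth_on_pd(1)[OF sY] nYx] F unfolding n_y 2 kd2 by simp
    moreover have "lor (n \<zeta>) (pdx (pdy Y) \<zeta>) = - 2 * Re (pdx k \<zeta>) + e1"
      using lor_pd_const(1)[OF D \<zeta> sn sXx(3) nXx(3)] F unfolding n_x 1 kd2 by simp
    ultimately show ?thesis using pd_commute[OF D sY \<zeta>] by (simp add: m_def dz_pd)
  qed
  show "pdx n \<zeta> = (4 * Re m) *\<^sub>R \<psi> \<zeta> - (2 * Re (k \<zeta>)) *\<^sub>R X \<zeta> + (2 * Im (k \<zeta>)) *\<^sub>R Y \<zeta>"
    "pdy n \<zeta> = - (4 * Im m) *\<^sub>R \<psi> \<zeta> + (2 * Im (k \<zeta>)) *\<^sub>R X \<zeta> + (2 * Re (k \<zeta>)) *\<^sub>R Y \<zeta>"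
    "pdx h \<zeta> = (- Re (s \<zeta>) - 2 * q) *\<^sub>R X \<zeta> + Im (s \<zeta>) *\<^sub>R Y \<zeta> + (4 * Re m) *\<^sub>R n \<zeta>"
    "pdy h \<zeta> = Im (s \<zeta>) *\<^sub>R X \<zeta> + (Re (s \<zeta>) - 2 * q) *\<^sub>R Y \<zeta> - (4 * Im m) *\<^sub>R n \<zeta>"
    using n_x n_y h_x h_y unfolding e1 e2 by simp_all
qed

section \<open>The structure equations as a flat linear system\<close>

text \<open>A moving frame \<open>(\<psi>, \<psi>\<^sub>x, \<psi>\<^sub>y, h, n)\<close> satisfies a linear system whose coefficients depend on
  \<open>(1, s, \<bar>k\<bar>\<^sup>2, k, dzbar k)\<close> through two fixed bilinear maps.\<close>

type_synonym frame = "lvec \<times> lvec \<times> lvec \<times> lvec \<times> lvec"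
text \<open>The constant \<open>1\<close> turns the affine dependence of the coefficients on the invariants into a
  linear one.\<close>

type_synonym structure_data = "real \<times> complex \<times> real \<times> complex \<times> complex"

definition act_x :: "structure_data \<Rightarrow> frame \<Rightarrow> frame" where
  "act_x = (\<lambda>(e, c, q, k, m) (p, X, Y, h, n).
    (e *\<^sub>R X,
     (- Re c - 2 * q) *\<^sub>R p + e *\<^sub>R h + (2 * Re k) *\<^sub>R n,
     Im c *\<^sub>R p - (2 * Im k) *\<^sub>R n,
     (- Re c - 2 * q) *\<^sub>R X + Im c *\<^sub>R Y + (4 * Re m) *\<^sub>R n,
     (4 * Re m) *\<^sub>R p - (2 * Re k) *\<^sub>R X + (2 * Im k) *\<^sub>R Y))"

definition act_y :: "structure_data \<Rightarrow> frame \<Rightarrow> frame" where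
  "act_y = (\<lambda>(e, c, q, k, m) (p, X, Y, h, n).
    (e *\<^sub>R Y,
     Im c *\<^sub>R p - (2 * Im k) *\<^sub>R n,
     (Re c - 2 * q) *\<^sub>R p + e *\<^sub>R h - (2 * Re k) *\<^sub>R n,
     Im c *\<^sub>R X + (Re c - 2 * q) *\<^sub>R Y - (4 * Im m) *\<^sub>R n,
     - (4 * Im m) *\<^sub>R p + (2 * Im k) *\<^sub>R X + (2 * Re k) *\<^sub>R Y))"

lemma bounded_bilinear_act_x: "bounded_bilinear act_x"
  unfolding bilinear_conv_bounded_bilinear[symmetric] bilinear_def act_x_def
  by (auto intro!: linearI simp: algebra_simps)

lemma bounded_bilinear_act_y: "bounded_bilinear act_y"
  unfolding bilinear_conv_bounded_bilinear[symmetric] bilinear_def act_y_def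
  by (auto intro!: linearI simp: algebra_simps)

definition structure_data :: "(complex \<Rightarrow> complex) \<Rightarrow> (complex \<Rightarrow> complex) \<Rightarrow> complex \<Rightarrow> structure_data" where
  "structure_data s k \<zeta> = (1, s \<zeta>, (cmod (k \<zeta>))\<^sup>2, k \<zeta>, dzbar k \<zeta>)"

definition moving_frame :: "(complex \<Rightarrow> complex) \<Rightarrow> (complex \<Rightarrow> lvec) \<Rightarrow> (complex \<Rightarrow> lvec) \<Rightarrow> complex \<Rightarrow> frame" where
  "moving_frame k \<psi> n \<zeta> = (\<psi> \<zeta>, pdx \<psi> \<zeta>, pdy \<psi> \<zeta>, dual_lift k \<psi> \<zeta>, n \<zeta>)"

lemma smooth_on_Pair:
  assumes "open S" "smooth_on S f" "smooth_on S g"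
  shows "smooth_on S (\<lambda>x. (f x, g x))"
proof -
  have "smooth_on S (\<lambda>x. (f x, 0) + (0, g x))"
    by (intro smooth_on_add[OF assms(1)] smooth_on_linear[OF assms(1) _ assms(2)] smooth_on_linear[OF assms(1) _ assms(3)]
        bounded_linear_Pair bounded_linear_ident bounded_linear_zero)
  then show ?thesis by simp
qed

lemma smooth_on_dzbar: "open D \<Longrightarrow> smooth_on D k \<Longrightarrow> smooth_on D (dzbar k)"
  unfolding dz_pd(2)[abs_def]
  by (intro smooth_on_linear[OF _ bounded_linear_divide] smooth_on_add smooth_on_linear[OF _ bounded_linear_mult_right] smooth_on_pd)

lemma smooth_on_cmod_power2: "open D \<Longrightarrow> smooth_on D k \<Longrightarrow> smooth_on D (\<lambda>t. (cmod (k t))\<^sup>2)"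
  unfolding cmod_power2 unfolding power2_eq_square
  by (intro smooth_on_add smooth_on_mult smooth_on_linear[OF _ bounded_linear_Re] smooth_on_linear[OF _ bounded_linear_Im])

lemma smooth_on_structure_data:
  "open D \<Longrightarrow> smooth_on D s \<Longrightarrow> smooth_on D k \<Longrightarrow> smooth_on D (structure_data s k)"
  unfolding structure_data_def[abs_def]
  by (intro smooth_on_Pair smooth_on_const smooth_on_cmod_power2 smooth_on_dzbar)

lemma moving_frame_derivative:
  assumes fl: "framed_lift D s k \<psi> n" and \<zeta>: "\<zeta> \<in> D"
  shows "(moving_frame k \<psi> n has_derivative (\<lambda>v.
     Re v *\<^sub>R act_x (structure_data s k \<zeta>) (moving_frame k \<psi> n \<zeta>) +
     Im v *\<^sub>R act_y (structure_data s k \<zeta>) (moving_frame k \<psi> n \<zeta>))) (at \<zeta>)"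
proof -
  note S = structure_equations[OF fl \<zeta>]
  note s\<psi> = framed_liftD(2)[OF fl] and sn = framed_liftD(3)[OF fl]
  note d = has_derivative_Pair[OF smooth_on_has_derivative_pd[OF s\<psi> \<zeta>]
      has_derivative_Pair[OF smooth_on_has_derivative_pd[OF smooth_on_pd(1)[OF s\<psi>] \<zeta>]
      has_derivative_Pair[OF smooth_on_has_derivative_pd[OF smooth_on_pd(2)[OF s\<psi>] \<zeta>]
      has_derivative_Pair[OF smooth_on_has_derivative_pd[OF S(3) \<zeta>] smooth_on_has_derivative_pd[OF sn \<zeta>]]]]]
  show ?thesis
    unfolding moving_frame_def[abs_def]
    by (rule has_derivative_eq_rhs[OF d])
      (simp add: act_x_def act_y_def structure_data_def S(5-12) fun_eq_iff)
qed

subsection \<open>Rigidity\<close>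

definition map_frame :: "(lvec \<Rightarrow> lvec) \<Rightarrow> frame \<Rightarrow> frame" where
  "map_frame B = (\<lambda>(p, X, Y, h, n). (B p, B X, B Y, B h, B n))"

lemma map_frame_act:
  assumes "linear B"
  shows "map_frame B (act_x P u) = act_x P (map_frame B u)" "map_frame B (act_y P u) = act_y P (map_frame B u)"
  by (auto simp: map_frame_def act_x_def act_y_def linear_add[OF assms] linear_diff[OF assms] linear_scale[OF assms] split: prod.splits)

lemma bounded_linear_map_frame:
  assumes "linear B"
  shows "bounded_linear (map_frame B)"
  unfolding linear_conv_bounded_linear[symmetric] map_frame_def
  by (auto intro!: linearI simp: linear_add[OF assms] linear_scale[OF assms])

text \<open>The linear map which matches two frames at one point sends the first solution of the
  structure equations to a solution with the same initial value as the second one.\<close>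

lemma framed_lift_rigidity:
  assumes f1: "framed_lift D s k \<psi> n" and f2: "framed_lift D s k \<psi>' n'" and p: "p \<in> D"
  shows "\<exists>B\<in>lorentz_maps. \<exists>r>0. ball p r \<subseteq> D \<and> (\<forall>\<zeta>\<in>ball p r. \<psi>' \<zeta> = B (\<psi> \<zeta>) \<and> n' \<zeta> = B (n \<zeta>))"
proof -
  note D = framed_liftD(1)[OF f1]
  note fr1 = structure_equations(4)[OF f1 p] and fr2 = structure_equations(4)[OF f2 p]
  define B where "B = frame_map (\<psi> p) (pdx \<psi> p) (pdy \<psi> p) (dual_lift k \<psi> p) (n p)
     (\<psi>' p) (pdx \<psi>' p) (pdy \<psi>' p) (dual_lift k \<psi>' p) (n' p)"
  have lin: "linear B" unfolding B_def by (rule linear_frame_map)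
  note Bf = frame_map_frame[OF fr1, of "\<psi>' p" "pdx \<psi>' p" "pdy \<psi>' p" "dual_lift k \<psi>' p" "n' p", folded B_def]
  have B: "B \<in> lorentz_maps"
    using lorentz_mapsI[OF lin, of "\<psi> p"] frame_map_lor[OF fr1 fr2, folded B_def] framed_liftD(4)[OF f1 p] framed_liftD(4)[OF f2 p] Bf(1)
    by simp
  have "smooth_on D (structure_data s k)"
    using smooth_on_structure_data[OF D] structure_equations(1,2)[OF f1 p] by blast
  then have cont: "continuous_on D (structure_data s k)" by (rule smooth_on_imp_continuous_on)
  have "\<exists>r>0. ball p r \<subseteq> D \<and> (\<forall>\<zeta>\<in>ball p r. map_frame B (moving_frame k \<psi> n \<zeta>) = moving_frame k \<psi>' n' \<zeta>)"
  proof (rule linear_system_unique[OF D p cont bounded_bilinear_act_x bounded_bilinear_act_y])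
    show "((\<lambda>\<zeta>. map_frame B (moving_frame k \<psi> n \<zeta>)) has_derivative
        (\<lambda>v. Re v *\<^sub>R act_x (structure_data s k \<zeta>) (map_frame B (moving_frame k \<psi> n \<zeta>)) +
             Im v *\<^sub>R act_y (structure_data s k \<zeta>) (map_frame B (moving_frame k \<psi> n \<zeta>)))) (at \<zeta>)"
      if "\<zeta> \<in> D" for \<zeta>
      by (rule has_derivative_eq_rhs[OF bounded_linear.has_derivative[OF bounded_linear_map_frame[OF lin] moving_frame_derivative[OF f1 that]]])
        (simp add: fun_eq_iff map_frame_act[OF lin] bounded_linear.linear[OF bounded_linear_map_frame[OF lin]] linear_add linear_scale)
    show "map_frame B (moving_frame k \<psi> n p) = moving_frame k \<psi>' n' p"
      by (simp add: map_frame_def moving_frame_def Bf)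
  qed (rule moving_frame_derivative[OF f2])
  then obtain r where "r > 0" "ball p r \<subseteq> D"
    "\<forall>\<zeta>\<in>ball p r. map_frame B (moving_frame k \<psi> n \<zeta>) = moving_frame k \<psi>' n' \<zeta>" by blast
  then show ?thesis
    by (intro bexI[OF _ B] exI[of _ r]) (auto simp: map_frame_def moving_frame_def)
qed

text \<open>The normalization \<open>\<bar>d\<psi>\<bar>\<^sup>2 = \<bar>dz\<bar>\<^sup>2\<close> leaves no freedom: a positive multiple \<open>\<mu> \<psi>\<close> has
  \<open>\<bar>d(\<mu>\<psi>)\<bar>\<^sup>2 = \<mu>\<^sup>2 \<bar>d\<psi>\<bar>\<^sup>2\<close> because \<open>\<psi>\<close> is null and orthogonal to its derivatives.\<close>

lemma normalized_lift_unique: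
  fixes \<psi> \<psi>' :: "complex \<Rightarrow> lvec"
  assumes D: "open D" and \<psi>: "smooth_on D \<psi>" and \<psi>': "smooth_on D \<psi>'"
    and lc: "\<forall>\<zeta>\<in>D. \<psi> \<zeta> \<in> light_cone" "\<forall>\<zeta>\<in>D. \<psi>' \<zeta> \<in> light_cone"
    and iso: "\<forall>\<zeta>\<in>D. \<forall>v. lor (frechet_derivative \<psi> (at \<zeta>) v) (frechet_derivative \<psi> (at \<zeta>) v) = (norm v)\<^sup>2"
    and iso': "\<forall>\<zeta>\<in>D. \<forall>v. lor (frechet_derivative \<psi>' (at \<zeta>) v) (frechet_derivative \<psi>' (at \<zeta>) v) = (norm v)\<^sup>2"
    and eq: "\<forall>\<zeta>\<in>D. sphere_point (\<psi> \<zeta>) = sphere_point (\<psi>' \<zeta>)" and \<zeta>: "\<zeta> \<in> D"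
  shows "\<psi>' \<zeta> = \<psi> \<zeta>"
proof -
  \<comment> \<open>Lifts of the same map are proportional; the factor is compared in the time component.\<close>
  define \<mu> where "\<mu> t = \<psi>' t $ None * inverse (\<psi> t $ None)" for t
  have null: "\<forall>\<zeta>\<in>D. lor (\<psi> \<zeta>) (\<psi> \<zeta>) = 0" "\<forall>\<zeta>\<in>D. lor (\<psi>' \<zeta>) (\<psi>' \<zeta>) = 0"
    using lc by (auto simp: light_cone_def)
  have pos: "\<psi> t $ None > 0" "\<psi>' t $ None > 0" if "t \<in> D" for t using lc that by (auto simp: light_cone_def)
  have \<psi>'_eq: "\<psi>' t = \<mu> t *\<^sub>R \<psi> t" if t: "t \<in> D" for t
  proof -
    have "\<psi>' t = \<psi>' t $ None *\<^sub>R null_vec (sphere_point (\<psi> t))"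
      using null_vec_sphere_point[of "\<psi>' t"] pos[OF t] eq t by simp
    moreover have "\<psi> t = \<psi> t $ None *\<^sub>R null_vec (sphere_point (\<psi> t))"
      using null_vec_sphere_point[of "\<psi> t"] pos[OF t] by simp
    moreover have "\<mu> t * \<psi> t $ None = \<psi>' t $ None" using pos[OF t] by (simp add: \<mu>_def)
    ultimately show ?thesis by (metis scaleR_scaleR)
  qed
  have s\<mu>: "smooth_on D \<mu>" unfolding \<mu>_def
    by (intro smooth_on_mult[OF D] smooth_on_inverse[OF D] smooth_on_linear[OF D bounded_linear_vec_nth] \<psi> \<psi>')
      (use pos in force)
  have "pdx \<psi>' \<zeta> = \<mu> \<zeta> *\<^sub>R pdx \<psi> \<zeta> + pdx \<mu> \<zeta> *\<^sub>R \<psi> \<zeta>"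
    using pd_cong(1)[OF D \<zeta> \<psi>'_eq] pd_bilinear(1)[OF bounded_bilinear_scaleR smooth_on_differentiable[OF s\<mu> \<zeta>] smooth_on_differentiable[OF \<psi> \<zeta>]]
    by simp
  then have "lor (pdx \<psi>' \<zeta>) (pdx \<psi>' \<zeta>) = (\<mu> \<zeta>)\<^sup>2"
    using isothermal_products(1,4)[OF D \<psi> null(1) iso \<zeta>] null(1) \<zeta> by (simp add: lor_commute power2_eq_square)
  then have "(\<mu> \<zeta>)\<^sup>2 = 1" using isothermal_products(1)[OF D \<psi>' null(2) iso' \<zeta>] by simp
  moreover have "\<mu> \<zeta> > 0" using pos[OF \<zeta>] by (simp add: \<mu>_def)
  ultimately have "\<mu> \<zeta> = 1" by (simp add: power2_eq_1_iff)
  then show ?thesis using \<psi>'_eq[OF \<zeta>] by simp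
qed

lemma framed_lift_subset:
  assumes "framed_lift D s k \<psi> n" "open D'" "D' \<subseteq> D"
  shows "framed_lift D' s k \<psi> n"
  using assms smooth_on_subset[OF _ assms(3)] unfolding framed_lift_def by blast

lemma lift_zzbar_linear:
  assumes "open D" "smooth_on D \<psi>" "t \<in> D" "linear B"
  shows "pdx (\<lambda>t. B (\<psi> t)) t = B (pdx \<psi> t)" "pdy (\<lambda>t. B (\<psi> t)) t = B (pdy \<psi> t)"
    "pdx (pdx (\<lambda>t. B (\<psi> t))) t = B (pdx (pdx \<psi>) t)" "pdy (pdx (\<lambda>t. B (\<psi> t))) t = B (pdy (pdx \<psi>) t)"
    "pdy (pdy (\<lambda>t. B (\<psi> t))) t = B (pdy (pdy \<psi>) t)"
    "lift_zzbar (\<lambda>t. B (\<psi> t)) t = B (lift_zzbar \<psi> t)"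
proof -
  have bl: "bounded_linear B" using assms(4) linear_conv_bounded_linear by blast
  have 1: "pdx (\<lambda>t. B (\<psi> t)) t = B (pdx \<psi> t)" "pdy (\<lambda>t. B (\<psi> t)) t = B (pdy \<psi> t)" if "smooth_on D \<psi>" "t \<in> D" for t and \<psi> :: "complex \<Rightarrow> lvec"
    using pd_linear[OF bl smooth_on_differentiable[OF that]] by auto
  show "pdx (\<lambda>t. B (\<psi> t)) t = B (pdx \<psi> t)" "pdy (\<lambda>t. B (\<psi> t)) t = B (pdy \<psi> t)" using 1[OF assms(2,3)] .
  show 2: "pdx (pdx (\<lambda>t. B (\<psi> t))) t = B (pdx (pdx \<psi>) t)" "pdy (pdx (\<lambda>t. B (\<psi> t))) t = B (pdy (pdx \<psi>) t)"
    "pdy (pdy (\<lambda>t. B (\<psi> t))) t = B (pdy (pdy \<psi>) t)"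
    using pd_cong[OF assms(1,3) 1(1)[OF assms(2)]] pd_cong[OF assms(1,3) 1(2)[OF assms(2)]]
      1[OF smooth_on_pd(1)[OF assms(2)] assms(3)] 1[OF smooth_on_pd(2)[OF assms(2)] assms(3)] by auto
  show "lift_zzbar (\<lambda>t. B (\<psi> t)) t = B (lift_zzbar \<psi> t)"
    unfolding lift_second_derivatives(2)[OF assms(1,3,2)] lift_second_derivatives(2)[OF assms(1,3) smooth_on_linear[OF assms(1) bl assms(2)]] 2
    by (simp add: linear_scale[OF assms(4)] linear_add[OF assms(4)])
qed

text \<open>Everything in the definition is expressed by linear combinations of derivatives and by the
  Lorentz form.\<close>

lemma framed_lift_lorentz:
  assumes fl: "framed_lift D s k \<psi> n" and B: "B \<in> lorentz_maps"
  shows "framed_lift D s k (\<lambda>t. B (\<psi> t)) (\<lambda>t. B (n t))"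
proof -
  note F = framed_liftD[OF fl] and L = lorentz_mapsD[OF B]
  have bl: "bounded_linear B" using L(1) linear_conv_bounded_linear by blast
  have s\<psi>: "smooth_on D (\<lambda>t. B (\<psi> t))" by (rule smooth_on_linear[OF F(1) bl F(2)])
  have "lor (frechet_derivative (\<lambda>t. B (\<psi> t)) (at \<zeta>) v) (frechet_derivative (\<lambda>t. B (\<psi> t)) (at \<zeta>) v) = (norm v)\<^sup>2" if "\<zeta> \<in> D" for \<zeta> v
    using frechet_derivative_at[OF bounded_linear.has_derivative[OF bl smooth_on_has_derivative[OF F(2) that]]] F(5)[OF that, of v] L(2)
    by metis
  moreover have "lor (B (n \<zeta>)) v = 0" if \<zeta>: "\<zeta> \<in> D" and v: "v \<in> V_fibre (\<lambda>t. B (\<psi> t)) \<zeta>" for \<zeta> v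
    using V_fibre_orthogonalI[OF s\<psi> \<zeta> _ _ _ _ v] lift_zzbar_linear[OF F(1,2) \<zeta> L(1)] L(2) F(6)[OF \<zeta> V_fibre_generators(1)[OF F(2) \<zeta>]]
      F(6)[OF \<zeta> V_fibre_generators(2)[OF F(2) \<zeta>]] F(6)[OF \<zeta> V_fibre_generators(3)[OF F(2) \<zeta>]] F(6)[OF \<zeta> V_fibre_generators(4)[OF F(2) \<zeta>]]
    by simp
  moreover have "lift_zz (\<lambda>t. B (\<psi> t)) \<zeta> + (s \<zeta> / 2) *s cvec (B (\<psi> \<zeta>)) = k \<zeta> *s cvec (B (n \<zeta>))" if \<zeta>: "\<zeta> \<in> D" for \<zeta>
    using F(8)[OF \<zeta>]
    unfolding fundamental_real[OF F(1) \<zeta> s\<psi>] fundamental_real[OF F(1) \<zeta> F(2)] lift_zzbar_linear(3-5)[OF F(1,2) \<zeta> L(1)]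
    by (metis linear_diff[OF L(1)] linear_scale[OF L(1)])
  ultimately show ?thesis
    unfolding framed_lift_def using F(1,4,7) s\<psi> smooth_on_linear[OF F(1) bl F(3)] L(2,3) by simp
qed

text \<open>By uniqueness of the normalized lift the two transformations agree on \<open>\<psi>\<close> itself, hence on the
  derivatives of \<open>\<psi>\<close>, and therefore on a frame.\<close>

lemma lorentz_unique_on_framed_lift:
  assumes fl: "framed_lift D s k \<psi> n" and B: "B \<in> lorentz_maps" "B' \<in> lorentz_maps" and p: "p \<in> D"
    and eq: "\<forall>\<zeta>\<in>D. sphere_point (B (\<psi> \<zeta>)) = sphere_point (B' (\<psi> \<zeta>)) \<and> B (n \<zeta>) = B' (n \<zeta>)"
  shows "B = B'"
proof -
  note F = framed_liftD[OF fl] and L = lorentz_mapsD[OF B(1)] and L' = lorentz_mapsD[OF B(2)]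
  note f = framed_liftD[OF framed_lift_lorentz[OF fl B(1)]] and f' = framed_liftD[OF framed_lift_lorentz[OF fl B(2)]]
  have same: "B (\<psi> t) = B' (\<psi> t)" if t: "t \<in> D" for t
    by (rule normalized_lift_unique[OF f(1) f'(2) f(2) _ _ _ _ _ t]) (use f(4,5) f'(4,5) eq in auto)
  have "pdx (\<lambda>t. B (\<psi> t)) p = pdx (\<lambda>t. B' (\<psi> t)) p" "pdy (\<lambda>t. B (\<psi> t)) p = pdy (\<lambda>t. B' (\<psi> t)) p"
    by (rule pd_cong[OF F(1) p same], assumption)+
  then have XY: "B (pdx \<psi> p) = B' (pdx \<psi> p)" "B (pdy \<psi> p) = B' (pdy \<psi> p)"
    using lift_zzbar_linear(1,2)[OF F(1,2) p L(1)] lift_zzbar_linear(1,2)[OF F(1,2) p L'(1)] by auto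
  have same1: "pdx (\<lambda>t. B (\<psi> t)) t = pdx (\<lambda>t. B' (\<psi> t)) t" "pdy (\<lambda>t. B (\<psi> t)) t = pdy (\<lambda>t. B' (\<psi> t)) t" if "t \<in> D" for t
    by (rule pd_cong[OF F(1) that same], assumption)+
  have "lift_zzbar (\<lambda>t. B (\<psi> t)) p = lift_zzbar (\<lambda>t. B' (\<psi> t)) p"
    unfolding lift_second_derivatives(2)[OF F(1) p f(2)] lift_second_derivatives(2)[OF F(1) p f'(2)]
    using pd_cong(1)[OF F(1) p same1(1)] pd_cong(2)[OF F(1) p same1(2)] by simp
  then have "B (lift_zzbar \<psi> p) = B' (lift_zzbar \<psi> p)"
    using lift_zzbar_linear(6)[OF F(1,2) p L(1)] lift_zzbar_linear(6)[OF F(1,2) p L'(1)] by simp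
  then have "B (dual_lift k \<psi> p) = B' (dual_lift k \<psi> p)"
    using same[OF p] by (simp add: dual_lift_def linear_add[OF L(1)] linear_scale[OF L(1)] linear_add[OF L'(1)] linear_scale[OF L'(1)])
  then show ?thesis
    using linear_eq_on_frame[OF structure_equations(4)[OF fl p] L(1) L'(1)] same[OF p] XY eq p by blast
qed

subsection \<open>Local existence\<close>

lemma pd_structure_data:
  assumes D: "open D" "\<zeta> \<in> D" and s: "smooth_on D s" and k: "smooth_on D k"
  shows "pdx (structure_data s k) \<zeta> = (0, pdx s \<zeta>, 2 * (Re (k \<zeta>) * Re (pdx k \<zeta>) + Im (k \<zeta>) * Im (pdx k \<zeta>)), pdx k \<zeta>, pdx (dzbar k) \<zeta>)"
    "pdy (structure_data s k) \<zeta> = (0, pdy s \<zeta>, 2 * (Re (k \<zeta>) * Re (pdy k \<zeta>) + Im (k \<zeta>) * Im (pdy k \<zeta>)), pdy k \<zeta>, pdy (dzbar k) \<zeta>)"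
proof -
  note dk = smooth_on_has_derivative_pd[OF k D(2)]
  note dRe = bounded_linear.has_derivative[OF bounded_linear_Re dk] and dIm = bounded_linear.has_derivative[OF bounded_linear_Im dk]
  have "((\<lambda>t. (cmod (k t))\<^sup>2) has_derivative
     (\<lambda>v. 2 * (Re (k \<zeta>) * Re (Re v *\<^sub>R pdx k \<zeta> + Im v *\<^sub>R pdy k \<zeta>) + Im (k \<zeta>) * Im (Re v *\<^sub>R pdx k \<zeta> + Im v *\<^sub>R pdy k \<zeta>)))) (at \<zeta>)"
    unfolding cmod_power2 unfolding power2_eq_square
    by (rule has_derivative_eq_rhs[OF has_derivative_add[OF has_derivative_mult[OF dRe dRe] has_derivative_mult[OF dIm dIm]]])
      (simp add: fun_eq_iff algebra_simps)
  note d = has_derivative_Pair[OF has_derivative_const[of "1::real"] has_derivative_Pair[OF smooth_on_has_derivative_pd[OF s D(2)]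
      has_derivative_Pair[OF this has_derivative_Pair[OF dk smooth_on_has_derivative_pd[OF smooth_on_dzbar[OF D(1) k] D(2)]]]]]
  show "pdx (structure_data s k) \<zeta> = (0, pdx s \<zeta>, 2 * (Re (k \<zeta>) * Re (pdx k \<zeta>) + Im (k \<zeta>) * Im (pdx k \<zeta>)), pdx k \<zeta>, pdx (dzbar k) \<zeta>)"
    "pdy (structure_data s k) \<zeta> = (0, pdy s \<zeta>, 2 * (Re (k \<zeta>) * Re (pdy k \<zeta>) + Im (k \<zeta>) * Im (pdy k \<zeta>)), pdy k \<zeta>, pdy (dzbar k) \<zeta>)"
    unfolding structure_data_def[abs_def] using pd_eqI[OF d] by simp_all
qed

text \<open>The Gauss and Codazzi equations are the integrability conditions of the structure equations.\<close>

lemma structure_data_flat: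
  assumes D: "open D" "\<zeta> \<in> D" and s: "smooth_on D s" and k: "smooth_on D k"
    and gauss: "(1/2) * dzbar s \<zeta> = 3 * dz (\<lambda>t. cnj (k t)) \<zeta> * k \<zeta> + cnj (k \<zeta>) * dz k \<zeta>"
    and codazzi: "Im (dzbar (dzbar k) \<zeta> + (1/2) * cnj (s \<zeta>) * k \<zeta>) = 0"
  shows "act_x (pdy (structure_data s k) \<zeta>) u + act_x (structure_data s k \<zeta>) (act_y (structure_data s k \<zeta>) u) =
         act_y (pdx (structure_data s k) \<zeta>) u + act_y (structure_data s k \<zeta>) (act_x (structure_data s k \<zeta>) u)"
proof -
  define k1 k2 a1 a2 b1 b2 where "k1 = Re (k \<zeta>)" and "k2 = Im (k \<zeta>)" and "a1 = Re (pdx k \<zeta>)" and "a2 = Im (pdx k \<zeta>)"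
    and "b1 = Re (pdy k \<zeta>)" and "b2 = Im (pdy k \<zeta>)"
  define s1 s2 x1 x2 y1 y2 where "s1 = Re (s \<zeta>)" and "s2 = Im (s \<zeta>)" and "x1 = Re (pdx s \<zeta>)" and "x2 = Im (pdx s \<zeta>)"
    and "y1 = Re (pdy s \<zeta>)" and "y2 = Im (pdy s \<zeta>)"
  define u1 u2 v1 v2 where "u1 = Re (pdx (dzbar k) \<zeta>)" and "u2 = Im (pdx (dzbar k) \<zeta>)" and "v1 = Re (pdy (dzbar k) \<zeta>)" and "v2 = Im (pdy (dzbar k) \<zeta>)"
  note defs = k1_def k2_def a1_def a2_def b1_def b2_def s1_def s2_def x1_def x2_def y1_def y2_def u1_def u2_def v1_def v2_def
  have m: "Re (dzbar k \<zeta>) = (a1 - b2) / 2" "Im (dzbar k \<zeta>) = (a2 + b1) / 2" by (simp_all add: dz_pd defs)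
  have q: "(cmod (k \<zeta>))\<^sup>2 = k1 * k1 + k2 * k2" unfolding cmod_power2 by (simp add: defs power2_eq_square)
  have "pdx (\<lambda>t. cnj (k t)) \<zeta> = cnj (pdx k \<zeta>)" "pdy (\<lambda>t. cnj (k t)) \<zeta> = cnj (pdy k \<zeta>)"
    using pd_linear[OF bounded_linear_cnj smooth_on_differentiable[OF k D(2)]] by auto
  then have x: "x1 = y2 + 6 * ((a1 - b2) * k1 + (a2 + b1) * k2) + 2 * (k1 * (a1 + b2) + k2 * (a2 - b1))"
    "x2 = - y1 + 6 * ((a1 - b2) * k2 - (a2 + b1) * k1) + 2 * (k1 * (a2 - b1) - k2 * (a1 + b2))"
    using gauss by (simp_all add: dz_pd complex_eq_iff defs field_simps)
  have v: "v1 = - u2 - s1 * k2 + s2 * k1"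
    using codazzi by (simp add: dz_pd(2)[of "dzbar k"] defs field_simps)
  obtain p X Y h n where u: "u = (p, X, Y, h, n)" by (cases u) auto
  show ?thesis
    unfolding pd_structure_data[OF D s k] u act_x_def act_y_def structure_data_def
    by (simp add: m q defs[symmetric] x v vec_eq_iff field_simps)
qed

definition horizontal :: "real^4 \<Rightarrow> lvec" where
  "horizontal x = (\<chi> i. case i of None \<Rightarrow> 0 | Some k \<Rightarrow> x $ k)"

lemma horizontal_simps [simp]: "horizontal x $ None = 0" "space_part (horizontal x) = x"
  by (simp_all add: horizontal_def space_part_def vec_eq_iff)

lemma has_derivative_lor_scaleR:
  assumes "(f has_derivative f') (at \<zeta>)" "(g has_derivative g') (at \<zeta>)"
  shows "((\<lambda>t. lor (f t) w *\<^sub>R g t) has_derivative (\<lambda>v. lor (f \<zeta>) w *\<^sub>R g' v + lor (f' v) w *\<^sub>R g \<zeta>)) (at \<zeta>)"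
  by (rule has_derivative_scaleR[OF bounded_linear.has_derivative[OF bounded_bilinear.bounded_linear_left[OF bounded_bilinear_lor] assms(1)] assms(2)])

text \<open>The derivative of the expansion \<open>frame_map u u w\<close> of a fixed vector \<open>w\<close>, as a function of the
  five vectors \<open>u\<close> and of their derivatives.\<close>

definition polarised_expansion :: "lvec \<Rightarrow> frame \<Rightarrow> frame \<Rightarrow> lvec" where
  "polarised_expansion w = (\<lambda>(p, X, Y, h, n) (p', X', Y', h', n').
     lor X w *\<^sub>R X' + lor X' w *\<^sub>R X + (lor Y w *\<^sub>R Y' + lor Y' w *\<^sub>R Y) + (lor n w *\<^sub>R n' + lor n' w *\<^sub>R n)
     - (lor h w *\<^sub>R p' + lor h' w *\<^sub>R p) - (lor p w *\<^sub>R h' + lor p' w *\<^sub>R h))"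

text \<open>This is skew-symmetry of the coefficient matrices: they lie in the Lie algebra of the group
  which preserves the Gram matrix of a frame.\<close>

lemma polarised_expansion_act:
  "polarised_expansion w u (act_x P u) = 0" "polarised_expansion w u (act_y P u) = 0"
  by (cases u; cases P; simp add: polarised_expansion_def act_x_def act_y_def algebra_simps)+

lemma polarised_expansion_linear:
  "polarised_expansion w u (a *\<^sub>R u' + b *\<^sub>R u'') = a *\<^sub>R polarised_expansion w u u' + b *\<^sub>R polarised_expansion w u u''"
  by (cases u; cases u'; cases u''; simp add: polarised_expansion_def algebra_simps)

text \<open>The expansion of a fixed vector in terms of the five vectors is constant along solutions, and
  the expansion formula characterises frames.\<close>

lemma solution_stays_frame:
  assumes du: "\<And>\<zeta>. \<zeta> \<in> S \<Longrightarrow> ((\<lambda>t. (p t, X t, Y t, h t, n t)) has_derivative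
      (\<lambda>v. Re v *\<^sub>R act_x (structure_data s k \<zeta>) (p \<zeta>, X \<zeta>, Y \<zeta>, h \<zeta>, n \<zeta>) +
           Im v *\<^sub>R act_y (structure_data s k \<zeta>) (p \<zeta>, X \<zeta>, Y \<zeta>, h \<zeta>, n \<zeta>))) (at \<zeta>)"
    and S: "convex S" "\<zeta>0 \<in> S" and init: "lorentz_frame (p \<zeta>0) (X \<zeta>0) (Y \<zeta>0) (h \<zeta>0) (n \<zeta>0)"
    and \<zeta>: "\<zeta> \<in> S"
  shows "lorentz_frame (p \<zeta>) (X \<zeta>) (Y \<zeta>) (h \<zeta>) (n \<zeta>)"
proof (rule lorentz_frame_of_expansion)
  fix w
  let ?E = "\<lambda>t. frame_map (p t) (X t) (Y t) (h t) (n t) (p t) (X t) (Y t) (h t) (n t) w"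
  have "(?E has_derivative (\<lambda>v. 0)) (at t)" if t: "t \<in> S" for t
  proof -
    let ?u = "(p t, X t, Y t, h t, n t)"
    define a b where "a = act_x (structure_data s k t) ?u" and "b = act_y (structure_data s k t) ?u"
    have d: "((\<lambda>t. (p t, X t, Y t, h t, n t)) has_derivative (\<lambda>v. Re v *\<^sub>R a + Im v *\<^sub>R b)) (at t)"
      unfolding a_def b_def by (rule du[OF t])
    note d1 = has_derivative_snd[OF d, unfolded snd_conv]
    note d2 = has_derivative_snd[OF d1, unfolded snd_conv]
    note d3 = has_derivative_snd[OF d2, unfolded snd_conv]
    define p' X' Y' h' n' where "p' v = fst (Re v *\<^sub>R a + Im v *\<^sub>R b)" and "X' v = fst (snd (Re v *\<^sub>R a + Im v *\<^sub>R b))"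
      and "Y' v = fst (snd (snd (Re v *\<^sub>R a + Im v *\<^sub>R b)))" and "h' v = fst (snd (snd (snd (Re v *\<^sub>R a + Im v *\<^sub>R b))))"
      and "n' v = snd (snd (snd (snd (Re v *\<^sub>R a + Im v *\<^sub>R b))))" for v
    have dp: "(p has_derivative p') (at t)" and dX: "(X has_derivative X') (at t)" and dY: "(Y has_derivative Y') (at t)"
      and dh: "(h has_derivative h') (at t)" and dn: "(n has_derivative n') (at t)"
      unfolding p'_def[abs_def] X'_def[abs_def] Y'_def[abs_def] h'_def[abs_def] n'_def[abs_def]
      using has_derivative_fst[OF d] has_derivative_fst[OF d1] has_derivative_fst[OF d2] has_derivative_fst[OF d3] has_derivative_snd[OF d3]
      by (simp_all only: fst_conv snd_conv)
    have "Re v *\<^sub>R a + Im v *\<^sub>R b = (p' v, X' v, Y' v, h' v, n' v)" for v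
      by (simp only: p'_def X'_def Y'_def h'_def n'_def prod.collapse)
    moreover have "polarised_expansion w ?u (Re v *\<^sub>R a + Im v *\<^sub>R b) = 0" for v
      unfolding polarised_expansion_linear a_def b_def polarised_expansion_act by simp
    ultimately have zero: "polarised_expansion w ?u (p' v, X' v, Y' v, h' v, n' v) = 0" for v by metis
    note D = has_derivative_diff[OF has_derivative_diff[OF has_derivative_add[OF has_derivative_add[OF
          has_derivative_lor_scaleR[OF dX dX, of w] has_derivative_lor_scaleR[OF dY dY, of w]] has_derivative_lor_scaleR[OF dn dn, of w]]
          has_derivative_lor_scaleR[OF dh dp, of w]] has_derivative_lor_scaleR[OF dp dh, of w]]
    show ?thesis unfolding frame_map_def
      by (rule has_derivative_eq_rhs[OF D], rule ext) (rule zero[unfolded polarised_expansion_def prod.case])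
  qed
  then have "\<exists>c. \<forall>t\<in>S. ?E t = c"
    by (intro has_derivative_zero_constant[OF S(1)]) (rule has_derivative_at_withinI)
  then obtain c where c: "\<And>t. t \<in> S \<Longrightarrow> ?E t = c" by blast
  have "?E \<zeta> = ?E \<zeta>0" using c S(2) \<zeta> by simp
  then show "?E \<zeta> = w" using frame_expansion[OF init] by simp
qed

text \<open>The first rows of the system say that \<open>X\<close>, \<open>Y\<close> are the partial derivatives of \<open>p\<close> and give the
  second derivatives of \<open>p\<close>, from which the defining equation of the invariants is read off.\<close>

lemma framed_lift_of_solution:
  assumes D: "open D"
    and ode: "\<forall>\<zeta>\<in>D. ((\<lambda>t. (p t, X t, Y t, h t, n t)) has_derivative
      (\<lambda>v. Re v *\<^sub>R act_x (structure_data s k \<zeta>) (p \<zeta>, X \<zeta>, Y \<zeta>, h \<zeta>, n \<zeta>) +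
           Im v *\<^sub>R act_y (structure_data s k \<zeta>) (p \<zeta>, X \<zeta>, Y \<zeta>, h \<zeta>, n \<zeta>))) (at \<zeta>)"
    and sm: "smooth_on D p" "smooth_on D n"
    and frame: "\<forall>\<zeta>\<in>D. lorentz_frame (p \<zeta>) (X \<zeta>) (Y \<zeta>) (h \<zeta>) (n \<zeta>)"
    and positive: "\<forall>\<zeta>\<in>D. p \<zeta> $ None > 0"
  shows "framed_lift D s k p n" "\<zeta> \<in> D \<Longrightarrow> pdx p \<zeta> = X \<zeta>" "\<zeta> \<in> D \<Longrightarrow> pdy p \<zeta> = Y \<zeta>"
proof -
  note du = ode[rule_format] and fr = frame[rule_format] and pos = positive[rule_format]
  have pd: "pdx p t = X t" "pdy p t = Y t" 
    "pdx X t = (- Re (s t) - 2 * (cmod (k t))\<^sup>2) *\<^sub>R p t + h t + (2 * Re (k t)) *\<^sub>R n t"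
    "pdy X t = Im (s t) *\<^sub>R p t - (2 * Im (k t)) *\<^sub>R n t"
    "pdy Y t = (Re (s t) - 2 * (cmod (k t))\<^sup>2) *\<^sub>R p t + h t - (2 * Re (k t)) *\<^sub>R n t" if t: "t \<in> D" for t
  proof -
    note d = du[OF t]
    note d1 = has_derivative_snd[OF d, simplified]
    note d2 = has_derivative_snd[OF d1, simplified]
    show "pdx p t = X t" "pdy p t = Y t"
      using pd_eqI[OF has_derivative_fst[OF d, simplified]] by (simp_all add: act_x_def act_y_def structure_data_def)
    show "pdx X t = (- Re (s t) - 2 * (cmod (k t))\<^sup>2) *\<^sub>R p t + h t + (2 * Re (k t)) *\<^sub>R n t"
      "pdy X t = Im (s t) *\<^sub>R p t - (2 * Im (k t)) *\<^sub>R n t"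
      using pd_eqI[OF has_derivative_fst[OF d1, simplified]] by (simp_all add: act_x_def act_y_def structure_data_def)
    show "pdy Y t = (Re (s t) - 2 * (cmod (k t))\<^sup>2) *\<^sub>R p t + h t - (2 * Re (k t)) *\<^sub>R n t"
      using pd_eqI[OF has_derivative_fst[OF d2, simplified]] by (simp_all add: act_x_def act_y_def structure_data_def)
  qed
  show "\<zeta> \<in> D \<Longrightarrow> pdx p \<zeta> = X \<zeta>" "\<zeta> \<in> D \<Longrightarrow> pdy p \<zeta> = Y \<zeta>" using pd by auto
  have pd2: "pdx (pdx p) t = pdx X t" "pdy (pdx p) t = pdy X t" "pdy (pdy p) t = pdy Y t" if t: "t \<in> D" for t
    using pd_cong[OF D t pd(1)] pd_cong(2)[OF D t pd(2)] by auto
  have zz: "lift_zzbar p t = (1/2) *\<^sub>R h t - (cmod (k t))\<^sup>2 *\<^sub>R p t" if t: "t \<in> D" for t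
    unfolding lift_second_derivatives(2)[OF D t sm(1)] pd2[OF t] pd(3,5)[OF t] by (simp add: vec_eq_iff field_simps)
  show "framed_lift D s k p n"
    unfolding framed_lift_def
  proof (intro conjI ballI allI D sm)
    fix t assume t: "t \<in> D"
    note F = lorentz_frame_lor[OF fr[OF t]]
    show "p t \<in> light_cone" using F pos[OF t] by (simp add: light_cone_def)
    show "lor (frechet_derivative p (at t) v) (frechet_derivative p (at t) v) = (norm v)\<^sup>2" for v
      unfolding frechet_pd[OF smooth_on_differentiable[OF sm(1) t]] pd(1,2)[OF t]
      unfolding cmod_power2 using F by (simp add: power2_eq_square)
    show "lor (n t) (n t) = 1" using F by simp
    show "lor (n t) v = 0" if "v \<in> V_fibre p t" for v
      by (rule V_fibre_orthogonalI[OF sm(1) t _ _ _ _ that]) (use F pd(1,2)[OF t] zz[OF t] in simp_all)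
    show "lift_zz p t + (s t / 2) *s cvec (p t) = k t *s cvec (n t)"
      unfolding fundamental_real[OF D t sm(1)] pd2[OF t] pd(3-5)[OF t] by (simp add: vec_eq_iff field_simps)
  qed
qed

text \<open>Every frame can serve as the initial value of the flat system; the one chosen here is positively
  oriented, which settles the orientation at \<open>p\<close>.\<close>

theorem framed_lift_exists:
  assumes D: "open D" "p \<in> D" and s: "smooth_on D s" and k: "smooth_on D k"
    and gc: "\<forall>\<zeta>\<in>D. (1/2) * dzbar s \<zeta> = 3 * dz (\<lambda>t. cnj (k t)) \<zeta> * k \<zeta> + cnj (k \<zeta>) * dz k \<zeta> \<and>
      Im (dzbar (dzbar k) \<zeta> + (1/2) * cnj (s \<zeta>) * k \<zeta>) = 0"
  shows "\<exists>r>0. ball p r \<subseteq> D \<and> (\<exists>\<psi> n. framed_lift (ball p r) s k \<psi> n \<and>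
    oriented_unit_normal (\<lambda>\<zeta>. sphere_point (\<psi> \<zeta>)) \<psi> p (n p))"
proof -
  note sP = smooth_on_structure_data[OF D(1) s k]
  \<comment> \<open>This initial frame makes the matrix in the orientation condition at \<open>p\<close> the unit matrix.\<close>
  let ?p = "null_vec (axis 1 1)" and ?X = "horizontal (axis 2 1)" and ?Y = "horizontal (axis 3 1)"
    and ?h = "(1/2) *\<^sub>R null_vec (- axis 1 1)" and ?n = "horizontal (axis 4 1)"
  have flat: "act_x (pdy (structure_data s k) \<zeta>) u + act_x (structure_data s k \<zeta>) (act_y (structure_data s k \<zeta>) u) =
         act_y (pdx (structure_data s k) \<zeta>) u + act_y (structure_data s k \<zeta>) (act_x (structure_data s k \<zeta>) u)"
    if "\<zeta> \<in> D" for \<zeta> u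
    using structure_data_flat[OF D(1) that s k] gc that by blast
  obtain r0 u where r0: "r0 > 0" "ball p r0 \<subseteq> D" and up: "u p = (?p, ?X, ?Y, ?h, ?n)"
    and du: "\<And>\<zeta>. \<zeta> \<in> ball p r0 \<Longrightarrow> (u has_derivative (\<lambda>v. Re v *\<^sub>R act_x (structure_data s k \<zeta>) (u \<zeta>) + Im v *\<^sub>R act_y (structure_data s k \<zeta>) (u \<zeta>))) (at \<zeta>)"
    using flat_linear_system_solvable[OF D sP bounded_bilinear_act_x bounded_bilinear_act_y flat, of "(?p, ?X, ?Y, ?h, ?n)"]
    by blast
  have su: "smooth_on (ball p r0) u"
    by (rule linear_system_smooth[OF open_ball smooth_on_subset[OF sP r0(2)] bounded_bilinear_act_x bounded_bilinear_act_y du])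
  define \<psi> X Y h n where "\<psi> t = fst (u t)" and "X t = fst (snd (u t))" and "Y t = fst (snd (snd (u t)))"
    and "h t = fst (snd (snd (snd (u t))))" and "n t = snd (snd (snd (snd (u t))))" for t
  have u_eq: "u = (\<lambda>t. (\<psi> t, X t, Y t, h t, n t))" by (simp add: \<psi>_def X_def Y_def h_def n_def)
  have sm: "smooth_on (ball p r0) \<psi>" "smooth_on (ball p r0) n"
    unfolding \<psi>_def[abs_def] n_def[abs_def]
    by (intro smooth_on_linear[OF open_ball bounded_linear_fst] smooth_on_linear[OF open_ball bounded_linear_snd] su)+
  have init: "\<psi> p = ?p" "X p = ?X" "Y p = ?Y" "h p = ?h" "n p = ?n" using up by (simp_all add: u_eq)
  have "isCont \<psi> p"
    using smooth_on_imp_continuous_on[OF sm(1)] r0(1) by (simp add: continuous_on_eq_continuous_at)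
  then have "isCont (\<lambda>t. \<psi> t $ None) p" by (intro continuous_intros)
  then have "\<forall>\<^sub>F t in at p. \<psi> t $ None > 0"
    unfolding isCont_def using order_tendstoD(1)[of "\<lambda>t. \<psi> t $ None" _ "at p" 0] init by simp
  then obtain r1 where r1: "r1 > 0" "\<And>t. t \<noteq> p \<Longrightarrow> dist t p < r1 \<Longrightarrow> \<psi> t $ None > 0"
    unfolding eventually_at by blast
  define r where "r = min r0 r1"
  have r: "r > 0" "ball p r \<subseteq> ball p r0" using r0 r1 by (auto simp: r_def)
  have pos: "\<psi> t $ None > 0" if "t \<in> ball p r" for t
    using r1(2)[of t] that init by (cases "t = p") (auto simp: r_def dist_commute)
  have du': "((\<lambda>t. (\<psi> t, X t, Y t, h t, n t)) has_derivative
      (\<lambda>v. Re v *\<^sub>R act_x (structure_data s k \<zeta>) (\<psi> \<zeta>, X \<zeta>, Y \<zeta>, h \<zeta>, n \<zeta>) +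
           Im v *\<^sub>R act_y (structure_data s k \<zeta>) (\<psi> \<zeta>, X \<zeta>, Y \<zeta>, h \<zeta>, n \<zeta>))) (at \<zeta>)" if "\<zeta> \<in> ball p r" for \<zeta>
    using du[of \<zeta>] r(2) that unfolding u_eq by blast
  then have ode: "\<forall>\<zeta>\<in>ball p r. ((\<lambda>t. (\<psi> t, X t, Y t, h t, n t)) has_derivative
      (\<lambda>v. Re v *\<^sub>R act_x (structure_data s k \<zeta>) (\<psi> \<zeta>, X \<zeta>, Y \<zeta>, h \<zeta>, n \<zeta>) +
           Im v *\<^sub>R act_y (structure_data s k \<zeta>) (\<psi> \<zeta>, X \<zeta>, Y \<zeta>, h \<zeta>, n \<zeta>))) (at \<zeta>)" by blast
  have pr: "p \<in> ball p r" using r by simp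
  have fr0: "lorentz_frame (\<psi> p) (X p) (Y p) (h p) (n p)"
    unfolding init lorentz_frame_def by (simp add: lor_space_part inner_axis_axis)
  have fr: "lorentz_frame (\<psi> \<zeta>) (X \<zeta>) (Y \<zeta>) (h \<zeta>) (n \<zeta>)" if "\<zeta> \<in> ball p r" for \<zeta>
    by (rule solution_stays_frame[OF du' convex_ball pr fr0 that])
  have "\<forall>\<zeta>\<in>ball p r. lorentz_frame (\<psi> \<zeta>) (X \<zeta>) (Y \<zeta>) (h \<zeta>) (n \<zeta>)" "\<forall>\<zeta>\<in>ball p r. \<psi> \<zeta> $ None > 0"
    using fr pos by blast+
  note FL = framed_lift_of_solution[OF open_ball ode smooth_on_subset[OF sm(1) r(2)] smooth_on_subset[OF sm(2) r(2)] this]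
  have "oriented_unit_normal (\<lambda>\<zeta>. sphere_point (\<psi> \<zeta>)) \<psi> p (n p)"
    unfolding oriented_unit_normal_def
  proof (intro conjI ballI)
    show "lor (n p) v = 0" if "v \<in> V_fibre \<psi> p" for v using framed_liftD(6)[OF FL(1) pr that] .
    show "lor (n p) (n p) = 1" using framed_liftD(7)[OF FL(1) pr] .
    have dp: "(\<psi> has_derivative (\<lambda>v. Re v *\<^sub>R ?X + Im v *\<^sub>R ?Y)) (at p)"
      using smooth_on_has_derivative_pd[OF framed_liftD(2)[OF FL(1)] pr] FL(2,3)[OF pr] init by simp
    have "((\<lambda>t. \<psi> t $ None) has_derivative (\<lambda>v. 0)) (at p)"
      using bounded_linear.has_derivative[OF bounded_linear_vec_nth[of None] dp] by simp
    then have "((\<lambda>t. 1 / \<psi> t $ None) has_derivative (\<lambda>v. 0)) (at p)"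
      using init(1) by (auto intro!: derivative_eq_intros)
    from has_derivative_scaleR[OF this bounded_linear.has_derivative[OF bounded_linear_space_part dp]]
    have dF: "((\<lambda>t. sphere_point (\<psi> t)) has_derivative (\<lambda>v. Re v *\<^sub>R axis 2 1 + Im v *\<^sub>R axis 3 1)) (at p)"
      unfolding sphere_point_def by (rule has_derivative_eq_rhs) (simp add: init)
    have fd: "frechet_derivative (\<lambda>t. sphere_point (\<psi> t)) (at p) = (\<lambda>v. Re v *\<^sub>R axis 2 1 + Im v *\<^sub>R axis 3 1)"
      by (rule frechet_derivative_at[OF dF, symmetric])
    have "(\<chi> i. if i = 1 then sphere_point (\<psi> p)
                else if i = 2 then frechet_derivative (\<lambda>\<zeta>. sphere_point (\<psi> \<zeta>)) (at p) 1
                else if i = 3 then frechet_derivative (\<lambda>\<zeta>. sphere_point (\<psi> \<zeta>)) (at p) \<i>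
                else (\<chi> k. n p $ Some k - n p $ None * sphere_point (\<psi> p) $ k)) = (mat 1 :: real^4^4)"
      unfolding fd init by (simp add: vec_eq_iff mat_def axis_def forall_4 horizontal_def)
    then show "det ((\<chi> i. if i = 1 then sphere_point (\<psi> p)
                else if i = 2 then frechet_derivative (\<lambda>\<zeta>. sphere_point (\<psi> \<zeta>)) (at p) 1
                else if i = 3 then frechet_derivative (\<lambda>\<zeta>. sphere_point (\<psi> \<zeta>)) (at p) \<i>
                else (\<chi> k. n p $ Some k - n p $ None * sphere_point (\<psi> p) $ k)) :: real^4^4) > 0"
      by simp
  qed
  then show ?thesis using FL(1) r r0(2) by blast
qed

section \<open>Immersions and their framed lifts\<close>

definition det4 :: "real^4 \<Rightarrow> real^4 \<Rightarrow> real^4 \<Rightarrow> real^4 \<Rightarrow> real" where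
  "det4 a b c d = det ((\<chi> i. if i = 1 then a else if i = 2 then b else if i = 3 then c else d) :: real^4^4)"

lemma det4_row:
  "det4 a b c d = det ((\<chi> i. if i = 2 then b else (if i = 1 then a else if i = 3 then c else d)) :: real^4^4)"
  "det4 a b c d = det ((\<chi> i. if i = 3 then c else (if i = 1 then a else if i = 2 then b else d)) :: real^4^4)"
  "det4 a b c d = det ((\<chi> i. if i = 4 then d else (if i = 1 then a else if i = 2 then b else c)) :: real^4^4)"
  unfolding det4_def by (rule arg_cong[where f = det], simp add: vec_eq_iff forall_4)+

lemma scalar_mult_scaleR: "r *s b = r *\<^sub>R (b :: real^'n)"
  by (simp add: vec_eq_iff)

lemma det4_add2: "det4 a (b + b') c d = det4 a b c d + det4 a b' c d"
  unfolding det4_row(1) by (rule det_row_add)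

lemma det4_scale2: "det4 a (r *\<^sub>R b) c d = r * det4 a b c d"
  unfolding det4_row(1) by (rule det_row_mul[of 2 r "\<lambda>_. b" "\<lambda>i. if i = 1 then a else if i = 3 then c else d", unfolded scalar_mult_scaleR])

lemma det4_add3: "det4 a b (c + c') d = det4 a b c d + det4 a b c' d"
  unfolding det4_row(2) by (rule det_row_add)

lemma det4_scale3: "det4 a b (r *\<^sub>R c) d = r * det4 a b c d"
  unfolding det4_row(2) by (rule det_row_mul[of 3 r "\<lambda>_. c" "\<lambda>i. if i = 1 then a else if i = 2 then b else d", unfolded scalar_mult_scaleR])

lemma det4_add4: "det4 a b c (d + d') = det4 a b c d + det4 a b c d'"
  unfolding det4_row(3) by (rule det_row_add)

lemma det4_scale4: "det4 a b c (r *\<^sub>R d) = r * det4 a b c d"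
  unfolding det4_row(3) by (rule det_row_mul[of 4 r "\<lambda>_. d" "\<lambda>i. if i = 1 then a else if i = 2 then b else c", unfolded scalar_mult_scaleR])

lemma det4_equal:
  "det4 a b b d = 0" "det4 a b c a = 0" "det4 a b c b = 0" "det4 a b c c = 0"
proof -
  show "det4 a b b d = 0" unfolding det4_def by (rule det_identical_rows[of 2 3]) (simp_all add: row_def)
  show "det4 a b c a = 0" unfolding det4_def by (rule det_identical_rows[of 1 4]) (simp_all add: row_def)
  show "det4 a b c b = 0" unfolding det4_def by (rule det_identical_rows[of 2 4]) (simp_all add: row_def)
  show "det4 a b c c = 0" unfolding det4_def by (rule det_identical_rows[of 3 4]) (simp_all add: row_def)
qed

lemma det4_swap: "det4 a c b d = - det4 a b c d"
proof -
  have "det4 a b c d + det4 a c b d = det4 a (b + c) (b + c) d"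
    unfolding det4_add2 det4_add3 by (simp add: det4_equal(1))
  then show ?thesis by (simp add: det4_equal(1))
qed

lemma oriented_unit_normal_det4:
  "oriented_unit_normal F \<psi> \<zeta> \<nu> \<longleftrightarrow> (\<forall>v \<in> V_fibre \<psi> \<zeta>. lor \<nu> v = 0) \<and> lor \<nu> \<nu> = 1 \<and>
     det4 (F \<zeta>) (pdx F \<zeta>) (pdy F \<zeta>) (space_part \<nu> - \<nu> $ None *\<^sub>R F \<zeta>) > 0"
proof -
  have "(\<chi> k. \<nu> $ Some k - \<nu> $ None * F \<zeta> $ k) = space_part \<nu> - \<nu> $ None *\<^sub>R F \<zeta>"
    by (simp add: vec_eq_iff)
  then show ?thesis unfolding oriented_unit_normal_def det4_def pdx_def pdy_def by (simp only:)
qed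

text \<open>The vector with \<open>cross4 a b c \<bullet> w = det4 a b c w\<close>.\<close>
definition cross4 :: "real^4 \<Rightarrow> real^4 \<Rightarrow> real^4 \<Rightarrow> real^4" where
  "cross4 a b c = (\<chi> j. det4 a b c (axis j 1))"

lemma cross4_inner: "cross4 a b c \<bullet> w = det4 a b c w"
proof -
  have lin: "linear (det4 a b c)" by (intro linearI) (simp_all add: det4_add4 det4_scale4)
  have "w = (\<Sum>j\<in>UNIV. w $ j *\<^sub>R axis j 1)" by (simp add: vec_eq_iff axis_def if_distrib cong: if_cong)
  then have "det4 a b c w = det4 a b c (\<Sum>j\<in>UNIV. w $ j *\<^sub>R axis j 1)" by simp
  also have "\<dots> = (\<Sum>j\<in>UNIV. w $ j * det4 a b c (axis j 1))"
    by (simp add: linear_sum[OF lin] linear_scale[OF lin])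
  finally show ?thesis by (simp add: cross4_def inner_vec_def mult.commute)
qed

lemma cross4_nonzero:
  assumes "a \<bullet> b = 0" "a \<bullet> c = 0" "b \<bullet> c = 0" "a \<noteq> 0" "b \<noteq> 0" "c \<noteq> 0"
  shows "cross4 a b c \<noteq> 0"
proof
  assume z: "cross4 a b c = 0"
  have "dim {a, b, c} \<le> card {a, b, c}" by (rule dim_le_card) (auto intro: span_base)
  also have "\<dots> < DIM(real^4)" by (simp add: card_insert_if)
  finally obtain w where w: "w \<noteq> 0" "\<And>y. y \<in> span {a, b, c} \<Longrightarrow> orthogonal w y"
    using orthogonal_to_subspace_exists by blast
  have ww: "w \<bullet> a = 0" "w \<bullet> b = 0" "w \<bullet> c = 0"
    using w(2)[OF span_base] by (auto simp: orthogonal_def)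
  let ?M = "(\<chi> i. if i = 1 then a else if i = 2 then b else if i = 3 then c else w) :: real^4^4"
  have "det ?M = 0" using cross4_inner[of a b c w] z by (simp add: det4_def)
  then have 0: "det (?M ** transpose ?M) = 0" by (simp add: det_mul)
  have off: "(?M $ i) \<bullet> (?M $ j) = 0" if "i \<noteq> j" for i j
    using that exhaust_4[of i] exhaust_4[of j] assms(1-3) ww by (auto simp: inner_commute)
  have "(?M ** transpose ?M) $ i $ j = (?M $ i) \<bullet> (?M $ j)" for i j
    by (simp add: matrix_matrix_mult_def transpose_def inner_vec_def)
  then have "det (?M ** transpose ?M) = (\<Prod>i\<in>UNIV. (?M $ i) \<bullet> (?M $ i))"
    using off by (subst det_diagonal) auto
  moreover have "(\<Prod>i\<in>UNIV. (?M $ i) \<bullet> (?M $ i)) \<noteq> 0"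
    using assms w(1) by simp
  ultimately show False using 0 by simp
qed

lemma smooth_on_prod:
  fixes f :: "'i \<Rightarrow> 'a::real_normed_vector \<Rightarrow> real"
  shows "open S \<Longrightarrow> (\<And>i. i \<in> I \<Longrightarrow> smooth_on S (f i)) \<Longrightarrow> smooth_on S (\<lambda>x. \<Prod>i\<in>I. f i x)"
  by (induction I rule: infinite_finite_induct) (auto intro: smooth_on_mult)

lemma smooth_on_det4:
  assumes D: "open D" and s: "smooth_on D a" "smooth_on D b" "smooth_on D c" "smooth_on D d"
  shows "smooth_on D (\<lambda>t. det4 (a t) (b t) (c t) (d t))"
proof -
  have "smooth_on D (\<lambda>t. (if i = 1 then a t else if i = 2 then b t else if i = 3 then c t else d t) $ j)" for i j :: 4
    using s smooth_on_linear[OF D bounded_linear_vec_nth] by (cases "i = 1"; cases "i = 2"; cases "i = 3") auto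
  then show ?thesis unfolding det4_def det_def vec_lambda_beta
    by (intro smooth_on_sum[OF D] smooth_on_linear[OF D bounded_linear_mult_right] smooth_on_prod[OF D])
qed

lemma bounded_linear_horizontal: "bounded_linear horizontal"
  by (rule linear_conv_bounded_linear[THEN iffD1], rule linearI) (auto simp: lvec_eqI)

lemma null_vec_horizontal: "null_vec x = null_vec 0 + horizontal x"
  by (rule lvec_eqI) simp_all

text \<open>The normalized lift of a conformal immersion \<open>F\<close> is \<open>(1, F) / \<bar>F\<^sub>x\<bar>\<close>.  A unit normal \<open>n\<^sub>0\<close> of the
  surface in \<open>S\<^sup>3\<close> is corrected by a multiple of \<open>\<psi>\<close> to become orthogonal to \<open>\<psi>\<^sub>z\<^sub>z\<^sub>b\<^sub>a\<^sub>r\<close>; the functions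
  \<open>s\<close> and \<open>k\<close> are the components of \<open>\<psi>\<^sub>z\<^sub>z\<close>, which is orthogonal to \<open>\<psi>\<close>, \<open>\<psi>\<^sub>x\<close> and \<open>\<psi>\<^sub>y\<close>.\<close>

lemma immersion_framed_lift:
  assumes D: "open D" and F: "smooth_on D F" and S: "F ` D \<subseteq> S3"
    and conf: "\<forall>\<zeta>\<in>D. \<exists>r>0. \<forall>v. norm (frechet_derivative F (at \<zeta>) v) = r * norm v"
  shows "\<exists>\<psi> n s k. framed_lift D s k \<psi> n \<and> (\<forall>\<zeta>\<in>D. F \<zeta> = sphere_point (\<psi> \<zeta>)) \<and>
     (\<forall>\<zeta>\<in>D. oriented_unit_normal F \<psi> \<zeta> (n \<zeta>))"
proof -
  note Fx = smooth_on_pd(1)[OF F] and Fy = smooth_on_pd(2)[OF F]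
  note fdF = frechet_pd[OF smooth_on_differentiable[OF F]]
  have FF: "F t \<bullet> F t = 1" if "t \<in> D" for t
    using S that by (force simp: dot_square_norm)
  have pdF: "F t \<bullet> pdx F t = 0" "F t \<bullet> pdy F t = 0" if t: "t \<in> D" for t
    using pd_bilinear[OF bounded_bilinear_inner smooth_on_differentiable[OF F t] smooth_on_differentiable[OF F t]]
      pd_cong[of D t "\<lambda>t. F t \<bullet> F t" "\<lambda>_. 1", OF D t FF] by (simp_all add: pd_const inner_commute)
  have metric: "pdx F t \<bullet> pdx F t > 0" "pdy F t \<bullet> pdy F t = pdx F t \<bullet> pdx F t" "pdx F t \<bullet> pdy F t = 0" if t: "t \<in> D" for t
  proof -
    obtain r where r: "r > 0" "\<And>v. norm (frechet_derivative F (at t) v) = r * norm v" using conf t by blast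
    have sq: "(Re v *\<^sub>R pdx F t + Im v *\<^sub>R pdy F t) \<bullet> (Re v *\<^sub>R pdx F t + Im v *\<^sub>R pdy F t) = r\<^sup>2 * (norm v)\<^sup>2" for v
      using r(2)[of v] unfolding fdF[OF t] by (simp only: dot_square_norm power_mult_distrib)
    have "(norm (1 + \<i>))\<^sup>2 = 2" by (simp add: cmod_def)
    with sq[of 1] sq[of \<i>] sq[of "1 + \<i>"] r(1)
    show "pdx F t \<bullet> pdx F t > 0" "pdy F t \<bullet> pdy F t = pdx F t \<bullet> pdx F t" "pdx F t \<bullet> pdy F t = 0"
      by (simp_all add: inner_simps inner_commute)
  qed
  define \<rho> where "\<rho> t = inverse (sqrt (pdx F t \<bullet> pdx F t))" for t
  have \<rho>: "\<rho> t > 0" "(\<rho> t)\<^sup>2 * (pdx F t \<bullet> pdx F t) = 1" if "t \<in> D" for t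
    using metric(1)[OF that] by (simp_all add: \<rho>_def power_inverse)
  have s\<rho>: "smooth_on D \<rho>"
    unfolding \<rho>_def
    by (intro smooth_on_inverse[OF D] smooth_on_sqrt[OF D] smooth_on_bilinear[OF D bounded_bilinear_inner] Fx)
      (use metric(1) in force)+
  define \<psi> where "\<psi> t = \<rho> t *\<^sub>R null_vec (F t)" for t
  have snv: "smooth_on D (\<lambda>t. null_vec (F t))"
    by (subst null_vec_horizontal) (intro smooth_on_add[OF D] smooth_on_const smooth_on_linear[OF D bounded_linear_horizontal] F)
  have s\<psi>: "smooth_on D \<psi>" unfolding \<psi>_def by (intro smooth_on_scaleR[OF D] s\<rho> snv)
  have pnv: "pdx (\<lambda>t. null_vec (F t)) t = horizontal (pdx F t)" "pdy (\<lambda>t. null_vec (F t)) t = horizontal (pdy F t)" if t: "t \<in> D" for t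
    using pd_add[of "\<lambda>_. null_vec 0" t "\<lambda>t. horizontal (F t)"] pd_linear[OF bounded_linear_horizontal smooth_on_differentiable[OF F t]]
      smooth_on_differentiable[OF smooth_on_linear[OF D bounded_linear_horizontal F] t]
    by (simp_all add: null_vec_horizontal[of "F _"] pd_const)
  have pd\<psi>: "pdx \<psi> t = \<rho> t *\<^sub>R horizontal (pdx F t) + pdx \<rho> t *\<^sub>R null_vec (F t)"
    "pdy \<psi> t = \<rho> t *\<^sub>R horizontal (pdy F t) + pdy \<rho> t *\<^sub>R null_vec (F t)" if t: "t \<in> D" for t
    using pd_bilinear[OF bounded_bilinear_scaleR smooth_on_differentiable[OF s\<rho> t] smooth_on_differentiable[OF snv t]] pnv[OF t]
    by (simp_all add: \<psi>_def[abs_def])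
  have lc: "\<psi> t \<in> light_cone" "sphere_point (\<psi> t) = F t" if t: "t \<in> D" for t
    using \<rho>(1)[OF t] FF[OF t] by (simp_all add: \<psi>_def light_cone_norm norm_eq_sqrt_inner)
  have iso: "lor (frechet_derivative \<psi> (at t) v) (frechet_derivative \<psi> (at t) v) = (norm v)\<^sup>2" if t: "t \<in> D" for t v
  proof -
    have "lor (frechet_derivative \<psi> (at t) v) (frechet_derivative \<psi> (at t) v) = ((Re v)\<^sup>2 + (Im v)\<^sup>2) * ((\<rho> t)\<^sup>2 * (pdx F t \<bullet> pdx F t))"
      unfolding frechet_pd[OF smooth_on_differentiable[OF s\<psi> t]] pd\<psi>[OF t]
      using pdF[OF t] metric(2,3)[OF t] FF[OF t]
      by (simp add: lor_space_part inner_simps inner_commute power2_eq_square algebra_simps)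
    then show ?thesis using \<rho>(2)[OF t] by (simp add: cmod_power2)
  qed
  have null: "\<forall>t\<in>D. lor (\<psi> t) (\<psi> t) = 0" using lc(1) by (simp add: light_cone_def)
  have "\<forall>t\<in>D. \<forall>v. lor (frechet_derivative \<psi> (at t) v) (frechet_derivative \<psi> (at t) v) = (norm v)\<^sup>2" using iso by blast
  note I = isothermal_products[OF D s\<psi> null this]
  define N where "N t = cross4 (F t) (pdx F t) (pdy F t)" for t
  have sN: "smooth_on D N" unfolding N_def cross4_def
    by (rule smooth_on_vec[OF D]) (simp add: smooth_on_det4[OF D F Fx Fy])
  have N: "N t \<bullet> w = det4 (F t) (pdx F t) (pdy F t) w" for t w unfolding N_def by (rule cross4_inner)
  have N0: "N t \<bullet> N t > 0" if t: "t \<in> D" for t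
  proof -
    have "F t \<noteq> 0" "pdx F t \<noteq> 0" "pdy F t \<noteq> 0" using FF[OF t] metric[OF t] by auto
    then have "N t \<noteq> 0" unfolding N_def using pdF[OF t] metric(3)[OF t] by (intro cross4_nonzero) auto
    then show ?thesis by simp
  qed
  define n0 where "n0 t = inverse (sqrt (N t \<bullet> N t)) *\<^sub>R N t" for t
  have sn0: "smooth_on D n0" unfolding n0_def
    by (intro smooth_on_scaleR[OF D] smooth_on_inverse[OF D] smooth_on_sqrt[OF D] smooth_on_bilinear[OF D bounded_bilinear_inner] sN)
      (use N0 in force)+
  have n0: "n0 t \<bullet> F t = 0" "n0 t \<bullet> pdx F t = 0" "n0 t \<bullet> pdy F t = 0" "n0 t \<bullet> n0 t = 1"
    "det4 (F t) (pdx F t) (pdy F t) (n0 t) > 0" if t: "t \<in> D" for t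
  proof -
    show "n0 t \<bullet> F t = 0" "n0 t \<bullet> pdx F t = 0" "n0 t \<bullet> pdy F t = 0"
      unfolding n0_def by (simp_all add: N det4_equal)
    show "n0 t \<bullet> n0 t = 1" unfolding n0_def using N0[OF t] by (simp add: field_simps flip: power2_eq_square)
    show "det4 (F t) (pdx F t) (pdy F t) (n0 t) > 0"
      unfolding N[symmetric] using N0[OF t] by (simp add: n0_def)
  qed
  \<comment> \<open>Adding a multiple of \<open>\<psi>\<close> changes the product with \<open>lift_zzbar \<psi>\<close> only, since \<open>\<psi>\<close> has product \<open>- 1/2\<close> with it.\<close>
  define n where "n t = horizontal (n0 t) + (2 * lor (horizontal (n0 t)) (lift_zzbar \<psi> t)) *\<^sub>R \<psi> t" for t
  have second: "lift_zzbar \<psi> t = (1/4) *\<^sub>R (pdx (pdx \<psi>) t + pdy (pdy \<psi>) t)" if "t \<in> D" for t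
    using lift_second_derivatives(2)[OF D that s\<psi>] .
  have sc: "smooth_on D (lift_zzbar \<psi>)"
    by (rule smooth_on_eqI[OF D second], assumption)
      (intro smooth_on_linear[OF D bounded_linear_scaleR_right] smooth_on_add[OF D] smooth_on_pd s\<psi>)
  have sn: "smooth_on D n" unfolding n_def
    by (intro smooth_on_add[OF D] smooth_on_scaleR[OF D] smooth_on_linear[OF D bounded_linear_mult_right] smooth_on_bilinear[OF D bounded_bilinear_lor]
        smooth_on_linear[OF D bounded_linear_horizontal] sn0 sc s\<psi>)
  have hn: "lor (horizontal (n0 t)) (\<psi> t) = 0" "lor (horizontal (n0 t)) (pdx \<psi> t) = 0" "lor (horizontal (n0 t)) (pdy \<psi> t) = 0"
    "lor (horizontal (n0 t)) (horizontal (n0 t)) = 1" if t: "t \<in> D" for t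
    using n0[OF t] unfolding pd\<psi>[OF t] by (simp_all add: \<psi>_def lor_space_part inner_simps)
  have n: "lor (n t) (\<psi> t) = 0" "lor (n t) (pdx \<psi> t) = 0" "lor (n t) (pdy \<psi> t) = 0" "lor (n t) (lift_zzbar \<psi> t) = 0" "lor (n t) (n t) = 1" if t: "t \<in> D" for t
    using hn[OF t] I(4,5,16)[OF t] null t by (simp_all add: n_def lor_commute)
  have V: "lor (n t) v = 0" if "t \<in> D" "v \<in> V_fibre \<psi> t" for t v
    by (rule V_fibre_orthogonalI[OF s\<psi> that(1) _ _ _ _ that(2)]) (use n[OF that(1)] in auto)
  define h where "h t = 2 *\<^sub>R lift_zzbar \<psi> t + (2 * lor (lift_zzbar \<psi> t) (lift_zzbar \<psi> t)) *\<^sub>R \<psi> t" for t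
  have frame: "lorentz_frame (\<psi> t) (pdx \<psi> t) (pdy \<psi> t) (h t) (n t)" if t: "t \<in> D" for t
    unfolding lorentz_frame_def h_def using I[OF t] n[OF t] null t by (simp add: lor_commute algebra_simps)
  define s k where "s t = Complex (lor (h t) (pdx (pdx \<psi>) t - pdy (pdy \<psi>) t) / 2) (- lor (h t) (pdy (pdx \<psi>) t))"
    and "k t = Complex (lor (n t) (pdx (pdx \<psi>) t - pdy (pdy \<psi>) t) / 4) (- lor (n t) (pdy (pdx \<psi>) t) / 2)" for t
  have "lift_zz \<psi> t + (s t / 2) *s cvec (\<psi> t) = k t *s cvec (n t)" if t: "t \<in> D" for t
    unfolding fundamental_real[OF D t s\<psi>]
  proof
    note E = frame_expansion[OF frame[OF t], symmetric]
    show "pdx (pdx \<psi>) t - pdy (pdy \<psi>) t = (4 * Re (k t)) *\<^sub>R n t - (2 * Re (s t)) *\<^sub>R \<psi> t"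
      by (rule trans[OF E]) (simp add: frame_map_def I[OF t] s_def k_def del: lor_simps(3,4), simp add: I[OF t])
    show "pdy (pdx \<psi>) t = Im (s t) *\<^sub>R \<psi> t - (2 * Im (k t)) *\<^sub>R n t"
      by (rule trans[OF E]) (simp add: frame_map_def I[OF t] s_def k_def)
  qed
  then have "framed_lift D s k \<psi> n" unfolding framed_lift_def using D s\<psi> sn lc(1) iso V n(5) by blast
  moreover have "oriented_unit_normal F \<psi> t (n t)" if t: "t \<in> D" for t
  proof -
    have "space_part (n t) - n t $ None *\<^sub>R F t = n0 t" by (simp add: n_def \<psi>_def)
    then show ?thesis unfolding oriented_unit_normal_det4 using V[OF t] n(5)[OF t] n0(5)[OF t] by simp
  qed
  ultimately show ?thesis using lc(2) by metis
qed

lemma span_singleton_scaleR: "c \<noteq> 0 \<Longrightarrow> span {c *\<^sub>R x} = span {x :: 'a::real_vector}"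
  unfolding span_singleton by (auto simp: image_def) (metis divide_inverse nonzero_eq_divide_eq)

lemma span_light_cone:
  assumes "v \<in> light_cone"
  shows "span {v} = span {null_vec x} \<longleftrightarrow> x = sphere_point v"
proof
  have v: "v $ None \<noteq> 0" using assms by (simp add: light_cone_def)
  have *: "span {v} = span {null_vec (sphere_point v)}"
    using span_singleton_scaleR[OF v, of "null_vec (sphere_point v)"] null_vec_sphere_point[OF v] by simp
  then show "x = sphere_point v \<Longrightarrow> span {v} = span {null_vec x}" by simp
  assume "span {v} = span {null_vec x}"
  then have "v \<in> span {null_vec x}" using span_base[of v "{v}"] by simp
  then obtain c where c: "v = c *\<^sub>R null_vec x" unfolding span_singleton by auto
  then have "c \<noteq> 0" using v by auto
  then show "x = sphere_point v" using c by simp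
qed

text \<open>Conversely a framed lift comes from an immersion with conformal factor \<open>1 / \<psi>\<^sub>0\<close>: the multiple
  \<open>(1, F)\<close> of \<open>\<psi>\<close> has constant time component, and \<open>\<bar>dF\<bar>\<close> is the length of its derivative.\<close>

lemma framed_lift_immersion:
  assumes fl: "framed_lift D s k \<psi> n" and F: "\<forall>\<zeta>\<in>D. F \<zeta> = sphere_point (\<psi> \<zeta>)"
  shows "smooth_on D F" "F ` D \<subseteq> S3" "\<forall>\<zeta>\<in>D. \<exists>r>0. \<forall>v. norm (frechet_derivative F (at \<zeta>) v) = r * norm v"
    "normalized_lift D F \<psi>"
proof -
  note f = framed_liftD[OF fl]
  have pos: "\<psi> t $ None > 0" if "t \<in> D" for t using f(4)[OF that] by (simp add: light_cone_def)
  define \<rho> where "\<rho> t = inverse (\<psi> t $ None)" for t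
  have s\<rho>: "smooth_on D \<rho>" unfolding \<rho>_def
    by (intro smooth_on_inverse[OF f(1)] smooth_on_linear[OF f(1) bounded_linear_vec_nth] f(2)) (use pos in force)
  define G where "G t = \<rho> t *\<^sub>R \<psi> t" for t
  have sG: "smooth_on D G" unfolding G_def by (intro smooth_on_scaleR[OF f(1)] s\<rho> f(2))
  have FG: "F t = space_part (G t)" "G t $ None = 1" if "t \<in> D" for t
    using F that pos[OF that] by (simp_all add: G_def \<rho>_def sphere_point_def divide_inverse)
  show "smooth_on D F"
    by (rule smooth_on_eqI[OF f(1) FG(1)], assumption) (rule smooth_on_linear[OF f(1) bounded_linear_space_part sG])
  show "F ` D \<subseteq> S3" using F sphere_point_S3 f(4) by auto
  show "\<forall>\<zeta>\<in>D. \<exists>r>0. \<forall>v. norm (frechet_derivative F (at \<zeta>) v) = r * norm v"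
  proof (intro ballI exI conjI allI)
    fix t v assume t: "t \<in> D"
    show "\<rho> t > 0" using pos[OF t] by (simp add: \<rho>_def)
    let ?d = "frechet_derivative \<psi> (at t) v" and ?r = "frechet_derivative \<rho> (at t) v" and ?g = "frechet_derivative G (at t) v"
    have g: "?g = \<rho> t *\<^sub>R ?d + ?r *\<^sub>R \<psi> t"
      unfolding G_def[abs_def]
      by (simp only: frechet_derivative_at[OF has_derivative_scaleR[OF smooth_on_has_derivative[OF s\<rho> t] smooth_on_has_derivative[OF f(2) t]], symmetric])
    have dG: "(G has_derivative frechet_derivative G (at t)) (at t)" by (rule smooth_on_has_derivative[OF sG t])
    have "((\<lambda>t. 1::real) has_derivative (\<lambda>v. frechet_derivative G (at t) v $ None)) (at t)"
      using bounded_linear.has_derivative[OF bounded_linear_vec_nth[of None] dG] has_derivative_cong_open[OF f(1) t, of "\<lambda>t. G t $ None" "\<lambda>_. 1"] FG(2)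
      by simp
    then have g0: "?g $ None = 0" using has_derivative_unique[OF _ has_derivative_const[of "1::real" "at t"]] by metis
    have "(F has_derivative (\<lambda>v. space_part (frechet_derivative G (at t) v))) (at t)"
      using bounded_linear.has_derivative[OF bounded_linear_space_part dG] has_derivative_cong_open[OF f(1) t, of F "\<lambda>t. space_part (G t)"] FG(1)
      by simp
    then have "frechet_derivative F (at t) v = space_part ?g" by (simp only: frechet_derivative_at[symmetric])
    then have "(norm (frechet_derivative F (at t) v))\<^sup>2 = lor ?g ?g"
      using g0 by (simp add: lor_space_part power2_norm_eq_inner)
    also have "\<dots> = (\<rho> t)\<^sup>2 * (norm v)\<^sup>2"
    proof -
      have null: "\<forall>t\<in>D. lor (\<psi> t) (\<psi> t) = 0" using f(4) by (simp add: light_cone_def)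
      have "\<forall>t\<in>D. \<forall>v. lor (frechet_derivative \<psi> (at t) v) (frechet_derivative \<psi> (at t) v) = (norm v)\<^sup>2" using f(5) by blast
      note I = isothermal_products[OF f(1,2) null this t]
      have "lor (\<psi> t) ?d = 0"
        unfolding frechet_pd[OF smooth_on_differentiable[OF f(2) t]] using I(4,5) by simp
      then show ?thesis unfolding g using f(5)[OF t, of v] null t by (simp add: lor_commute power2_eq_square)
    qed
    finally have "(norm (frechet_derivative F (at t) v))\<^sup>2 = (\<rho> t * norm v)\<^sup>2" by (simp add: power_mult_distrib)
    then show "norm (frechet_derivative F (at t) v) = \<rho> t * norm v"
      using \<open>\<rho> t > 0\<close> by (simp add: power2_eq_iff_nonneg)
  qed
  show "normalized_lift D F \<psi>"
    unfolding normalized_lift_def using f(2,4,5) F span_light_cone by blast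
qed

text \<open>The orthogonal complement of \<open>V\<close> is a line.\<close>

lemma unit_normal_up_to_sign:
  assumes fl: "framed_lift D s k \<psi> n" and \<zeta>: "\<zeta> \<in> D"
    and V: "\<forall>v\<in>V_fibre \<psi> \<zeta>. lor \<nu> v = 0" and one: "lor \<nu> \<nu> = 1"
  shows "\<nu> = n \<zeta> \<or> \<nu> = - n \<zeta>"
proof -
  note f = framed_liftD[OF fl]
  note fr = structure_equations(4)[OF fl \<zeta>]
  note V' = V_fibre_generators[OF f(2) \<zeta>, THEN bspec[OF V]]
  have "lor \<nu> (dual_lift k \<psi> \<zeta>) = 0" using V' by (simp add: dual_lift_def)
  then have eq: "\<nu> = lor (n \<zeta>) \<nu> *\<^sub>R n \<zeta>"
    using frame_expansion[OF fr, of \<nu>] V' by (simp add: frame_map_def lor_commute)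
  define c where "c = lor (n \<zeta>) \<nu>"
  have \<nu>: "\<nu> = c *\<^sub>R n \<zeta>" unfolding c_def by (rule eq)
  have "c * c = 1" using one f(7)[OF \<zeta>] by (simp add: \<nu>)
  then have "c = 1 \<or> c = -1" by (simp add: square_eq_1_iff)
  then show ?thesis using \<nu> by auto
qed

lemma oriented_unit_normal_unique:
  assumes fl: "framed_lift D s k \<psi> n" and \<zeta>: "\<zeta> \<in> D"
    and o: "oriented_unit_normal F \<psi> \<zeta> (n \<zeta>)" "oriented_unit_normal F \<psi> \<zeta> \<nu>"
  shows "\<nu> = n \<zeta>"
proof (rule ccontr)
  assume "\<nu> \<noteq> n \<zeta>"
  then have "\<nu> = - n \<zeta>"
    using unit_normal_up_to_sign[OF fl \<zeta>, of \<nu>] o(2) unfolding oriented_unit_normal_def by blast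
  then have "space_part \<nu> - \<nu> $ None *\<^sub>R F \<zeta> = (-1) *\<^sub>R (space_part (n \<zeta>) - n \<zeta> $ None *\<^sub>R F \<zeta>)"
    by (simp add: vec_eq_iff)
  then show False using o unfolding oriented_unit_normal_det4 by (simp only: det4_scale4) simp
qed

text \<open>Hence the Schwarzian derivative and the Hopf differential are well defined.\<close>

lemma fundamental_eq_iff:
  assumes fl: "framed_lift D s k \<psi> n" and F: "\<forall>\<zeta>\<in>D. F \<zeta> = sphere_point (\<psi> \<zeta>)" and \<zeta>: "\<zeta> \<in> D"
    and o: "oriented_unit_normal F \<psi> \<zeta> (n \<zeta>)"
  shows "fundamental_eq D F \<zeta> c \<kappa> \<longleftrightarrow> c = s \<zeta> \<and> \<kappa> = k \<zeta>"
proof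
  note f = framed_liftD[OF fl]
  assume "c = s \<zeta> \<and> \<kappa> = k \<zeta>"
  then show "fundamental_eq D F \<zeta> c \<kappa>"
    unfolding fundamental_eq_def using framed_lift_immersion(4)[OF fl F] o f(8)[OF \<zeta>] by blast
next
  note f = framed_liftD[OF fl]
  assume "fundamental_eq D F \<zeta> c \<kappa>"
  then obtain \<psi>' \<nu> where nl: "normalized_lift D F \<psi>'" and o': "oriented_unit_normal F \<psi>' \<zeta> \<nu>"
    and eq: "lift_zz \<psi>' \<zeta> + (c / 2) *s cvec (\<psi>' \<zeta>) = \<kappa> *s cvec \<nu>" unfolding fundamental_eq_def by blast
  have s': "smooth_on D \<psi>'" and lc': "\<forall>t\<in>D. \<psi>' t \<in> light_cone"
    and iso': "\<forall>t\<in>D. \<forall>v. lor (frechet_derivative \<psi>' (at t) v) (frechet_derivative \<psi>' (at t) v) = (norm v)\<^sup>2"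
    and "\<forall>t\<in>D. span {\<psi>' t} = span {null_vec (F t)}"
    using nl unfolding normalized_lift_def by blast+
  then have "\<forall>t\<in>D. sphere_point (\<psi> t) = sphere_point (\<psi>' t)" using span_light_cone F by metis
  then have same: "\<psi>' t = \<psi> t" if "t \<in> D" for t
    using normalized_lift_unique[OF f(1,2) s' _ lc' _ iso' _ that] f(4,5) by blast
  have pd: "pdx \<psi>' t = pdx \<psi> t" "pdy \<psi>' t = pdy \<psi> t" if "t \<in> D" for t
    by (rule pd_cong[OF f(1) that same], assumption)+
  have pd2: "pdx (pdx \<psi>') \<zeta> = pdx (pdx \<psi>) \<zeta>" "pdy (pdx \<psi>') \<zeta> = pdy (pdx \<psi>) \<zeta>" "pdy (pdy \<psi>') \<zeta> = pdy (pdy \<psi>) \<zeta>"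
    by (rule pd_cong[OF f(1) \<zeta> pd(1)] pd_cong[OF f(1) \<zeta> pd(2)], assumption)+
  have "V_fibre \<psi>' \<zeta> = V_fibre \<psi> \<zeta>"
    unfolding V_fibre_def lift_second_derivatives(2)[OF f(1) \<zeta> f(2)] lift_second_derivatives(2)[OF f(1) \<zeta> s'] pd2
    using same[OF \<zeta>] frechet_derivative_cong_open[OF f(1) \<zeta> same] by simp
  then have "oriented_unit_normal F \<psi> \<zeta> \<nu>" using o' unfolding oriented_unit_normal_def by simp
  then have \<nu>: "\<nu> = n \<zeta>" by (rule oriented_unit_normal_unique[OF fl \<zeta> o])
  have A: "pdx (pdx \<psi>) \<zeta> - pdy (pdy \<psi>) \<zeta> = (4 * Re \<kappa>) *\<^sub>R n \<zeta> - (2 * Re c) *\<^sub>R \<psi> \<zeta>"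
    "pdy (pdx \<psi>) \<zeta> = Im c *\<^sub>R \<psi> \<zeta> - (2 * Im \<kappa>) *\<^sub>R n \<zeta>"
    using eq unfolding fundamental_real[OF f(1) \<zeta> s'] unfolding pd2 \<nu> same[OF \<zeta>] by blast+
  have B: "pdx (pdx \<psi>) \<zeta> - pdy (pdy \<psi>) \<zeta> = (4 * Re (k \<zeta>)) *\<^sub>R n \<zeta> - (2 * Re (s \<zeta>)) *\<^sub>R \<psi> \<zeta>"
    "pdy (pdx \<psi>) \<zeta> = Im (s \<zeta>) *\<^sub>R \<psi> \<zeta> - (2 * Im (k \<zeta>)) *\<^sub>R n \<zeta>"
    using f(8)[OF \<zeta>] unfolding fundamental_real[OF f(1) \<zeta> f(2)] by auto
  note L = lorentz_frame_lor[OF structure_equations(4)[OF fl \<zeta>]]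
  have "lor v ((4 * Re \<kappa>) *\<^sub>R n \<zeta> - (2 * Re c) *\<^sub>R \<psi> \<zeta>) = lor v ((4 * Re (k \<zeta>)) *\<^sub>R n \<zeta> - (2 * Re (s \<zeta>)) *\<^sub>R \<psi> \<zeta>)"
    "lor v (Im c *\<^sub>R \<psi> \<zeta> - (2 * Im \<kappa>) *\<^sub>R n \<zeta>) = lor v (Im (s \<zeta>) *\<^sub>R \<psi> \<zeta> - (2 * Im (k \<zeta>)) *\<^sub>R n \<zeta>)" for v
    using A B by simp_all
  from this[of "n \<zeta>"] this[of "dual_lift k \<psi> \<zeta>"] show "c = s \<zeta> \<and> \<kappa> = k \<zeta>"
    by (simp add: L complex_eq_iff)
qed

section \<open>Changes of coordinates\<close>

lemma wirtinger_eqI: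
  assumes "(g has_derivative (\<lambda>v. a * v + b * cnj v)) (at \<zeta>)"
  shows "dz g \<zeta> = a" "dzbar g \<zeta> = b"
  unfolding dz_pd pd_eqI[OF assms] by (simp_all add: complex_eq_iff)

lemma wirtinger_const: "dz (\<lambda>t. c) \<zeta> = 0" "dzbar (\<lambda>t. c) \<zeta> = 0"
  by (simp_all add: dz_pd pd_const)

lemma has_derivative_wirtinger:
  assumes "g differentiable (at \<zeta>)"
  shows "(g has_derivative (\<lambda>v. dz g \<zeta> * v + dzbar g \<zeta> * cnj v)) (at \<zeta>)"
proof -
  have "frechet_derivative g (at \<zeta>) = (\<lambda>v. dz g \<zeta> * v + dzbar g \<zeta> * cnj v)"
  proof
    fix v
    show "frechet_derivative g (at \<zeta>) v = dz g \<zeta> * v + dzbar g \<zeta> * cnj v"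
      unfolding frechet_pd[OF assms] dz_pd by (simp add: complex_eq_iff field_simps)
  qed
  then show ?thesis using assms[unfolded frechet_derivative_works] by simp
qed

lemma wirtinger_add:
  assumes "f differentiable (at \<zeta>)" "g differentiable (at \<zeta>)"
  shows "dz (\<lambda>t. f t + g t) \<zeta> = dz f \<zeta> + dz g \<zeta>" "dzbar (\<lambda>t. f t + g t) \<zeta> = dzbar f \<zeta> + dzbar g \<zeta>"
  using wirtinger_eqI[OF has_derivative_eq_rhs[OF has_derivative_add[OF has_derivative_wirtinger[OF assms(1)] has_derivative_wirtinger[OF assms(2)]]],
      of "dz f \<zeta> + dz g \<zeta>" "dzbar f \<zeta> + dzbar g \<zeta>"]
  by (simp_all add: fun_eq_iff algebra_simps)

lemma wirtinger_mult:
  assumes "f differentiable (at \<zeta>)" "g differentiable (at \<zeta>)"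
  shows "dz (\<lambda>t. f t * g t) \<zeta> = f \<zeta> * dz g \<zeta> + dz f \<zeta> * g \<zeta>" "dzbar (\<lambda>t. f t * g t) \<zeta> = f \<zeta> * dzbar g \<zeta> + dzbar f \<zeta> * g \<zeta>"
  using wirtinger_eqI[OF has_derivative_eq_rhs[OF has_derivative_mult[OF has_derivative_wirtinger[OF assms(1)] has_derivative_wirtinger[OF assms(2)]]],
      of "f \<zeta> * dz g \<zeta> + dz f \<zeta> * g \<zeta>" "f \<zeta> * dzbar g \<zeta> + dzbar f \<zeta> * g \<zeta>"]
  by (simp_all add: fun_eq_iff algebra_simps)

lemma wirtinger_holomorphic:
  assumes "f holomorphic_on D" "open D" "\<zeta> \<in> D"
  shows "dz f \<zeta> = deriv f \<zeta>" "dzbar f \<zeta> = 0" "dz (\<lambda>t. cnj (f t)) \<zeta> = 0" "dzbar (\<lambda>t. cnj (f t)) \<zeta> = cnj (deriv f \<zeta>)"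
    "f differentiable (at \<zeta>)" "(\<lambda>t. cnj (f t)) differentiable (at \<zeta>)"
proof -
  have d: "(f has_derivative (\<lambda>v. deriv f \<zeta> * v)) (at \<zeta>)"
    using holomorphic_derivI[OF assms] by (simp add: has_field_derivative_def)
  show "dz f \<zeta> = deriv f \<zeta>" "dzbar f \<zeta> = 0" using wirtinger_eqI[of f "deriv f \<zeta>" 0 \<zeta>] d by simp_all
  have c: "((\<lambda>t. cnj (f t)) has_derivative (\<lambda>v. cnj (deriv f \<zeta> * v))) (at \<zeta>)"
    by (rule bounded_linear.has_derivative[OF bounded_linear_cnj d])
  then show "dz (\<lambda>t. cnj (f t)) \<zeta> = 0" "dzbar (\<lambda>t. cnj (f t)) \<zeta> = cnj (deriv f \<zeta>)"
    using wirtinger_eqI[of "\<lambda>t. cnj (f t)" 0 "cnj (deriv f \<zeta>)" \<zeta>] by simp_all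
  show "f differentiable (at \<zeta>)" "(\<lambda>t. cnj (f t)) differentiable (at \<zeta>)" using d c by (auto simp: differentiable_def)
qed

lemma wirtinger_compose:
  assumes "f holomorphic_on D" "open D" "\<zeta> \<in> D" and g: "g differentiable (at (f \<zeta>))"
  shows "dz (\<lambda>t. g (f t)) \<zeta> = dz g (f \<zeta>) * deriv f \<zeta>" "dzbar (\<lambda>t. g (f t)) \<zeta> = dzbar g (f \<zeta>) * cnj (deriv f \<zeta>)"
    "(\<lambda>t. g (f t)) differentiable (at \<zeta>)"
proof -
  have d: "(f has_derivative (\<lambda>v. deriv f \<zeta> * v)) (at \<zeta>)"
    using holomorphic_derivI[OF assms(1-3)] by (simp add: has_field_derivative_def)
  have c: "((\<lambda>t. g (f t)) has_derivative (\<lambda>v. dz g (f \<zeta>) * (deriv f \<zeta> * v) + dzbar g (f \<zeta>) * cnj (deriv f \<zeta> * v))) (at \<zeta>)"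
    by (rule has_derivative_compose[OF d has_derivative_wirtinger[OF g]])
  then show "dz (\<lambda>t. g (f t)) \<zeta> = dz g (f \<zeta>) * deriv f \<zeta>" "dzbar (\<lambda>t. g (f t)) \<zeta> = dzbar g (f \<zeta>) * cnj (deriv f \<zeta>)"
    using wirtinger_eqI[of "\<lambda>t. g (f t)" "dz g (f \<zeta>) * deriv f \<zeta>" "dzbar g (f \<zeta>) * cnj (deriv f \<zeta>)" \<zeta>]
    by (simp_all add: mult.assoc)
  show "(\<lambda>t. g (f t)) differentiable (at \<zeta>)" using c by (auto simp: differentiable_def)
qed

lemma wirtinger_cong:
  assumes "open S" "\<zeta> \<in> S" "\<And>y. y \<in> S \<Longrightarrow> f y = g y"
  shows "dz f \<zeta> = dz g \<zeta>" "dzbar f \<zeta> = dzbar g \<zeta>"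
  unfolding dz_pd using pd_cong[OF assms] by auto

lemma classical_schwarzian_cong:
  assumes S: "open S" "\<zeta> \<in> S" and eq: "\<And>t. t \<in> S \<Longrightarrow> f t = g t"
  shows "deriv f \<zeta> = deriv g \<zeta>" "classical_schwarzian f \<zeta> = classical_schwarzian g \<zeta>"
proof -
  have d: "deriv f t = deriv g t" if "t \<in> S" and "\<And>t. t \<in> S \<Longrightarrow> f t = g t" for f g :: "complex \<Rightarrow> complex" and t
    by (rule deriv_cong_ev) (use that S(1) eventually_nhds in blast)+
  have d1: "deriv f t = deriv g t" if "t \<in> S" for t by (rule d[OF that]) (rule eq)
  have d2: "deriv (deriv f) t = deriv (deriv g) t" if "t \<in> S" for t by (rule d[OF that]) (rule d1)
  show "deriv f \<zeta> = deriv g \<zeta>" by (rule d1[OF S(2)])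
  have "deriv (\<lambda>s. deriv (deriv f) s / deriv f s) \<zeta> = deriv (\<lambda>s. deriv (deriv g) s / deriv g s) \<zeta>"
    by (rule d[OF S(2)]) (simp add: d1 d2)
  then show "classical_schwarzian f \<zeta> = classical_schwarzian g \<zeta>"
    unfolding classical_schwarzian_def d1[OF S(2)] d2[OF S(2)] by simp
qed

lemma smooth_on_dz: "open D \<Longrightarrow> smooth_on D k \<Longrightarrow> smooth_on D (dz k)"
  unfolding dz_pd(1)[abs_def]
  by (intro smooth_on_linear[OF _ bounded_linear_divide] smooth_on_diff smooth_on_linear[OF _ bounded_linear_mult_right] smooth_on_pd)

text \<open>The density \<open>1 / \<bar>T\<bar>\<close> for holomorphic \<open>T\<close>, differentiated through \<open>R\<^sup>2 T cnj T = 1\<close>.\<close>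

lemma wirtinger_density:
  assumes T: "T holomorphic_on D" "\<forall>t\<in>D. T t \<noteq> 0" and D: "open D" "\<zeta> \<in> D"
  defines "R \<equiv> \<lambda>t. complex_of_real (1 / cmod (T t))"
  shows "smooth_on D (\<lambda>t. 1 / cmod (T t))" "R differentiable (at \<zeta>)"
    "dz R \<zeta> = - (1/2) * (deriv T \<zeta> / T \<zeta>) * R \<zeta>" "dzbar R \<zeta> = - (1/2) * cnj (deriv T \<zeta> / T \<zeta>) * R \<zeta>"
proof -
  have sT: "smooth_on D T" by (rule smooth_on_holomorphic[OF D(1) T(1)])
  have pos: "(cmod (T t))\<^sup>2 > 0" if "t \<in> D" for t using T(2) that by simp
  have eq: "1 / cmod (T t) = inverse (sqrt ((cmod (T t))\<^sup>2))" for t by (simp add: divide_inverse)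
  show sr: "smooth_on D (\<lambda>t. 1 / cmod (T t))" unfolding eq
    by (intro smooth_on_inverse[OF D(1)] smooth_on_sqrt[OF D(1)] smooth_on_cmod_power2[OF D(1) sT]) (use T(2) in auto)
  have sR: "smooth_on D R" unfolding R_def by (rule smooth_on_linear[OF D(1) bounded_linear_of_real sr])
  show dR: "R differentiable (at \<zeta>)" by (rule smooth_on_differentiable[OF sR D(2)])
  note h = wirtinger_holomorphic[OF T(1) D]
  have RR: "(\<lambda>t. R t * R t) differentiable (at \<zeta>)"
    by (rule smooth_on_differentiable[OF smooth_on_mult[OF D(1) sR sR] D(2)])
  have TT: "(\<lambda>t. T t * cnj (T t)) differentiable (at \<zeta>)"
    by (rule smooth_on_differentiable[OF smooth_on_mult[OF D(1) sT smooth_on_linear[OF D(1) bounded_linear_cnj sT]] D(2)])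
  have one: "(R t * R t) * (T t * cnj (T t)) = 1" if "t \<in> D" for t
    using T(2) that unfolding R_def by (simp add: complex_norm_square[symmetric] power2_eq_square flip: of_real_mult)
  have "dz (\<lambda>t. (R t * R t) * (T t * cnj (T t))) \<zeta> = dz (\<lambda>t. 1) \<zeta>" "dzbar (\<lambda>t. (R t * R t) * (T t * cnj (T t))) \<zeta> = dzbar (\<lambda>t. 1) \<zeta>"
    by (rule wirtinger_cong[OF D one], assumption)+
  then have z: "R \<zeta> * R \<zeta> * (deriv T \<zeta> * cnj (T \<zeta>)) + 2 * R \<zeta> * dz R \<zeta> * (T \<zeta> * cnj (T \<zeta>)) = 0"
    "R \<zeta> * R \<zeta> * (T \<zeta> * cnj (deriv T \<zeta>)) + 2 * R \<zeta> * dzbar R \<zeta> * (T \<zeta> * cnj (T \<zeta>)) = 0"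
    unfolding wirtinger_mult[OF RR TT] wirtinger_mult[OF dR dR] wirtinger_mult[OF h(5,6)] h(1-4)
    by (simp_all add: wirtinger_const algebra_simps)
  have nz: "R \<zeta> \<noteq> 0" "T \<zeta> \<noteq> 0" using T(2) D(2) by (auto simp: R_def)
  have "R \<zeta> * cnj (T \<zeta>) * (R \<zeta> * deriv T \<zeta> + 2 * dz R \<zeta> * T \<zeta>) = 0"
    "R \<zeta> * T \<zeta> * (R \<zeta> * cnj (deriv T \<zeta>) + 2 * dzbar R \<zeta> * cnj (T \<zeta>)) = 0"
    using z by (simp_all add: algebra_simps)
  then have "R \<zeta> * deriv T \<zeta> + 2 * dz R \<zeta> * T \<zeta> = 0" "R \<zeta> * cnj (deriv T \<zeta>) + 2 * dzbar R \<zeta> * cnj (T \<zeta>) = 0"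
    using nz by auto
  then show "dz R \<zeta> = - (1/2) * (deriv T \<zeta> / T \<zeta>) * R \<zeta>" "dzbar R \<zeta> = - (1/2) * cnj (deriv T \<zeta> / T \<zeta>) * R \<zeta>"
    using nz by (simp_all add: field_simps add_eq_0_iff)
qed

text \<open>Under a holomorphic change of coordinates \<open>\<tau>\<close> the normalized lift is multiplied by the density
  \<open>1 / \<bar>\<tau>'\<bar>\<close> and the normal field is unchanged.  Differentiating \<open>(\<psi> \<circ> \<tau>) / \<bar>\<tau>'\<bar>\<close> twice produces the
  classical Schwarzian derivative of \<open>\<tau>\<close>.\<close>

lemma framed_lift_pullback:
  assumes fl: "framed_lift D' s k \<psi> n" and D: "open D" and \<tau>: "\<tau> holomorphic_on D" "\<tau> ` D \<subseteq> D'"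
    and nz: "\<forall>\<zeta>\<in>D. deriv \<tau> \<zeta> \<noteq> 0"
  shows "framed_lift D (\<lambda>\<zeta>. s (\<tau> \<zeta>) * (deriv \<tau> \<zeta>)\<^sup>2 + classical_schwarzian \<tau> \<zeta>)
     (\<lambda>\<zeta>. k (\<tau> \<zeta>) * ((deriv \<tau> \<zeta>)\<^sup>2 / of_real (cmod (deriv \<tau> \<zeta>))))
     (\<lambda>\<zeta>. (1 / cmod (deriv \<tau> \<zeta>)) *\<^sub>R \<psi> (\<tau> \<zeta>)) (\<lambda>\<zeta>. n (\<tau> \<zeta>))"
proof -
  note f = framed_liftD[OF fl]
  define T where "T = deriv \<tau>"
  have hT: "T holomorphic_on D" unfolding T_def by (rule holomorphic_deriv[OF \<tau>(1) D])
  have nzT: "\<forall>t\<in>D. T t \<noteq> 0" using nz by (simp add: T_def)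
  \<comment> \<open>With this notation the Schwarzian derivative of \<open>\<tau>\<close> is \<open>Q' - Q\<^sup>2 / 2\<close>, and the density \<open>R\<close> has logarithmic derivative \<open>- Q / 2\<close>.\<close>
  define Q where "Q t = deriv T t / T t" for t
  have hT': "deriv T holomorphic_on D" by (rule holomorphic_deriv[OF hT D])
  have hQ: "Q holomorphic_on D" unfolding Q_def using nzT by (intro holomorphic_on_divide hT hT') auto
  define \<rho> where "\<rho> t = 1 / cmod (T t)" for t
  define R where "R t = complex_of_real (\<rho> t)" for t
  have R: "R differentiable (at t)" "dz R t = - (1/2) * Q t * R t" "dzbar R t = - (1/2) * cnj (Q t) * R t" if t: "t \<in> D" for t
    using wirtinger_density(2-4)[OF hT nzT D t] by (simp_all add: R_def[abs_def] \<rho>_def Q_def)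
  have s\<tau>: "smooth_on D \<tau>" by (rule smooth_on_holomorphic[OF D \<tau>(1)])
  have \<tau>D: "\<tau> t \<in> D'" if "t \<in> D" for t using \<tau>(2) that by blast
  have \<rho>pos: "\<rho> t > 0" if "t \<in> D" for t using nzT that by (simp add: \<rho>_def)
  have s\<rho>: "smooth_on D \<rho>" if "t \<in> D" for t unfolding \<rho>_def by (rule wirtinger_density(1)[OF hT nzT D that])
  then have s\<rho>: "smooth_on D \<rho>" by (cases "D = {}") (auto intro: smooth_on_local)
  define \<psi>' where "\<psi>' t = \<rho> t *\<^sub>R \<psi> (\<tau> t)" for t
  have s\<psi>\<tau>: "smooth_on D (\<lambda>t. \<psi> (\<tau> t))" by (rule smooth_on_compose[OF D \<tau>(2) f(2) s\<tau>])
  have s\<psi>': "smooth_on D \<psi>'" unfolding \<psi>'_def by (rule smooth_on_scaleR[OF D s\<rho> s\<psi>\<tau>])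
  have sn': "smooth_on D (\<lambda>t. n (\<tau> t))" by (rule smooth_on_compose[OF D \<tau>(2) f(3) s\<tau>])
  have fd: "frechet_derivative \<psi>' (at t) v = \<rho> t *\<^sub>R frechet_derivative \<psi> (at (\<tau> t)) (T t * v) + frechet_derivative \<rho> (at t) v *\<^sub>R \<psi> (\<tau> t)"
    if t: "t \<in> D" for t v
  proof -
    have d\<tau>: "(\<tau> has_derivative (\<lambda>v. T t * v)) (at t)"
      using holomorphic_derivI[OF \<tau>(1) D t] by (simp add: has_field_derivative_def T_def)
    have "((\<lambda>t. \<psi> (\<tau> t)) has_derivative (\<lambda>v. frechet_derivative \<psi> (at (\<tau> t)) (T t * v))) (at t)"
      by (rule has_derivative_compose[OF d\<tau> smooth_on_has_derivative[OF f(2) \<tau>D[OF t]]])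
    from has_derivative_scaleR[OF smooth_on_has_derivative[OF s\<rho> t] this]
    show ?thesis unfolding \<psi>'_def[abs_def] by (simp only: frechet_derivative_at[symmetric])
  qed
  have gen: "lor (n (\<tau> t)) (\<psi> (\<tau> t)) = 0" "lor (n (\<tau> t)) (frechet_derivative \<psi> (at (\<tau> t)) v) = 0" "lor (n (\<tau> t)) (lift_zzbar \<psi> (\<tau> t)) = 0"
    "lor (n (\<tau> t)) (pdx \<psi> (\<tau> t)) = 0" "lor (n (\<tau> t)) (pdy \<psi> (\<tau> t)) = 0" if t: "t \<in> D" for t v
  proof -
    have "frechet_derivative \<psi> (at (\<tau> t)) v \<in> V_fibre \<psi> (\<tau> t)" unfolding V_fibre_def by (auto intro: span_base)
    then show "lor (n (\<tau> t)) (\<psi> (\<tau> t)) = 0" "lor (n (\<tau> t)) (frechet_derivative \<psi> (at (\<tau> t)) v) = 0" "lor (n (\<tau> t)) (lift_zzbar \<psi> (\<tau> t)) = 0"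
      "lor (n (\<tau> t)) (pdx \<psi> (\<tau> t)) = 0" "lor (n (\<tau> t)) (pdy \<psi> (\<tau> t)) = 0"
      using f(6)[OF \<tau>D[OF t]] V_fibre_generators[OF f(2) \<tau>D[OF t]] by blast+
  qed
  have iso: "lor (frechet_derivative \<psi>' (at t) v) (frechet_derivative \<psi>' (at t) v) = (norm v)\<^sup>2" if t: "t \<in> D" for t v
  proof -
    have null: "\<forall>t\<in>D'. lor (\<psi> t) (\<psi> t) = 0" using f(4) by (simp add: light_cone_def)
    have "\<forall>t\<in>D'. \<forall>v. lor (frechet_derivative \<psi> (at t) v) (frechet_derivative \<psi> (at t) v) = (norm v)\<^sup>2" using f(5) by blast
    note I = isothermal_products(4,5)[OF f(1,2) null this \<tau>D[OF t]]
    have "lor (\<psi> (\<tau> t)) (frechet_derivative \<psi> (at (\<tau> t)) w) = 0" for w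
      unfolding frechet_pd[OF smooth_on_differentiable[OF f(2) \<tau>D[OF t]]] using I by simp
    then have "lor (frechet_derivative \<psi>' (at t) v) (frechet_derivative \<psi>' (at t) v) = (\<rho> t)\<^sup>2 * (norm (T t * v))\<^sup>2"
      unfolding fd[OF t] using null \<tau>D[OF t] f(5)[OF \<tau>D[OF t], of "T t * v"] by (simp add: lor_commute power2_eq_square)
    then show ?thesis using nzT t by (simp add: \<rho>_def norm_mult power_divide power_mult_distrib)
  qed
  define U where "U t = - (1/2) * (Q t * R t)" for t
  define V where "V t = R t * T t" for t
  have UV: "U differentiable (at t)" "V differentiable (at t)"
    "dz U t = - (1/2) * (deriv Q t * R t + Q t * (- (1/2) * Q t * R t))" "dzbar U t = - (1/2) * (Q t * (- (1/2) * cnj (Q t) * R t))"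
    "dz V t = - (1/2) * Q t * R t * T t + R t * (Q t * T t)" "dzbar V t = - (1/2) * cnj (Q t) * R t * T t" if t: "t \<in> D" for t
  proof -
    note q = wirtinger_holomorphic[OF hQ D t] and tt = wirtinger_holomorphic[OF hT D t]
    have c: "(\<lambda>t. - (1/2) :: complex) differentiable (at t)" by simp
    have QR: "(\<lambda>t. Q t * R t) differentiable (at t)" using q(5) R(1)[OF t] by (rule differentiable_mult)
    have T': "deriv T t = Q t * T t" using nzT t by (simp add: Q_def)
    show "U differentiable (at t)" unfolding U_def[abs_def] using c QR by (rule differentiable_mult)
    show "V differentiable (at t)" unfolding V_def[abs_def] using R(1)[OF t] tt(5) by (rule differentiable_mult)
    show "dz U t = - (1/2) * (deriv Q t * R t + Q t * (- (1/2) * Q t * R t))" "dzbar U t = - (1/2) * (Q t * (- (1/2) * cnj (Q t) * R t))"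
      unfolding U_def[abs_def] wirtinger_mult[OF c QR] wirtinger_mult[OF q(5) R(1)[OF t]] R[OF t] q
      by (simp_all add: wirtinger_const algebra_simps)
    show "dz V t = - (1/2) * Q t * R t * T t + R t * (Q t * T t)" "dzbar V t = - (1/2) * cnj (Q t) * R t * T t"
      unfolding V_def[abs_def] wirtinger_mult[OF R(1)[OF t] tt(5)] R[OF t] tt T' by (simp_all add: algebra_simps)
  qed
  have comp: "dz (dz (\<lambda>t. cvec (\<psi>' t) $ i)) t = R t * ((T t)\<^sup>2 * lift_zz \<psi> (\<tau> t) $ i - (1/2) * (deriv Q t - (1/2) * (Q t)\<^sup>2) * cvec (\<psi> (\<tau> t)) $ i)"
    "dzbar (dz (\<lambda>t. cvec (\<psi>' t) $ i)) t = R t * ((1/4) * (Q t * cnj (Q t)) * cvec (\<psi> (\<tau> t)) $ i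
       - (1/2) * (Q t * cnj (T t) * dzbar (\<lambda>u. cvec (\<psi> u) $ i) (\<tau> t) + cnj (Q t) * T t * dz (\<lambda>u. cvec (\<psi> u) $ i) (\<tau> t))
       + T t * cnj (T t) * dzbar (dz (\<lambda>u. cvec (\<psi> u) $ i)) (\<tau> t))" if t: "t \<in> D" for t i
  proof -
    let ?a = "\<lambda>u. cvec (\<psi> u) $ i"
    have sa: "smooth_on D' ?a" by (rule smooth_on_linear[OF f(1) bounded_linear_cvec_nth f(2)])
    have sb: "smooth_on D' (dz ?a)" by (rule smooth_on_dz[OF f(1) sa])
    note A = wirtinger_compose[OF \<tau>(1) D _ smooth_on_differentiable[OF sa \<tau>D]]
    note B = wirtinger_compose[OF \<tau>(1) D _ smooth_on_differentiable[OF sb \<tau>D]]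
    have first: "dz (\<lambda>t. cvec (\<psi>' t) $ i) t = U t * ?a (\<tau> t) + V t * dz ?a (\<tau> t)" if t: "t \<in> D" for t
    proof -
      have "(\<lambda>t. cvec (\<psi>' t) $ i) = (\<lambda>t. R t * ?a (\<tau> t))" by (simp add: \<psi>'_def cvec_def R_def)
      then show ?thesis
        using wirtinger_mult(1)[OF R(1)[OF t] A(3)[OF t t]] R(2)[OF t] A(1)[OF t t]
        by (simp add: U_def V_def T_def algebra_simps)
    qed
    have Ua: "(\<lambda>t. U t * ?a (\<tau> t)) differentiable (at t)" using UV(1)[OF t] A(3)[OF t t] by (rule differentiable_mult)
    have Vb: "(\<lambda>t. V t * dz ?a (\<tau> t)) differentiable (at t)" using UV(2)[OF t] B(3)[OF t t] by (rule differentiable_mult)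
    have zz: "lift_zz \<psi> (\<tau> t) $ i = dz (dz ?a) (\<tau> t)" by (simp add: lift_zz_def)
    have "dz (dz (\<lambda>t. cvec (\<psi>' t) $ i)) t = dz (\<lambda>t. U t * ?a (\<tau> t) + V t * dz ?a (\<tau> t)) t"
      by (rule wirtinger_cong(1)[OF D t first])
    also have "\<dots> = R t * ((T t)\<^sup>2 * lift_zz \<psi> (\<tau> t) $ i - (1/2) * (deriv Q t - (1/2) * (Q t)\<^sup>2) * cvec (\<psi> (\<tau> t)) $ i)"
      unfolding wirtinger_add(1)[OF Ua Vb] wirtinger_mult(1)[OF UV(1)[OF t] A(3)[OF t t]] wirtinger_mult(1)[OF UV(2)[OF t] B(3)[OF t t]]
        A(1)[OF t t] B(1)[OF t t] UV(3,5)[OF t] zz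
      by (simp add: U_def V_def T_def[symmetric] algebra_simps power2_eq_square)
    finally show "dz (dz (\<lambda>t. cvec (\<psi>' t) $ i)) t = R t * ((T t)\<^sup>2 * lift_zz \<psi> (\<tau> t) $ i - (1/2) * (deriv Q t - (1/2) * (Q t)\<^sup>2) * cvec (\<psi> (\<tau> t)) $ i)" .
    have "dzbar (dz (\<lambda>t. cvec (\<psi>' t) $ i)) t = dzbar (\<lambda>t. U t * ?a (\<tau> t) + V t * dz ?a (\<tau> t)) t"
      by (rule wirtinger_cong(2)[OF D t first])
    also have "\<dots> = R t * ((1/4) * (Q t * cnj (Q t)) * cvec (\<psi> (\<tau> t)) $ i
       - (1/2) * (Q t * cnj (T t) * dzbar ?a (\<tau> t) + cnj (Q t) * T t * dz ?a (\<tau> t)) + T t * cnj (T t) * dzbar (dz ?a) (\<tau> t))"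
      unfolding wirtinger_add(2)[OF Ua Vb] wirtinger_mult(2)[OF UV(1)[OF t] A(3)[OF t t]] wirtinger_mult(2)[OF UV(2)[OF t] B(3)[OF t t]]
        A(2)[OF t t] B(2)[OF t t] UV(4,6)[OF t]
      by (simp add: U_def V_def T_def[symmetric] algebra_simps)
    finally show "dzbar (dz (\<lambda>t. cvec (\<psi>' t) $ i)) t = R t * ((1/4) * (Q t * cnj (Q t)) * cvec (\<psi> (\<tau> t)) $ i
       - (1/2) * (Q t * cnj (T t) * dzbar ?a (\<tau> t) + cnj (Q t) * T t * dz ?a (\<tau> t)) + T t * cnj (T t) * dzbar (dz ?a) (\<tau> t))" .
  qed
  have zzb: "lift_zzbar \<psi>' t = (\<rho> t / 4 * (cmod (Q t))\<^sup>2) *\<^sub>R \<psi> (\<tau> t)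
      - (\<rho> t / 2) *\<^sub>R (Re (cnj (Q t) * T t) *\<^sub>R pdx \<psi> (\<tau> t) + Im (cnj (Q t) * T t) *\<^sub>R pdy \<psi> (\<tau> t))
      + (\<rho> t * (cmod (T t))\<^sup>2) *\<^sub>R lift_zzbar \<psi> (\<tau> t)" if t: "t \<in> D" for t
  proof -
    have "lift_zzbar \<psi>' t $ i = ((\<rho> t / 4 * (cmod (Q t))\<^sup>2) *\<^sub>R \<psi> (\<tau> t)
      - (\<rho> t / 2) *\<^sub>R (Re (cnj (Q t) * T t) *\<^sub>R pdx \<psi> (\<tau> t) + Im (cnj (Q t) * T t) *\<^sub>R pdy \<psi> (\<tau> t))
      + (\<rho> t * (cmod (T t))\<^sup>2) *\<^sub>R lift_zzbar \<psi> (\<tau> t)) $ i" for i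
    proof -
      define w where "w = dzbar (dz (\<lambda>u. cvec (\<psi> u) $ i)) (\<tau> t)"
      have z: "lift_zzbar \<psi> (\<tau> t) $ i = Re w" by (simp add: lift_zzbar_def w_def)
      have "lift_zzbar \<psi>' t $ i = Re (dzbar (dz (\<lambda>t. cvec (\<psi>' t) $ i)) t)" by (simp add: lift_zzbar_def)
      also have "\<dots> = \<rho> t * ((1/4) * (cmod (Q t))\<^sup>2 * \<psi> (\<tau> t) $ i
         - (1/2) * (Re (cnj (Q t) * T t) * pdx \<psi> (\<tau> t) $ i + Im (cnj (Q t) * T t) * pdy \<psi> (\<tau> t) $ i)
         + (cmod (T t))\<^sup>2 * lift_zzbar \<psi> (\<tau> t) $ i)"
        unfolding comp(2)[OF t, of i, folded w_def] unfolding dz_component[OF f(2) \<tau>D[OF t]] z R_def unfolding cvec_def cmod_power2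
        by (simp add: field_simps power2_eq_square)
      finally show ?thesis by (simp add: algebra_simps)
    qed
    then show ?thesis unfolding vec_eq_iff by blast
  qed
  show ?thesis
    unfolding framed_lift_def T_def[symmetric] \<rho>_def[symmetric] \<psi>'_def[symmetric]
  proof (intro conjI ballI allI D)
    show "smooth_on D \<psi>'" by (rule s\<psi>')
    show "smooth_on D (\<lambda>\<zeta>. n (\<tau> \<zeta>))" by (rule sn')
    fix t assume t: "t \<in> D"
    show "\<psi>' t \<in> light_cone" unfolding \<psi>'_def using scaleR_light_cone[OF f(4)[OF \<tau>D[OF t]] \<rho>pos[OF t]] .
    show "lor (frechet_derivative \<psi>' (at t) v) (frechet_derivative \<psi>' (at t) v) = (norm v)\<^sup>2" for v
      by (rule iso[OF t])
    show "lor (n (\<tau> t)) (n (\<tau> t)) = 1" by (rule f(7)[OF \<tau>D[OF t]])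
    show "lor (n (\<tau> t)) v = 0" if "v \<in> V_fibre \<psi>' t" for v
      by (rule V_fibre_orthogonalI[OF s\<psi>' t _ _ _ _ that])
        (simp_all add: pdx_def[of \<psi>'] pdy_def[of \<psi>'] fd[OF t] gen[OF t] zzb[OF t] \<psi>'_def[of t])
    have S: "classical_schwarzian \<tau> t = deriv Q t - (1/2) * (Q t)\<^sup>2"
      unfolding classical_schwarzian_def Q_def[abs_def] T_def ..
    have "lift_zz \<psi>' t $ i + (s (\<tau> t) * (T t)\<^sup>2 + classical_schwarzian \<tau> t) / 2 * cvec (\<psi>' t) $ i =
        k (\<tau> t) * ((T t)\<^sup>2 / of_real (cmod (T t))) * cvec (n (\<tau> t)) $ i" for i
    proof -
      have fi: "lift_zz \<psi> (\<tau> t) $ i + s (\<tau> t) / 2 * cvec (\<psi> (\<tau> t)) $ i = k (\<tau> t) * cvec (n (\<tau> t)) $ i"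
        using f(8)[OF \<tau>D[OF t]] by (metis vector_add_component vector_smult_component)
      have c: "cvec (\<psi>' t) $ i = R t * cvec (\<psi> (\<tau> t)) $ i" by (simp add: \<psi>'_def cvec_def R_def)
      have z: "lift_zz \<psi>' t $ i = dz (dz (\<lambda>t. cvec (\<psi>' t) $ i)) t" by (simp add: lift_zz_def)
      have "lift_zz \<psi>' t $ i + (s (\<tau> t) * (T t)\<^sup>2 + classical_schwarzian \<tau> t) / 2 * cvec (\<psi>' t) $ i
         = R t * (T t)\<^sup>2 * (lift_zz \<psi> (\<tau> t) $ i + s (\<tau> t) / 2 * cvec (\<psi> (\<tau> t)) $ i)"
        unfolding z comp(1)[OF t] c S by (simp add: field_simps)
      then show ?thesis unfolding fi R_def \<rho>_def by (simp add: algebra_simps)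
    qed
    then show "lift_zz \<psi>' t + ((s (\<tau> t) * (T t)\<^sup>2 + classical_schwarzian \<tau> t) / 2) *s cvec (\<psi>' t) =
       (k (\<tau> t) * ((T t)\<^sup>2 / of_real (cmod (T t)))) *s cvec (n (\<tau> t))"
      unfolding vec_eq_iff by (simp only: vector_add_component vector_smult_component) simp
  qed
qed

lemma det4_rotate:
  "det4 a (x *\<^sub>R b + y *\<^sub>R c) (- y *\<^sub>R b + x *\<^sub>R c) d = (x\<^sup>2 + y\<^sup>2) * det4 a b c d"
  unfolding det4_add2 det4_add3 det4_scale2 det4_scale3
  using det4_swap[of a c b d] by (simp add: det4_equal power2_eq_square algebra_simps)

section \<open>Framed maps of planar domains\<close>

text \<open>In contrast to the lift, the map \<open>F\<close> and the normal field \<open>n\<close> do not depend on the coordinate, so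
  that framed maps in different charts can be compared.\<close>

definition framed_map :: "complex set \<Rightarrow> (complex \<Rightarrow> complex) \<Rightarrow> (complex \<Rightarrow> complex) \<Rightarrow>
    (complex \<Rightarrow> real^4) \<Rightarrow> (complex \<Rightarrow> lvec) \<Rightarrow> bool" where
  "framed_map D s k F n \<longleftrightarrow> (\<exists>\<psi>. framed_lift D s k \<psi> n \<and> (\<forall>\<zeta>\<in>D. F \<zeta> = sphere_point (\<psi> \<zeta>)))"

lemma framed_map_open: "framed_map D s k F n \<Longrightarrow> open D"
  unfolding framed_map_def using framed_liftD(1) by blast

lemma framed_mapD:
  assumes "framed_map D s k F n"
  shows "smooth_on D F" "F ` D \<subseteq> S3" "\<forall>\<zeta>\<in>D. \<exists>r>0. \<forall>v. norm (frechet_derivative F (at \<zeta>) v) = r * norm v"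
    "smooth_on D n"
proof -
  obtain \<psi> where p: "framed_lift D s k \<psi> n" "\<forall>\<zeta>\<in>D. F \<zeta> = sphere_point (\<psi> \<zeta>)"
    using assms unfolding framed_map_def by blast
  note framed_lift_immersion[OF p]
  then show "smooth_on D F" "F ` D \<subseteq> S3" "\<forall>\<zeta>\<in>D. \<exists>r>0. \<forall>v. norm (frechet_derivative F (at \<zeta>) v) = r * norm v"
    by blast+
  show "smooth_on D n" by (rule framed_liftD(3)[OF p(1)])
qed

lemma lift_germ_cong:
  assumes T: "open T" "t \<in> T" and eq\<^sub>0: "\<forall>u\<in>T. \<psi>' u = \<psi> u"
  shows "frechet_derivative \<psi>' (at t) = frechet_derivative \<psi> (at t)"
    "lift_zz \<psi>' t = lift_zz \<psi> t" "lift_zzbar \<psi>' t = lift_zzbar \<psi> t" "V_fibre \<psi>' t = V_fibre \<psi> t"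
proof -
  have eq: "\<psi>' u = \<psi> u" if "u \<in> T" for u using eq\<^sub>0 that by blast
  show 1: "frechet_derivative \<psi>' (at t) = frechet_derivative \<psi> (at t)" by (rule frechet_derivative_cong_open[OF T eq], assumption)
  have d: "dz (\<lambda>s. cvec (\<psi>' s) $ i) u = dz (\<lambda>s. cvec (\<psi> s) $ i) u" if "u \<in> T" for i u
    by (rule wirtinger_cong(1)[OF T(1) that]) (simp add: eq)
  show "lift_zz \<psi>' t = lift_zz \<psi> t" unfolding lift_zz_def vec_eq_iff vec_lambda_beta
    by (intro allI wirtinger_cong(1)[OF T] d)
  have "dzbar (dz (\<lambda>s. cvec (\<psi>' s) $ i)) t = dzbar (dz (\<lambda>s. cvec (\<psi> s) $ i)) t" for i
    by (intro wirtinger_cong(2)[OF T] d)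
  then show 2: "lift_zzbar \<psi>' t = lift_zzbar \<psi> t" unfolding lift_zzbar_def by simp
  show "V_fibre \<psi>' t = V_fibre \<psi> t" unfolding V_fibre_def 1 2 eq[OF T(2)] ..
qed

lemma framed_lift_localI:
  assumes D: "open D"
    and loc: "\<And>p. p \<in> D \<Longrightarrow> \<exists>T \<psi>\<^sub>0 s\<^sub>0 k\<^sub>0 n\<^sub>0. p \<in> T \<and> T \<subseteq> D \<and> framed_lift T s\<^sub>0 k\<^sub>0 \<psi>\<^sub>0 n\<^sub>0 \<and>
       (\<forall>t\<in>T. \<psi> t = \<psi>\<^sub>0 t \<and> n t = n\<^sub>0 t \<and> s t = s\<^sub>0 t \<and> k t = k\<^sub>0 t)"
  shows "framed_lift D s k \<psi> n"
  unfolding framed_lift_def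
proof (intro conjI ballI allI D)
  have sm: "\<exists>T. open T \<and> p \<in> T \<and> smooth_on T \<psi> \<and> smooth_on T n" if p: "p \<in> D" for p
  proof -
    obtain T \<psi>\<^sub>0 s\<^sub>0 k\<^sub>0 n\<^sub>0 where T: "p \<in> T" "framed_lift T s\<^sub>0 k\<^sub>0 \<psi>\<^sub>0 n\<^sub>0"
       "\<forall>t\<in>T. \<psi> t = \<psi>\<^sub>0 t \<and> n t = n\<^sub>0 t \<and> s t = s\<^sub>0 t \<and> k t = k\<^sub>0 t" using loc[OF p] by metis
    note f = framed_liftD[OF T(2)]
    have "smooth_on T \<psi>" using f(2) smooth_on_cong[OF f(1), of \<psi> \<psi>\<^sub>0] T(3) by blast
    moreover have "smooth_on T n" using f(3) smooth_on_cong[OF f(1), of n n\<^sub>0] T(3) by blast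
    ultimately show ?thesis using f(1) T(1) by blast
  qed
  then show "smooth_on D \<psi>" "smooth_on D n" by (meson smooth_on_local)+
  fix p assume p: "p \<in> D"
  obtain T \<psi>\<^sub>0 s\<^sub>0 k\<^sub>0 n\<^sub>0 where T: "p \<in> T" "framed_lift T s\<^sub>0 k\<^sub>0 \<psi>\<^sub>0 n\<^sub>0"
       and eq: "\<forall>t\<in>T. \<psi> t = \<psi>\<^sub>0 t \<and> n t = n\<^sub>0 t \<and> s t = s\<^sub>0 t \<and> k t = k\<^sub>0 t" using loc[OF p] by metis
  note f = framed_liftD[OF T(2)]
  have e\<psi>: "\<forall>t\<in>T. \<psi> t = \<psi>\<^sub>0 t" using eq by blast
  note g = lift_germ_cong[OF f(1) T(1) e\<psi>]
  have e: "n p = n\<^sub>0 p" "s p = s\<^sub>0 p" "k p = k\<^sub>0 p" using eq T(1) by blast+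
  show "\<psi> p \<in> light_cone" using f(4)[OF T(1)] e\<psi> T(1) by simp
  show "lor (frechet_derivative \<psi> (at p) v) (frechet_derivative \<psi> (at p) v) = (norm v)\<^sup>2" for v
    unfolding g using f(5)[OF T(1)] .
  show "lor (n p) v = 0" if "v \<in> V_fibre \<psi> p" for v unfolding e using f(6)[OF T(1)] that unfolding g .
  show "lor (n p) (n p) = 1" unfolding e using f(7)[OF T(1)] .
  show "lift_zz \<psi> p + (s p / 2) *s cvec (\<psi> p) = k p *s cvec (n p)"
    unfolding g e bspec[OF e\<psi> T(1)] using f(8)[OF T(1)] .
qed

lemma framed_lift_same_map:
  assumes f: "framed_lift D s k \<psi> n" and f': "framed_lift D' s' k' \<psi>' n'"
    and eq: "\<forall>\<zeta>\<in>D \<inter> D'. sphere_point (\<psi> \<zeta>) = sphere_point (\<psi>' \<zeta>)" and \<zeta>: "\<zeta> \<in> D" "\<zeta> \<in> D'"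
  shows "\<psi>' \<zeta> = \<psi> \<zeta>"
proof -
  have o: "open (D \<inter> D')" using framed_liftD(1)[OF f] framed_liftD(1)[OF f'] by blast
  note g = framed_liftD[OF framed_lift_subset[OF f o Int_lower1]]
  note g' = framed_liftD[OF framed_lift_subset[OF f' o Int_lower2]]
  show ?thesis
    by (rule normalized_lift_unique[OF o g(2) g'(2) _ _ _ _ eq]) (use g(4,5) g'(4,5) \<zeta> in blast)+
qed

text \<open>The normalized lift of a map is unique, so that local lifts fit together.\<close>

lemma framed_map_localI:
  assumes D: "open D" and loc: "\<And>p. p \<in> D \<Longrightarrow> \<exists>T. p \<in> T \<and> framed_map T s k F n"
  shows "framed_map D s k F n"
proof -
  have "\<exists>T \<psi>. p \<in> T \<and> T \<subseteq> D \<and> framed_lift T s k \<psi> n \<and> (\<forall>\<zeta>\<in>T. F \<zeta> = sphere_point (\<psi> \<zeta>))" if p: "p \<in> D" for p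
  proof -
    obtain T \<psi> where "p \<in> T" "framed_lift T s k \<psi> n" "\<forall>\<zeta>\<in>T. F \<zeta> = sphere_point (\<psi> \<zeta>)"
      using loc[OF p] unfolding framed_map_def by blast
    moreover from this have "framed_lift (T \<inter> D) s k \<psi> n"
      using framed_lift_subset[OF _ _ Int_lower1] open_Int[OF framed_liftD(1) D] by blast
    ultimately show ?thesis using p by (intro exI[of _ "T \<inter> D"] exI[of _ \<psi>]) blast
  qed
  then obtain T \<Psi> where T: "\<And>p. p \<in> D \<Longrightarrow> p \<in> T p" "\<And>p. p \<in> D \<Longrightarrow> T p \<subseteq> D"
      "\<And>p. p \<in> D \<Longrightarrow> framed_lift (T p) s k (\<Psi> p) n" "\<And>p \<zeta>. p \<in> D \<Longrightarrow> \<zeta> \<in> T p \<Longrightarrow> F \<zeta> = sphere_point (\<Psi> p \<zeta>)"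
    by metis
  have same: "\<Psi> t t = \<Psi> p t" if p: "p \<in> D" and t: "t \<in> T p" for p t
  proof -
    have tD: "t \<in> D" using T(2) p t by blast
    show ?thesis
      by (rule framed_lift_same_map[OF T(3)[OF p] T(3)[OF tD] _ t T(1)[OF tD]])
        (metis IntE T(4)[OF p] T(4)[OF tD])
  qed
  have "framed_lift D s k (\<lambda>t. \<Psi> t t) n"
  proof (rule framed_lift_localI[OF D])
    fix p assume p: "p \<in> D"
    show "\<exists>U \<psi>\<^sub>0 s\<^sub>0 k\<^sub>0 n\<^sub>0. p \<in> U \<and> U \<subseteq> D \<and> framed_lift U s\<^sub>0 k\<^sub>0 \<psi>\<^sub>0 n\<^sub>0 \<and>
       (\<forall>t\<in>U. \<Psi> t t = \<psi>\<^sub>0 t \<and> n t = n\<^sub>0 t \<and> s t = s\<^sub>0 t \<and> k t = k\<^sub>0 t)"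
      by (rule exI[of _ "T p"], rule exI[of _ "\<Psi> p"], rule exI[of _ s], rule exI[of _ k], rule exI[of _ n])
        (use T(1-3)[OF p] same[OF p] in blast)
  qed
  then show ?thesis unfolding framed_map_def using T(1,4) by blast
qed

lemma framed_map_cong:
  assumes f: "framed_map D s k F n"
    and eq: "\<And>t. t \<in> D \<Longrightarrow> F' t = F t \<and> n' t = n t \<and> s' t = s t \<and> k' t = k t"
  shows "framed_map D s' k' F' n'"
proof -
  obtain \<psi> where p: "framed_lift D s k \<psi> n" "\<forall>\<zeta>\<in>D. F \<zeta> = sphere_point (\<psi> \<zeta>)"
    using f unfolding framed_map_def by blast
  have "framed_lift D s' k' \<psi> n'"
    by (rule framed_lift_localI[OF framed_liftD(1)[OF p(1)]]) (use p(1) eq in blast)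
  then show ?thesis unfolding framed_map_def using p(2) eq by (metis (no_types))
qed

lemma framed_map_cong_map:
  assumes "framed_map D s k F n" "\<forall>t\<in>D. F' t = F t"
  shows "framed_map D s k F' n"
  by (rule framed_map_cong[OF assms(1)]) (simp add: assms(2))

lemma framed_map_subset: "framed_map D s k F n \<Longrightarrow> open D' \<Longrightarrow> D' \<subseteq> D \<Longrightarrow> framed_map D' s k F n"
  unfolding framed_map_def using framed_lift_subset by blast

lemma framed_map_lorentz:
  assumes f: "framed_map D s k F n" and B: "B \<in> lorentz_maps"
  shows "framed_map D s k (\<lambda>t. moebius_of B (F t)) (\<lambda>t. B (n t))"
proof -
  obtain \<psi> where p: "framed_lift D s k \<psi> n" "\<forall>\<zeta>\<in>D. F \<zeta> = sphere_point (\<psi> \<zeta>)"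
    using f unfolding framed_map_def by blast
  then show ?thesis unfolding framed_map_def
    using framed_lift_lorentz[OF p(1) B] moebius_of_sphere_point[OF B framed_liftD(4)[OF p(1)]] by auto
qed

lemma framed_map_pullback:
  assumes f: "framed_map D' s k F n" and D: "open D" and \<tau>: "\<tau> holomorphic_on D" "\<tau> ` D \<subseteq> D'"
    and nz: "\<forall>\<zeta>\<in>D. deriv \<tau> \<zeta> \<noteq> 0"
  shows "framed_map D (\<lambda>\<zeta>. s (\<tau> \<zeta>) * (deriv \<tau> \<zeta>)\<^sup>2 + classical_schwarzian \<tau> \<zeta>)
    (\<lambda>\<zeta>. k (\<tau> \<zeta>) * ((deriv \<tau> \<zeta>)\<^sup>2 / of_real (cmod (deriv \<tau> \<zeta>)))) (\<lambda>\<zeta>. F (\<tau> \<zeta>)) (\<lambda>\<zeta>. n (\<tau> \<zeta>))"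
proof -
  obtain \<psi> where p: "framed_lift D' s k \<psi> n" "\<forall>\<zeta>\<in>D'. F \<zeta> = sphere_point (\<psi> \<zeta>)"
    using f unfolding framed_map_def by blast
  have "F (\<tau> \<zeta>) = sphere_point ((1 / cmod (deriv \<tau> \<zeta>)) *\<^sub>R \<psi> (\<tau> \<zeta>))" if "\<zeta> \<in> D" for \<zeta>
    using p(2) \<tau>(2) that nz by (simp add: sphere_point_scaleR image_subset_iff)
  then show ?thesis unfolding framed_map_def using framed_lift_pullback[OF p(1) D \<tau> nz] by blast
qed

lemma framed_map_rigidity:
  assumes f: "framed_map D s k F n" and f': "framed_map D s k F' n'" and p: "p \<in> D"
  shows "\<exists>B\<in>lorentz_maps. \<exists>r>0. ball p r \<subseteq> D \<and> (\<forall>t\<in>ball p r. F' t = moebius_of B (F t) \<and> n' t = B (n t))"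
proof -
  obtain \<psi> where \<psi>: "framed_lift D s k \<psi> n" "\<forall>\<zeta>\<in>D. F \<zeta> = sphere_point (\<psi> \<zeta>)"
    using f unfolding framed_map_def by blast
  obtain \<psi>' where \<psi>': "framed_lift D s k \<psi>' n'" "\<forall>\<zeta>\<in>D. F' \<zeta> = sphere_point (\<psi>' \<zeta>)"
    using f' unfolding framed_map_def by blast
  obtain B r where B: "B \<in> lorentz_maps" "r > 0" "ball p r \<subseteq> D" "\<forall>t\<in>ball p r. \<psi>' t = B (\<psi> t) \<and> n' t = B (n t)"
    using framed_lift_rigidity[OF \<psi>(1) \<psi>'(1) p] by blast
  have "F' t = moebius_of B (F t)" if t: "t \<in> ball p r" for t
  proof -
    have "t \<in> D" using B(3) t by blast
    then show ?thesis
      using \<psi>(2) \<psi>'(2) B(4) t moebius_of_sphere_point[OF B(1) framed_liftD(4)[OF \<psi>(1)]] by simp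
  qed
  then show ?thesis using B by blast
qed

lemma framed_map_lorentz_unique:
  assumes f: "framed_map D s k F n" and B: "B \<in> lorentz_maps" "B' \<in> lorentz_maps" and p: "p \<in> D"
    and eq: "\<forall>t\<in>D. moebius_of B (F t) = moebius_of B' (F t) \<and> B (n t) = B' (n t)"
  shows "B = B'"
proof -
  obtain \<psi> where \<psi>: "framed_lift D s k \<psi> n" "\<forall>\<zeta>\<in>D. F \<zeta> = sphere_point (\<psi> \<zeta>)"
    using f unfolding framed_map_def by blast
  show ?thesis
    by (rule lorentz_unique_on_framed_lift[OF \<psi>(1) B p])
      (use eq \<psi>(2) moebius_of_sphere_point[OF B(1) framed_liftD(4)[OF \<psi>(1)]]
        moebius_of_sphere_point[OF B(2) framed_liftD(4)[OF \<psi>(1)]] in \<open>simp\<close>)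
qed

subsection \<open>Orientation\<close>

text \<open>The determinant whose sign decides whether the unit normal is the oriented one.\<close>

definition orientation_det :: "(complex \<Rightarrow> real^4) \<Rightarrow> (complex \<Rightarrow> lvec) \<Rightarrow> complex \<Rightarrow> real" where
  "orientation_det F n \<zeta> = det4 (F \<zeta>) (pdx F \<zeta>) (pdy F \<zeta>) (space_part (n \<zeta>) - n \<zeta> $ None *\<^sub>R F \<zeta>)"

lemma oriented_unit_normal_iff:
  assumes "framed_lift D s k \<psi> n" "\<zeta> \<in> D"
  shows "oriented_unit_normal F \<psi> \<zeta> (n \<zeta>) \<longleftrightarrow> orientation_det F n \<zeta> > 0"
  unfolding oriented_unit_normal_det4 orientation_det_def using framed_liftD(6,7)[OF assms] by simp

lemma fundamental_eq_framed_map: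
  assumes f: "framed_map D s k F n" and \<zeta>: "\<zeta> \<in> D" and o: "orientation_det F n \<zeta> > 0"
  shows "fundamental_eq D F \<zeta> c \<kappa> \<longleftrightarrow> c = s \<zeta> \<and> \<kappa> = k \<zeta>"
proof -
  obtain \<psi> where \<psi>: "framed_lift D s k \<psi> n" "\<forall>\<zeta>\<in>D. F \<zeta> = sphere_point (\<psi> \<zeta>)"
    using f unfolding framed_map_def by blast
  show ?thesis using fundamental_eq_iff[OF \<psi> \<zeta>] oriented_unit_normal_iff[OF \<psi>(1) \<zeta>] o by blast
qed

lemma immersion_framed_map:
  assumes "open D" "smooth_on D F" "F ` D \<subseteq> S3"
    and "\<forall>\<zeta>\<in>D. \<exists>r>0. \<forall>v. norm (frechet_derivative F (at \<zeta>) v) = r * norm v"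
  shows "\<exists>s k n. framed_map D s k F n \<and> (\<forall>\<zeta>\<in>D. orientation_det F n \<zeta> > 0)"
  using immersion_framed_lift[OF assms] oriented_unit_normal_iff unfolding framed_map_def by blast

lemma framed_map_normal:
  assumes f: "framed_map D s k F n" and f': "framed_map D s' k' F n'" and \<zeta>: "\<zeta> \<in> D"
  shows "n' \<zeta> = n \<zeta> \<or> n' \<zeta> = - n \<zeta>"
proof -
  obtain \<psi> where \<psi>: "framed_lift D s k \<psi> n" "\<forall>\<zeta>\<in>D. F \<zeta> = sphere_point (\<psi> \<zeta>)"
    using f unfolding framed_map_def by blast
  obtain \<psi>' where \<psi>': "framed_lift D s' k' \<psi>' n'" "\<forall>\<zeta>\<in>D. F \<zeta> = sphere_point (\<psi>' \<zeta>)"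
    using f' unfolding framed_map_def by blast
  have same: "\<psi>' t = \<psi> t" if "t \<in> D" for t
    using framed_lift_same_map[OF \<psi>(1) \<psi>'(1) _ that that] \<psi>(2) \<psi>'(2) by simp
  note f = framed_liftD[OF \<psi>(1)] and f' = framed_liftD[OF \<psi>'(1)]
  have "\<forall>v\<in>V_fibre \<psi> \<zeta>. lor (n' \<zeta>) v = 0"
    using f'(6)[OF \<zeta>] lift_germ_cong(4)[OF f(1) \<zeta>, of \<psi>' \<psi>] same by blast
  then show ?thesis using unit_normal_up_to_sign[OF \<psi>(1) \<zeta>] f'(7)[OF \<zeta>] by blast
qed

lemma orientation_det_uminus: "n' \<zeta> = - n \<zeta> \<Longrightarrow> orientation_det F n' \<zeta> = - orientation_det F n \<zeta>"
proof -
  assume "n' \<zeta> = - n \<zeta>"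
  then have "space_part (n' \<zeta>) - n' \<zeta> $ None *\<^sub>R F \<zeta> = (-1) *\<^sub>R (space_part (n \<zeta>) - n \<zeta> $ None *\<^sub>R F \<zeta>)"
    by (simp add: space_part_def vec_eq_iff)
  then show ?thesis unfolding orientation_det_def by (simp only: det4_scale4)
qed

lemma orientation_det_cong_normal: "n' \<zeta> = n \<zeta> \<Longrightarrow> orientation_det F n' \<zeta> = orientation_det F n \<zeta>"
  unfolding orientation_det_def by simp

lemma orientation_det_cong:
  assumes "open D" "\<zeta> \<in> D" "\<And>t. t \<in> D \<Longrightarrow> F' t = F t" "n' \<zeta> = n \<zeta>"
  shows "orientation_det F' n' \<zeta> = orientation_det F n \<zeta>"
  unfolding orientation_det_def using pd_cong[OF assms(1-3)] assms by simp

text \<open>The unit normal is the oriented one or its negative.\<close>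

lemma orientation_det_nonzero:
  assumes f: "framed_map D s k F n" and \<zeta>: "\<zeta> \<in> D"
  shows "orientation_det F n \<zeta> \<noteq> 0"
proof -
  obtain s' k' n' where f': "framed_map D s' k' F n'" "\<forall>\<zeta>\<in>D. orientation_det F n' \<zeta> > 0"
    using immersion_framed_map[OF framed_map_open[OF f] framed_mapD(1-3)[OF f]] by blast
  show ?thesis using framed_map_normal[OF f f'(1) \<zeta>] orientation_det_cong_normal orientation_det_uminus f'(2) \<zeta>
    by (metis less_irrefl neg_0_equal_iff_equal)
qed

lemma framed_map_oriented_normal_unique:
  assumes f: "framed_map D s k F n" and f': "framed_map D s' k' F n'" and \<zeta>: "\<zeta> \<in> D"
    and o: "orientation_det F n \<zeta> > 0" "orientation_det F n' \<zeta> > 0"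
  shows "n' \<zeta> = n \<zeta>"
  using framed_map_normal[OF f f' \<zeta>] orientation_det_uminus o by (metis less_le_not_le neg_0_le_iff_le less_imp_le)

lemma continuous_on_orientation_det:
  assumes f: "framed_map D s k F n"
  shows "continuous_on D (orientation_det F n)"
proof -
  note D = framed_map_open[OF f] and F = framed_mapD[OF f]
  have sp: "bounded_linear space_part"
    unfolding linear_conv_bounded_linear[symmetric] by (rule linearI) (simp_all add: space_part_def vec_eq_iff)
  have "smooth_on D (\<lambda>t. det4 (F t) (pdx F t) (pdy F t) (space_part (n t) - n t $ None *\<^sub>R F t))"
    by (intro smooth_on_det4[OF D] F(1) smooth_on_pd smooth_on_diff[OF D] smooth_on_scaleR[OF D]
        smooth_on_linear[OF D sp] smooth_on_linear[OF D bounded_linear_vec_nth] F(4))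
  then show ?thesis unfolding orientation_det_def[abs_def] by (rule smooth_on_imp_continuous_on)
qed

text \<open>A holomorphic change of coordinates rotates and scales the tangent vectors \<open>F\<^sub>x\<close>, \<open>F\<^sub>y\<close>, which
  does not affect the sign.\<close>

lemma orientation_det_pullback:
  assumes D: "open D" and \<tau>: "\<tau> holomorphic_on D" "\<tau> ` D \<subseteq> D'"
    and F: "smooth_on D' F" and \<zeta>: "\<zeta> \<in> D"
  shows "orientation_det (\<lambda>\<zeta>. F (\<tau> \<zeta>)) (\<lambda>\<zeta>. n (\<tau> \<zeta>)) \<zeta> = (cmod (deriv \<tau> \<zeta>))\<^sup>2 * orientation_det F n (\<tau> \<zeta>)"
proof -
  let ?T = "deriv \<tau> \<zeta>"
  have \<tau>\<zeta>: "\<tau> \<zeta> \<in> D'" using \<tau>(2) \<zeta> by blast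
  have d\<tau>: "(\<tau> has_derivative (\<lambda>v. ?T * v)) (at \<zeta>)"
    using holomorphic_derivI[OF \<tau>(1) D \<zeta>] by (simp add: has_field_derivative_def)
  have "((\<lambda>t. F (\<tau> t)) has_derivative (\<lambda>v. Re (?T * v) *\<^sub>R pdx F (\<tau> \<zeta>) + Im (?T * v) *\<^sub>R pdy F (\<tau> \<zeta>))) (at \<zeta>)"
    by (rule has_derivative_compose[OF d\<tau> smooth_on_has_derivative_pd[OF F \<tau>\<zeta>]])
  from pd_eqI[OF this]
  have "pdx (\<lambda>t. F (\<tau> t)) \<zeta> = Re ?T *\<^sub>R pdx F (\<tau> \<zeta>) + Im ?T *\<^sub>R pdy F (\<tau> \<zeta>)"
    "pdy (\<lambda>t. F (\<tau> t)) \<zeta> = - Im ?T *\<^sub>R pdx F (\<tau> \<zeta>) + Re ?T *\<^sub>R pdy F (\<tau> \<zeta>)" by simp_all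
  then show ?thesis unfolding orientation_det_def by (simp only: det4_rotate cmod_power2)
qed

section \<open>Charts and rigidity\<close>

definition coordinate_chart :: "'x::topological_space set \<Rightarrow> 'x set \<Rightarrow> ('x \<Rightarrow> complex) \<Rightarrow> bool" where
  "coordinate_chart X U z \<longleftrightarrow> openin (top_of_set X) U \<and> open (z ` U) \<and> homeomorphism U (z ` U) z (inv_into U z)"

lemma coordinate_chartD:
  assumes "coordinate_chart X U z"
  shows "openin (top_of_set X) U" "open (z ` U)" "homeomorphism U (z ` U) z (inv_into U z)"
    "U \<subseteq> X" "continuous_on U z" "x \<in> U \<Longrightarrow> inv_into U z (z x) = x" "inj_on z U"
proof -
  show "openin (top_of_set X) U" "open (z ` U)" and h: "homeomorphism U (z ` U) z (inv_into U z)"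
    using assms unfolding coordinate_chart_def by blast+
  then show "U \<subseteq> X" "continuous_on U z" using openin_imp_subset homeomorphism_cont1 by blast+
  show i: "x \<in> U \<Longrightarrow> inv_into U z (z x) = x" for x using homeomorphism_apply1[OF h] .
  then show "inj_on z U" by (rule inj_on_inverseI)
qed

lemma coordinate_chart_restrict:
  assumes c: "coordinate_chart X U z" and V: "openin (top_of_set X) V" "V \<subseteq> U"
  shows "coordinate_chart X V z" and "\<zeta> \<in> z ` V \<Longrightarrow> inv_into V z \<zeta> = inv_into U z \<zeta>"
proof -
  note C = coordinate_chartD[OF c]
  have i: "inj_on z V" using C(7) V(2) inj_on_subset by blast
  show e: "inv_into V z \<zeta> = inv_into U z \<zeta>" if "\<zeta> \<in> z ` V" for \<zeta>
    using that V(2) C(6) i by (metis imageE inv_into_f_f subsetD)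
  have "openin (top_of_set U) V" using V openin_subset_trans C(4) by blast
  then have "openin (top_of_set (z ` U)) (z ` V)" by (rule homeomorphism_imp_open_map[OF C(3)])
  then have o: "open (z ` V)" using C(2) openin_open_trans by blast
  have "homeomorphism V (z ` V) z (inv_into U z)"
    by (rule homeomorphism_of_subsets[OF C(3) V(2) _ refl]) (use V(2) in blast)
  then have "homeomorphism V (z ` V) z (inv_into V z)"
    by (rule homeomorphism_cong) (use e in auto)
  then show "coordinate_chart X V z" unfolding coordinate_chart_def using V(1) o by blast
qed

lemma coordinate_chart_preimage:
  assumes c: "coordinate_chart X U z" and D: "open D"
  shows "coordinate_chart X (U \<inter> z -` D) z" "z ` (U \<inter> z -` D) = z ` U \<inter> D"
proof -
  note C = coordinate_chartD[OF c]
  have "openin (top_of_set U) (U \<inter> z -` D)" using C(5) D by (rule continuous_openin_preimage_gen)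
  then have "openin (top_of_set X) (U \<inter> z -` D)" using C(1) openin_trans by blast
  then show "coordinate_chart X (U \<inter> z -` D) z" using coordinate_chart_restrict(1)[OF c] by blast
  show "z ` (U \<inter> z -` D) = z ` U \<inter> D" by blast
qed

lemma local_rep_apply: "local_rep (U, z) g \<zeta> = g (inv_into U z \<zeta>)"
  by (simp add: local_rep_def)

lemma locally_path_connected_charts:
  assumes ch: "\<And>x. x \<in> X \<Longrightarrow> \<exists>U z. coordinate_chart X U z \<and> x \<in> U"
  shows "locally path_connected X"
  unfolding locally_def
proof (intro allI impI, elim conjE)
  fix W x assume W: "openin (top_of_set X) W" "x \<in> W"
  then have "x \<in> X" using openin_imp_subset by blast
  then obtain U z where U: "coordinate_chart X U z" "x \<in> U" using ch by blast
  have "openin (top_of_set X) (W \<inter> U)" using W(1) coordinate_chartD(1)[OF U(1)] by blast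
  note V = coordinate_chart_restrict(1)[OF U(1) this Int_lower2]
  note v = coordinate_chartD[OF V]
  have "z x \<in> z ` (W \<inter> U)" using W U by blast
  then obtain r where r: "r > 0" "ball (z x) r \<subseteq> z ` (W \<inter> U)" using v(2) open_contains_ball by blast
  define T where "T = (W \<inter> U) \<inter> z -` ball (z x) r"
  note t = coordinate_chart_preimage[OF V open_ball, of "z x" r, folded T_def]
  have zT: "z ` T = ball (z x) r" using t(2) r(2) by blast
  have "path_connected (inv_into T z ` ball (z x) r)"
    using coordinate_chartD(3)[OF t(1)] convex_imp_path_connected[OF convex_ball]
    unfolding zT by (intro path_connected_continuous_image homeomorphism_cont2)
  then have "path_connected T" using coordinate_chartD(3)[OF t(1)] unfolding zT homeomorphism_def by simp
  moreover have "x \<in> T" using W U r(1) by (simp add: T_def)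
  moreover have "T \<subseteq> W" by (auto simp: T_def)
  ultimately show "\<exists>u v. openin (top_of_set X) u \<and> path_connected v \<and> x \<in> u \<and> u \<subseteq> v \<and> v \<subseteq> W"
    using coordinate_chartD(1)[OF t(1)] by blast
qed

definition compatible :: "'x set \<Rightarrow> ('x \<Rightarrow> complex) \<Rightarrow> 'x set \<Rightarrow> ('x \<Rightarrow> complex) \<Rightarrow> bool" where
  "compatible U z V w \<longleftrightarrow> local_rep (U, z) w holomorphic_on z ` (U \<inter> V) \<and> local_rep (V, w) z holomorphic_on w ` (U \<inter> V)"

text \<open>The derivative of a change of coordinates does not vanish, because the inverse change of
  coordinates is holomorphic, too.\<close>

lemma transition:
  assumes U: "coordinate_chart X U z" and V: "coordinate_chart X V w" and UV: "compatible U z V w"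
  shows "open (z ` (U \<inter> V))" "local_rep (U, z) w ` z ` (U \<inter> V) \<subseteq> w ` V"
    "\<forall>\<zeta>\<in>z ` (U \<inter> V). deriv (local_rep (U, z) w) \<zeta> \<noteq> 0"
    "x \<in> U \<Longrightarrow> local_rep (U, z) g (z x) = g x"
    "\<zeta> \<in> z ` (U \<inter> V) \<Longrightarrow> local_rep (V, w) g (local_rep (U, z) w \<zeta>) = local_rep (U \<inter> V, z) g \<zeta>"
proof -
  note u = coordinate_chartD[OF U] and v = coordinate_chartD[OF V]
  have o: "openin (top_of_set X) (U \<inter> V)" using u(1) v(1) by blast
  note ru = coordinate_chart_restrict[OF U o Int_lower1] and rv = coordinate_chart_restrict[OF V o Int_lower2]
  show oz: "open (z ` (U \<inter> V))" using coordinate_chartD(2)[OF ru(1)] .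
  have ow: "open (w ` (U \<inter> V))" using coordinate_chartD(2)[OF rv(1)] .
  show r: "x \<in> U \<Longrightarrow> local_rep (U, z) g (z x) = g x" for x and g :: "'a \<Rightarrow> 'c" using u(6) by (simp add: local_rep_apply)
  have rV: "x \<in> V \<Longrightarrow> local_rep (V, w) g (w x) = g x" for x and g :: "'a \<Rightarrow> 'c" using v(6) by (simp add: local_rep_apply)
  show im: "local_rep (U, z) w ` z ` (U \<inter> V) \<subseteq> w ` V" using u(6) by (auto simp: local_rep_apply)
  show "local_rep (V, w) g (local_rep (U, z) w \<zeta>) = local_rep (U \<inter> V, z) g \<zeta>" if "\<zeta> \<in> z ` (U \<inter> V)"
    using that u(6) v(6) coordinate_chartD(6)[OF ru(1)] by (auto simp: local_rep_apply)
  show "\<forall>\<zeta>\<in>z ` (U \<inter> V). deriv (local_rep (U, z) w) \<zeta> \<noteq> 0"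
  proof
    let ?\<tau> = "local_rep (U, z) w" and ?\<sigma> = "local_rep (V, w) z"
    fix \<zeta> assume \<zeta>: "\<zeta> \<in> z ` (U \<inter> V)"
    have \<tau>\<zeta>: "?\<tau> \<zeta> \<in> w ` (U \<inter> V)" using \<zeta> u(6) by (auto simp: local_rep_apply)
    have d1: "(?\<tau> has_field_derivative deriv ?\<tau> \<zeta>) (at \<zeta>)"
      using UV unfolding compatible_def by (intro holomorphic_derivI[OF _ oz \<zeta>]) blast
    have d2: "(?\<sigma> has_field_derivative deriv ?\<sigma> (?\<tau> \<zeta>)) (at (?\<tau> \<zeta>))"
      using UV unfolding compatible_def by (intro holomorphic_derivI[OF _ ow \<tau>\<zeta>]) blast
    have "((\<lambda>t. ?\<sigma> (?\<tau> t)) has_field_derivative deriv ?\<sigma> (?\<tau> \<zeta>) * deriv ?\<tau> \<zeta>) (at \<zeta>)"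
      using DERIV_chain[OF d2 d1] by (simp add: o_def)
    moreover have "?\<sigma> (?\<tau> t) = t" if "t \<in> z ` (U \<inter> V)" for t
      using that u(6) v(6) by (auto simp: local_rep_apply)
    ultimately have "((\<lambda>t. t) has_field_derivative deriv ?\<sigma> (?\<tau> \<zeta>) * deriv ?\<tau> \<zeta>) (at \<zeta>)"
      by (rule has_field_derivative_transform_within_open[OF _ oz \<zeta>])
    then have "deriv ?\<sigma> (?\<tau> \<zeta>) * deriv ?\<tau> \<zeta> = 1" using DERIV_unique[OF _ DERIV_ident] by blast
    then show "deriv ?\<tau> \<zeta> \<noteq> 0" by auto
  qed
qed

definition framed_in :: "'x set \<Rightarrow> ('x \<Rightarrow> complex) \<Rightarrow> (complex \<Rightarrow> complex) \<Rightarrow> (complex \<Rightarrow> complex) \<Rightarrow>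
    ('x \<Rightarrow> real^4) \<Rightarrow> ('x \<Rightarrow> lvec) \<Rightarrow> bool" where
  "framed_in U z s k f \<nu> \<longleftrightarrow> framed_map (z ` U) s k (local_rep (U, z) f) (local_rep (U, z) \<nu>)"

lemma framed_in_restrict:
  assumes c: "coordinate_chart X U z" and V: "openin (top_of_set X) V" "V \<subseteq> U" and f: "framed_in U z s k f \<nu>"
  shows "framed_in V z s k f \<nu>"
  unfolding framed_in_def
proof (rule framed_map_cong)
  note r = coordinate_chart_restrict[OF c V]
  show "framed_map (z ` V) s k (local_rep (U, z) f) (local_rep (U, z) \<nu>)"
    using f coordinate_chartD(2)[OF r(1)] V(2) unfolding framed_in_def by (blast intro: framed_map_subset)
qed (simp add: local_rep_apply coordinate_chart_restrict(2)[OF c V])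

lemma framed_in_cong:
  assumes f: "framed_in U z s k f \<nu>"
    and eq: "\<And>x. x \<in> U \<Longrightarrow> f' x = f x \<and> \<nu>' x = \<nu> x" "\<And>\<zeta>. \<zeta> \<in> z ` U \<Longrightarrow> s' \<zeta> = s \<zeta> \<and> k' \<zeta> = k \<zeta>"
  shows "framed_in U z s' k' f' \<nu>'"
  unfolding framed_in_def
  by (rule framed_map_cong[OF f[unfolded framed_in_def]]) (simp add: local_rep_apply eq inv_into_into)

lemma framed_in_localI:
  assumes c: "coordinate_chart X U z"
    and loc: "\<And>x. x \<in> U \<Longrightarrow> \<exists>V. openin (top_of_set X) V \<and> x \<in> V \<and> V \<subseteq> U \<and> framed_in V z s k f \<nu>"
  shows "framed_in U z s k f \<nu>"
  unfolding framed_in_def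
proof (rule framed_map_localI[OF coordinate_chartD(2)[OF c]])
  fix \<zeta> assume "\<zeta> \<in> z ` U"
  then obtain x where x: "x \<in> U" "\<zeta> = z x" by blast
  obtain V where V: "openin (top_of_set X) V" "x \<in> V" "V \<subseteq> U" "framed_in V z s k f \<nu>" using loc[OF x(1)] by metis
  have "framed_map (z ` V) s k (local_rep (U, z) f) (local_rep (U, z) \<nu>)"
    by (rule framed_map_cong[OF V(4)[unfolded framed_in_def]])
      (simp add: local_rep_apply coordinate_chart_restrict(2)[OF c V(1,3)])
  then show "\<exists>T. \<zeta> \<in> T \<and> framed_map T s k (local_rep (U, z) f) (local_rep (U, z) \<nu>)" using x V(2) by blast
qed

lemma framed_in_lorentz:
  assumes f: "framed_in U z s k f \<nu>" and B: "B \<in> lorentz_maps"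
  shows "framed_in U z s k (\<lambda>x. moebius_of B (f x)) (\<lambda>x. B (\<nu> x))"
  using framed_map_lorentz[OF f[unfolded framed_in_def] B] unfolding framed_in_def by (simp add: local_rep_def o_def)

lemma framed_in_transition:
  assumes U: "coordinate_chart X U z" and V: "coordinate_chart X V w" and UV: "compatible U z V w"
    and f: "framed_in V w s k f \<nu>" and \<tau>_def: "\<tau> = local_rep (U, z) w"
  shows "framed_in (U \<inter> V) z (\<lambda>\<zeta>. s (\<tau> \<zeta>) * (deriv \<tau> \<zeta>)\<^sup>2 + classical_schwarzian \<tau> \<zeta>)
    (\<lambda>\<zeta>. k (\<tau> \<zeta>) * ((deriv \<tau> \<zeta>)\<^sup>2 / of_real (cmod (deriv \<tau> \<zeta>)))) f \<nu>"
proof -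
  note T = transition[OF U V UV, folded \<tau>_def]
  have h: "\<tau> holomorphic_on z ` (U \<inter> V)" using UV unfolding compatible_def \<tau>_def by blast
  show ?thesis unfolding framed_in_def
    by (rule framed_map_cong[OF framed_map_pullback[OF f[unfolded framed_in_def] T(1) h T(2,3)]]) (simp add: T(5))
qed

definition orientation_at :: "'x set \<Rightarrow> ('x \<Rightarrow> complex) \<Rightarrow> ('x \<Rightarrow> real^4) \<Rightarrow> ('x \<Rightarrow> lvec) \<Rightarrow> 'x \<Rightarrow> real" where
  "orientation_at U z f \<nu> x = orientation_det (local_rep (U, z) f) (local_rep (U, z) \<nu>) (z x)"

lemma orientation_at_restrict:
  assumes c: "coordinate_chart X U z" and V: "openin (top_of_set X) V" "V \<subseteq> U" "x \<in> V"
  shows "orientation_at V z f \<nu> x = orientation_at U z f \<nu> x"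
proof -
  note r = coordinate_chart_restrict[OF c V(1,2)]
  show ?thesis unfolding orientation_at_def
    by (rule orientation_det_cong[OF coordinate_chartD(2)[OF r(1)]]) (use V(3) r(2) in \<open>auto simp: local_rep_apply\<close>)
qed

lemma orientation_at_cong:
  assumes c: "coordinate_chart X U z" and x: "x \<in> U" and eq: "\<And>y. y \<in> U \<Longrightarrow> f' y = f y \<and> \<nu>' y = \<nu> y"
  shows "orientation_at U z f' \<nu>' x = orientation_at U z f \<nu> x"
  unfolding orientation_at_def
  by (rule orientation_det_cong[OF coordinate_chartD(2)[OF c]]) (use x in \<open>auto simp: local_rep_apply eq inv_into_into\<close>)

lemma orientation_at_transition:
  assumes U: "coordinate_chart X U z" and V: "coordinate_chart X V w" and UV: "compatible U z V w"
    and f: "framed_in V w s k f \<nu>" and x: "x \<in> U" "x \<in> V"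
  shows "orientation_at U z f \<nu> x > 0 \<longleftrightarrow> orientation_at V w f \<nu> x > 0"
proof -
  define \<tau> where "\<tau> = local_rep (U, z) w"
  note T = transition[OF U V UV, folded \<tau>_def]
  have h: "\<tau> holomorphic_on z ` (U \<inter> V)" using UV unfolding compatible_def \<tau>_def by blast
  have o: "openin (top_of_set X) (U \<inter> V)" using coordinate_chartD(1)[OF U] coordinate_chartD(1)[OF V] by blast
  have zx: "z x \<in> z ` (U \<inter> V)" using x by blast
  have \<tau>x: "\<tau> (z x) = w x" using T(4)[OF x(1), of w] by (simp add: \<tau>_def)
  have "orientation_at U z f \<nu> x = orientation_at (U \<inter> V) z f \<nu> x"
    by (rule orientation_at_restrict[OF U o, symmetric]) (use x in auto)
  also have "\<dots> = orientation_det (\<lambda>t. local_rep (V, w) f (\<tau> t)) (\<lambda>t. local_rep (V, w) \<nu> (\<tau> t)) (z x)"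
    unfolding orientation_at_def by (rule orientation_det_cong[OF T(1) zx]) (simp_all add: T(5)[OF zx] T(5))
  also have "\<dots> = (cmod (deriv \<tau> (z x)))\<^sup>2 * orientation_at V w f \<nu> x"
    using orientation_det_pullback[OF T(1) h T(2) framed_mapD(1)[OF f[unfolded framed_in_def]] zx]
    by (simp add: \<tau>x orientation_at_def)
  finally show ?thesis using bspec[OF T(3) zx] by (simp add: zero_less_mult_iff)
qed

subsection \<open>Rigidity\<close>

text \<open>Two pairs of a map and a normal field with the same invariants near \<open>x\<close>.  One common coordinate
  is enough, and it can be any homeomorphism onto an open set of the plane.\<close>

definition jointly_framed :: "'x::topological_space set \<Rightarrow> ('x \<Rightarrow> real^4) \<Rightarrow> ('x \<Rightarrow> lvec) \<Rightarrow>
    ('x \<Rightarrow> real^4) \<Rightarrow> ('x \<Rightarrow> lvec) \<Rightarrow> 'x \<Rightarrow> bool" where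
  "jointly_framed X f \<nu> f' \<nu>' x \<longleftrightarrow>
     (\<exists>U z s k. coordinate_chart X U z \<and> x \<in> U \<and> framed_in U z s k f \<nu> \<and> framed_in U z s k f' \<nu>')"

definition congruent_at :: "'x::topological_space set \<Rightarrow> ('x \<Rightarrow> real^4) \<Rightarrow> ('x \<Rightarrow> lvec) \<Rightarrow>
    ('x \<Rightarrow> real^4) \<Rightarrow> ('x \<Rightarrow> lvec) \<Rightarrow> 'x \<Rightarrow> (lvec \<Rightarrow> lvec) \<Rightarrow> bool" where
  "congruent_at X f \<nu> f' \<nu>' x B \<longleftrightarrow> B \<in> lorentz_maps \<and>
     (\<exists>T. openin (top_of_set X) T \<and> x \<in> T \<and> (\<forall>y\<in>T. f' y = moebius_of B (f y) \<and> \<nu>' y = B (\<nu> y)))"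

lemma jointly_framed_congruent:
  assumes "jointly_framed X f \<nu> f' \<nu>' x"
  shows "\<exists>B. congruent_at X f \<nu> f' \<nu>' x B"
proof -
  obtain U z s k where U: "coordinate_chart X U z" "x \<in> U"
      and f: "framed_in U z s k f \<nu>" "framed_in U z s k f' \<nu>'" using assms unfolding jointly_framed_def by blast
  note u = coordinate_chartD[OF U(1)]
  obtain B r where B: "B \<in> lorentz_maps" "r > 0" "ball (z x) r \<subseteq> z ` U"
     "\<forall>t\<in>ball (z x) r. local_rep (U, z) f' t = moebius_of B (local_rep (U, z) f t) \<and> local_rep (U, z) \<nu>' t = B (local_rep (U, z) \<nu> t)"
    using framed_map_rigidity[OF f[unfolded framed_in_def], of "z x"] U(2) by blast
  have "openin (top_of_set X) (U \<inter> z -` ball (z x) r)"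
    using coordinate_chartD(1)[OF coordinate_chart_preimage(1)[OF U(1) open_ball]] .
  moreover have "f' y = moebius_of B (f y) \<and> \<nu>' y = B (\<nu> y)" if "y \<in> U \<inter> z -` ball (z x) r" for y
    using bspec[OF B(4), of "z y"] that u(6)[of y] by (simp add: local_rep_apply)
  moreover have "x \<in> U \<inter> z -` ball (z x) r" using U(2) B(2) by simp
  ultimately show ?thesis unfolding congruent_at_def using B(1) by (intro exI[of _ B] conjI exI[of _ "U \<inter> z -` ball (z x) r"]) blast+
qed

text \<open>A Lorentz transformation is determined by the germ of an immersion with its normal.\<close>

lemma congruent_at_unique:
  assumes j: "jointly_framed X f \<nu> f' \<nu>' x" and B: "congruent_at X f \<nu> f'' \<nu>'' x B" and B': "congruent_at X f \<nu> f'' \<nu>'' x B'"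
  shows "B = B'"
proof -
  obtain U z s k where U: "coordinate_chart X U z" "x \<in> U" and f: "framed_in U z s k f \<nu>"
    using j unfolding jointly_framed_def by blast
  obtain T where T: "B \<in> lorentz_maps" "openin (top_of_set X) T" "x \<in> T" "\<forall>y\<in>T. f'' y = moebius_of B (f y) \<and> \<nu>'' y = B (\<nu> y)"
    using B unfolding congruent_at_def by blast
  obtain T' where T': "B' \<in> lorentz_maps" "openin (top_of_set X) T'" "x \<in> T'" "\<forall>y\<in>T'. f'' y = moebius_of B' (f y) \<and> \<nu>'' y = B' (\<nu> y)"
    using B' unfolding congruent_at_def by blast
  let ?V = "U \<inter> T \<inter> T'"
  have V: "openin (top_of_set X) ?V" using coordinate_chartD(1)[OF U(1)] T(2) T'(2) by blast
  have fV: "framed_map (z ` ?V) s k (local_rep (?V, z) f) (local_rep (?V, z) \<nu>)"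
    using framed_in_restrict[OF U(1) V _ f] unfolding framed_in_def by blast
  show ?thesis
  proof (rule framed_map_lorentz_unique[OF fV T(1) T'(1)])
    show "z x \<in> z ` ?V" using U(2) T(3) T'(3) by blast
    show "\<forall>t\<in>z ` ?V. moebius_of B (local_rep (?V, z) f t) = moebius_of B' (local_rep (?V, z) f t) \<and>
      B (local_rep (?V, z) \<nu> t) = B' (local_rep (?V, z) \<nu> t)"
    proof
      fix t assume "t \<in> z ` ?V"
      then have "inv_into ?V z t \<in> ?V" by (rule inv_into_into)
      then show "moebius_of B (local_rep (?V, z) f t) = moebius_of B' (local_rep (?V, z) f t) \<and>
          B (local_rep (?V, z) \<nu> t) = B' (local_rep (?V, z) \<nu> t)"
        unfolding local_rep_apply using T(4) T'(4) by (metis IntE)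
    qed
  qed
qed

lemma congruent_at_comp:
  assumes j: "jointly_framed X f \<nu> f' \<nu>' x"
    and B: "congruent_at X f \<nu> f' \<nu>' x B" and C: "congruent_at X f' \<nu>' f'' \<nu>'' x C"
  shows "congruent_at X f \<nu> f'' \<nu>'' x (C \<circ> B)"
proof -
  obtain U z s k where U: "coordinate_chart X U z" "x \<in> U" "framed_in U z s k f \<nu>"
    using j unfolding jointly_framed_def by blast
  obtain T where T: "B \<in> lorentz_maps" "openin (top_of_set X) T" "x \<in> T" "\<forall>y\<in>T. f' y = moebius_of B (f y) \<and> \<nu>' y = B (\<nu> y)"
    using B unfolding congruent_at_def by blast
  obtain T' where T': "C \<in> lorentz_maps" "openin (top_of_set X) T'" "x \<in> T'" "\<forall>y\<in>T'. f'' y = moebius_of C (f' y) \<and> \<nu>'' y = C (\<nu>' y)"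
    using C unfolding congruent_at_def by blast
  have fS: "f y \<in> S3" if y: "y \<in> U" for y
  proof -
    have "local_rep (U, z) f (z y) \<in> S3" using framed_mapD(2)[OF U(3)[unfolded framed_in_def]] y by blast
    then show ?thesis using coordinate_chartD(6)[OF U(1) y] by (simp add: local_rep_apply)
  qed
  have "f'' y = moebius_of (C \<circ> B) (f y) \<and> \<nu>'' y = (C \<circ> B) (\<nu> y)" if "y \<in> U \<inter> T \<inter> T'" for y
    using that T(4) T'(4) fS[of y] by (simp add: moebius_of_comp[OF T'(1) T(1)] compose_def)
  moreover have "openin (top_of_set X) (U \<inter> T \<inter> T')" using coordinate_chartD(1)[OF U(1)] T(2) T'(2) by blast
  ultimately show ?thesis unfolding congruent_at_def
    using lorentz_maps_comp[OF T'(1) T(1)] U(2) T(3) T'(3) by (intro conjI exI[of _ "U \<inter> T \<inter> T'"]) auto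
qed

definition congruence :: "'x::topological_space set \<Rightarrow> ('x \<Rightarrow> real^4) \<Rightarrow> ('x \<Rightarrow> lvec) \<Rightarrow>
    ('x \<Rightarrow> real^4) \<Rightarrow> ('x \<Rightarrow> lvec) \<Rightarrow> 'x \<Rightarrow> lvec \<Rightarrow> lvec" where
  "congruence X f \<nu> f' \<nu>' x = (THE B. congruent_at X f \<nu> f' \<nu>' x B)"

lemma congruence_eq:
  assumes "jointly_framed X f \<nu> f' \<nu>' x" "congruent_at X f \<nu> f' \<nu>' x B"
  shows "congruence X f \<nu> f' \<nu>' x = B"
  unfolding congruence_def by (rule the_equality, rule assms(2), rule congruent_at_unique[OF assms(1) _ assms(2)])

lemma congruence:
  assumes "jointly_framed X f \<nu> f' \<nu>' x"
  shows "congruent_at X f \<nu> f' \<nu>' x (congruence X f \<nu> f' \<nu>' x)"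
  using jointly_framed_congruent[OF assms] congruence_eq[OF assms] by metis

lemma congruence_locally_constant:
  assumes j: "jointly_framed X f \<nu> f' \<nu>' x"
  shows "\<forall>\<^sub>F y in at x within X. congruence X f \<nu> f' \<nu>' y = congruence X f \<nu> f' \<nu>' x"
proof -
  define B where "B = congruence X f \<nu> f' \<nu>' x"
  obtain T where T: "B \<in> lorentz_maps" "openin (top_of_set X) T" "x \<in> T" "\<forall>y\<in>T. f' y = moebius_of B (f y) \<and> \<nu>' y = B (\<nu> y)"
    using congruence[OF j] unfolding congruent_at_def B_def by blast
  obtain U z s k where U: "coordinate_chart X U z" "x \<in> U"
      and f: "framed_in U z s k f \<nu>" "framed_in U z s k f' \<nu>'" using j unfolding jointly_framed_def by blast
  have c: "congruence X f \<nu> f' \<nu>' y = B" if y: "y \<in> U \<inter> T" for y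
  proof (rule congruence_eq)
    show "jointly_framed X f \<nu> f' \<nu>' y" unfolding jointly_framed_def using U(1) f y by blast
    show "congruent_at X f \<nu> f' \<nu>' y B" unfolding congruent_at_def using T y by blast
  qed
  have o: "openin (top_of_set X) (U \<inter> T)" "x \<in> U \<inter> T" using coordinate_chartD(1)[OF U(1)] T(2,3) U(2) by blast+
  show ?thesis unfolding B_def[symmetric] by (rule eventually_at_within_openin[OF o c])
qed

text \<open>The transformation matching the two germs at a point is locally constant.\<close>

theorem rigidity:
  assumes X: "connected X" and j: "\<And>x. x \<in> X \<Longrightarrow> jointly_framed X f \<nu> f' \<nu>' x"
  shows "\<exists>B\<in>lorentz_maps. \<forall>x\<in>X. f' x = moebius_of B (f x) \<and> \<nu>' x = B (\<nu> x)"
proof (cases "X = {}")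
  case True
  then show ?thesis using lorentz_maps_id by blast
next
  case False
  have "congruence X f \<nu> f' \<nu>' constant_on X"
    by (rule eventually_constant_imp_constant[OF X congruence_locally_constant[OF j]])
  then obtain B where B: "\<And>x. x \<in> X \<Longrightarrow> congruence X f \<nu> f' \<nu>' x = B" unfolding constant_on_def by blast
  have "congruent_at X f \<nu> f' \<nu>' x B" if "x \<in> X" for x using congruence[OF j[OF that]] B[OF that] by simp
  then show ?thesis using False unfolding congruent_at_def by blast
qed

section \<open>Immersions of Riemann surfaces\<close>

lemma hol_charts_coordinate_chart: "(U, z) \<in> hol_charts M A \<Longrightarrow> coordinate_chart M U z"
  unfolding hol_charts_def coordinate_chart_def by blast

lemma hol_charts_compatible:
  assumes "(U, z) \<in> hol_charts M A" "(V, w) \<in> A"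
  shows "compatible U z V w"
  using assms unfolding hol_charts_def compatible_def by blast

lemma atlas_chart:
  assumes "riemann_surface M A" "x \<in> M"
  obtains V w where "(V, w) \<in> A" "(V, w) \<in> hol_charts M A" "x \<in> V"
  using assms unfolding riemann_surface_def by blast

text \<open>Near each point both coordinates are holomorphic functions of a chart of the atlas, with
  holomorphic inverses.\<close>

lemma hol_charts_transition:
  assumes rs: "riemann_surface M A" and U: "(U, z) \<in> hol_charts M A" and V: "(V, w) \<in> hol_charts M A"
  shows "local_rep (U, z) w holomorphic_on z ` (U \<inter> V)"
proof -
  note u = coordinate_chartD[OF hol_charts_coordinate_chart[OF U]]
  note v = coordinate_chartD[OF hol_charts_coordinate_chart[OF V]]
  have cover: "z ` (U \<inter> V) = (\<Union>(Y, y)\<in>A. z ` (U \<inter> V \<inter> Y))"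
  proof -
    have "U \<subseteq> (\<Union>(Y, y)\<in>A. Y)" using rs u(4) unfolding riemann_surface_def by blast
    then have "U \<inter> V = (\<Union>C\<in>A. U \<inter> V \<inter> fst C)" by (auto simp: split_def)
    then show ?thesis unfolding split_def by (metis image_UN)
  qed
  have "local_rep (U, z) w holomorphic_on (\<Union>(Y, y)\<in>A. z ` (U \<inter> V \<inter> Y))"
    unfolding split_def
  proof (rule holomorphic_on_UN_open)
    fix C assume "C \<in> A"
    then obtain Y y where C: "C = (Y, y)" and Y: "(Y, y) \<in> A" by (cases C) auto
    then have Y': "(Y, y) \<in> hol_charts M A" using rs unfolding riemann_surface_def by blast
    note c = coordinate_chartD[OF hol_charts_coordinate_chart[OF Y']]
    let ?D = "z ` (U \<inter> V \<inter> Y)"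
    have "openin (top_of_set M) (U \<inter> V \<inter> Y)" using u(1) v(1) c(1) by blast
    then show "open (z ` (U \<inter> V \<inter> fst C))"
      using coordinate_chartD(2) coordinate_chart_restrict(1)[OF hol_charts_coordinate_chart[OF U], of "U \<inter> V \<inter> Y"]
      by (metis C Int_assoc Int_lower1 fst_conv)
    have 1: "local_rep (U, z) y holomorphic_on ?D"
      using hol_charts_compatible[OF U Y] unfolding compatible_def by (rule_tac holomorphic_on_subset) auto
    have 2: "local_rep (Y, y) w holomorphic_on y ` (V \<inter> Y)"
      using hol_charts_compatible[OF V Y] unfolding compatible_def by blast
    have 3: "local_rep (U, z) y ` ?D \<subseteq> y ` (V \<inter> Y)" using u(6) by (auto simp: local_rep_apply)
    have "local_rep (Y, y) w \<circ> local_rep (U, z) y holomorphic_on ?D"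
      by (rule holomorphic_on_compose_gen[OF 1 2 3])
    then have "local_rep (U, z) w holomorphic_on ?D"
      by (rule holomorphic_transform) (use u(6) c(6) in \<open>auto simp: local_rep_apply\<close>)
    then show "local_rep (U, z) w holomorphic_on z ` (U \<inter> V \<inter> fst C)" by (simp add: C)
  qed
  then show ?thesis unfolding cover .
qed

lemma hol_charts_mutually_compatible:
  assumes "riemann_surface M A" "(U, z) \<in> hol_charts M A" "(V, w) \<in> hol_charts M A"
  shows "compatible U z V w"
  unfolding compatible_def using hol_charts_transition[OF assms] hol_charts_transition[OF assms(1,3,2)]
  by (simp add: Int_commute)

lemma invariants_framed_in:
  assumes c: "coordinate_chart X U z" and f: "framed_in U z s k f \<nu>" and x: "x \<in> U" and o: "orientation_at U z f \<nu> x > 0"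
  shows "schwarzian f (U, z) x = s (z x)" "hopf f (U, z) x = k (z x)"
proof -
  have zx: "z x \<in> z ` U" using x by blast
  note iff = fundamental_eq_framed_map[OF f[unfolded framed_in_def] zx o[unfolded orientation_at_def]]
  show "schwarzian f (U, z) x = s (z x)" "hopf f (U, z) x = k (z x)"
    unfolding schwarzian_def hopf_def split_conv by (rule the_equality; use iff in blast)+
qed

text \<open>The orientation fixes the normal at each point independently of the chart, because the sign
  of the orientation determinant is invariant under changes of coordinates.\<close>

lemma oriented_normals_agree:
  assumes U: "coordinate_chart X U z" and V: "coordinate_chart X V w" and UV: "compatible U z V w"
    and f: "framed_in U z s k f \<nu>" and f': "framed_in V w s' k' f \<nu>'" and x: "x \<in> U" "x \<in> V"
    and o: "orientation_at U z f \<nu> x > 0" and o': "orientation_at V w f \<nu>' x > 0"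
  shows "\<nu>' x = \<nu> x"
proof -
  have op: "openin (top_of_set X) (U \<inter> V)" using coordinate_chartD(1)[OF U] coordinate_chartD(1)[OF V] by blast
  note F = framed_in_restrict[OF U op Int_lower1 f, unfolded framed_in_def]
  note F' = framed_in_transition[OF U V UV f' refl, unfolded framed_in_def]
  have x': "x \<in> U \<inter> V" "z x \<in> z ` (U \<inter> V)" using x by auto
  have 1: "orientation_at (U \<inter> V) z f \<nu> x > 0"
    using orientation_at_restrict[OF U op Int_lower1 x'(1)] o by simp
  have 2: "orientation_at (U \<inter> V) z f \<nu>' x > 0"
    using orientation_at_restrict[OF U op Int_lower1 x'(1)] orientation_at_transition[OF U V UV f' x] o' by simp
  have "local_rep (U \<inter> V, z) \<nu>' (z x) = local_rep (U \<inter> V, z) \<nu> (z x)"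
    by (rule framed_map_oriented_normal_unique[OF F F' x'(2) 1[unfolded orientation_at_def] 2[unfolded orientation_at_def]])
  moreover have "inv_into (U \<inter> V) z (z x) = x"
    using coordinate_chartD(6)[OF coordinate_chart_restrict(1)[OF U op Int_lower1] x'(1)] .
  ultimately show ?thesis by (simp add: local_rep_apply)
qed

lemma immersion_framed_in:
  assumes f: "conformal_immersion M A f" and U: "(U, z) \<in> hol_charts M A"
  shows "\<exists>s k \<nu>. framed_in U z s k f \<nu> \<and> (\<forall>x\<in>U. orientation_at U z f \<nu> x > 0)"
proof -
  note u = coordinate_chartD[OF hol_charts_coordinate_chart[OF U]]
  have S: "local_rep (U, z) f ` z ` U \<subseteq> S3"
  proof -
    have "f ` M \<subseteq> S3" using f unfolding conformal_immersion_def by blast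
    then show ?thesis using u(4,6) by (auto simp: local_rep_apply subset_iff image_subset_iff simp del: mem_sphere_0)
  qed
  have sm: "smooth_on (z ` U) (local_rep (U, z) f)"
    and cf: "\<forall>\<zeta> \<in> z ` U. \<exists>r>0. \<forall>v. norm (frechet_derivative (local_rep (U, z) f) (at \<zeta>) v) = r * norm v"
    using f U unfolding conformal_immersion_def by blast+
  obtain s k n where F: "framed_map (z ` U) s k (local_rep (U, z) f) n"
      and o: "\<forall>\<zeta>\<in>z ` U. orientation_det (local_rep (U, z) f) n \<zeta> > 0"
    using immersion_framed_map[OF u(2) sm S cf] by metis
  have e: "local_rep (U, z) (n \<circ> z) \<zeta> = n \<zeta>" if "\<zeta> \<in> z ` U" for \<zeta>
    using that by (simp add: local_rep_apply f_inv_into_f)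
  have "framed_in U z s k f (n \<circ> z)" unfolding framed_in_def by (rule framed_map_cong[OF F]) (simp add: e)
  moreover have "orientation_at U z f (n \<circ> z) x > 0" if "x \<in> U" for x
    using o that unfolding orientation_at_def
    by (subst orientation_det_cong_normal[of "local_rep (U, z) (n \<circ> z)" _ n]) (auto simp: e)
  ultimately show ?thesis by blast
qed

text \<open>The oriented normals in the various charts agree, so that they define a global normal field,
  with which the immersion is framed in every chart by its own invariants.\<close>

lemma oriented_framing:
  assumes rs: "riemann_surface M A" and f: "conformal_immersion M A f"
  shows "\<exists>\<nu>. \<forall>(U, z)\<in>hol_charts M A.
     framed_in U z (local_rep (U, z) (schwarzian f (U, z))) (local_rep (U, z) (hopf f (U, z))) f \<nu>"
proof -
  have "\<forall>C\<in>hol_charts M A. \<exists>s k \<nu>. framed_in (fst C) (snd C) s k f \<nu> \<and> (\<forall>x\<in>fst C. orientation_at (fst C) (snd C) f \<nu> x > 0)"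
    using immersion_framed_in[OF f] by simp
  then obtain s k m where m0: "\<forall>C\<in>hol_charts M A. framed_in (fst C) (snd C) (s C) (k C) f (m C) \<and>
      (\<forall>x\<in>fst C. orientation_at (fst C) (snd C) f (m C) x > 0)" by metis
  have m: "framed_in U z (s (U, z)) (k (U, z)) f (m (U, z))" "x \<in> U \<Longrightarrow> orientation_at U z f (m (U, z)) x > 0"
    if "(U, z) \<in> hol_charts M A" for U z x
    using bspec[OF m0 that] by auto
  have "\<forall>x\<in>M. \<exists>C. C \<in> hol_charts M A \<and> x \<in> fst C" using atlas_chart[OF rs] by (metis fst_conv)
  then obtain ch where ch: "\<forall>x\<in>M. ch x \<in> hol_charts M A \<and> x \<in> fst (ch x)" by metis
  define \<nu> where "\<nu> x = m (ch x) x" for x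
  show ?thesis
  proof (intro exI[of _ \<nu>] ballI, clarify)
    fix U z assume U: "(U, z) \<in> hol_charts M A"
    note cU = hol_charts_coordinate_chart[OF U]
    have e: "\<nu> x = m (U, z) x" if x: "x \<in> U" for x
    proof -
      obtain V w where V: "ch x = (V, w)" by (cases "ch x")
      have "x \<in> M" using coordinate_chartD(4)[OF cU] x by blast
      then have V': "(V, w) \<in> hol_charts M A" "x \<in> V" using ch V by (metis, metis fst_conv)
      show ?thesis unfolding \<nu>_def V
        by (rule oriented_normals_agree[OF cU hol_charts_coordinate_chart[OF V'(1)]
            hol_charts_mutually_compatible[OF rs U V'(1)] m(1)[OF U] m(1)[OF V'(1)] x V'(2) m(2)[OF U x] m(2)[OF V']])
    qed
    note inv = invariants_framed_in[OF cU m(1)[OF U] _ m(2)[OF U]]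
    show "framed_in U z (local_rep (U, z) (schwarzian f (U, z))) (local_rep (U, z) (hopf f (U, z))) f \<nu>"
    proof (rule framed_in_cong[OF m(1)[OF U]])
      fix \<zeta> assume "\<zeta> \<in> z ` U"
      then obtain x where x: "x \<in> U" "\<zeta> = z x" by blast
      then show "local_rep (U, z) (schwarzian f (U, z)) \<zeta> = s (U, z) \<zeta> \<and> local_rep (U, z) (hopf f (U, z)) \<zeta> = k (U, z) \<zeta>"
        using inv[OF x(1) x(1)] coordinate_chartD(6)[OF cU x(1)] by (simp add: local_rep_apply)
    qed (simp add: e)
  qed
qed

text \<open>With their oriented normals, the two immersions are framed by the same functions in every
  chart.\<close>

theorem equal_invariants_imp_congruent:
  assumes rs: "riemann_surface M A" and M: "connected M"
    and f: "conformal_immersion M A f1" "conformal_immersion M A f2"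
    and eq: "\<forall>(U, z) \<in> hol_charts M A. \<forall>x\<in>U. hopf f1 (U, z) x = hopf f2 (U, z) x \<and> schwarzian f1 (U, z) x = schwarzian f2 (U, z) x"
  shows "\<exists>T \<in> moebius_maps. \<forall>x\<in>M. T (f1 x) = f2 x"
proof -
  obtain \<nu>1 where 1: "\<forall>(U, z)\<in>hol_charts M A.
     framed_in U z (local_rep (U, z) (schwarzian f1 (U, z))) (local_rep (U, z) (hopf f1 (U, z))) f1 \<nu>1"
    using oriented_framing[OF rs f(1)] by blast
  obtain \<nu>2 where 2: "\<forall>(U, z)\<in>hol_charts M A.
     framed_in U z (local_rep (U, z) (schwarzian f2 (U, z))) (local_rep (U, z) (hopf f2 (U, z))) f2 \<nu>2"
    using oriented_framing[OF rs f(2)] by blast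
  have "jointly_framed M f1 \<nu>1 f2 \<nu>2 x" if x: "x \<in> M" for x
  proof -
    obtain V w where V: "(V, w) \<in> hol_charts M A" "x \<in> V" using atlas_chart[OF rs x] by metis
    have "framed_in V w (local_rep (V, w) (schwarzian f1 (V, w))) (local_rep (V, w) (hopf f1 (V, w))) f1 \<nu>1"
      using 1 V(1) by blast
    moreover have "framed_in V w (local_rep (V, w) (schwarzian f1 (V, w))) (local_rep (V, w) (hopf f1 (V, w))) f2 \<nu>2"
    proof (rule framed_in_cong)
      show "framed_in V w (local_rep (V, w) (schwarzian f2 (V, w))) (local_rep (V, w) (hopf f2 (V, w))) f2 \<nu>2"
        using 2 V(1) by blast
      fix \<zeta> assume "\<zeta> \<in> w ` V"
      then have "inv_into V w \<zeta> \<in> V" by (rule inv_into_into)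
      then show "local_rep (V, w) (schwarzian f1 (V, w)) \<zeta> = local_rep (V, w) (schwarzian f2 (V, w)) \<zeta> \<and>
         local_rep (V, w) (hopf f1 (V, w)) \<zeta> = local_rep (V, w) (hopf f2 (V, w)) \<zeta>"
        using eq V(1) unfolding local_rep_apply by blast
    qed simp
    ultimately show ?thesis unfolding jointly_framed_def using hol_charts_coordinate_chart[OF V(1)] V(2) by blast
  qed
  from rigidity[OF M this] show ?thesis using moebius_of_moebius_maps by metis
qed

section \<open>Sheets of a covering of a Riemann surface\<close>

locale covered_surface =
  fixes M :: "'a::topological_space set" and A :: "'a chart set"
    and N :: "'b::topological_space set" and p :: "'b \<Rightarrow> 'a"
  assumes rs: "riemann_surface M A" and cover: "covering_space N p M"
begin

text \<open>A piece \<open>U'\<close> of the cover which \<open>p\<close> maps homeomorphically into the domain of the coordinate \<open>z\<close>, so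
  that \<open>z \<circ> p\<close> is a coordinate on \<open>U'\<close>.  The chart \<open>(U, z)\<close> of the base is recorded because the
  prescribed invariants are indexed by charts of the base.\<close>

definition sheet :: "'b set \<Rightarrow> 'a set \<Rightarrow> ('a \<Rightarrow> complex) \<Rightarrow> bool" where
  "sheet U' U z \<longleftrightarrow> openin (top_of_set N) U' \<and> inj_on p U' \<and> p ` U' \<subseteq> U \<and> (U, z) \<in> hol_charts M A"

lemma sheetD:
  assumes "sheet U' U z"
  shows "openin (top_of_set N) U'" "inj_on p U'" "p ` U' \<subseteq> U" "(U, z) \<in> hol_charts M A" "U' \<subseteq> N" "coordinate_chart M U z"
  using assms hol_charts_coordinate_chart openin_imp_subset unfolding sheet_def by blast+

text \<open>A covering map is a local homeomorphism onto open sets.\<close>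

lemma projection_open:
  assumes "openin (top_of_set N) V"
  shows "openin (top_of_set M) (p ` V)"
proof (subst openin_subopen, intro ballI)
  fix y assume "y \<in> p ` V"
  then obtain x where x: "x \<in> V" "y = p x" by blast
  have "x \<in> N" using x(1) openin_imp_subset[OF assms] by blast
  then obtain T u q where T: "x \<in> T" "openin (top_of_set N) T" "p x \<in> u" "openin (top_of_set M) u" "homeomorphism T u p q"
    by (rule covering_space_local_homeomorphism[OF cover])
  have "openin (top_of_set T) (V \<inter> T)"
    using assms T(2) openin_subset_trans[of N "V \<inter> T" T] openin_imp_subset[OF T(2)] by blast
  from homeomorphism_imp_open_map[OF T(5) this] have "openin (top_of_set M) (p ` (V \<inter> T))"
    using T(4) openin_trans by blast
  then show "\<exists>T. openin (top_of_set M) T \<and> y \<in> T \<and> T \<subseteq> p ` V"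
    using x T(1) by (intro exI[of _ "p ` (V \<inter> T)"]) blast
qed

lemma sheet_chart:
  assumes s: "sheet U' U z"
  shows "coordinate_chart N U' (z \<circ> p)"
    "\<zeta> \<in> (z \<circ> p) ` U' \<Longrightarrow> p (inv_into U' (z \<circ> p) \<zeta>) = inv_into U z \<zeta>"
proof -
  note S = sheetD[OF s]
  note u = coordinate_chartD[OF S(6)]
  have pU: "openin (top_of_set M) (p ` U')" by (rule projection_open[OF S(1)])
  note c = coordinate_chart_restrict[OF S(6) pU S(3)]
  have cont: "continuous_on U' p" using cover S(5) covering_space_imp_continuous continuous_on_subset by blast
  have inj: "inj_on (z \<circ> p) U'" using comp_inj_on[OF S(2) inj_on_subset[OF u(7) S(3)]] .
  obtain g where g: "homeomorphism U' (p ` U') p g"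
  proof (rule homeomorphism_injective_open_map[OF cont refl S(2)])
    fix V assume V: "openin (top_of_set U') V"
    then have "openin (top_of_set M) (p ` V)" using projection_open openin_trans[OF _ S(1)] by blast
    then show "openin (top_of_set (p ` U')) (p ` V)"
      using openin_subset_trans[of M "p ` V" "p ` U'"] openin_imp_subset[OF V] openin_imp_subset[OF pU] by blast
  qed
  have h: "homeomorphism U' (z ` p ` U') (z \<circ> p) (g \<circ> inv_into (p ` U') z)"
    by (rule homeomorphism_compose[OF g coordinate_chartD(3)[OF c(1)]])
  have "homeomorphism U' ((z \<circ> p) ` U') (z \<circ> p) (inv_into U' (z \<circ> p))"
  proof (rule homeomorphism_cong[OF h])
    fix y assume "y \<in> z ` p ` U'"
    then obtain x where x: "x \<in> U'" "y = (z \<circ> p) x" by auto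
    then show "inv_into U' (z \<circ> p) y = (g \<circ> inv_into (p ` U') z) y"
      using homeomorphism_apply1[OF h] inv_into_f_f[OF inj] by metis
  qed (simp_all add: image_comp)
  then show "coordinate_chart N U' (z \<circ> p)"
    unfolding coordinate_chart_def using S(1) coordinate_chartD(2)[OF c(1)] by (simp add: image_comp)
  assume "\<zeta> \<in> (z \<circ> p) ` U'"
  then obtain x where x: "x \<in> U'" "\<zeta> = (z \<circ> p) x" by blast
  have "inv_into U z \<zeta> = p x" using u(6)[of "p x"] x S(3) by auto
  then show "p (inv_into U' (z \<circ> p) \<zeta>) = inv_into U z \<zeta>" using inv_into_f_f[OF inj x(1)] x(2) by simp
qed

text \<open>Changes of coordinates between sheets are restrictions of those on the base.\<close>

lemma sheet_transition:
  assumes s1: "sheet U' U z" and s2: "sheet V' V w"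
  shows "compatible U' (z \<circ> p) V' (w \<circ> p)"
    "\<zeta> \<in> (z \<circ> p) ` (U' \<inter> V') \<Longrightarrow> local_rep (U', z \<circ> p) (w \<circ> p) \<zeta> = local_rep (U, z) w \<zeta>"
proof -
  have e: "local_rep (U', z \<circ> p) (w \<circ> p) \<zeta> = local_rep (U, z) w \<zeta>"
    if "sheet U' U z" "\<zeta> \<in> (z \<circ> p) ` U'" for U' U z w \<zeta>
    using sheet_chart(2)[OF that] by (simp add: local_rep_apply)
  have h: "local_rep (U', z \<circ> p) (w \<circ> p) holomorphic_on (z \<circ> p) ` (U' \<inter> V')"
    if s: "sheet U' U z" "sheet V' V w" for U' U z V' V w
  proof -
    have "local_rep (U, z) w holomorphic_on z ` (U \<inter> V)"
      by (rule hol_charts_transition[OF rs sheetD(4)[OF s(1)] sheetD(4)[OF s(2)]])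
    then have "local_rep (U, z) w holomorphic_on (z \<circ> p) ` (U' \<inter> V')"
      by (rule holomorphic_on_subset) (use sheetD(3)[OF s(1)] sheetD(3)[OF s(2)] in auto)
    then show ?thesis by (rule holomorphic_transform) (rule e[OF s(1), symmetric], blast)
  qed
  show "compatible U' (z \<circ> p) V' (w \<circ> p)"
    unfolding compatible_def using h[OF s1 s2] h[OF s2 s1] by (simp add: Int_commute)
  show "\<zeta> \<in> (z \<circ> p) ` (U' \<inter> V') \<Longrightarrow> local_rep (U', z \<circ> p) (w \<circ> p) \<zeta> = local_rep (U, z) w \<zeta>"
    using e[OF s1] by blast
qed

lemma sheet_subset: "sheet U' U z \<Longrightarrow> openin (top_of_set N) V' \<Longrightarrow> V' \<subseteq> U' \<Longrightarrow> sheet V' U z"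
  unfolding sheet_def using inj_on_subset by blast

lemma sheet_exists:
  assumes x: "x \<in> W" "openin (top_of_set N) W" and U: "(U, z) \<in> hol_charts M A" "p x \<in> U"
  shows "\<exists>U'. sheet U' U z \<and> x \<in> U' \<and> U' \<subseteq> W"
proof -
  have xN: "x \<in> N" using x openin_imp_subset by blast
  obtain T u q where T: "x \<in> T" "openin (top_of_set N) T" "homeomorphism T u p q"
    by (rule covering_space_local_homeomorphism[OF cover xN])
  have pc: "continuous_on N p" using covering_space_imp_continuous[OF cover] .
  have "p ` N \<subseteq> M" using covering_space_imp_surjective[OF cover] by blast
  then have "openin (top_of_set N) (N \<inter> p -` U)"
    using continuous_openin_preimage[OF pc _ coordinate_chartD(1)[OF hol_charts_coordinate_chart[OF U(1)]]] by blast
  then have "openin (top_of_set N) (T \<inter> W \<inter> (N \<inter> p -` U))" using T(2) x(2) by blast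
  moreover have "inj_on p T" using T(3) by (metis homeomorphism_apply1 inj_on_inverseI)
  ultimately have "sheet (T \<inter> W \<inter> (N \<inter> p -` U)) U z"
    unfolding sheet_def using U(1) by (auto intro: inj_on_subset)
  then show ?thesis using x(1) T(1) xN U(2) by blast
qed

lemma projection_in: "x \<in> N \<Longrightarrow> p x \<in> M"
  using covering_space_imp_surjective[OF cover] by blast

lemma sheet_near:
  assumes "x \<in> W" "openin (top_of_set N) W"
  obtains U' U z where "sheet U' U z" "x \<in> U'" "U' \<subseteq> W" "(U, z) \<in> A"
proof -
  have "p x \<in> M" using assms openin_imp_subset projection_in by blast
  from atlas_chart[OF rs this] obtain V w where V: "(V, w) \<in> A" "(V, w) \<in> hol_charts M A" "p x \<in> V" by metis
  then show ?thesis using sheet_exists[OF assms V(2,3)] that by blast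
qed

lemma cover_locally_path_connected: "locally path_connected N"
proof (rule locally_path_connected_charts)
  fix x assume "x \<in> N"
  then obtain U' U z where "sheet U' U z" "x \<in> U'" by (rule sheet_near) simp
  then show "\<exists>U z. coordinate_chart N U z \<and> x \<in> U" using sheet_chart(1) by blast
qed

end

section \<open>Solutions with prescribed invariants\<close>

locale prescribed_invariants = covered_surface +
  fixes \<kappa> c :: "'a chart \<Rightarrow> 'a \<Rightarrow> complex"
  assumes hopf_section: "LK2_section M A \<kappa>" and schwarzian_section: "schwarzian_derivative_on M A c"
    and integrability: "gauss_codazzi M A \<kappa> c"
begin

definition local_schwarzian :: "'a set \<Rightarrow> ('a \<Rightarrow> complex) \<Rightarrow> complex \<Rightarrow> complex" where
  "local_schwarzian U z = local_rep (U, z) (c (U, z))"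

definition local_hopf :: "'a set \<Rightarrow> ('a \<Rightarrow> complex) \<Rightarrow> complex \<Rightarrow> complex" where
  "local_hopf U z = local_rep (U, z) (\<kappa> (U, z))"

text \<open>The transformation laws of the prescribed data are those of a pulled back framed lift.\<close>

lemma transformation_laws:
  assumes s1: "sheet U' U z" and s2: "sheet V' V w" and \<zeta>: "\<zeta> \<in> (z \<circ> p) ` (U' \<inter> V')"
    and \<tau>_def: "\<tau> = local_rep (U', z \<circ> p) (w \<circ> p)"
  shows "local_schwarzian U z \<zeta> = local_schwarzian V w (\<tau> \<zeta>) * (deriv \<tau> \<zeta>)\<^sup>2 + classical_schwarzian \<tau> \<zeta>"
    "local_hopf U z \<zeta> = local_hopf V w (\<tau> \<zeta>) * ((deriv \<tau> \<zeta>)\<^sup>2 / of_real (cmod (deriv \<tau> \<zeta>)))"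
proof -
  note S1 = sheetD[OF s1] and S2 = sheetD[OF s2]
  define \<tau>0 where "\<tau>0 = local_rep (U, z) w"
  note o = transition(1)[OF sheet_chart(1)[OF s1] sheet_chart(1)[OF s2] sheet_transition(1)[OF s1 s2]]
  have e: "\<tau> t = \<tau>0 t" if "t \<in> (z \<circ> p) ` (U' \<inter> V')" for t
    unfolding \<tau>_def \<tau>0_def using sheet_transition(2)[OF s1 s2 that] .
  note d = classical_schwarzian_cong[OF o \<zeta> e, OF _]
  have d: "deriv \<tau> \<zeta> = deriv \<tau>0 \<zeta>" "classical_schwarzian \<tau> \<zeta> = classical_schwarzian \<tau>0 \<zeta>"
    by (rule classical_schwarzian_cong[OF o \<zeta>], erule e)+
  obtain y where y: "y \<in> U'" "y \<in> V'" "\<zeta> = z (p y)" using \<zeta> by auto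
  define x where "x = p y"
  have x: "x \<in> U \<inter> V" "z x = \<zeta>" using y S1(3) S2(3) by (auto simp: x_def)
  have iU: "inv_into U z \<zeta> = x" using coordinate_chartD(6)[OF S1(6), of x] x by auto
  have iV: "inv_into V w (\<tau>0 \<zeta>) = x" using coordinate_chartD(6)[OF S2(6), of x] x iU by (simp add: \<tau>0_def local_rep_apply)
  have "c (V, w) x * (deriv \<tau>0 \<zeta>)\<^sup>2 = c (U, z) x - classical_schwarzian \<tau>0 \<zeta>"
    using schwarzian_section S1(4) S2(4) x unfolding schwarzian_derivative_on_def Let_def \<tau>0_def by fast
  then show "local_schwarzian U z \<zeta> = local_schwarzian V w (\<tau> \<zeta>) * (deriv \<tau> \<zeta>)\<^sup>2 + classical_schwarzian \<tau> \<zeta>"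
    unfolding d e[OF \<zeta>] local_schwarzian_def local_rep_apply iU iV by simp
  have "\<kappa> (V, w) x * ((deriv \<tau>0 \<zeta>)\<^sup>2 / of_real (cmod (deriv \<tau>0 \<zeta>))) = \<kappa> (U, z) x"
    using hopf_section S1(4) S2(4) x unfolding LK2_section_def Let_def \<tau>0_def by fast
  then show "local_hopf U z \<zeta> = local_hopf V w (\<tau> \<zeta>) * ((deriv \<tau> \<zeta>)\<^sup>2 / of_real (cmod (deriv \<tau> \<zeta>)))"
    unfolding d e[OF \<zeta>] local_hopf_def local_rep_apply iU iV by simp
qed

text \<open>Pairs of a map and a normal field which have the prescribed invariants in all coordinates
  lifted from the base.  No orientation is required, so that solutions can be moved by arbitrary
  Lorentz transformations.\<close>

definition solution :: "'b set \<Rightarrow> ('b \<Rightarrow> real^4) \<Rightarrow> ('b \<Rightarrow> lvec) \<Rightarrow> bool" where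
  "solution W f \<nu> \<longleftrightarrow> openin (top_of_set N) W \<and>
     (\<forall>U' U z. sheet U' U z \<and> U' \<subseteq> W \<longrightarrow> framed_in U' (z \<circ> p) (local_schwarzian U z) (local_hopf U z) f \<nu>)"

lemma solutionD:
  "solution W f \<nu> \<Longrightarrow> openin (top_of_set N) W"
  "solution W f \<nu> \<Longrightarrow> sheet U' U z \<Longrightarrow> U' \<subseteq> W \<Longrightarrow> framed_in U' (z \<circ> p) (local_schwarzian U z) (local_hopf U z) f \<nu>"
  unfolding solution_def by blast+

text \<open>One coordinate near each point is enough: the prescribed data and the invariants of the pair
  transform in the same way.\<close>

lemma solutionI:
  assumes W: "openin (top_of_set N) W"
    and loc: "\<And>x. x \<in> W \<Longrightarrow> \<exists>U' U z. sheet U' U z \<and> x \<in> U' \<and> framed_in U' (z \<circ> p) (local_schwarzian U z) (local_hopf U z) f \<nu>"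
  shows "solution W f \<nu>"
  unfolding solution_def
proof (intro conjI W allI impI, elim conjE)
  fix U' U z assume s1: "sheet U' U z" and UW: "U' \<subseteq> W"
  note c1 = sheet_chart(1)[OF s1]
  show "framed_in U' (z \<circ> p) (local_schwarzian U z) (local_hopf U z) f \<nu>"
  proof (rule framed_in_localI[OF c1])
    fix x assume x: "x \<in> U'"
    then obtain V' V w where s2: "sheet V' V w" and xV: "x \<in> V'" and f: "framed_in V' (w \<circ> p) (local_schwarzian V w) (local_hopf V w) f \<nu>"
      using loc UW by blast
    note c2 = sheet_chart(1)[OF s2]
    note F = framed_in_transition[OF c1 c2 sheet_transition(1)[OF s1 s2] f refl]
    have "framed_in (U' \<inter> V') (z \<circ> p) (local_schwarzian U z) (local_hopf U z) f \<nu>"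
      by (rule framed_in_cong[OF F]) (use transformation_laws[OF s1 s2 _ refl] in auto)
    then show "\<exists>V'. openin (top_of_set N) V' \<and> x \<in> V' \<and> V' \<subseteq> U' \<and> framed_in V' (z \<circ> p) (local_schwarzian U z) (local_hopf U z) f \<nu>"
      using sheetD(1)[OF s1] sheetD(1)[OF s2] x xV by (intro exI[of _ "U' \<inter> V'"]) blast
  qed
qed

lemma solutions_jointly_framed:
  assumes "solution W f \<nu>" "solution W' f' \<nu>'" "x \<in> W" "x \<in> W'"
  shows "jointly_framed N f \<nu> f' \<nu>' x"
proof -
  have "openin (top_of_set N) (W \<inter> W')" using assms(1,2) solutionD(1) by blast
  moreover have "x \<in> W \<inter> W'" using assms(3,4) by blast
  ultimately obtain U' U z where s: "sheet U' U z" "x \<in> U'" "U' \<subseteq> W \<inter> W'" using sheet_near by metis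
  have "framed_in U' (z \<circ> p) (local_schwarzian U z) (local_hopf U z) f \<nu>" "framed_in U' (z \<circ> p) (local_schwarzian U z) (local_hopf U z) f' \<nu>'"
    using solutionD(2)[OF assms(1) s(1)] solutionD(2)[OF assms(2) s(1)] s(3) by blast+
  then show ?thesis unfolding jointly_framed_def using sheet_chart(1)[OF s(1)] s(2) by blast
qed

text \<open>The local solution is positively oriented at the point itself; by continuity and connectedness
  this will imply positivity everywhere for the global solution.\<close>

lemma solution_exists:
  assumes x: "x \<in> N"
  shows "\<exists>W f \<nu> U z. x \<in> W \<and> solution W f \<nu> \<and> sheet W U z \<and> orientation_at W (z \<circ> p) f \<nu> x > 0"
proof -
  obtain U' U z where s1: "sheet U' U z" "x \<in> U'" using sheet_near[OF x openin_subtopology_self] by metis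
  note S = sheetD[OF s1(1)]
  note c1 = sheet_chart(1)[OF s1(1)]
  note C = coordinate_chartD[OF c1]
  let ?y = "z \<circ> p"
  have D: "?y ` U' \<subseteq> z ` U" using S(3) by auto
  have sm: "smooth_on (?y ` U') (local_schwarzian U z)" "smooth_on (?y ` U') (local_hopf U z)"
    using hopf_section schwarzian_section S(4) smooth_on_subset[OF _ D]
    unfolding LK2_section_def schwarzian_derivative_on_def local_schwarzian_def local_hopf_def by blast+
  have gc: "\<forall>\<zeta>\<in>?y ` U'. (1/2) * dzbar (local_schwarzian U z) \<zeta> = 3 * dz (\<lambda>t. cnj (local_hopf U z t)) \<zeta> * local_hopf U z \<zeta> + cnj (local_hopf U z \<zeta>) * dz (local_hopf U z) \<zeta> \<and>
      Im (dzbar (dzbar (local_hopf U z)) \<zeta> + (1/2) * cnj (local_schwarzian U z \<zeta>) * local_hopf U z \<zeta>) = 0"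
    using integrability S(4) D unfolding gauss_codazzi_def local_schwarzian_def local_hopf_def Let_def by blast
  have yx: "?y x \<in> ?y ` U'" using s1(2) by blast
  obtain r \<psi> n where r: "r > 0" "ball (?y x) r \<subseteq> ?y ` U'" and fl: "framed_lift (ball (?y x) r) (local_schwarzian U z) (local_hopf U z) \<psi> n"
    and o: "oriented_unit_normal (\<lambda>\<zeta>. sphere_point (\<psi> \<zeta>)) \<psi> (?y x) (n (?y x))"
    using framed_lift_exists[OF C(2) yx sm gc] by blast
  define W where "W = U' \<inter> ?y -` ball (?y x) r"
  note cW = coordinate_chart_preimage[OF c1 open_ball, of "?y x" r, folded W_def]
  have yW: "?y ` W = ball (?y x) r" using cW(2) r(2) by blast
  have oW: "openin (top_of_set N) W" using coordinate_chartD(1)[OF cW(1)] .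
  have sW: "sheet W U z" by (rule sheet_subset[OF s1(1) oW]) (simp add: W_def)
  have xW: "x \<in> W" using s1(2) r(1) by (simp add: W_def)
  define f where "f = (\<lambda>y. sphere_point (\<psi> (?y y)))"
  define \<nu> where "\<nu> = (\<lambda>y. n (?y y))"
  have eq: "local_rep (W, ?y) f t = sphere_point (\<psi> t) \<and> local_rep (W, ?y) \<nu> t = n t" if "t \<in> ball (?y x) r" for t
    using f_inv_into_f[of t ?y W] that unfolding local_rep_apply f_def \<nu>_def by (simp only: yW)
  have fm: "framed_map (ball (?y x) r) (local_schwarzian U z) (local_hopf U z) (\<lambda>\<zeta>. sphere_point (\<psi> \<zeta>)) n"
    unfolding framed_map_def using fl by blast
  have fr: "framed_in W ?y (local_schwarzian U z) (local_hopf U z) f \<nu>"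
    unfolding framed_in_def yW by (rule framed_map_cong[OF fm]) (simp add: eq)
  have xb: "?y x \<in> ball (?y x) r" using r(1) by simp
  have "orientation_at W ?y f \<nu> x = orientation_det (\<lambda>\<zeta>. sphere_point (\<psi> \<zeta>)) n (?y x)"
    unfolding orientation_at_def by (rule orientation_det_cong[OF open_ball xb]) (use eq xb in blast)+
  then have pos: "orientation_at W ?y f \<nu> x > 0" using o oriented_unit_normal_iff[OF fl xb] by metis
  have "solution W f \<nu>" by (rule solutionI[OF oW]) (use sW fr in blast)
  then show ?thesis using xW sW pos by blast
qed

lemma solution_patch:
  assumes W: "openin (top_of_set N) W"
    and loc: "\<And>x. x \<in> W \<Longrightarrow> \<exists>T g \<mu> B. solution T g \<mu> \<and> B \<in> lorentz_maps \<and> x \<in> T \<and>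
       (\<forall>y\<in>T. f y = moebius_of B (g y) \<and> \<nu> y = B (\<mu> y))"
  shows "solution W f \<nu>"
proof (rule solutionI[OF W])
  fix x assume "x \<in> W"
  then obtain T g \<mu> B where T: "solution T g \<mu>" "B \<in> lorentz_maps" "x \<in> T" "\<forall>y\<in>T. f y = moebius_of B (g y) \<and> \<nu> y = B (\<mu> y)"
    using loc by metis
  obtain U' U z where s1: "sheet U' U z" "x \<in> U'" "U' \<subseteq> T" using sheet_near[OF T(3) solutionD(1)[OF T(1)]] by metis
  have "framed_in U' (z \<circ> p) (local_schwarzian U z) (local_hopf U z) f \<nu>"
    by (rule framed_in_cong[OF framed_in_lorentz[OF solutionD(2)[OF T(1) s1(1,3)] T(2)]]) (use T(4) s1(3) in auto)
  then show "\<exists>U' U z. sheet U' U z \<and> x \<in> U' \<and> framed_in U' (z \<circ> p) (local_schwarzian U z) (local_hopf U z) f \<nu>" using s1 by blast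
qed

lemma solution_restrict:
  assumes "solution W f \<nu>" "openin (top_of_set N) W'" "W' \<subseteq> W"
  shows "solution W' f \<nu>"
  using assms unfolding solution_def by blast

text \<open>The orientation determinant is continuous and nowhere zero in each sheet, and its sign does not
  depend on the sheet; so the sign is locally constant on \<open>N\<close>.\<close>

lemma orientation_constant:
  assumes N: "connected N" and sol: "solution N f \<nu>"
    and x0: "sheet U0' U0 z0" "x0 \<in> U0'" "orientation_at U0' (z0 \<circ> p) f \<nu> x0 > 0"
    and x: "sheet U' U z" "x \<in> U'"
  shows "orientation_at U' (z \<circ> p) f \<nu> x > 0"
proof -
  have fr: "framed_in U' (z \<circ> p) (local_schwarzian U z) (local_hopf U z) f \<nu>" if "sheet U' U z" for U' U z
    using solutionD(2)[OF sol that] sheetD(5)[OF that] by blast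
  have eq: "orientation_at U' (z \<circ> p) f \<nu> x > 0 \<longleftrightarrow> orientation_at V' (w \<circ> p) f \<nu> x > 0"
    if "sheet U' U z" "x \<in> U'" "sheet V' V w" "x \<in> V'" for U' U z V' V w x
    by (rule orientation_at_transition[OF sheet_chart(1)[OF that(1)] sheet_chart(1)[OF that(3)]
        sheet_transition(1)[OF that(1,3)] fr[OF that(3)] that(2,4)])
  define P where "P x \<longleftrightarrow> (\<exists>U' U z. sheet U' U z \<and> x \<in> U' \<and> orientation_at U' (z \<circ> p) f \<nu> x > 0)" for x
  have P: "P x \<longleftrightarrow> orientation_at U' (z \<circ> p) f \<nu> x > 0" if "sheet U' U z" "x \<in> U'" for U' U z x
    unfolding P_def using eq[OF that] that by blast
  have loc: "\<forall>\<^sub>F y in at x within N. P y = P x" if xN: "x \<in> N" for x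
  proof -
    obtain U' U z where s1: "sheet U' U z" "x \<in> U'" using sheet_near[OF xN openin_subtopology_self] by metis
    note C = coordinate_chartD[OF sheet_chart(1)[OF s1(1)]]
    define \<sigma> where "\<sigma> = orientation_det (local_rep (U', z \<circ> p) f) (local_rep (U', z \<circ> p) \<nu>)"
    have c\<sigma>: "continuous_on ((z \<circ> p) ` U') \<sigma>"
      unfolding \<sigma>_def by (rule continuous_on_orientation_det[OF fr[OF s1(1), unfolded framed_in_def]])
    have nz: "\<sigma> t \<noteq> 0" if "t \<in> (z \<circ> p) ` U'" for t
      unfolding \<sigma>_def by (rule orientation_det_nonzero[OF fr[OF s1(1), unfolded framed_in_def] that])
    have c: "continuous_on U' (\<lambda>y. \<sigma> ((z \<circ> p) y) * \<sigma> ((z \<circ> p) x))"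
      using continuous_on_compose[OF C(5) c\<sigma>] by (intro continuous_on_mult_right) (simp add: o_def)
    define T where "T = U' \<inter> (\<lambda>y. \<sigma> ((z \<circ> p) y) * \<sigma> ((z \<circ> p) x)) -` {0<..}"
    have "openin (top_of_set U') T" unfolding T_def by (rule continuous_openin_preimage_gen[OF c]) simp
    then have T: "openin (top_of_set N) T" using C(1) openin_trans by blast
    have "\<sigma> ((z \<circ> p) x) \<noteq> 0" using nz s1(2) by blast
    then have xT: "x \<in> T" using s1(2) by (simp add: T_def zero_less_mult_iff) linarith
    have "P y = P x" if "y \<in> T" for y
    proof -
      have "y \<in> U'" "\<sigma> ((z \<circ> p) y) * \<sigma> ((z \<circ> p) x) > 0" using that by (auto simp: T_def)
      then show ?thesis using P[OF s1(1)] s1(2)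
        unfolding orientation_at_def \<sigma>_def[symmetric] by (auto simp: zero_less_mult_iff)
    qed
    then show ?thesis by (rule eventually_at_within_openin[OF T xT])
  qed
  have "P constant_on N" by (rule eventually_constant_imp_constant[OF N loc])
  moreover have "x0 \<in> N" "x \<in> N" using x0(1,2) x sheetD(5) by blast+
  moreover have "P x0" using P[OF x0(1,2)] x0(3) by blast
  ultimately have "P x" unfolding constant_on_def by metis
  then show ?thesis using P[OF x] by blast
qed

end

section \<open>The global immersion and its holonomy\<close>

context prescribed_invariants
begin

lemma solution_S3:
  assumes "solution W f \<nu>" "x \<in> W"
  shows "f x \<in> S3"
proof -
  obtain U' U z where s: "sheet U' U z" "x \<in> U'" "U' \<subseteq> W" using sheet_near[OF assms(2) solutionD(1)[OF assms(1)]] by metis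
  have "local_rep (U', z \<circ> p) f ((z \<circ> p) x) \<in> S3"
    using framed_mapD(2)[OF solutionD(2)[OF assms(1) s(1,3), unfolded framed_in_def]] s(2) by blast
  then show ?thesis using coordinate_chartD(6)[OF sheet_chart(1)[OF s(1)] s(2)] by (simp add: local_rep_apply)
qed

text \<open>All local solutions form the index set of a cover.  The transformations between them are a
  cocycle of locally constant functions with values in the Lorentz group; a trivialisation \<open>h\<close> of it
  moves each local solution \<open>i\<close> by \<open>h i\<close> so that they agree on overlaps.  The trivialisation is
  normalised at one positively oriented local solution, which fixes the orientation.\<close>

theorem global_solution:
  assumes sc: "simply_connected N"
  shows "\<exists>f \<nu>. solution N f \<nu> \<and> (\<forall>U' U z x. sheet U' U z \<and> x \<in> U' \<longrightarrow> orientation_at U' (z \<circ> p) f \<nu> x > 0)"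
proof (cases "N = {}")
  case True
  have "x \<in> N" if "sheet U' U z \<and> x \<in> U'" for U' U z x using that sheetD(5) by blast
  then have "\<forall>U' U z x. sheet U' U z \<and> x \<in> U' \<longrightarrow> orientation_at U' (z \<circ> p) (\<lambda>_. 0) (\<lambda>_. 0) x > 0"
    using True by fast
  moreover have "solution N (\<lambda>_. 0) (\<lambda>_. 0)" by (rule solutionI) (simp_all add: True)
  ultimately show ?thesis by (intro exI conjI)
next
  case False
  then obtain x0 where x0: "x0 \<in> N" by blast
  define I where "I = {(W, f, \<nu>). solution W f \<nu>}"
  define F where "F i = fst (snd i)" for i :: "'b set \<times> ('b \<Rightarrow> real^4) \<times> ('b \<Rightarrow> lvec)"
  define V where "V i = snd (snd i)" for i :: "'b set \<times> ('b \<Rightarrow> real^4) \<times> ('b \<Rightarrow> lvec)"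
  define g where "g i j x = congruence N (F j) (V j) (F i) (V i) x" for i j x
  have I: "solution (fst i) (F i) (V i)" if "i \<in> I" for i using that by (auto simp: I_def F_def V_def)
  have jf: "jointly_framed N (F j) (V j) (F i) (V i) x" if "i \<in> I" "j \<in> I" "x \<in> fst i" "x \<in> fst j" for i j x
    using solutions_jointly_framed[OF I[OF that(2)] I[OF that(1)] that(4,3)] .
  have g: "congruent_at N (F j) (V j) (F i) (V i) x (g i j x)" if "i \<in> I" "j \<in> I" "x \<in> fst i" "x \<in> fst j" for i j x
    unfolding g_def by (rule congruence[OF jf[OF that]])
  have g_eq: "F i x = moebius_of (g i j x) (F j x) \<and> V i x = g i j x (V j x) \<and> g i j x \<in> lorentz_maps"
    if "i \<in> I" "j \<in> I" "x \<in> fst i" "x \<in> fst j" for i j x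
    using g[OF that] unfolding congruent_at_def by blast
  have cover: "\<exists>i\<in>I. x \<in> fst i" if x: "x \<in> N" for x
    using solution_exists[OF x] unfolding I_def by force
  interpret lorentz: group lorentz_group by (rule group_lorentz_group)
  interpret cc: locally_constant_cocycle lorentz_group N I fst g
  proof
    show "openin (top_of_set N) (fst i)" if "i \<in> I" for i using solutionD(1)[OF I[OF that]] .
    show "\<exists>i\<in>I. x \<in> fst i" if "x \<in> N" for x by (rule cover[OF that])
    show "g i j x \<in> carrier lorentz_group" if "i \<in> I" "j \<in> I" "x \<in> fst i" "x \<in> fst j" for i j x
      using g_eq[OF that] by (simp add: lorentz_group_def)
    show "\<forall>\<^sub>F y in at x within N. g i j y = g i j x" if "i \<in> I" "j \<in> I" "x \<in> fst i" "x \<in> fst j" for i j x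
      unfolding g_def by (rule congruence_locally_constant[OF jf[OF that]])
    show "g i j x \<otimes>\<^bsub>lorentz_group\<^esub> g j l x = g i l x"
      if "i \<in> I" "j \<in> I" "l \<in> I" "x \<in> fst i" "x \<in> fst j" "x \<in> fst l" for i j l x
    proof -
      have "congruent_at N (F l) (V l) (F i) (V i) x (g i j x \<circ> g j l x)"
        by (rule congruent_at_comp[OF jf g g]) (use that in auto)
      then have "g i l x = g i j x \<circ> g j l x"
        unfolding g_def[of i l] by (rule congruence_eq[OF jf, rotated -1]) (use that in auto)
      then show ?thesis by (simp add: lorentz_group_def)
    qed
  qed
  obtain W0 f0 \<nu>0 U0 z0 where i0: "x0 \<in> W0" "solution W0 f0 \<nu>0" "sheet W0 U0 z0" "orientation_at W0 (z0 \<circ> p) f0 \<nu>0 x0 > 0"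
    using solution_exists[OF x0] by blast
  let ?i0 = "(W0, f0, \<nu>0)"
  have i0I: "?i0 \<in> I" "x0 \<in> fst ?i0" using i0 by (auto simp: I_def)
  obtain h where h: "cc.trivial_along (\<lambda>x. x) N h" "h ?i0 x0 = \<one>\<^bsub>lorentz_group\<^esub>"
    using cc.trivial_on_simply_connected[OF sc cover_locally_path_connected i0I] by blast
  have fN: "fst i \<subseteq> N" if "i \<in> I" for i using solutionD(1)[OF I[OF that]] openin_imp_subset by blast
  have hc: "h i x \<in> lorentz_maps" "\<forall>\<^sub>F y in at x within N. h i y = h i x" if "i \<in> I" "x \<in> fst i" for i x
    using cc.trivial_alongD(1,2)[OF h(1) _ that(1), of x] that fN[OF that(1)] by (auto simp: lorentz_group_def)
  have hg: "h j x = h i x \<circ> g i j x" if "i \<in> I" "j \<in> I" "x \<in> fst i" "x \<in> fst j" for i j x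
    using cc.trivial_alongD(3)[OF h(1) _ that(1), of x j] that fN[OF that(1)] by (auto simp: lorentz_group_def)
  have "\<forall>x\<in>N. \<exists>i. i \<in> I \<and> x \<in> fst i" using cover by blast
  then obtain e where e: "\<And>x. x \<in> N \<Longrightarrow> e x \<in> I \<and> x \<in> fst (e x)" by metis
  define f where "f x = moebius_of (h (e x) x) (F (e x) x)" for x
  define \<nu> where "\<nu> x = h (e x) x (V (e x) x)" for x
  have indep: "f x = moebius_of (h i x) (F i x) \<and> \<nu> x = h i x (V i x)" if i: "i \<in> I" "x \<in> fst i" for i x
  proof -
    define j where "j = e x"
    have j: "j \<in> I" "x \<in> fst j" using e[of x] fN[OF i(1)] i(2) by (auto simp: j_def)
    note G = g_eq[OF i(1) j(1) i(2) j(2)]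
    have S: "F j x \<in> S3" by (rule solution_S3[OF I[OF j(1)] j(2)])
    have "moebius_of (h j x) (F j x) = moebius_of (h i x) (moebius_of (g i j x) (F j x))"
      unfolding hg[OF i(1) j(1) i(2) j(2)] using moebius_of_comp[OF hc(1)[OF i], of "g i j x"] G S by (simp add: compose_def)
    then show ?thesis unfolding f_def \<nu>_def j_def[symmetric] using hg[OF i(1) j(1) i(2) j(2)] G by simp
  qed
  have near: "\<exists>T. openin (top_of_set N) T \<and> x \<in> T \<and> T \<subseteq> fst i \<and> (\<forall>y\<in>T. f y = moebius_of (h i x) (F i y) \<and> \<nu> y = h i x (V i y))"
    if i: "i \<in> I" "x \<in> fst i" for i x
  proof -
    have "x \<in> N" using i fN by blast
    from eventually_at_within_openinD[OF hc(2)[OF i] this refl]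
    obtain T where T: "openin (top_of_set N) T" "x \<in> T" "\<forall>y\<in>T. h i y = h i x" by blast
    have o: "openin (top_of_set N) (T \<inter> fst i)" using T(1) solutionD(1)[OF I[OF i(1)]] by blast
    have "f y = moebius_of (h i x) (F i y) \<and> \<nu> y = h i x (V i y)" if y: "y \<in> T \<inter> fst i" for y
      using indep[OF i(1), of y] bspec[OF T(3), of y] y by simp
    then show ?thesis using o T(2) i(2) by (intro exI[of _ "T \<inter> fst i"] conjI ballI) auto
  qed
  have sol: "solution N f \<nu>"
  proof (rule solution_patch)
    fix x assume x: "x \<in> N"
    note ex = conjunct1[OF e[OF x]] conjunct2[OF e[OF x]]
    obtain T where T: "openin (top_of_set N) T" "x \<in> T" "T \<subseteq> fst (e x)"
       "\<forall>y\<in>T. f y = moebius_of (h (e x) x) (F (e x) y) \<and> \<nu> y = h (e x) x (V (e x) y)" using near[OF ex] by blast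
    have "solution T (F (e x)) (V (e x))" by (rule solution_restrict[OF I[OF ex(1)] T(1,3)])
    then show "\<exists>T g \<mu> B. solution T g \<mu> \<and> B \<in> lorentz_maps \<and> x \<in> T \<and> (\<forall>y\<in>T. f y = moebius_of B (g y) \<and> \<nu> y = B (\<mu> y))"
      using T(2,4) hc(1)[OF ex] by blast
  qed simp
  have h0: "h ?i0 x0 = id" using h(2) by (simp add: lorentz_group_def)
  obtain T where T: "openin (top_of_set N) T" "x0 \<in> T" "T \<subseteq> W0"
       "\<forall>y\<in>T. f y = moebius_of id (f0 y) \<and> \<nu> y = \<nu>0 y" using near[OF i0I] unfolding h0 by (auto simp: F_def V_def)
  have same: "f y = f0 y \<and> \<nu> y = \<nu>0 y" if "y \<in> T" for y
  proof -
    have "f0 y \<in> S3" by (rule solution_S3[OF i0(2)]) (use that T(3) in blast)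
    then show ?thesis using bspec[OF T(4) that] moebius_of_id by simp
  qed
  note sT = sheet_subset[OF i0(3) T(1,3)]
  have "orientation_at T (z0 \<circ> p) f \<nu> x0 = orientation_at T (z0 \<circ> p) f0 \<nu>0 x0"
    by (rule orientation_at_cong[OF sheet_chart(1)[OF sT] T(2)]) (rule same)
  then have pos: "orientation_at T (z0 \<circ> p) f \<nu> x0 > 0"
    using orientation_at_restrict[OF sheet_chart(1)[OF i0(3)] T(1,3,2)] i0(4) by simp
  have "orientation_at U' (z \<circ> p) f \<nu> x > 0" if "sheet U' U z" "x \<in> U'" for U' U z x
    by (rule orientation_constant[OF simply_connected_connected[OF sc] sol sT T(2) pos that])
  then show ?thesis using sol by blast
qed

text \<open>A coordinate of the cover is related holomorphically to the sheets over the charts of the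
  atlas, in which the solution is an immersion.\<close>

lemma solution_conformal_immersion:
  assumes sol: "solution N f \<nu>"
  shows "conformal_immersion N (pullback_atlas N p A) f"
  unfolding conformal_immersion_def
proof (intro conjI ballI, goal_cases)
  case 1
  show ?case using solution_S3[OF sol] by blast
next
  case (2 C)
  obtain V y where C: "C = (V, y)" by (cases C)
  have V: "(V, y) \<in> hol_charts N (pullback_atlas N p A)" using 2 C by simp
  note cV = hol_charts_coordinate_chart[OF V]
  have ex: "\<exists>T s k n. \<zeta> \<in> T \<and> framed_map T s k (local_rep (V, y) f) n" if \<zeta>: "\<zeta> \<in> y ` V" for \<zeta>
  proof -
    obtain x where x: "x \<in> V" "\<zeta> = y x" using \<zeta> by blast
    have xN: "x \<in> N" using coordinate_chartD(4)[OF cV] x(1) by blast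
    obtain U' U z where s1: "sheet U' U z" "x \<in> U'" "(U, z) \<in> A" using sheet_near[OF xN openin_subtopology_self] by metis
    have "(U', z \<circ> p) \<in> pullback_atlas N p A"
      using s1(3) sheetD(1-3)[OF s1(1)] unfolding pullback_atlas_def by blast
    note comp = hol_charts_compatible[OF V this]
    note fr = solutionD(2)[OF sol s1(1) sheetD(5)[OF s1(1)]]
    have o: "openin (top_of_set N) (V \<inter> U')" using coordinate_chartD(1)[OF cV] sheetD(1)[OF s1(1)] by blast
    note F = framed_in_transition[OF cV sheet_chart(1)[OF s1(1)] comp fr refl, unfolded framed_in_def]
    have e: "local_rep (V, y) f t = local_rep (V \<inter> U', y) f t" if "t \<in> y ` (V \<inter> U')" for t
      using coordinate_chart_restrict(2)[OF cV o Int_lower1 that] by (simp add: local_rep_apply)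
    have \<zeta>': "\<zeta> \<in> y ` (V \<inter> U')" using x s1(2) by blast
    show ?thesis by (intro exI conjI, rule \<zeta>', rule framed_map_cong_map[OF F], rule ballI, rule e)
  qed
  have loc: "\<exists>T. open T \<and> \<zeta> \<in> T \<and> smooth_on T (local_rep (V, y) f) \<and>
      (\<exists>r>0. \<forall>v. norm (frechet_derivative (local_rep (V, y) f) (at \<zeta>) v) = r * norm v)" if \<zeta>: "\<zeta> \<in> y ` V" for \<zeta>
  proof -
    obtain T s k n where T: "\<zeta> \<in> T" "framed_map T s k (local_rep (V, y) f) n" using ex[OF \<zeta>] by blast
    show ?thesis
      by (intro exI[of _ T] conjI framed_map_open[OF T(2)] T(1) framed_mapD(1)[OF T(2)] bspec[OF framed_mapD(3)[OF T(2)] T(1)])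
  qed
  have "smooth_on (y ` V) (local_rep (V, y) f)" by (rule smooth_on_local) (use loc in blast)
  moreover have "\<forall>\<zeta>\<in>y ` V. \<exists>r>0. \<forall>v. norm (frechet_derivative (local_rep (V, y) f) (at \<zeta>) v) = r * norm v"
    using loc by blast
  ultimately show ?case by (simp add: C)
qed

lemma solution_invariants:
  assumes sol: "solution N f \<nu>" and pos: "\<forall>U' U z x. sheet U' U z \<and> x \<in> U' \<longrightarrow> orientation_at U' (z \<circ> p) f \<nu> x > 0"
  shows "invariants_descend_to M A N p f \<kappa> c"
  unfolding invariants_descend_to_def
proof (intro ballI, clarify)
  fix U z U' x assume "(U, z) \<in> hol_charts M A" "openin (top_of_set N) U'" "inj_on p U'" "p ` U' \<subseteq> U" and x: "x \<in> U'"
  then have s1: "sheet U' U z" unfolding sheet_def by blast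
  note S = sheetD[OF s1]
  have o: "orientation_at U' (z \<circ> p) f \<nu> x > 0" using pos s1 x by blast
  note inv = invariants_framed_in[OF sheet_chart(1)[OF s1] solutionD(2)[OF sol s1 S(5)] x o]
  have "inv_into U z ((z \<circ> p) x) = p x" using coordinate_chartD(6)[OF S(6), of "p x"] S(3) x by auto
  then show "hopf f (U', z \<circ> p) x = \<kappa> (U, z) (p x) \<and> schwarzian f (U', z \<circ> p) x = c (U, z) (p x)"
    unfolding inv local_schwarzian_def local_hopf_def local_rep_apply by simp
qed

text \<open>A deck transformation maps sheets to sheets over the same chart and preserves the coordinate
  \<open>z \<circ> p\<close>.\<close>

lemma solution_deck:
  assumes sol: "solution N f \<nu>" and \<gamma>: "\<gamma> \<in> carrier (deck_group N p)"
  shows "solution N (\<lambda>x. f (\<gamma> x)) (\<lambda>x. \<nu> (\<gamma> x))"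
  unfolding solution_def
proof (intro conjI allI impI, simp, elim conjE)
  have hom: "homeomorphism N N \<gamma> (inv_into N \<gamma>)" and pg: "\<And>x. x \<in> N \<Longrightarrow> p (\<gamma> x) = p x"
    using \<gamma> unfolding deck_group_def by auto
  fix U' U z assume s1: "sheet U' U z"
  note S = sheetD[OF s1]
  have img: "g ` \<gamma> ` U' = g' ` U'" if "\<And>x. x \<in> N \<Longrightarrow> g (\<gamma> x) = g' x" for g :: "'b \<Rightarrow> 'x" and g'
    using that S(5) by (force simp: image_image)
  have "inj_on p (\<gamma> ` U')"
  proof (rule inj_onI)
    fix a b assume "a \<in> \<gamma> ` U'" "b \<in> \<gamma> ` U'" "p a = p b"
    then show "a = b" using pg S(2,5) unfolding inj_on_def by (smt (verit) imageE subsetD)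
  qed
  then have s2: "sheet (\<gamma> ` U') U z"
    unfolding sheet_def using homeomorphism_imp_open_map[OF hom S(1)] S(3,4) img[of p p] pg by simp
  have D: "(z \<circ> p) ` \<gamma> ` U' = (z \<circ> p) ` U'" by (rule img) (simp add: pg)
  have e: "\<gamma> (inv_into U' (z \<circ> p) \<zeta>) = inv_into (\<gamma> ` U') (z \<circ> p) \<zeta>" if "\<zeta> \<in> (z \<circ> p) ` U'" for \<zeta>
  proof -
    obtain x where x: "x \<in> U'" "\<zeta> = (z \<circ> p) x" using \<open>\<zeta> \<in> (z \<circ> p) ` U'\<close> by blast
    have "inv_into U' (z \<circ> p) \<zeta> = x" using coordinate_chartD(6)[OF sheet_chart(1)[OF s1] x(1)] x(2) by simp
    moreover have "(z \<circ> p) (\<gamma> x) = \<zeta>" using pg[of x] x S(5) by auto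
    then have "inv_into (\<gamma> ` U') (z \<circ> p) \<zeta> = \<gamma> x"
      using coordinate_chartD(6)[OF sheet_chart(1)[OF s2], of "\<gamma> x"] x(1) by simp
    ultimately show ?thesis by simp
  qed
  note fr = solutionD(2)[OF sol s2 sheetD(5)[OF s2], unfolded framed_in_def D]
  show "framed_in U' (z \<circ> p) (local_schwarzian U z) (local_hopf U z) (\<lambda>x. f (\<gamma> x)) (\<lambda>x. \<nu> (\<gamma> x))"
    unfolding framed_in_def by (rule framed_map_cong[OF fr]) (simp only: local_rep_apply e simp_thms)
qed

text \<open>Rigidity compares \<open>f \<circ> \<gamma>\<close> with \<open>f\<close>.  The Lorentz transformation so obtained is unique as soon as
  \<open>N\<close> is nonempty, and the composite of the transformations for two deck transformations has the
  property which characterises the transformation of their composite.\<close>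

lemma solution_holonomy:
  assumes N: "connected N" and sol: "solution N f \<nu>"
  shows "\<exists>\<rho> \<in> hom (deck_group N p) moebius_group. \<forall>\<gamma> \<in> carrier (deck_group N p). \<forall>x\<in>N. f (\<gamma> x) = \<rho> \<gamma> (f x)"
proof -
  define Q where "Q \<gamma> B \<longleftrightarrow> B \<in> lorentz_maps \<and> (\<forall>x\<in>N. f (\<gamma> x) = moebius_of B (f x) \<and> \<nu> (\<gamma> x) = B (\<nu> x))" for \<gamma> B
  have ex: "\<exists>B. Q \<gamma> B" if \<gamma>: "\<gamma> \<in> carrier (deck_group N p)" for \<gamma>
  proof -
    have "jointly_framed N f \<nu> (\<lambda>x. f (\<gamma> x)) (\<lambda>x. \<nu> (\<gamma> x)) x" if "x \<in> N" for x
      by (rule solutions_jointly_framed[OF sol solution_deck[OF sol \<gamma>] that that])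
    from rigidity[OF N this] show ?thesis unfolding Q_def by blast
  qed
  have uniq: "B = C" if ne: "N \<noteq> {}" and "Q \<gamma> B" "Q \<gamma> C" for \<gamma> B C
  proof -
    obtain x where x: "x \<in> N" using ne by blast
    have cong: "congruent_at N f \<nu> (\<lambda>x. f (\<gamma> x)) (\<lambda>x. \<nu> (\<gamma> x)) x B" if "Q \<gamma> B" for B
      using that x unfolding Q_def congruent_at_def by (intro conjI exI[of _ N]) auto
    show ?thesis by (rule congruent_at_unique[OF solutions_jointly_framed[OF sol sol x x] cong[OF that(2)] cong[OF that(3)]])
  qed
  have maps: "\<gamma> x \<in> N" if "\<gamma> \<in> carrier (deck_group N p)" "x \<in> N" for \<gamma> x
    using that unfolding deck_group_def Bij_def bij_betw_def by auto
  have comp: "Q (compose N \<gamma> \<delta>) (B \<circ> C)"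
    if "\<gamma> \<in> carrier (deck_group N p)" "\<delta> \<in> carrier (deck_group N p)" "Q \<gamma> B" "Q \<delta> C" for \<gamma> \<delta> B C
  proof -
    have B: "B \<in> lorentz_maps" and C: "C \<in> lorentz_maps" using that(3,4) unfolding Q_def by blast+
    have "f (compose N \<gamma> \<delta> x) = moebius_of (B \<circ> C) (f x) \<and> \<nu> (compose N \<gamma> \<delta> x) = (B \<circ> C) (\<nu> x)" if x: "x \<in> N" for x
    proof -
      have "f x \<in> S3" by (rule solution_S3[OF sol x])
      then show ?thesis
        using \<open>Q \<gamma> B\<close> \<open>Q \<delta> C\<close> x maps[OF \<open>\<delta> \<in> carrier (deck_group N p)\<close> x]
        unfolding Q_def moebius_of_comp[OF B C] by (simp add: compose_def)
    qed
    then show ?thesis unfolding Q_def using lorentz_maps_comp[OF B C] by blast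
  qed
  \<comment> \<open>On the empty cover every transformation qualifies, and arbitrary choices would not be multiplicative.\<close>
  define b where "b \<gamma> = (if N = {} then id else SOME B. Q \<gamma> B)" for \<gamma>
  have b: "Q \<gamma> (b \<gamma>)" if "\<gamma> \<in> carrier (deck_group N p)" for \<gamma>
  proof (cases "N = {}")
    case True
    then show ?thesis unfolding b_def Q_def using lorentz_maps_id by simp
  next
    case False
    then show ?thesis unfolding b_def using someI_ex[OF ex[OF that]] by simp
  qed
  have bcomp: "b (compose N \<gamma> \<delta>) = b \<gamma> \<circ> b \<delta>"
    if "\<gamma> \<in> carrier (deck_group N p)" "\<delta> \<in> carrier (deck_group N p)" for \<gamma> \<delta>
  proof (cases "N = {}")
    case True then show ?thesis by (simp add: b_def)
  next
    case False
    note Q = comp[OF that b[OF that(1)] b[OF that(2)]]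
    have "Q (compose N \<gamma> \<delta>) (b (compose N \<gamma> \<delta>))" using someI[of "Q (compose N \<gamma> \<delta>)", OF Q] False unfolding b_def by simp
    then show ?thesis by (rule uniq[OF False _ Q])
  qed
  have bl: "b \<gamma> \<in> lorentz_maps" if "\<gamma> \<in> carrier (deck_group N p)" for \<gamma> using b[OF that] unfolding Q_def by blast
  have Bij: "moebius_maps \<subseteq> Bij S3" "carrier (deck_group N p) \<subseteq> Bij N"
    unfolding moebius_maps_def deck_group_def by auto
  have "(\<lambda>\<gamma>. moebius_of (b \<gamma>)) \<in> hom (deck_group N p) moebius_group"
  proof (rule homI)
    fix \<gamma> assume "\<gamma> \<in> carrier (deck_group N p)"
    then show "moebius_of (b \<gamma>) \<in> carrier moebius_group"
      using moebius_of_moebius_maps[OF bl] by (simp add: moebius_group_def)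
  next
    fix \<gamma> \<delta> assume \<gamma>: "\<gamma> \<in> carrier (deck_group N p)" and \<delta>: "\<delta> \<in> carrier (deck_group N p)"
    have mem: "moebius_of (b \<gamma>) \<in> Bij S3" "moebius_of (b \<delta>) \<in> Bij S3" "\<gamma> \<in> Bij N" "\<delta> \<in> Bij N"
      using moebius_of_moebius_maps[OF bl[OF \<gamma>]] moebius_of_moebius_maps[OF bl[OF \<delta>]] Bij \<gamma> \<delta> by blast+
    have "\<gamma> \<otimes>\<^bsub>deck_group N p\<^esub> \<delta> = compose N \<gamma> \<delta>"
      using mem(3,4) by (simp add: deck_group_def BijGroup_def)
    moreover have "moebius_of (b \<gamma>) \<otimes>\<^bsub>moebius_group\<^esub> moebius_of (b \<delta>) = compose S3 (moebius_of (b \<gamma>)) (moebius_of (b \<delta>))"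
      using mem(1,2) by (simp add: moebius_group_def BijGroup_def)
    ultimately show "moebius_of (b (\<gamma> \<otimes>\<^bsub>deck_group N p\<^esub> \<delta>)) = moebius_of (b \<gamma>) \<otimes>\<^bsub>moebius_group\<^esub> moebius_of (b \<delta>)"
      using bcomp[OF \<gamma> \<delta>] moebius_of_comp[OF bl[OF \<gamma>] bl[OF \<delta>]] by simp
  qed
  moreover have "\<forall>\<gamma> \<in> carrier (deck_group N p). \<forall>x\<in>N. f (\<gamma> x) = moebius_of (b \<gamma>) (f x)"
    using b unfolding Q_def by blast
  ultimately show ?thesis by (intro bexI[where x = "\<lambda>\<gamma>. moebius_of (b \<gamma>)"])
qed

theorem immersion_with_invariants_exists:
  assumes sc: "simply_connected N"
  shows "\<exists>f. moebius_holonomy_immersion M A N p f \<and> invariants_descend_to M A N p f \<kappa> c"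
proof -
  obtain f \<nu> where sol: "solution N f \<nu>"
      and pos: "\<forall>U' U z x. sheet U' U z \<and> x \<in> U' \<longrightarrow> orientation_at U' (z \<circ> p) f \<nu> x > 0"
    using global_solution[OF sc] by blast
  have "moebius_holonomy_immersion M A N p f"
    unfolding moebius_holonomy_immersion_def universal_cover_def
    by (intro conjI cover sc solution_conformal_immersion[OF sol] solution_holonomy[OF simply_connected_connected[OF sc] sol])
  then show ?thesis using solution_invariants[OF sol pos] by blast
qed

end

theorem theorem3p1:
  fixes M :: "'a::topological_space set" and A :: "'a chart set"
  assumes "riemann_surface M A" and "connected M"
  shows "(\<forall>f1 f2.
            conformal_immersion M A f1 \<and> conformal_immersion M A f2 \<and>
            (\<forall>(U, z) \<in> hol_charts M A. \<forall>x\<in>U.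
               hopf f1 (U, z) x = hopf f2 (U, z) x \<and>
               schwarzian f1 (U, z) x = schwarzian f2 (U, z) x) \<longrightarrow>
            (\<exists>T \<in> moebius_maps. \<forall>x\<in>M. T (f1 x) = f2 x)) \<and>
         (\<forall>(N :: 'b::topological_space set) (p :: 'b \<Rightarrow> 'a) \<kappa> c.
            universal_cover N p M \<and>
            LK2_section M A \<kappa> \<and> schwarzian_derivative_on M A c \<and> gauss_codazzi M A \<kappa> c \<longrightarrow>
            (\<exists>f. moebius_holonomy_immersion M A N p f \<and> invariants_descend_to M A N p f \<kappa> c))"
proof (intro conjI allI impI; elim conjE)
  fix f1 f2
  assume f: "conformal_immersion M A f1" "conformal_immersion M A f2"
    and eq: "\<forall>(U, z) \<in> hol_charts M A. \<forall>x\<in>U. hopf f1 (U, z) x = hopf f2 (U, z) x \<and> schwarzian f1 (U, z) x = schwarzian f2 (U, z) x"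
  show "\<exists>T \<in> moebius_maps. \<forall>x\<in>M. T (f1 x) = f2 x"
    by (rule equal_invariants_imp_congruent[OF assms f eq])
next
  fix N :: "'b::topological_space set" and p :: "'b \<Rightarrow> 'a" and \<kappa> c
  assume uc: "universal_cover N p M"
    and inv: "LK2_section M A \<kappa>" "schwarzian_derivative_on M A c" "gauss_codazzi M A \<kappa> c"
  interpret prescribed_invariants M A N p \<kappa> c
    by unfold_locales (use assms(1) uc inv in \<open>auto simp: universal_cover_def\<close>)
  show "\<exists>f. moebius_holonomy_immersion M A N p f \<and> invariants_descend_to M A N p f \<kappa> c"
    by (rule immersion_with_invariants_exists) (use uc in \<open>simp add: universal_cover_def\<close>)
qed

end
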